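(* The double nerve construction $\mathcal G\mapsto\mathbf N\mathcal G$ embeds, as a reflective subcategory, the category of double groupoids satisfying the filling condition (and double functors) into the category of those bisimplicial sets $K$ that satisfy the extension condition and such that $\pi_2(K_{*,0},a)=0=\pi_2(K_{0,*},a)$ for all vertices $a\in K_{0,0}$. The reflector (left adjoint) functor for such bisimplicial sets is given by the homotopy double groupoid construction $K\mapsto\mathbf PK$. Thus $\mathbf P\mathbf N\mathcal G=\mathcal G$, and there are natural bisimplicial maps $\epsilon(K):K\to\mathbf N\mathbf PK$ such that $\mathbf P\epsilon=\mathrm{id}$ and $\epsilon\mathbf N=\mathrm{id}$.
   Context: **Double groupoids.** A double category consists of sets $O$ (objects), $H$ (horizontal morphisms), $V$ (vertical morphisms), $C$ (squares) with four category structures $(H,O,s^h,t^h,I^h,\circ_h)$, $(V,O,s^v,t^v,I^v,\circ_v)$, $(C,V,s^h,t^h,I^h,\circ_h)$, $(C,H,s^v,t^v,I^v,\circ_v)$ (sources, targets, identities, compositions; $f\circ g$ is defined when source of $f$ = target of $g$) such that: (1) $s^hs^v=s^vs^h$, $t^ht^v=t^vt^h$, $s^ht^v=t^vs^h$, $s^vt^h=t^hs^v$ on squares; $s^hI^v=I^vs^h$, $t^hI^v=I^vt^h$, $s^vI^h=I^hs^v$, $t^vI^h=I^ht^v$; $I^hI^v=I^vI^h$ on objects; (2) $s^v,t^v$ on squares preserve $\circ_h$, $s^h,t^h$ on squares preserve $\circ_v$, $I^v(f\circ_hf')=I^vf\circ_hI^vf'$, $I^h(u\circ_vu')=I^hu\circ_vI^hu'$;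 (3) interchange: $(\alpha\circ_h\beta)\circ_v(\gamma\circ_h\delta)=(\alpha\circ_v\gamma)\circ_h(\beta\circ_v\delta)$ whenever defined. It is a double groupoid if all four categories are groupoids. Filling condition: for every horizontal $g$ and vertical $u$ with $s^hg=t^vu$ there is a square $\alpha$ with $s^h\alpha=u$, $t^v\alpha=g$. Double functors preserve all the structure. **Double nerve.** $\mathbf N\mathcal G$ is the bisimplicial set whose $(p,q)$-bisimplices are double functors $[p]\otimes[q]\to\mathcal G$. Here $[n]$ is the category with objects $0,\dots,n$ and exactly one arrow $j\to i$ when $i\le j$; for categories $\mathcal A,\mathcal B$, $\mathcal A\otimes\mathcal B$ is the double category with objects $(a,b)$, horizontal morphisms $(f,b)$, vertical morphisms $(a,u)$, and squares $(f,u)$ ($f:a\to c$ in $\mathcal A$, $u:b\to d$ in $\mathcal B$) with $s^h=(a,u)$, $t^h=(c,u)$, $s^v=(f,b)$, $t^v=(f,d)$. **Extension condition and bihomotopy.** In $K_{p,q}$ the first index is horizontal, with operators $d_i^h,s_i^h$; the second is vertical, with $d_j^v,s_j^v$. For $p,q\ge1$, $0\le k\le p$, $0\le l\le q$, $\Lambda^{k,l}[p,q]\subset\Delta[p,q]$ is the bisimplicial subset of the representable one generated by all horizontal faces with index $\ne k$ and vertical faces with index $\ne l$. $K$ satisfies the extension condition if all $K_{p,*}$, $K_{*,q}$ are Kan complexes and every map $\Lambda^{k,l}[p,q]\to K$ extends to $\Delta[p,q]$. In a Kan complex $L$, $n$-simplices $x,x'$ are homotopic if they have the same faces and there is $y\in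 L_{n+1}$ with $d_iy=s_{n-1}d_ix$ ($i<n$), $d_ny=x$, $d_{n+1}y=x'$. For $x\in K_{p,q}$, $[x]_h$ and $[x]_v$ are its homotopy classes in $K_{*,q}$ and $K_{p,*}$. Bisimplices $x,x'\in K_{p,q}$ are bihomotopic if there is $y\in K_{p,q}$ with $[x]_h=[y]_h$ and $[y]_v=[x']_v$; this is an equivalence relation, with classes $[[x]]$. The fundamental groupoid $\mathrm PL$ of a Kan complex has the vertices as objects, homotopy classes $[x]:d_0x\to d_1x$ of $1$-simplices as morphisms, composition $[x]\circ[x']=[d_1y]$ for any $y\in L_2$ with $d_2y=x$, $d_0y=x'$, and identities $[s_0a]$. **$\mathbf PK$**, for $K$ satisfying the extension condition with $\pi_2(K_{*,0},a)=0=\pi_2(K_{0,*},a)$ for all $a\in K_{0,0}$. Objects: $K_{0,0}$. Horizontal morphisms: the groupoid $\mathrm PK_{*,0}$; vertical morphisms: the groupoid $\mathrm PK_{0,*}$. Squares: bihomotopy classes $[[x]]$, $x\in K_{1,1}$, with $s^h[[x]]=[d_0^hx]_v$, $t^h[[x]]=[d_1^hx]_v$, $s^v[[x]]=[d_0^vx]_h$, $t^v[[x]]=[d_1^vx]_h$. If $[d_0^hx]_v=[d_1^hy]_v$, then $[[x]]\circ_h[[y]]=[[d_1^h\gamma]]$ for any $x'\in K_{1,1}$ with $[x']_v=[x]_v$, $d_0^hx'=d_1^hy$ and any $\gamma\in K_{2,1}$ with $d_2^h\gamma=x'$, $d_0^h\gamma=y$. Symmetrically, if $[d_0^vx]_h=[d_1^vy]_h$,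 $[[x]]\circ_v[[y]]=[[d_1^v\gamma]]$ for any $x'$ with $[x']_h=[x]_h$, $d_0^vx'=d_1^vy$ and $\gamma\in K_{1,2}$ with $d_2^v\gamma=x'$, $d_0^v\gamma=y$. Identities: $I^h[u]_v=[[s_0^hu]]$, $I^v[f]_h=[[s_0^vf]]$. This is a double groupoid satisfying the filling condition, functorial in $K$. (In $\mathbf N\mathcal G$ the relevant homotopy and bihomotopy relations are trivial, and one-element classes are identified with their elements.) *)

theory Defs
  imports Main "HOL-Library.FuncSet"
begin

section \<open>Categories, groupoids and functors\<close>

record ('o, 'm) catg =
  Obj :: "'o set"
  Arr :: "'m set"
  Dom :: "'m \<Rightarrow> 'o"
  Cod :: "'m \<Rightarrow> 'o"
  Idn :: "'o \<Rightarrow> 'm"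
  Cmp :: "'m \<Rightarrow> 'm \<Rightarrow> 'm"

text \<open>The composite \<open>Cmp C f g\<close> is meaningful when the source of \<open>f\<close> is the target of \<open>g\<close>.\<close>

definition category :: "('o, 'm) catg \<Rightarrow> bool" where
  "category C \<longleftrightarrow>
     Dom C \<in> Arr C \<rightarrow> Obj C \<and> Cod C \<in> Arr C \<rightarrow> Obj C \<and> Idn C \<in> Obj C \<rightarrow> Arr C \<and>
     (\<forall>a\<in>Obj C. Dom C (Idn C a) = a \<and> Cod C (Idn C a) = a) \<and>
     (\<forall>f\<in>Arr C. \<forall>g\<in>Arr C. Dom C f = Cod C g \<longrightarrow>
        Cmp C f g \<in> Arr C \<and> Dom C (Cmp C f g) = Dom C g \<and> Cod C (Cmp C f g) = Cod C f) \<and>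
     (\<forall>f\<in>Arr C. Cmp C f (Idn C (Dom C f)) = f \<and> Cmp C (Idn C (Cod C f)) f = f) \<and>
     (\<forall>f\<in>Arr C. \<forall>g\<in>Arr C. \<forall>h\<in>Arr C. Dom C f = Cod C g \<and> Dom C g = Cod C h \<longrightarrow>
        Cmp C (Cmp C f g) h = Cmp C f (Cmp C g h))"

definition groupoid :: "('o, 'm) catg \<Rightarrow> bool" where
  "groupoid C \<longleftrightarrow> category C \<and>
     (\<forall>f\<in>Arr C. \<exists>g\<in>Arr C. Dom C g = Cod C f \<and> Cod C g = Dom C f \<and>
        Cmp C f g = Idn C (Cod C f) \<and> Cmp C g f = Idn C (Dom C f))"

definition is_functor ::
  "('o, 'm) catg \<Rightarrow> ('o \<Rightarrow> 'o2) \<Rightarrow> ('m \<Rightarrow> 'm2) \<Rightarrow> ('o2, 'm2) catg \<Rightarrow> bool" where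
  "is_functor C F0 F1 D \<longleftrightarrow>
     F0 \<in> Obj C \<rightarrow> Obj D \<and> F1 \<in> Arr C \<rightarrow> Arr D \<and>
     (\<forall>f\<in>Arr C. Dom D (F1 f) = F0 (Dom C f) \<and> Cod D (F1 f) = F0 (Cod C f)) \<and>
     (\<forall>a\<in>Obj C. F1 (Idn C a) = Idn D (F0 a)) \<and>
     (\<forall>f\<in>Arr C. \<forall>g\<in>Arr C. Dom C f = Cod C g \<longrightarrow> F1 (Cmp C f g) = Cmp D (F1 f) (F1 g))"

definition full ::
  "('o, 'm) catg \<Rightarrow> ('o \<Rightarrow> 'o2) \<Rightarrow> ('m \<Rightarrow> 'm2) \<Rightarrow> ('o2, 'm2) catg \<Rightarrow> bool" where
  "full C F0 F1 D \<longleftrightarrow>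
     (\<forall>a\<in>Obj C. \<forall>b\<in>Obj C. \<forall>g\<in>Arr D. Dom D g = F0 a \<and> Cod D g = F0 b \<longrightarrow>
        (\<exists>f\<in>Arr C. Dom C f = a \<and> Cod C f = b \<and> F1 f = g))"

definition faithful :: "('o, 'm) catg \<Rightarrow> ('m \<Rightarrow> 'm2) \<Rightarrow> bool" where
  "faithful C F1 \<longleftrightarrow>
     (\<forall>f\<in>Arr C. \<forall>g\<in>Arr C. Dom C f = Dom C g \<and> Cod C f = Cod C g \<and> F1 f = F1 g \<longrightarrow> f = g)"

text \<open>The structure maps are total HOL functions.  The following condition pins down their values
  outside the domains prescribed by the mathematics, so that equality of structures is the
  set-theoretic one.\<close>

definition ext_catg :: "('o, 'm) catg \<Rightarrow> bool" where
  "ext_catg C \<longleftrightarrow>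
     Dom C \<in> extensional (Arr C) \<and> Cod C \<in> extensional (Arr C) \<and> Idn C \<in> extensional (Obj C) \<and>
     (\<forall>f g. \<not> (f \<in> Arr C \<and> g \<in> Arr C \<and> Dom C f = Cod C g) \<longrightarrow> Cmp C f g = undefined)"


section \<open>Double categories\<close>

text \<open>The four category structures on \<open>(H,O)\<close>, \<open>(V,O)\<close>, \<open>(C,V)\<close> (horizontal) and \<open>(C,H)\<close>
  (vertical), in this order.\<close>

record ('o, 'h, 'v, 'c) dbl =
  HC :: "('o, 'h) catg"
  VC :: "('o, 'v) catg"
  SH :: "('v, 'c) catg"
  SV :: "('h, 'c) catg"

definition double_category :: "('o, 'h, 'v, 'c) dbl \<Rightarrow> bool" where
  "double_category D \<longleftrightarrow>
     category (HC D) \<and> category (VC D) \<and> category (SH D) \<and> category (SV D) \<and>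
     Obj (VC D) = Obj (HC D) \<and> Obj (SH D) = Arr (VC D) \<and> Obj (SV D) = Arr (HC D) \<and>
     Arr (SV D) = Arr (SH D) \<and>
     (\<forall>x\<in>Arr (SH D).
        Dom (HC D) (Dom (SV D) x) = Dom (VC D) (Dom (SH D) x) \<and>
        Cod (HC D) (Cod (SV D) x) = Cod (VC D) (Cod (SH D) x) \<and>
        Dom (HC D) (Cod (SV D) x) = Cod (VC D) (Dom (SH D) x) \<and>
        Dom (VC D) (Cod (SH D) x) = Cod (HC D) (Dom (SV D) x)) \<and>
     (\<forall>f\<in>Arr (HC D).
        Dom (SH D) (Idn (SV D) f) = Idn (VC D) (Dom (HC D) f) \<and>
        Cod (SH D) (Idn (SV D) f) = Idn (VC D) (Cod (HC D) f)) \<and>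
     (\<forall>u\<in>Arr (VC D).
        Dom (SV D) (Idn (SH D) u) = Idn (HC D) (Dom (VC D) u) \<and>
        Cod (SV D) (Idn (SH D) u) = Idn (HC D) (Cod (VC D) u)) \<and>
     (\<forall>a\<in>Obj (HC D). Idn (SH D) (Idn (VC D) a) = Idn (SV D) (Idn (HC D) a)) \<and>
     (\<forall>x\<in>Arr (SH D). \<forall>y\<in>Arr (SH D). Dom (SH D) x = Cod (SH D) y \<longrightarrow>
        Dom (SV D) (Cmp (SH D) x y) = Cmp (HC D) (Dom (SV D) x) (Dom (SV D) y) \<and>
        Cod (SV D) (Cmp (SH D) x y) = Cmp (HC D) (Cod (SV D) x) (Cod (SV D) y)) \<and>
     (\<forall>x\<in>Arr (SH D). \<forall>y\<in>Arr (SH D). Dom (SV D) x = Cod (SV D) y \<longrightarrow>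
        Dom (SH D) (Cmp (SV D) x y) = Cmp (VC D) (Dom (SH D) x) (Dom (SH D) y) \<and>
        Cod (SH D) (Cmp (SV D) x y) = Cmp (VC D) (Cod (SH D) x) (Cod (SH D) y)) \<and>
     (\<forall>f\<in>Arr (HC D). \<forall>g\<in>Arr (HC D). Dom (HC D) f = Cod (HC D) g \<longrightarrow>
        Idn (SV D) (Cmp (HC D) f g) = Cmp (SH D) (Idn (SV D) f) (Idn (SV D) g)) \<and>
     (\<forall>u\<in>Arr (VC D). \<forall>w\<in>Arr (VC D). Dom (VC D) u = Cod (VC D) w \<longrightarrow>
        Idn (SH D) (Cmp (VC D) u w) = Cmp (SV D) (Idn (SH D) u) (Idn (SH D) w)) \<and>
     (\<forall>x\<in>Arr (SH D). \<forall>y\<in>Arr (SH D). \<forall>z\<in>Arr (SH D). \<forall>w\<in>Arr (SH D).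
        Dom (SH D) x = Cod (SH D) y \<and> Dom (SH D) z = Cod (SH D) w \<and>
        Dom (SV D) x = Cod (SV D) z \<and> Dom (SV D) y = Cod (SV D) w \<longrightarrow>
        Cmp (SV D) (Cmp (SH D) x y) (Cmp (SH D) z w) =
        Cmp (SH D) (Cmp (SV D) x z) (Cmp (SV D) y w))"

definition double_groupoid :: "('o, 'h, 'v, 'c) dbl \<Rightarrow> bool" where
  "double_groupoid D \<longleftrightarrow> double_category D \<and>
     groupoid (HC D) \<and> groupoid (VC D) \<and> groupoid (SH D) \<and> groupoid (SV D)"

definition filling :: "('o, 'h, 'v, 'c) dbl \<Rightarrow> bool" where
  "filling D \<longleftrightarrow> (\<forall>g\<in>Arr (HC D). \<forall>u\<in>Arr (VC D). Dom (HC D) g = Cod (VC D) u \<longrightarrow>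
     (\<exists>x\<in>Arr (SH D). Dom (SH D) x = u \<and> Cod (SV D) x = g))"

definition ext_dbl :: "('o, 'h, 'v, 'c) dbl \<Rightarrow> bool" where
  "ext_dbl D \<longleftrightarrow> ext_catg (HC D) \<and> ext_catg (VC D) \<and> ext_catg (SH D) \<and> ext_catg (SV D)"

record ('o, 'h, 'v, 'c, 'o2, 'h2, 'v2, 'c2) dfun =
  fO :: "'o \<Rightarrow> 'o2"
  fH :: "'h \<Rightarrow> 'h2"
  fV :: "'v \<Rightarrow> 'v2"
  fC :: "'c \<Rightarrow> 'c2"

definition dbl_homs ::
  "('o, 'h, 'v, 'c) dbl \<Rightarrow> ('o2, 'h2, 'v2, 'c2) dbl \<Rightarrow>
   ('o, 'h, 'v, 'c, 'o2, 'h2, 'v2, 'c2) dfun set" where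
  "dbl_homs D E = {F.
     is_functor (HC D) (fO F) (fH F) (HC E) \<and> is_functor (VC D) (fO F) (fV F) (VC E) \<and>
     is_functor (SH D) (fV F) (fC F) (SH E) \<and> is_functor (SV D) (fH F) (fC F) (SV E) \<and>
     fO F \<in> extensional (Obj (HC D)) \<and> fH F \<in> extensional (Arr (HC D)) \<and>
     fV F \<in> extensional (Arr (VC D)) \<and> fC F \<in> extensional (Arr (SH D))}"

definition dbl_id :: "('o, 'h, 'v, 'c) dbl \<Rightarrow> ('o, 'h, 'v, 'c, 'o, 'h, 'v, 'c) dfun" where
  "dbl_id D = \<lparr>fO = (\<lambda>a\<in>Obj (HC D). a), fH = (\<lambda>f\<in>Arr (HC D). f),
               fV = (\<lambda>u\<in>Arr (VC D). u), fC = (\<lambda>x\<in>Arr (SH D). x)\<rparr>"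

text \<open>\<open>dbl_comp D G F\<close> is \<open>G\<close> after \<open>F\<close>, where \<open>D\<close> is the source of \<open>F\<close>.\<close>

definition dbl_comp ::
  "('o, 'h, 'v, 'c) dbl \<Rightarrow> ('o2, 'h2, 'v2, 'c2, 'o3, 'h3, 'v3, 'c3) dfun \<Rightarrow>
   ('o, 'h, 'v, 'c, 'o2, 'h2, 'v2, 'c2) dfun \<Rightarrow>
   ('o, 'h, 'v, 'c, 'o3, 'h3, 'v3, 'c3) dfun" where
  "dbl_comp D G F = \<lparr>fO = compose (Obj (HC D)) (fO G) (fO F),
                     fH = compose (Arr (HC D)) (fH G) (fH F),
                     fV = compose (Arr (VC D)) (fV G) (fV F),
                     fC = compose (Arr (SH D)) (fC G) (fC F)\<rparr>"

definition dbl_isos ::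
  "('o, 'h, 'v, 'c) dbl \<Rightarrow> ('o2, 'h2, 'v2, 'c2) dbl \<Rightarrow>
   ('o, 'h, 'v, 'c, 'o2, 'h2, 'v2, 'c2) dfun set" where
  "dbl_isos D E = {F \<in> dbl_homs D E.
     \<exists>G\<in>dbl_homs E D. dbl_comp D G F = dbl_id D \<and> dbl_comp E F G = dbl_id E}"

type_synonym ('o, 'h, 'v, 'c) dbl_arr =
  "('o, 'h, 'v, 'c) dbl \<times> ('o, 'h, 'v, 'c, 'o, 'h, 'v, 'c) dfun \<times> ('o, 'h, 'v, 'c) dbl"

definition DGpd :: "(('o, 'h, 'v, 'c) dbl, ('o, 'h, 'v, 'c) dbl_arr) catg" where
  "DGpd = (let Ob = {D. double_groupoid D \<and> filling D \<and> ext_dbl D} in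
     \<lparr>Obj = Ob,
      Arr = {(D, F, E). D \<in> Ob \<and> E \<in> Ob \<and> F \<in> dbl_homs D E},
      Dom = (\<lambda>(D, F, E). D),
      Cod = (\<lambda>(D, F, E). E),
      Idn = (\<lambda>D. (D, dbl_id D, D)),
      Cmp = (\<lambda>(D', G, E') (D, F, E). (D, dbl_comp D G F, E'))\<rparr>)"


section \<open>Simplicial and bisimplicial sets\<close>

text \<open>\<open>ops m n\<close> is the set of monotone maps \<open>[m] \<rightarrow> [n]\<close>; simplicial and bisimplicial sets are
  presheaves: \<open>sact L m n \<alpha>\<close> is the operator \<open>L n \<rightarrow> L m\<close> induced by \<open>\<alpha>\<close>, and
  \<open>bact K m n p q \<alpha> \<beta>\<close> is the operator \<open>K p q \<rightarrow> K m n\<close> induced by \<open>\<alpha> : [m] \<rightarrow> [p]\<close>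
  (horizontal) and \<open>\<beta> : [n] \<rightarrow> [q]\<close> (vertical).\<close>

definition ops :: "nat \<Rightarrow> nat \<Rightarrow> (nat \<Rightarrow> nat) set" where
  "ops m n = {\<alpha> \<in> {..m} \<rightarrow>\<^sub>E {..n}. mono_on {..m} \<alpha>}"

definition idop :: "nat \<Rightarrow> nat \<Rightarrow> nat" where
  "idop n = (\<lambda>i\<in>{..n}. i)"

text \<open>The maps \<open>[n - 1] \<rightarrow> [n]\<close> omitting \<open>i\<close> (for \<open>n \<ge> 1\<close>) and \<open>[n + 1] \<rightarrow> [n]\<close> repeating \<open>i\<close>.\<close>

definition coface :: "nat \<Rightarrow> nat \<Rightarrow> nat \<Rightarrow> nat" where
  "coface n i = (\<lambda>j\<in>{..n - 1}. if j < i then j else j + 1)"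

definition codeg :: "nat \<Rightarrow> nat \<Rightarrow> nat \<Rightarrow> nat" where
  "codeg n i = (\<lambda>j\<in>{..n + 1}. if j \<le> i then j else j - 1)"

record 'a sset =
  simps :: "nat \<Rightarrow> 'a set"
  sact :: "nat \<Rightarrow> nat \<Rightarrow> (nat \<Rightarrow> nat) \<Rightarrow> 'a \<Rightarrow> 'a"

definition simplicial_set :: "'a sset \<Rightarrow> bool" where
  "simplicial_set L \<longleftrightarrow>
     (\<forall>m n. \<forall>\<alpha>\<in>ops m n. sact L m n \<alpha> \<in> simps L n \<rightarrow> simps L m) \<and>
     (\<forall>n. \<forall>x\<in>simps L n. sact L n n (idop n) x = x) \<and>
     (\<forall>k m n. \<forall>\<beta>\<in>ops k m. \<forall>\<alpha>\<in>ops m n. \<forall>x\<in>simps L n.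
        sact L k m \<beta> (sact L m n \<alpha> x) = sact L k n (compose {..k} \<alpha> \<beta>) x)"

definition sset_homs :: "'a sset \<Rightarrow> 'b sset \<Rightarrow> (nat \<Rightarrow> 'a \<Rightarrow> 'b) set" where
  "sset_homs L M = {f. (\<forall>n. f n \<in> simps L n \<rightarrow>\<^sub>E simps M n) \<and>
     (\<forall>m n. \<forall>\<alpha>\<in>ops m n. \<forall>x\<in>simps L n. f m (sact L m n \<alpha> x) = sact M m n \<alpha> (f n x))}"

definition face :: "'a sset \<Rightarrow> nat \<Rightarrow> nat \<Rightarrow> 'a \<Rightarrow> 'a" where
  "face L n i = sact L (n - 1) n (coface n i)"

definition degen :: "'a sset \<Rightarrow> nat \<Rightarrow> nat \<Rightarrow> 'a \<Rightarrow> 'a" where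
  "degen L n i = sact L (n + 1) n (codeg n i)"

definition Delta :: "nat \<Rightarrow> (nat \<Rightarrow> nat) sset" where
  "Delta n = \<lparr>simps = (\<lambda>m. ops m n), sact = (\<lambda>k m \<beta> \<alpha>. compose {..k} \<alpha> \<beta>)\<rparr>"

definition generated :: "'a sset \<Rightarrow> (nat \<Rightarrow> 'a set) \<Rightarrow> 'a sset" where
  "generated L X = L\<lparr>simps := \<lambda>m. {sact L m n \<alpha> x | n \<alpha> x. \<alpha> \<in> ops m n \<and> x \<in> X n}\<rparr>"

definition Horn :: "nat \<Rightarrow> nat \<Rightarrow> (nat \<Rightarrow> nat) sset" where
  "Horn k n = generated (Delta n) (\<lambda>m. {coface n i | i. m = n - 1 \<and> i \<le> n \<and> i \<noteq> k})"

definition Kan :: "'a sset \<Rightarrow> bool" where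
  "Kan L \<longleftrightarrow> simplicial_set L \<and>
     (\<forall>n k. 1 \<le> n \<and> k \<le> n \<longrightarrow>
        (\<forall>f\<in>sset_homs (Horn k n) L. \<exists>g\<in>sset_homs (Delta n) L.
           \<forall>m. \<forall>x\<in>simps (Horn k n) m. g m x = f m x))"

definition homotopic :: "'a sset \<Rightarrow> nat \<Rightarrow> 'a \<Rightarrow> 'a \<Rightarrow> bool" where
  "homotopic L n x x' \<longleftrightarrow> x \<in> simps L n \<and> x' \<in> simps L n \<and>
     (1 \<le> n \<longrightarrow> (\<forall>i\<le>n. face L n i x = face L n i x')) \<and>
     (\<exists>y\<in>simps L (n + 1).
        (\<forall>i<n. face L (n + 1) i y = degen L (n - 1) (n - 1) (face L n i x)) \<and>
        face L (n + 1) n y = x \<and> face L (n + 1) (n + 1) y = x')"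

definition hclass :: "'a sset \<Rightarrow> nat \<Rightarrow> 'a \<Rightarrow> 'a set" where
  "hclass L n x = {x'. homotopic L n x x'}"

text \<open>The totally degenerate \<open>n\<close>-simplex on a vertex, and the underlying set of \<open>\<pi>\<^sub>n(L,a)\<close>
  for \<open>n \<ge> 1\<close>, whose neutral element is the class of that simplex.\<close>

definition base_simplex :: "'a sset \<Rightarrow> nat \<Rightarrow> 'a \<Rightarrow> 'a" where
  "base_simplex L n a = sact L n 0 (\<lambda>i\<in>{..n}. 0) a"

definition homotopy_group :: "'a sset \<Rightarrow> nat \<Rightarrow> 'a \<Rightarrow> 'a set set" where
  "homotopy_group L n a =
     hclass L n ` {x \<in> simps L n. \<forall>i\<le>n. face L n i x = base_simplex L (n - 1) a}"

definition homotopy_group_zero :: "'a sset \<Rightarrow> nat \<Rightarrow> 'a \<Rightarrow> bool" where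
  "homotopy_group_zero L n a \<longleftrightarrow> homotopy_group L n a = {hclass L n (base_simplex L n a)}"

definition fund_groupoid :: "'a sset \<Rightarrow> ('a, 'a set) catg" where
  "fund_groupoid L = (let A = hclass L 1 ` simps L 1;
      s = (\<lambda>X\<in>A. THE a. \<exists>x\<in>simps L 1. X = hclass L 1 x \<and> a = face L 1 0 x);
      t = (\<lambda>X\<in>A. THE a. \<exists>x\<in>simps L 1. X = hclass L 1 x \<and> a = face L 1 1 x) in
     \<lparr>Obj = simps L 0,
      Arr = A,
      Dom = s,
      Cod = t,
      Idn = (\<lambda>a\<in>simps L 0. hclass L 1 (degen L 0 0 a)),
      Cmp = (\<lambda>X X'. if X \<in> A \<and> X' \<in> A \<and> s X = t X' then
               (THE Z. \<exists>y\<in>simps L 2. X = hclass L 1 (face L 2 2 y) \<and>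
                  X' = hclass L 1 (face L 2 0 y) \<and> Z = hclass L 1 (face L 2 1 y))
             else undefined)\<rparr>)"

record 'a bisset =
  bisimps :: "nat \<Rightarrow> nat \<Rightarrow> 'a set"
  bact :: "nat \<Rightarrow> nat \<Rightarrow> nat \<Rightarrow> nat \<Rightarrow> (nat \<Rightarrow> nat) \<Rightarrow> (nat \<Rightarrow> nat) \<Rightarrow> 'a \<Rightarrow> 'a"

definition bisimplicial_set :: "'a bisset \<Rightarrow> bool" where
  "bisimplicial_set K \<longleftrightarrow>
     (\<forall>m n p q. \<forall>\<alpha>\<in>ops m p. \<forall>\<beta>\<in>ops n q. bact K m n p q \<alpha> \<beta> \<in> bisimps K p q \<rightarrow> bisimps K m n) \<and>
     (\<forall>p q. \<forall>x\<in>bisimps K p q. bact K p q p q (idop p) (idop q) x = x) \<and>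
     (\<forall>i j m n p q. \<forall>\<alpha>'\<in>ops i m. \<forall>\<beta>'\<in>ops j n. \<forall>\<alpha>\<in>ops m p. \<forall>\<beta>\<in>ops n q. \<forall>x\<in>bisimps K p q.
        bact K i j m n \<alpha>' \<beta>' (bact K m n p q \<alpha> \<beta> x) =
        bact K i j p q (compose {..i} \<alpha> \<alpha>') (compose {..j} \<beta> \<beta>') x)"

definition bis_homs :: "'a bisset \<Rightarrow> 'b bisset \<Rightarrow> (nat \<Rightarrow> nat \<Rightarrow> 'a \<Rightarrow> 'b) set" where
  "bis_homs K L = {f. (\<forall>p q. f p q \<in> bisimps K p q \<rightarrow>\<^sub>E bisimps L p q) \<and>
     (\<forall>m n p q. \<forall>\<alpha>\<in>ops m p. \<forall>\<beta>\<in>ops n q. \<forall>x\<in>bisimps K p q.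
        f m n (bact K m n p q \<alpha> \<beta> x) = bact L m n p q \<alpha> \<beta> (f p q x))}"

definition bis_id :: "'a bisset \<Rightarrow> nat \<Rightarrow> nat \<Rightarrow> 'a \<Rightarrow> 'a" where
  "bis_id K p q = (\<lambda>x\<in>bisimps K p q. x)"

text \<open>\<open>bis_comp K g f\<close> is \<open>g\<close> after \<open>f\<close>, where \<open>K\<close> is the source of \<open>f\<close>.\<close>

definition bis_comp ::
  "'a bisset \<Rightarrow> (nat \<Rightarrow> nat \<Rightarrow> 'b \<Rightarrow> 'c) \<Rightarrow> (nat \<Rightarrow> nat \<Rightarrow> 'a \<Rightarrow> 'b) \<Rightarrow> nat \<Rightarrow> nat \<Rightarrow> 'a \<Rightarrow> 'c" where
  "bis_comp K g f p q = compose (bisimps K p q) (g p q) (f p q)"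

text \<open>The simplicial sets \<open>K\<^sub>*\<^sub>,\<^sub>q\<close> and \<open>K\<^sub>p\<^sub>,\<^sub>*\<close>.\<close>

definition hrow :: "'a bisset \<Rightarrow> nat \<Rightarrow> 'a sset" where
  "hrow K q = \<lparr>simps = (\<lambda>p. bisimps K p q), sact = (\<lambda>m n \<alpha>. bact K m q n q \<alpha> (idop q))\<rparr>"

definition vcol :: "'a bisset \<Rightarrow> nat \<Rightarrow> 'a sset" where
  "vcol K p = \<lparr>simps = (\<lambda>q. bisimps K p q), sact = (\<lambda>m n \<beta>. bact K p m p n (idop p) \<beta>)\<rparr>"

definition hface :: "'a bisset \<Rightarrow> nat \<Rightarrow> nat \<Rightarrow> nat \<Rightarrow> 'a \<Rightarrow> 'a" where
  "hface K p q i = face (hrow K q) p i"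

definition vface :: "'a bisset \<Rightarrow> nat \<Rightarrow> nat \<Rightarrow> nat \<Rightarrow> 'a \<Rightarrow> 'a" where
  "vface K p q j = face (vcol K p) q j"

definition hdegen :: "'a bisset \<Rightarrow> nat \<Rightarrow> nat \<Rightarrow> nat \<Rightarrow> 'a \<Rightarrow> 'a" where
  "hdegen K p q i = degen (hrow K q) p i"

definition vdegen :: "'a bisset \<Rightarrow> nat \<Rightarrow> nat \<Rightarrow> nat \<Rightarrow> 'a \<Rightarrow> 'a" where
  "vdegen K p q j = degen (vcol K p) q j"

definition biDelta :: "nat \<Rightarrow> nat \<Rightarrow> ((nat \<Rightarrow> nat) \<times> (nat \<Rightarrow> nat)) bisset" where
  "biDelta p q = \<lparr>bisimps = (\<lambda>m n. ops m p \<times> ops n q),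
     bact = (\<lambda>i j m n \<alpha>' \<beta>' (\<alpha>, \<beta>). (compose {..i} \<alpha> \<alpha>', compose {..j} \<beta> \<beta>'))\<rparr>"

definition bigenerated :: "'a bisset \<Rightarrow> (nat \<Rightarrow> nat \<Rightarrow> 'a set) \<Rightarrow> 'a bisset" where
  "bigenerated K X = K\<lparr>bisimps := \<lambda>m n.
     {bact K m n p q \<alpha> \<beta> x | p q \<alpha> \<beta> x. \<alpha> \<in> ops m p \<and> \<beta> \<in> ops n q \<and> x \<in> X p q}\<rparr>"

definition biHorn :: "nat \<Rightarrow> nat \<Rightarrow> nat \<Rightarrow> nat \<Rightarrow> ((nat \<Rightarrow> nat) \<times> (nat \<Rightarrow> nat)) bisset" where
  "biHorn k l p q = bigenerated (biDelta p q) (\<lambda>m n.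
     {(coface p i, idop q) | i. m = p - 1 \<and> n = q \<and> i \<le> p \<and> i \<noteq> k} \<union>
     {(idop p, coface q j) | j. m = p \<and> n = q - 1 \<and> j \<le> q \<and> j \<noteq> l})"

definition extension_condition :: "'a bisset \<Rightarrow> bool" where
  "extension_condition K \<longleftrightarrow>
     (\<forall>p. Kan (vcol K p)) \<and> (\<forall>q. Kan (hrow K q)) \<and>
     (\<forall>p q k l. 1 \<le> p \<and> 1 \<le> q \<and> k \<le> p \<and> l \<le> q \<longrightarrow>
        (\<forall>f\<in>bis_homs (biHorn k l p q) K. \<exists>g\<in>bis_homs (biDelta p q) K.
           \<forall>m n. \<forall>x\<in>bisimps (biHorn k l p q) m n. g m n x = f m n x))"

type_synonym 'a bis_arr = "'a bisset \<times> (nat \<Rightarrow> nat \<Rightarrow> 'a \<Rightarrow> 'a) \<times> 'a bisset"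

definition BiSet :: "('a bisset, 'a bis_arr) catg" where
  "BiSet = (let Ob = {K. bisimplicial_set K \<and> extension_condition K \<and>
       (\<forall>a\<in>bisimps K 0 0. homotopy_group_zero (hrow K 0) 2 a \<and>
          homotopy_group_zero (vcol K 0) 2 a)} in
     \<lparr>Obj = Ob,
      Arr = {(K, f, L). K \<in> Ob \<and> L \<in> Ob \<and> f \<in> bis_homs K L},
      Dom = (\<lambda>(K, f, L). K),
      Cod = (\<lambda>(K, f, L). L),
      Idn = (\<lambda>K. (K, bis_id K, K)),
      Cmp = (\<lambda>(K', g, L') (K, f, L). (K, bis_comp K g f, L'))\<rparr>)"


section \<open>The double nerve\<close>

text \<open>The arrow \<open>j \<rightarrow> i\<close> of \<open>[n]\<close>, for \<open>i \<le> j\<close>, is the pair \<open>(i, j)\<close>.\<close>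

definition ord_cat :: "nat \<Rightarrow> (nat, nat \<times> nat) catg" where
  "ord_cat n = \<lparr>Obj = {..n}, Arr = {(i, j). i \<le> j \<and> j \<le> n}, Dom = snd, Cod = fst,
     Idn = (\<lambda>i. (i, i)), Cmp = (\<lambda>f g. (fst f, snd g))\<rparr>"

definition tensor ::
  "('a, 'f) catg \<Rightarrow> ('b, 'g) catg \<Rightarrow> ('a \<times> 'b, 'f \<times> 'b, 'a \<times> 'g, 'f \<times> 'g) dbl" where
  "tensor A B = \<lparr>
     HC = \<lparr>Obj = Obj A \<times> Obj B, Arr = Arr A \<times> Obj B,
           Dom = (\<lambda>(f, b). (Dom A f, b)), Cod = (\<lambda>(f, b). (Cod A f, b)),
           Idn = (\<lambda>(a, b). (Idn A a, b)), Cmp = (\<lambda>(f, b) (f', b'). (Cmp A f f', b))\<rparr>,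
     VC = \<lparr>Obj = Obj A \<times> Obj B, Arr = Obj A \<times> Arr B,
           Dom = (\<lambda>(a, u). (a, Dom B u)), Cod = (\<lambda>(a, u). (a, Cod B u)),
           Idn = (\<lambda>(a, b). (a, Idn B b)), Cmp = (\<lambda>(a, u) (a', u'). (a, Cmp B u u'))\<rparr>,
     SH = \<lparr>Obj = Obj A \<times> Arr B, Arr = Arr A \<times> Arr B,
           Dom = (\<lambda>(f, u). (Dom A f, u)), Cod = (\<lambda>(f, u). (Cod A f, u)),
           Idn = (\<lambda>(a, u). (Idn A a, u)), Cmp = (\<lambda>(f, u) (f', u'). (Cmp A f f', u))\<rparr>,
     SV = \<lparr>Obj = Arr A \<times> Obj B, Arr = Arr A \<times> Arr B,
           Dom = (\<lambda>(f, u). (f, Dom B u)), Cod = (\<lambda>(f, u). (f, Cod B u)),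
           Idn = (\<lambda>(f, b). (f, Idn B b)), Cmp = (\<lambda>(f, u) (f', u'). (f, Cmp B u u'))\<rparr>\<rparr>"

abbreviation grid ::
  "nat \<Rightarrow> nat \<Rightarrow> (nat \<times> nat, (nat \<times> nat) \<times> nat, nat \<times> (nat \<times> nat), (nat \<times> nat) \<times> (nat \<times> nat)) dbl"
  where "grid p q \<equiv> tensor (ord_cat p) (ord_cat q)"

type_synonym ('o, 'h, 'v, 'c) grid_fun =
  "(nat \<times> nat, (nat \<times> nat) \<times> nat, nat \<times> (nat \<times> nat), (nat \<times> nat) \<times> (nat \<times> nat), 'o, 'h, 'v, 'c) dfun"

text \<open>The double functor \<open>[m] \<otimes> [n] \<rightarrow> [p] \<otimes> [q]\<close> induced by \<open>\<alpha> : [m] \<rightarrow> [p]\<close> and \<open>\<beta> : [n] \<rightarrow> [q]\<close>.\<close>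

definition grid_map ::
  "nat \<Rightarrow> nat \<Rightarrow> (nat \<Rightarrow> nat) \<Rightarrow> (nat \<Rightarrow> nat) \<Rightarrow>
   (nat \<times> nat, (nat \<times> nat) \<times> nat, nat \<times> (nat \<times> nat), (nat \<times> nat) \<times> (nat \<times> nat)) grid_fun" where
  "grid_map m n \<alpha> \<beta> = \<lparr>
     fO = restrict (map_prod \<alpha> \<beta>) (Obj (HC (grid m n))),
     fH = restrict (map_prod (map_prod \<alpha> \<alpha>) \<beta>) (Arr (HC (grid m n))),
     fV = restrict (map_prod \<alpha> (map_prod \<beta> \<beta>)) (Arr (VC (grid m n))),
     fC = restrict (map_prod (map_prod \<alpha> \<alpha>) (map_prod \<beta> \<beta>)) (Arr (SH (grid m n)))\<rparr>"

definition Nerve :: "('o, 'h, 'v, 'c) dbl \<Rightarrow> ('o, 'h, 'v, 'c) grid_fun bisset" where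
  "Nerve G = \<lparr>bisimps = (\<lambda>p q. dbl_homs (grid p q) G),
     bact = (\<lambda>m n p q \<alpha> \<beta> x. dbl_comp (grid m n) x (grid_map m n \<alpha> \<beta>))\<rparr>"

definition nerve_map ::
  "('o, 'h, 'v, 'c) dbl \<Rightarrow> ('o, 'h, 'v, 'c, 'o2, 'h2, 'v2, 'c2) dfun \<Rightarrow>
   nat \<Rightarrow> nat \<Rightarrow> ('o, 'h, 'v, 'c) grid_fun \<Rightarrow> ('o2, 'h2, 'v2, 'c2) grid_fun" where
  "nerve_map G F p q = (\<lambda>x\<in>bisimps (Nerve G) p q. dbl_comp (grid p q) F x)"

definition nerve_arr :: "('o, 'h, 'v, 'c) dbl_arr \<Rightarrow> ('o, 'h, 'v, 'c) grid_fun bis_arr" where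
  "nerve_arr = (\<lambda>(G, F, G'). (Nerve G, nerve_map G F, Nerve G'))"


section \<open>The homotopy double groupoid\<close>

definition hcls :: "'a bisset \<Rightarrow> nat \<Rightarrow> nat \<Rightarrow> 'a \<Rightarrow> 'a set" where
  "hcls K p q x = hclass (hrow K q) p x"

definition vcls :: "'a bisset \<Rightarrow> nat \<Rightarrow> nat \<Rightarrow> 'a \<Rightarrow> 'a set" where
  "vcls K p q x = hclass (vcol K p) q x"

definition bihomotopic :: "'a bisset \<Rightarrow> nat \<Rightarrow> nat \<Rightarrow> 'a \<Rightarrow> 'a \<Rightarrow> bool" where
  "bihomotopic K p q x x' \<longleftrightarrow> x \<in> bisimps K p q \<and> x' \<in> bisimps K p q \<and>
     (\<exists>y\<in>bisimps K p q. hcls K p q x = hcls K p q y \<and> vcls K p q y = vcls K p q x')"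

definition bicls :: "'a bisset \<Rightarrow> nat \<Rightarrow> nat \<Rightarrow> 'a \<Rightarrow> 'a set" where
  "bicls K p q x = {x'. bihomotopic K p q x x'}"

text \<open>Horizontal and vertical category structures on the set of bihomotopy classes of
  \<open>(1,1)\<close>-bisimplices.\<close>

definition sq_hcat :: "'a bisset \<Rightarrow> ('a set, 'a set) catg" where
  "sq_hcat K = (let A = bicls K 1 1 ` bisimps K 1 1;
      s = (\<lambda>X\<in>A. THE u. \<exists>x\<in>bisimps K 1 1. X = bicls K 1 1 x \<and> u = vcls K 0 1 (hface K 1 1 0 x));
      t = (\<lambda>X\<in>A. THE u. \<exists>x\<in>bisimps K 1 1. X = bicls K 1 1 x \<and> u = vcls K 0 1 (hface K 1 1 1 x)) in
     \<lparr>Obj = vcls K 0 1 ` bisimps K 0 1,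
      Arr = A,
      Dom = s,
      Cod = t,
      Idn = (\<lambda>U\<in>vcls K 0 1 ` bisimps K 0 1.
               THE Z. \<exists>u\<in>bisimps K 0 1. U = vcls K 0 1 u \<and> Z = bicls K 1 1 (hdegen K 0 1 0 u)),
      Cmp = (\<lambda>X Y. if X \<in> A \<and> Y \<in> A \<and> s X = t Y then
               (THE Z. \<exists>x\<in>bisimps K 1 1. \<exists>y\<in>bisimps K 1 1. \<exists>x'\<in>bisimps K 1 1. \<exists>c\<in>bisimps K 2 1.
                  X = bicls K 1 1 x \<and> Y = bicls K 1 1 y \<and>
                  vcls K 1 1 x' = vcls K 1 1 x \<and> hface K 1 1 0 x' = hface K 1 1 1 y \<and>
                  hface K 2 1 2 c = x' \<and> hface K 2 1 0 c = y \<and>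
                  Z = bicls K 1 1 (hface K 2 1 1 c))
             else undefined)\<rparr>)"

definition sq_vcat :: "'a bisset \<Rightarrow> ('a set, 'a set) catg" where
  "sq_vcat K = (let A = bicls K 1 1 ` bisimps K 1 1;
      s = (\<lambda>X\<in>A. THE f. \<exists>x\<in>bisimps K 1 1. X = bicls K 1 1 x \<and> f = hcls K 1 0 (vface K 1 1 0 x));
      t = (\<lambda>X\<in>A. THE f. \<exists>x\<in>bisimps K 1 1. X = bicls K 1 1 x \<and> f = hcls K 1 0 (vface K 1 1 1 x)) in
     \<lparr>Obj = hcls K 1 0 ` bisimps K 1 0,
      Arr = A,
      Dom = s,
      Cod = t,
      Idn = (\<lambda>F\<in>hcls K 1 0 ` bisimps K 1 0.
               THE Z. \<exists>f\<in>bisimps K 1 0. F = hcls K 1 0 f \<and> Z = bicls K 1 1 (vdegen K 1 0 0 f)),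
      Cmp = (\<lambda>X Y. if X \<in> A \<and> Y \<in> A \<and> s X = t Y then
               (THE Z. \<exists>x\<in>bisimps K 1 1. \<exists>y\<in>bisimps K 1 1. \<exists>x'\<in>bisimps K 1 1. \<exists>c\<in>bisimps K 1 2.
                  X = bicls K 1 1 x \<and> Y = bicls K 1 1 y \<and>
                  hcls K 1 1 x' = hcls K 1 1 x \<and> vface K 1 1 0 x' = vface K 1 1 1 y \<and>
                  vface K 1 2 2 c = x' \<and> vface K 1 2 0 c = y \<and>
                  Z = bicls K 1 1 (vface K 1 2 1 c))
             else undefined)\<rparr>)"

definition PGpd :: "'a bisset \<Rightarrow> ('a, 'a set, 'a set, 'a set) dbl" where
  "PGpd K = \<lparr>HC = fund_groupoid (hrow K 0), VC = fund_groupoid (vcol K 0),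
             SH = sq_hcat K, SV = sq_vcat K\<rparr>"

definition P_map ::
  "'a bisset \<Rightarrow> (nat \<Rightarrow> nat \<Rightarrow> 'a \<Rightarrow> 'b) \<Rightarrow> 'b bisset \<Rightarrow>
   ('a, 'a set, 'a set, 'a set, 'b, 'b set, 'b set, 'b set) dfun" where
  "P_map K f L = \<lparr>
     fO = (\<lambda>a\<in>bisimps K 0 0. f 0 0 a),
     fH = (\<lambda>X\<in>Arr (HC (PGpd K)).
             THE Z. \<exists>x\<in>bisimps K 1 0. X = hcls K 1 0 x \<and> Z = hcls L 1 0 (f 1 0 x)),
     fV = (\<lambda>X\<in>Arr (VC (PGpd K)).
             THE Z. \<exists>x\<in>bisimps K 0 1. X = vcls K 0 1 x \<and> Z = vcls L 0 1 (f 0 1 x)),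
     fC = (\<lambda>X\<in>Arr (SH (PGpd K)).
             THE Z. \<exists>x\<in>bisimps K 1 1. X = bicls K 1 1 x \<and> Z = bicls L 1 1 (f 1 1 x))\<rparr>"

definition P_arr :: "'a bis_arr \<Rightarrow> ('a, 'a set, 'a set, 'a set) dbl_arr" where
  "P_arr = (\<lambda>(K, f, L). (PGpd K, P_map K f L, PGpd L))"


section \<open>The unit and counit\<close>

text \<open>\<open>eps K\<close> sends a bisimplex \<open>x\<close> to the double functor to \<open>PGpd K\<close> given by its vertices and
  by the classes of its edges and squares, i.e. of its restrictions along \<open>[0] \<rightarrow> [n]\<close>, \<open>0 \<mapsto> i\<close>,
  and \<open>[1] \<rightarrow> [n]\<close>, \<open>0 \<mapsto> i\<close>, \<open>1 \<mapsto> j\<close>.\<close>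

definition vertex_op :: "nat \<Rightarrow> nat \<Rightarrow> nat" where
  "vertex_op i = (\<lambda>k\<in>{..0}. i)"

definition edge_op :: "nat \<times> nat \<Rightarrow> nat \<Rightarrow> nat" where
  "edge_op e = (\<lambda>k\<in>{..1}. if k = 0 then fst e else snd e)"

definition eps ::
  "'a bisset \<Rightarrow> nat \<Rightarrow> nat \<Rightarrow> 'a \<Rightarrow> ('a, 'a set, 'a set, 'a set) grid_fun" where
  "eps K p q = (\<lambda>x\<in>bisimps K p q. \<lparr>
     fO = (\<lambda>(i, j)\<in>Obj (HC (grid p q)). bact K 0 0 p q (vertex_op i) (vertex_op j) x),
     fH = (\<lambda>(e, j)\<in>Arr (HC (grid p q)). hcls K 1 0 (bact K 1 0 p q (edge_op e) (vertex_op j) x)),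
     fV = (\<lambda>(i, e)\<in>Arr (VC (grid p q)). vcls K 0 1 (bact K 0 1 p q (vertex_op i) (edge_op e) x)),
     fC = (\<lambda>(e, e')\<in>Arr (SH (grid p q)). bicls K 1 1 (bact K 1 1 p q (edge_op e) (edge_op e') x))\<rparr>)"

text \<open>The identification of the homotopy double groupoid of \<open>Nerve G\<close> with \<open>G\<close>: a class \<open>{x}\<close> is
  identified with \<open>x\<close>, and \<open>x\<close> with its value on the generating cell of \<open>[p] \<otimes> [q]\<close>, \<open>p, q \<le> 1\<close>.\<close>

definition PN_ident ::
  "('o, 'h, 'v, 'c) dbl \<Rightarrow>
   (('o, 'h, 'v, 'c) grid_fun, ('o, 'h, 'v, 'c) grid_fun set, ('o, 'h, 'v, 'c) grid_fun set,
    ('o, 'h, 'v, 'c) grid_fun set, 'o, 'h, 'v, 'c) dfun" where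
  "PN_ident G = \<lparr>
     fO = (\<lambda>x\<in>Obj (HC (PGpd (Nerve G))). fO x (0, 0)),
     fH = (\<lambda>X\<in>Arr (HC (PGpd (Nerve G))). fH (the_elem X) ((0, 1), 0)),
     fV = (\<lambda>X\<in>Arr (VC (PGpd (Nerve G))). fV (the_elem X) (0, (0, 1))),
     fC = (\<lambda>X\<in>Arr (SH (PGpd (Nerve G))). fC (the_elem X) ((0, 1), (0, 1)))\<rparr>"

text \<open>The adjunction bijection from double functors \<open>PGpd K \<rightarrow> G\<close> to bisimplicial maps
  \<open>K \<rightarrow> Nerve G\<close>.\<close>

definition transpose_map ::
  "'a bisset \<Rightarrow> ('a, 'a set, 'a set, 'a set, 'o, 'h, 'v, 'c) dfun \<Rightarrow>
   nat \<Rightarrow> nat \<Rightarrow> 'a \<Rightarrow> ('o, 'h, 'v, 'c) grid_fun" where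
  "transpose_map K F = bis_comp K (nerve_map (PGpd K) F) (eps K)"

end

theory Submission
  imports Defs
begin

text \<open>
  In \<open>\<^bold>P K\<close> the composite of two bihomotopy classes of squares is well defined because two vertical
  homotopies between the same edges differ by an element of \<open>\<pi>\<^sub>2 = 0\<close>: they can be made to agree
  on the common edge of the squares, and the composites of the boundary data are then connected by a
  filler of a bihorn. Transposition exchanges the two directions, so only horizontal composition has
  to be treated.

  A double functor from a grid into a double groupoid is determined by its star at any base vertex,
  the squares joining that vertex to the other ones, and every compatible star occurs. A horn or bihorn
  contains a full star once its base vertex is chosen well; the remaining low-dimensional cases are
  exactly the inverses and the filling condition. This gives the extension condition for the nerve, and
  the uniqueness of the fillers makes all homotopy relations in it trivial, so that \<open>\<^bold>P \<^bold>N G\<close> is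
  \<open>G\<close> with each cell replaced by its singleton.
  The unit sends a bisimplex to the double functor formed by the classes of its edges and squares, and
  the adjunction follows from the two triangle identities.
\<close>

section \<open>Monotone operators\<close>

text \<open>Composites in \<open>PGpd K\<close> are defined by bisimplices with strictly matching
  faces, while the data are classes. So representatives are first moved into strict position by
  lifting a homotopy of an edge to a square; the lift leaves the two faces in the other direction
  unchanged. Bihomotopy is a horizontal homotopy followed by a vertical one, and that the order can
  be reversed is what makes it an equivalence relation and invariant under transposition. For the
  nerve, double functors are replaced by families of squares indexed by arbitrary pairs of rows and
  columns, not only ordered ones: inverses make this possible, and it puts all vertices on the same
  footing. The base vertex of a horn is then the one opposite to the omitted face, because it lies
  in every face that is present. The transpose \<open>tr K\<close> has the same type as
  \<open>K\<close>, so lemmas transfer by instantiation; transposing a double groupoid changes the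
  type of its nerve, and results are carried over along \<open>trn\<close>.\<close>

lemma ops_le: "\<alpha> \<in> ops m n \<Longrightarrow> i \<le> m \<Longrightarrow> \<alpha> i \<le> n"
  by (auto simp: ops_def)

lemma ops_mono: "\<alpha> \<in> ops m n \<Longrightarrow> i \<le> j \<Longrightarrow> j \<le> m \<Longrightarrow> \<alpha> i \<le> \<alpha> j"
  by (auto simp: ops_def mono_on_def)

lemma ops_extensional: "\<alpha> \<in> ops m n \<Longrightarrow> \<alpha> \<in> extensional {..m}"
  by (auto simp: ops_def PiE_def)

lemma opsI:
  assumes "\<And>i. i \<le> m \<Longrightarrow> \<alpha> i \<le> n" "\<And>i j. i \<le> j \<Longrightarrow> j \<le> m \<Longrightarrow> \<alpha> i \<le> \<alpha> j"
    "\<And>i. \<not> i \<le> m \<Longrightarrow> \<alpha> i = undefined"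
  shows "\<alpha> \<in> ops m n"
  using assms by (auto simp: ops_def PiE_def extensional_def mono_on_def)

lemma ops_eqI:
  assumes "\<alpha> \<in> extensional {..m}" "\<beta> \<in> extensional {..m}" "\<And>i. i \<le> m \<Longrightarrow> \<alpha> i = \<beta> i"
  shows "\<alpha> = \<beta>"
  using assms by (intro extensionalityI[of _ "{..m}"]) auto

lemma idop_ops [simp]: "idop n \<in> ops n n"
  by (rule opsI) (auto simp: idop_def)

lemma idop_apply [simp]: "i \<le> n \<Longrightarrow> idop n i = i"
  by (simp add: idop_def)

lemma compose_ops [simp]:
  "\<beta> \<in> ops k m \<Longrightarrow> \<alpha> \<in> ops m n \<Longrightarrow> compose {..k} \<alpha> \<beta> \<in> ops k n"
  by (rule opsI) (auto simp: compose_def intro: ops_le ops_mono)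

lemma compose_apply [simp]: "i \<le> k \<Longrightarrow> compose {..k} \<alpha> \<beta> i = \<alpha> (\<beta> i)"
  by (simp add: compose_def)

lemma compose_idop_right [simp]: "\<alpha> \<in> ops m n \<Longrightarrow> compose {..m} \<alpha> (idop m) = \<alpha>"
  by (rule ops_eqI[of _ m]) (auto simp: ops_extensional)

lemma compose_idop_left [simp]: "\<alpha> \<in> ops m n \<Longrightarrow> compose {..m} (idop n) \<alpha> = \<alpha>"
  by (rule ops_eqI[of _ m]) (auto simp: ops_extensional ops_le)

lemma coface_ops [simp]: "1 \<le> n \<Longrightarrow> i \<le> n \<Longrightarrow> m = n - 1 \<Longrightarrow> coface n i \<in> ops m n"
  by (rule opsI) (auto simp: coface_def)

lemma codeg_ops [simp]: "i \<le> n \<Longrightarrow> m = n + 1 \<Longrightarrow> codeg n i \<in> ops m n"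
  by (rule opsI) (auto simp: codeg_def)

lemma vertex_op_ops [simp]: "i \<le> n \<Longrightarrow> vertex_op i \<in> ops 0 n"
  by (rule opsI) (auto simp: vertex_op_def)

lemma vertex_op_apply [simp]: "vertex_op i 0 = i"
  by (simp add: vertex_op_def)

lemma edge_op_ops [simp]: "fst e \<le> snd e \<Longrightarrow> snd e \<le> n \<Longrightarrow> edge_op e \<in> ops 1 n"
  by (rule opsI) (auto simp: edge_op_def)

lemma edge_op_apply [simp]: "edge_op e 0 = fst e" "edge_op e (Suc 0) = snd e"
  by (auto simp: edge_op_def)

text \<open>An operator \<open>\<alpha>\<close> whose image misses \<open>i\<close> factors through
  the coface omitting \<open>i\<close>; this is the other factor. It gives access to a simplex of a
  horn through a face that contains it.\<close>

definition omit :: "nat \<Rightarrow> nat \<Rightarrow> (nat \<Rightarrow> nat) \<Rightarrow> nat \<Rightarrow> nat" where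
  "omit i m \<alpha> = (\<lambda>j\<in>{..m}. if \<alpha> j < i then \<alpha> j else \<alpha> j - 1)"

lemma omit_ops:
  assumes "\<alpha> \<in> ops m n" "i \<notin> \<alpha> ` {..m}" "i \<le> n"
  shows "omit i m \<alpha> \<in> ops m (n - 1)"
proof (rule opsI)
  fix j assume j: "j \<le> m"
  then have "\<alpha> j \<noteq> i" using assms by auto
  then show "omit i m \<alpha> j \<le> n - 1" using ops_le[OF assms(1) j] assms(3) j by (auto simp: omit_def)
next
  fix j k assume jk: "j \<le> k" "k \<le> m"
  then have "\<alpha> j \<noteq> i" "\<alpha> k \<noteq> i" using assms by auto
  then show "omit i m \<alpha> j \<le> omit i m \<alpha> k" using ops_mono[OF assms(1) jk] jk by (auto simp: omit_def)
qed (auto simp: omit_def)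

lemma coface_omit:
  assumes "\<alpha> \<in> ops m n" "i \<notin> \<alpha> ` {..m}" "i \<le> n"
  shows "compose {..m} (coface n i) (omit i m \<alpha>) = \<alpha>"
proof (rule ops_eqI)
  fix j assume j: "j \<le> m"
  then have "\<alpha> j \<noteq> i" using assms by auto
  then show "compose {..m} (coface n i) (omit i m \<alpha>) j = \<alpha> j"
    using ops_le[OF assms(1) j] assms(3) j by (auto simp: omit_def coface_def)
qed (use assms ops_extensional in auto)

lemma omit_coface: "1 \<le> n \<Longrightarrow> i \<le> n \<Longrightarrow> omit i (n - 1) (coface n i) = idop (n - 1)"
  by (rule ops_eqI[of _ "n - 1"]) (auto simp: omit_def coface_def idop_def)

lemma omit_compose: "\<beta> \<in> ops k m \<Longrightarrow> omit i k (compose {..k} \<alpha> \<beta>) = compose {..k} (omit i m \<alpha>) \<beta>"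
  by (rule ops_eqI[of _ k]) (auto simp: omit_def ops_le)

lemma coface_omits: "i \<notin> coface n i ` {..n - 1}"
  by (auto simp: coface_def)

text \<open>Once \<open>i\<close> has been removed, a larger index \<open>j\<close> is called
  \<open>j - 1\<close>. This is the cosimplicial identity for cofaces, read off on the factors, and
  it matches the index shift in the face compatibility of horn data.\<close>

lemma omit_omit:
  assumes "i < j" "i \<notin> \<alpha> ` {..m}" "j \<notin> \<alpha> ` {..m}"
  shows "omit i m (omit j m \<alpha>) = omit (j - 1) m (omit i m \<alpha>)"
    and "i \<notin> omit j m \<alpha> ` {..m}" and "j - 1 \<notin> omit i m \<alpha> ` {..m}"
proof -
  have ne: "\<alpha> l \<noteq> i \<and> \<alpha> l \<noteq> j" if "l \<le> m" for l using assms that by auto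
  show "omit i m (omit j m \<alpha>) = omit (j - 1) m (omit i m \<alpha>)"
  proof (rule ops_eqI[of _ m])
    fix l assume l: "l \<le> m"
    show "omit i m (omit j m \<alpha>) l = omit (j - 1) m (omit i m \<alpha>) l"
      using ne[OF l] assms(1) l by (auto simp: omit_def)
  qed (auto simp: omit_def)
  show "i \<notin> omit j m \<alpha> ` {..m}"
  proof
    assume "i \<in> omit j m \<alpha> ` {..m}"
    then obtain l where l: "l \<le> m" "i = omit j m \<alpha> l" by auto
    then show False using ne[OF l(1)] assms(1) by (auto simp: omit_def split: if_splits)
  qed
  show "j - 1 \<notin> omit i m \<alpha> ` {..m}"
  proof
    assume "j - 1 \<in> omit i m \<alpha> ` {..m}"
    then obtain l where l: "l \<le> m" "j - 1 = omit i m \<alpha> l" by auto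
    then show False using ne[OF l(1)] assms(1) by (auto simp: omit_def split: if_splits)
  qed
qed

lemma compose_omits: "\<beta> \<in> ops k m \<Longrightarrow> i \<notin> \<alpha> ` {..m} \<Longrightarrow> i \<notin> compose {..k} \<alpha> \<beta> ` {..k}"
  using ops_le by fastforce

section \<open>Simplicial sets and horns\<close>

lemma sact_in: "simplicial_set L \<Longrightarrow> \<alpha> \<in> ops m n \<Longrightarrow> x \<in> simps L n \<Longrightarrow> sact L m n \<alpha> x \<in> simps L m"
  unfolding simplicial_set_def by blast

lemma sact_id [simp]: "simplicial_set L \<Longrightarrow> x \<in> simps L n \<Longrightarrow> sact L n n (idop n) x = x"
  unfolding simplicial_set_def by blast

lemma sact_sact: "simplicial_set L \<Longrightarrow> \<beta> \<in> ops k m \<Longrightarrow> \<alpha> \<in> ops m n \<Longrightarrow> x \<in> simps L n \<Longrightarrow>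
    sact L k m \<beta> (sact L m n \<alpha> x) = sact L k n (compose {..k} \<alpha> \<beta>) x"
  unfolding simplicial_set_def by blast

lemma face_in:
  "simplicial_set L \<Longrightarrow> 1 \<le> n \<Longrightarrow> i \<le> n \<Longrightarrow> x \<in> simps L n \<Longrightarrow> face L n i x \<in> simps L (n - 1)"
  unfolding face_def by (rule sact_in) simp_all

lemma degen_in:
  "simplicial_set L \<Longrightarrow> i \<le> n \<Longrightarrow> x \<in> simps L n \<Longrightarrow> degen L n i x \<in> simps L (n + 1)"
  unfolding degen_def by (rule sact_in) simp_all

lemma face_face:
  assumes "simplicial_set L" "x \<in> simps L n" "i < j" "j \<le> n" "2 \<le> n"
  shows "face L (n - 1) i (face L n j x) = face L (n - 1) (j - 1) (face L n i x)"
proof -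
  have "compose {..n - 1 - 1} (coface n j) (coface (n - 1) i) =
      compose {..n - 1 - 1} (coface n i) (coface (n - 1) (j - 1))"
    by (rule ops_eqI[of _ "n - 1 - 1"]) (use assms in \<open>auto simp: coface_def\<close>)
  then show ?thesis using assms unfolding face_def by (subst (1 2) sact_sact) auto
qed

lemma face_degen_same:
  assumes "simplicial_set L" "x \<in> simps L n" "j \<le> n" "i = j \<or> i = j + 1"
  shows "face L (n + 1) i (degen L n j x) = x"
proof -
  have "compose {..n} (codeg n j) (coface (n + 1) i) = idop n"
    by (rule ops_eqI[of _ n]) (use assms in \<open>auto simp: coface_def codeg_def idop_def\<close>)
  then show ?thesis using assms unfolding face_def degen_def by (subst sact_sact) auto
qed

lemma face_degen_less:
  assumes "simplicial_set L" "x \<in> simps L n" "j \<le> n" "i < j"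
  shows "face L (n + 1) i (degen L n j x) = degen L (n - 1) (j - 1) (face L n i x)"
proof -
  have "compose {..n} (codeg n j) (coface (n + 1) i) = compose {..n} (coface n i) (codeg (n - 1) (j - 1))"
    by (rule ops_eqI[of _ n]) (use assms in \<open>auto simp: coface_def codeg_def\<close>)
  then show ?thesis using assms unfolding face_def degen_def by (subst (1 2) sact_sact) auto
qed

lemma face_degen_greater:
  assumes "simplicial_set L" "x \<in> simps L n" "j + 1 < i" "i \<le> n + 1"
  shows "face L (n + 1) i (degen L n j x) = degen L (n - 1) j (face L n (i - 1) x)"
proof -
  have "compose {..n} (codeg n j) (coface (n + 1) i) = compose {..n} (coface n (i - 1)) (codeg (n - 1) j)"
    by (rule ops_eqI[of _ n]) (use assms in \<open>auto simp: coface_def codeg_def\<close>)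
  then show ?thesis using assms unfolding face_def degen_def by (subst (1 2) sact_sact) auto
qed

lemma sset_hom_in: "f \<in> sset_homs L M \<Longrightarrow> x \<in> simps L n \<Longrightarrow> f n x \<in> simps M n"
  unfolding sset_homs_def by (blast intro: PiE_mem)

lemma sset_hom_act: "f \<in> sset_homs L M \<Longrightarrow> \<alpha> \<in> ops m n \<Longrightarrow> x \<in> simps L n \<Longrightarrow>
    f m (sact L m n \<alpha> x) = sact M m n \<alpha> (f n x)"
  unfolding sset_homs_def by blast

text \<open>Being generated by faces becomes a condition on images: an operator lies in the face
  opposite to \<open>i\<close> exactly if it misses \<open>i\<close>, and then \<open>omit\<close>
  provides the factor.\<close>

lemma simps_Horn:
  assumes "1 \<le> n"
  shows "simps (Horn k n) m = {\<alpha> \<in> ops m n. \<exists>i\<le>n. i \<noteq> k \<and> i \<notin> \<alpha> ` {..m}}"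
proof (intro equalityI subsetI)
  fix \<alpha> assume "\<alpha> \<in> simps (Horn k n) m"
  then obtain \<beta> i where *: "\<alpha> = compose {..m} (coface n i) \<beta>" "\<beta> \<in> ops m (n - 1)" "i \<le> n" "i \<noteq> k"
    by (auto simp: Horn_def generated_def Delta_def)
  then show "\<alpha> \<in> {\<alpha> \<in> ops m n. \<exists>i\<le>n. i \<noteq> k \<and> i \<notin> \<alpha> ` {..m}}"
    using compose_ops[OF *(2) coface_ops[OF assms *(3)]] compose_omits[OF *(2) coface_omits[of i n]] by auto
next
  fix \<alpha> assume "\<alpha> \<in> {\<alpha> \<in> ops m n. \<exists>i\<le>n. i \<noteq> k \<and> i \<notin> \<alpha> ` {..m}}"
  then obtain i where *: "\<alpha> \<in> ops m n" "i \<le> n" "i \<noteq> k" "i \<notin> \<alpha> ` {..m}" by auto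
  show "\<alpha> \<in> simps (Horn k n) m"
    unfolding Horn_def generated_def Delta_def
    using * omit_ops[OF *(1,4,2)] coface_omit[OF *(1,4,2)] by simp metis
qed

lemma sact_Horn [simp]: "sact (Horn k n) i j \<beta> \<alpha> = compose {..i} \<alpha> \<beta>"
  by (simp add: Horn_def generated_def Delta_def)

lemma simps_Delta [simp]: "simps (Delta n) m = ops m n"
  by (simp add: Delta_def)

lemma sact_Delta [simp]: "sact (Delta n) i j \<beta> \<alpha> = compose {..i} \<alpha> \<beta>"
  by (simp add: Delta_def)

text \<open>A simplex missing both \<open>i\<close> and \<open>j\<close> lies in a face of
  codimension two. Both sides are restrictions along \<open>\<rho>\<close>, which omits both
  indices, of the two faces identified by \<open>eq\<close>.\<close>

lemma sact_omit_agree: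
  assumes L: "simplicial_set L" and \<alpha>: "\<alpha> \<in> ops m n"
    and ij: "i \<notin> \<alpha> ` {..m}" "j \<notin> \<alpha> ` {..m}" "i < j" "j \<le> n"
    and x: "x i \<in> simps L (n - 1)" "x j \<in> simps L (n - 1)"
    and eq: "2 \<le> n \<Longrightarrow> face L (n - 1) i (x j) = face L (n - 1) (j - 1) (x i)"
  shows "sact L m (n - 1) (omit j m \<alpha>) (x j) = sact L m (n - 1) (omit i m \<alpha>) (x i)"
proof -
  note oo = omit_omit[OF ij(3,1,2)]
  \<comment> \<open>The value \<open>\<alpha> 0\<close> is a third index, different from
    \<open>i\<close> and \<open>j\<close>; three indices up to \<open>n\<close> force
    \<open>2 \<le> n\<close>.\<close>
  have "\<alpha> 0 \<le> n" "\<alpha> 0 \<noteq> i" "\<alpha> 0 \<noteq> j" using ij ops_le[OF \<alpha>, of 0] by auto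
  then have n2: "2 \<le> n" using ij by auto
  have oj: "omit j m \<alpha> \<in> ops m (n - 1)" and oi: "omit i m \<alpha> \<in> ops m (n - 1)"
    using omit_ops[OF \<alpha>] ij by auto
  define \<rho> where "\<rho> = omit i m (omit j m \<alpha>)"
  have \<rho>: "\<rho> \<in> ops m (n - 1 - 1)" unfolding \<rho>_def
    by (rule omit_ops) (use oj oo ij in auto)
  have ej: "omit j m \<alpha> = compose {..m} (coface (n - 1) i) \<rho>"
    unfolding \<rho>_def by (rule coface_omit[symmetric]) (use oj oo ij in auto)
  have ei: "omit i m \<alpha> = compose {..m} (coface (n - 1) (j - 1)) \<rho>"
    unfolding \<rho>_def oo(1) by (rule coface_omit[symmetric]) (use oi oo ij in auto)
  have "sact L m (n - 1) (omit j m \<alpha>) (x j) = sact L m (n - 1 - 1) \<rho> (face L (n - 1) i (x j))"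
    unfolding ej face_def by (rule sact_sact[symmetric]) (use L \<rho> ij n2 x in auto)
  also have "\<dots> = sact L m (n - 1 - 1) \<rho> (face L (n - 1) (j - 1) (x i))" using eq n2 by simp
  also have "\<dots> = sact L m (n - 1) (omit i m \<alpha>) (x i)"
    unfolding ei face_def by (rule sact_sact) (use L \<rho> ij n2 x in auto)
  finally show ?thesis .
qed

text \<open>Passage from horns as simplicial sets to lists of compatible faces. The horn map sends
  an operator to the restriction of any face \<open>x i\<close> that contains it; compatibility
  makes the choice of \<open>i\<close> irrelevant, and naturality holds because a missed index stays
  missed after composition.\<close>

proposition Kan_filler:
  assumes "Kan L" and n: "1 \<le> n" and "k \<le> n"
    and x: "\<And>i. i \<le> n \<Longrightarrow> i \<noteq> k \<Longrightarrow> x i \<in> simps L (n - 1)"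
    and compat: "\<And>i j. i < j \<Longrightarrow> j \<le> n \<Longrightarrow> i \<noteq> k \<Longrightarrow> j \<noteq> k \<Longrightarrow> 2 \<le> n \<Longrightarrow>
      face L (n - 1) i (x j) = face L (n - 1) (j - 1) (x i)"
  obtains y where "y \<in> simps L n" "\<And>i. i \<le> n \<Longrightarrow> i \<noteq> k \<Longrightarrow> face L n i y = x i"
proof -
  have L: "simplicial_set L" using assms by (auto simp: Kan_def)
  define ok where "ok m \<alpha> i \<longleftrightarrow> i \<le> n \<and> i \<noteq> k \<and> i \<notin> \<alpha> ` {..m}" for m and \<alpha> :: "nat \<Rightarrow> nat" and i
  define v where "v m \<alpha> i = sact L m (n - 1) (omit i m \<alpha>) (x i)" for m \<alpha> i
  have v_less: "v m \<alpha> j = v m \<alpha> i" if "\<alpha> \<in> ops m n" "ok m \<alpha> i" "ok m \<alpha> j" "i < j" for m \<alpha> i j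
    unfolding v_def
    by (rule sact_omit_agree[OF L that(1)]) (use that x compat in \<open>auto simp: ok_def\<close>)
  have v_eq: "v m \<alpha> j = v m \<alpha> i" if "\<alpha> \<in> ops m n" "ok m \<alpha> i" "ok m \<alpha> j" for m \<alpha> i j
    using v_less that by (metis nat_neq_iff)
  define f where "f m = (\<lambda>\<alpha>\<in>simps (Horn k n) m. v m \<alpha> (SOME i. ok m \<alpha> i))" for m
  have f: "f m \<alpha> = v m \<alpha> i" if "\<alpha> \<in> ops m n" "ok m \<alpha> i" for m \<alpha> i
  proof -
    have "ok m \<alpha> (SOME i. ok m \<alpha> i)" using that(2) by (rule someI)
    from v_eq[OF that this] show ?thesis using that by (auto simp: f_def simps_Horn[OF n] ok_def)
  qed
  have Hok: "\<exists>i. ok m \<alpha> i \<and> \<alpha> \<in> ops m n" if "\<alpha> \<in> simps (Horn k n) m" for m \<alpha>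
    using that by (auto simp: simps_Horn[OF n] ok_def)
  have "f \<in> sset_homs (Horn k n) L"
    unfolding sset_homs_def
  proof (intro CollectI conjI allI ballI PiE_I)
    fix m \<alpha> assume "\<alpha> \<in> simps (Horn k n) m"
    then obtain i where i: "ok m \<alpha> i" "\<alpha> \<in> ops m n" using Hok by blast
    show "f m \<alpha> \<in> simps L m" unfolding f[OF i(2,1)] v_def
      by (rule sact_in[OF L omit_ops x]) (use i in \<open>auto simp: ok_def\<close>)
  next
    fix m \<alpha> assume "\<alpha> \<notin> simps (Horn k n) m" then show "f m \<alpha> = undefined" by (simp add: f_def)
  next
    fix m l \<beta> \<alpha> assume b: "\<beta> \<in> ops m l" "\<alpha> \<in> simps (Horn k n) l"
    then obtain i where i: "ok l \<alpha> i" "\<alpha> \<in> ops l n" using Hok by blast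
    have i': "ok m (compose {..m} \<alpha> \<beta>) i" using i(1) compose_omits[OF b(1), of i \<alpha>] unfolding ok_def by blast
    show "f m (sact (Horn k n) m l \<beta> \<alpha>) = sact L m l \<beta> (f l \<alpha>)"
      unfolding sact_Horn f[OF i(2,1)] f[OF compose_ops[OF b(1) i(2)] i'] v_def omit_compose[OF b(1)]
      by (rule sact_sact[symmetric, OF L b(1) omit_ops x]) (use i in \<open>auto simp: ok_def\<close>)
  qed
  then obtain g where g: "g \<in> sset_homs (Delta n) L"
    "\<And>m \<alpha>. \<alpha> \<in> simps (Horn k n) m \<Longrightarrow> g m \<alpha> = f m \<alpha>"
    using assms(1-3) unfolding Kan_def by blast
  show thesis
  proof
    show "g n (idop n) \<in> simps L n" by (rule sset_hom_in[OF g(1)]) simp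
    fix i assume i: "i \<le> n" "i \<noteq> k"
    have ci: "coface n i \<in> ops (n - 1) n" and oki: "ok (n - 1) (coface n i) i"
      using i n coface_omits by (auto simp: ok_def)
    then have "face L n i (g n (idop n)) = g (n - 1) (coface n i)"
      using sset_hom_act[OF g(1) ci, of "idop n"] by (simp add: face_def)
    also have "\<dots> = f (n - 1) (coface n i)"
      by (rule g(2)) (use ci oki in \<open>auto simp: simps_Horn[OF n] ok_def\<close>)
    also have "\<dots> = x i" unfolding f[OF ci oki] v_def omit_coface[OF n i(1)] using L x i by simp
    finally show "face L n i (g n (idop n)) = x i" .
  qed
qed


section \<open>Bisimplicial sets and bihorns\<close>

lemma bact_in: "bisimplicial_set K \<Longrightarrow> \<alpha> \<in> ops m p \<Longrightarrow> \<beta> \<in> ops n q \<Longrightarrow> x \<in> bisimps K p q \<Longrightarrow>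
    bact K m n p q \<alpha> \<beta> x \<in> bisimps K m n"
  by (rule funcset_mem[of _ "bisimps K p q"]) (simp_all add: bisimplicial_set_def)

lemma bact_id: "bisimplicial_set K \<Longrightarrow> x \<in> bisimps K p q \<Longrightarrow> bact K p q p q (idop p) (idop q) x = x"
  unfolding bisimplicial_set_def by blast

lemma bact_bact: "bisimplicial_set K \<Longrightarrow> \<alpha>' \<in> ops i m \<Longrightarrow> \<beta>' \<in> ops j n \<Longrightarrow>
    \<alpha> \<in> ops m p \<Longrightarrow> \<beta> \<in> ops n q \<Longrightarrow> x \<in> bisimps K p q \<Longrightarrow>
    bact K i j m n \<alpha>' \<beta>' (bact K m n p q \<alpha> \<beta> x) =
    bact K i j p q (compose {..i} \<alpha> \<alpha>') (compose {..j} \<beta> \<beta>') x"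
  unfolding bisimplicial_set_def by blast

lemma bis_hom_in: "f \<in> bis_homs K L \<Longrightarrow> x \<in> bisimps K p q \<Longrightarrow> f p q x \<in> bisimps L p q"
  unfolding bis_homs_def by (blast intro: PiE_mem)

lemma bis_hom_act: "f \<in> bis_homs K L \<Longrightarrow> \<alpha> \<in> ops m p \<Longrightarrow> \<beta> \<in> ops n q \<Longrightarrow> x \<in> bisimps K p q \<Longrightarrow>
    f m n (bact K m n p q \<alpha> \<beta> x) = bact L m n p q \<alpha> \<beta> (f p q x)"
  unfolding bis_homs_def by blast

lemma hface_eq: "hface K p q i = bact K (p - 1) q p q (coface p i) (idop q)"
  by (simp add: hface_def face_def hrow_def)

lemma vface_eq: "vface K p q j = bact K p (q - 1) p q (idop p) (coface q j)"
  by (simp add: vface_def face_def vcol_def)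

lemma hdegen_eq: "hdegen K p q i = bact K (p + 1) q p q (codeg p i) (idop q)"
  by (simp add: hdegen_def degen_def hrow_def)

lemma vdegen_eq: "vdegen K p q j = bact K p (q + 1) p q (idop p) (codeg q j)"
  by (simp add: vdegen_def degen_def vcol_def)

lemma simplicial_set_hrow: "bisimplicial_set K \<Longrightarrow> simplicial_set (hrow K q)"
  unfolding simplicial_set_def hrow_def
  by (intro conjI allI ballI funcsetI) (simp_all add: bact_in bact_id bact_bact)

lemma simplicial_set_vcol: "bisimplicial_set K \<Longrightarrow> simplicial_set (vcol K p)"
  unfolding simplicial_set_def vcol_def
  by (intro conjI allI ballI funcsetI) (simp_all add: bact_in bact_id bact_bact)

lemma bact_biHorn [simp]:
  "bact (biHorn k l p q) i j m n \<alpha> \<beta> z = (compose {..i} (fst z) \<alpha>, compose {..j} (snd z) \<beta>)"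
  by (simp add: biHorn_def bigenerated_def biDelta_def case_prod_beta)

lemma bact_biDelta [simp]:
  "bact (biDelta p q) i j m n \<alpha> \<beta> z = (compose {..i} (fst z) \<alpha>, compose {..j} (snd z) \<beta>)"
  by (simp add: biDelta_def case_prod_beta)

lemma bisimps_biDelta [simp]: "bisimps (biDelta p q) m n = ops m p \<times> ops n q"
  by (simp add: biDelta_def)

lemma bisimps_biHorn:
  assumes "1 \<le> p" "1 \<le> q"
  shows "bisimps (biHorn k l p q) m n = {(\<alpha>, \<beta>). \<alpha> \<in> ops m p \<and> \<beta> \<in> ops n q \<and>
    ((\<exists>i\<le>p. i \<noteq> k \<and> i \<notin> \<alpha> ` {..m}) \<or> (\<exists>j\<le>q. j \<noteq> l \<and> j \<notin> \<beta> ` {..n}))}" (is "?L = ?R")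
proof (intro equalityI subsetI)
  fix z assume "z \<in> ?L"
  then consider (h) i \<alpha> \<beta> where "z = (compose {..m} (coface p i) \<alpha>, compose {..n} (idop q) \<beta>)"
      "i \<le> p" "i \<noteq> k" "\<alpha> \<in> ops m (p - 1)" "\<beta> \<in> ops n q"
    | (v) j \<alpha> \<beta> where "z = (compose {..m} (idop p) \<alpha>, compose {..n} (coface q j) \<beta>)"
      "j \<le> q" "j \<noteq> l" "\<alpha> \<in> ops m p" "\<beta> \<in> ops n (q - 1)"
    by (auto simp: biHorn_def bigenerated_def biDelta_def)
  then show "z \<in> ?R"
  proof cases
    case h
    have "compose {..m} (coface p i) \<alpha> \<in> ops m p" by (rule compose_ops[OF h(4)]) (use assms h in auto)
    then show ?thesis using h compose_omits[OF h(4) coface_omits[of i p]] by auto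
  next
    case v
    have "compose {..n} (coface q j) \<beta> \<in> ops n q" by (rule compose_ops[OF v(5)]) (use assms v in auto)
    then show ?thesis using v compose_omits[OF v(5) coface_omits[of j q]] by auto
  qed
next
  fix z assume "z \<in> ?R"
  then obtain \<alpha> \<beta> where z: "z = (\<alpha>, \<beta>)" and o: "\<alpha> \<in> ops m p" "\<beta> \<in> ops n q"
    and "(\<exists>i\<le>p. i \<noteq> k \<and> i \<notin> \<alpha> ` {..m}) \<or> (\<exists>j\<le>q. j \<noteq> l \<and> j \<notin> \<beta> ` {..n})" by auto
  then consider (h) i where "i \<le> p" "i \<noteq> k" "i \<notin> \<alpha> ` {..m}"
    | (v) j where "j \<le> q" "j \<noteq> l" "j \<notin> \<beta> ` {..n}" by blast
  then show "z \<in> ?L"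
  proof cases
    case h
    have "z = (compose {..m} (coface p i) (omit i m \<alpha>), compose {..n} (idop q) \<beta>)"
      using z o h coface_omit by simp
    moreover have "omit i m \<alpha> \<in> ops m (p - 1)" using omit_ops o h by simp
    ultimately show ?thesis using o h unfolding biHorn_def bigenerated_def biDelta_def
      by (simp only: bisset.simps case_prod_conv mem_Collect_eq, intro exI[of _ "p - 1"] exI[of _ q]
          exI[of _ "omit i m \<alpha>"] exI[of _ \<beta>] exI[of _ "(coface p i, idop q)"]) auto
  next
    case v
    have "z = (compose {..m} (idop p) \<alpha>, compose {..n} (coface q j) (omit j n \<beta>))"
      using z o v coface_omit by simp
    moreover have "omit j n \<beta> \<in> ops n (q - 1)" using omit_ops o v by simp
    ultimately show ?thesis using o v unfolding biHorn_def bigenerated_def biDelta_def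
      by (simp only: bisset.simps case_prod_conv mem_Collect_eq, intro exI[of _ p] exI[of _ "q - 1"]
          exI[of _ \<alpha>] exI[of _ "omit j n \<beta>"] exI[of _ "(idop p, coface q j)"]) auto
  qed
qed

text \<open>The same translation in two directions. A cell of the bihorn may lie in several
  horizontal and vertical faces, so the choice ranges over a sum type: \<open>Inl i\<close> stands
  for a horizontal and \<open>Inr j\<close> for a vertical face, and agreement is checked for the
  three kinds of pairs.\<close>

proposition biHorn_filler:
  assumes K: "bisimplicial_set K" and E: "extension_condition K"
    and pq: "1 \<le> p" "1 \<le> q" "k \<le> p" "l \<le> q"
    and x: "\<And>i. i \<le> p \<Longrightarrow> i \<noteq> k \<Longrightarrow> x i \<in> bisimps K (p - 1) q"
    and y: "\<And>j. j \<le> q \<Longrightarrow> j \<noteq> l \<Longrightarrow> y j \<in> bisimps K p (q - 1)"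
    and xx: "\<And>i j. i < j \<Longrightarrow> j \<le> p \<Longrightarrow> i \<noteq> k \<Longrightarrow> j \<noteq> k \<Longrightarrow> 2 \<le> p \<Longrightarrow>
      hface K (p - 1) q i (x j) = hface K (p - 1) q (j - 1) (x i)"
    and yy: "\<And>i j. i < j \<Longrightarrow> j \<le> q \<Longrightarrow> i \<noteq> l \<Longrightarrow> j \<noteq> l \<Longrightarrow> 2 \<le> q \<Longrightarrow>
      vface K p (q - 1) i (y j) = vface K p (q - 1) (j - 1) (y i)"
    and xy: "\<And>i j. i \<le> p \<Longrightarrow> j \<le> q \<Longrightarrow> i \<noteq> k \<Longrightarrow> j \<noteq> l \<Longrightarrow>
      vface K (p - 1) q j (x i) = hface K p (q - 1) i (y j)"
  obtains z where "z \<in> bisimps K p q" "\<And>i. i \<le> p \<Longrightarrow> i \<noteq> k \<Longrightarrow> hface K p q i z = x i"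
    "\<And>j. j \<le> q \<Longrightarrow> j \<noteq> l \<Longrightarrow> vface K p q j z = y j"
proof -
  define okh where "okh m \<alpha> i \<longleftrightarrow> i \<le> p \<and> i \<noteq> k \<and> i \<notin> \<alpha> ` {..m}" for m and \<alpha> :: "nat \<Rightarrow> nat" and i
  define okv where "okv n \<beta> j \<longleftrightarrow> j \<le> q \<and> j \<noteq> l \<and> j \<notin> \<beta> ` {..n}" for n and \<beta> :: "nat \<Rightarrow> nat" and j
  define ok where "ok m n z = case_sum (okh m (fst z)) (okv n (snd z))" for m n z
  define vh where "vh m n \<alpha> \<beta> i = bact K m n (p - 1) q (omit i m \<alpha>) \<beta> (x i)" for m n \<alpha> \<beta> i
  define vv where "vv m n \<alpha> \<beta> j = bact K m n p (q - 1) \<alpha> (omit j n \<beta>) (y j)" for m n \<alpha> \<beta> j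
  define v where "v m n z = case_sum (vh m n (fst z) (snd z)) (vv m n (fst z) (snd z))" for m n z
  have vh_less: "vh m n \<alpha> \<beta> j = vh m n \<alpha> \<beta> i"
    if "\<alpha> \<in> ops m p" "\<beta> \<in> ops n q" "okh m \<alpha> i" "okh m \<alpha> j" "i < j" for m n \<alpha> \<beta> i j
  proof -
    \<comment> \<open>The vertical action of \<open>\<beta>\<close> can be done last, so two
      horizontal faces are compared inside row \<open>q\<close>, where
      \<open>sact_omit_agree\<close> applies.\<close>
    have "vh m n \<alpha> \<beta> i' = bact K m n m q (idop m) \<beta> (sact (hrow K q) m (p - 1) (omit i' m \<alpha>) (x i'))"
      if "okh m \<alpha> i'" for i'
      using omit_ops[OF \<open>\<alpha> \<in> ops m p\<close>, of i'] that x K \<open>\<alpha> \<in> ops m p\<close> \<open>\<beta> \<in> ops n q\<close>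
      unfolding vh_def hrow_def sset.simps
      by (subst bact_bact) (auto simp: okh_def)
    moreover have "sact (hrow K q) m (p - 1) (omit j m \<alpha>) (x j) = sact (hrow K q) m (p - 1) (omit i m \<alpha>) (x i)"
      by (rule sact_omit_agree[OF simplicial_set_hrow[OF K] that(1)])
        (use that x xx in \<open>auto simp: okh_def hface_def hrow_def\<close>)
    ultimately show ?thesis using that by simp
  qed
  have vv_less: "vv m n \<alpha> \<beta> j = vv m n \<alpha> \<beta> i"
    if "\<alpha> \<in> ops m p" "\<beta> \<in> ops n q" "okv n \<beta> i" "okv n \<beta> j" "i < j" for m n \<alpha> \<beta> i j
  proof -
    have "vv m n \<alpha> \<beta> j' = bact K m n p n \<alpha> (idop n) (sact (vcol K p) n (q - 1) (omit j' n \<beta>) (y j'))"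
      if "okv n \<beta> j'" for j'
      using omit_ops[OF \<open>\<beta> \<in> ops n q\<close>, of j'] that y K \<open>\<alpha> \<in> ops m p\<close> \<open>\<beta> \<in> ops n q\<close>
      unfolding vv_def vcol_def sset.simps
      by (subst bact_bact) (auto simp: okv_def)
    moreover have "sact (vcol K p) n (q - 1) (omit j n \<beta>) (y j) = sact (vcol K p) n (q - 1) (omit i n \<beta>) (y i)"
      by (rule sact_omit_agree[OF simplicial_set_vcol[OF K] that(2)])
        (use that y yy in \<open>auto simp: okv_def vface_def vcol_def\<close>)
    ultimately show ?thesis using that by simp
  qed
  have vhv: "vh m n \<alpha> \<beta> i = vv m n \<alpha> \<beta> j"
    if "\<alpha> \<in> ops m p" "\<beta> \<in> ops n q" "okh m \<alpha> i" "okv n \<beta> j" for m n \<alpha> \<beta> i j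
  proof -
    have ij: "i \<notin> \<alpha> ` {..m}" "i \<le> p" "i \<noteq> k" "j \<notin> \<beta> ` {..n}" "j \<le> q" "j \<noteq> l"
      using that by (auto simp: okh_def okv_def)
    have oi: "omit i m \<alpha> \<in> ops m (p - 1)" and oj: "omit j n \<beta> \<in> ops n (q - 1)"
      using omit_ops that(1,2) ij by auto
    \<comment> \<open>A cell in a horizontal and a vertical face lies in their common corner face,
      where \<open>xy\<close> identifies the data.\<close>
    have "vh m n \<alpha> \<beta> i = bact K m n (p - 1) (q - 1) (omit i m \<alpha>) (omit j n \<beta>) (vface K (p - 1) q j (x i))"
      unfolding vh_def vface_eq
      by (subst bact_bact) (use K oi oj that ij x pq coface_omit[OF that(2) ij(4,5)] in auto)
    also have "\<dots> = bact K m n (p - 1) (q - 1) (omit i m \<alpha>) (omit j n \<beta>) (hface K p (q - 1) i (y j))"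
      using xy ij by simp
    also have "\<dots> = vv m n \<alpha> \<beta> j"
      unfolding vv_def hface_eq
      by (subst bact_bact) (use K oi oj that ij y pq coface_omit[OF that(1) ij(1,2)] in auto)
    finally show ?thesis .
  qed
  have v_eq: "v m n (\<alpha>, \<beta>) a = v m n (\<alpha>, \<beta>) b"
    if "\<alpha> \<in> ops m p" "\<beta> \<in> ops n q" "ok m n (\<alpha>, \<beta>) a" "ok m n (\<alpha>, \<beta>) b" for m n \<alpha> \<beta> a b
  proof (cases a; cases b)
    fix i j assume "a = Inl i" "b = Inl j"
    then show ?thesis using that vh_less[of \<alpha> m \<beta> n i j] vh_less[of \<alpha> m \<beta> n j i]
      by (cases i j rule: linorder_cases) (auto simp: v_def ok_def)
  next
    fix i j assume "a = Inr i" "b = Inr j"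
    then show ?thesis using that vv_less[of \<alpha> m \<beta> n i j] vv_less[of \<alpha> m \<beta> n j i]
      by (cases i j rule: linorder_cases) (auto simp: v_def ok_def)
  qed (use that vhv in \<open>auto simp: v_def ok_def\<close>)
  have v_in: "v m n (\<alpha>, \<beta>) a \<in> bisimps K m n"
    if "\<alpha> \<in> ops m p" "\<beta> \<in> ops n q" "ok m n (\<alpha>, \<beta>) a" for m n \<alpha> \<beta> a
  proof (cases a)
    case (Inl i)
    then have i: "i \<le> p" "i \<noteq> k" "i \<notin> \<alpha> ` {..m}" using that by (auto simp: ok_def okh_def)
    show ?thesis using bact_in[OF K omit_ops[OF that(1) i(3,1)] that(2) x[OF i(1,2)]]
      by (simp add: Inl v_def vh_def)
  next
    case (Inr j)
    then have j: "j \<le> q" "j \<noteq> l" "j \<notin> \<beta> ` {..n}" using that by (auto simp: ok_def okv_def)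
    show ?thesis using bact_in[OF K that(1) omit_ops[OF that(2) j(3,1)] y[OF j(1,2)]]
      by (simp add: Inr v_def vv_def)
  qed
  have v_comp: "v m' n' (compose {..m'} \<alpha> \<alpha>', compose {..n'} \<beta> \<beta>') a =
      bact K m' n' m n \<alpha>' \<beta>' (v m n (\<alpha>, \<beta>) a)"
    if "\<alpha> \<in> ops m p" "\<beta> \<in> ops n q" "ok m n (\<alpha>, \<beta>) a" "\<alpha>' \<in> ops m' m" "\<beta>' \<in> ops n' n"
    for m n \<alpha> \<beta> a m' n' \<alpha>' \<beta>'
  proof (cases a)
    case (Inl i)
    then have i: "i \<le> p" "i \<noteq> k" "i \<notin> \<alpha> ` {..m}" using that by (auto simp: ok_def okh_def)
    show ?thesis using that omit_ops[OF that(1) i(3,1)] x i K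
      by (simp add: Inl v_def vh_def omit_compose[OF that(4)] bact_bact)
  next
    case (Inr j)
    then have i: "j \<le> q" "j \<noteq> l" "j \<notin> \<beta> ` {..n}" using that by (auto simp: ok_def okv_def)
    show ?thesis using that omit_ops[OF that(2) i(3,1)] y i K
      by (simp add: Inr v_def vv_def omit_compose[OF that(5)] bact_bact)
  qed
  have ok_comp: "ok m' n' (compose {..m'} \<alpha> \<alpha>', compose {..n'} \<beta> \<beta>') a"
    if "ok m n (\<alpha>, \<beta>) a" "\<alpha>' \<in> ops m' m" "\<beta>' \<in> ops n' n" for m n \<alpha> \<beta> a m' n' \<alpha>' \<beta>'
    using that compose_omits[OF that(2), of _ \<alpha>] compose_omits[OF that(3), of _ \<beta>]
    by (cases a) (simp_all add: ok_def okh_def okv_def del: image_iff)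
  have Hmem: "(\<alpha>, \<beta>) \<in> bisimps (biHorn k l p q) m n \<longleftrightarrow>
      \<alpha> \<in> ops m p \<and> \<beta> \<in> ops n q \<and> (\<exists>a. ok m n (\<alpha>, \<beta>) a)" for m n \<alpha> \<beta>
    unfolding bisimps_biHorn[OF pq(1,2)] split_sum_ex ok_def okh_def okv_def by simp
  define f where "f m n = (\<lambda>z\<in>bisimps (biHorn k l p q) m n. v m n z (SOME a. ok m n z a))" for m n
  have f: "f m n (\<alpha>, \<beta>) = v m n (\<alpha>, \<beta>) a"
    if "\<alpha> \<in> ops m p" "\<beta> \<in> ops n q" "ok m n (\<alpha>, \<beta>) a" for m n \<alpha> \<beta> a
  proof -
    have "ok m n (\<alpha>, \<beta>) (SOME a. ok m n (\<alpha>, \<beta>) a)" using that(3) by (rule someI)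
    from v_eq[OF that this] show ?thesis using Hmem that by (auto simp: f_def)
  qed
  have "f \<in> bis_homs (biHorn k l p q) K"
    unfolding bis_homs_def
  proof (intro CollectI conjI allI ballI PiE_I)
    fix m n z assume "z \<in> bisimps (biHorn k l p q) m n"
    then obtain \<alpha> \<beta> a where z: "z = (\<alpha>, \<beta>)" "\<alpha> \<in> ops m p" "\<beta> \<in> ops n q" "ok m n (\<alpha>, \<beta>) a"
      using Hmem by (metis surj_pair)
    show "f m n z \<in> bisimps K m n" using f[OF z(2-4)] v_in[OF z(2-4)] z(1) by simp
  next
    fix m n z assume "z \<notin> bisimps (biHorn k l p q) m n" then show "f m n z = undefined"
      by (simp add: f_def)
  next
    fix m' n' m n \<alpha>' \<beta>' z
    assume b: "\<alpha>' \<in> ops m' m" "\<beta>' \<in> ops n' n" "z \<in> bisimps (biHorn k l p q) m n"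
    then obtain \<alpha> \<beta> a where z: "z = (\<alpha>, \<beta>)" "\<alpha> \<in> ops m p" "\<beta> \<in> ops n q" "ok m n (\<alpha>, \<beta>) a"
      using Hmem by (metis surj_pair)
    show "f m' n' (bact (biHorn k l p q) m' n' m n \<alpha>' \<beta>' z) = bact K m' n' m n \<alpha>' \<beta>' (f m n z)"
      using f[OF z(2-4)] f[OF compose_ops[OF b(1) z(2)] compose_ops[OF b(2) z(3)] ok_comp[OF z(4) b(1,2)]]
        v_comp[OF z(2-4) b(1,2)] by (simp add: z(1))
  qed
  then have "\<exists>g\<in>bis_homs (biDelta p q) K. \<forall>m n. \<forall>z\<in>bisimps (biHorn k l p q) m n. g m n z = f m n z"
    using E pq unfolding extension_condition_def by simp
  then obtain g where g: "g \<in> bis_homs (biDelta p q) K"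
    "\<And>m n z. z \<in> bisimps (biHorn k l p q) m n \<Longrightarrow> g m n z = f m n z" by blast
  have g_act: "bact K m n p q \<alpha> \<beta> (g p q (idop p, idop q)) = g m n (\<alpha>, \<beta>)"
    if "\<alpha> \<in> ops m p" "\<beta> \<in> ops n q" for m n \<alpha> \<beta>
    using bis_hom_act[OF g(1) that, of "(idop p, idop q)"] that by simp
  have g_ok: "g m n (\<alpha>, \<beta>) = v m n (\<alpha>, \<beta>) a"
    if "\<alpha> \<in> ops m p" "\<beta> \<in> ops n q" "ok m n (\<alpha>, \<beta>) a" for m n \<alpha> \<beta> a
    using g(2) f[OF that] Hmem that by metis
  show thesis
  proof
    show "g p q (idop p, idop q) \<in> bisimps K p q" by (rule bis_hom_in[OF g(1)]) simp
    fix i assume i: "i \<le> p" "i \<noteq> k"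
    have "ok (p - 1) q (coface p i, idop q) (Inl i)" using i coface_omits by (simp add: ok_def okh_def del: image_iff)
    then show "hface K p q i (g p q (idop p, idop q)) = x i"
      unfolding hface_eq using g_act[of "coface p i" "p - 1" "idop q" q] g_ok[of "coface p i" "p - 1" "idop q" q "Inl i"]
        i pq bact_id[OF K x[OF i]] omit_coface[OF pq(1) i(1)] by (simp add: v_def vh_def)
  next
    fix j assume j: "j \<le> q" "j \<noteq> l"
    have "ok p (q - 1) (idop p, coface q j) (Inr j)" using j coface_omits by (simp add: ok_def okv_def del: image_iff)
    then show "vface K p q j (g p q (idop p, idop q)) = y j"
      unfolding vface_eq using g_act[of "idop p" p "coface q j" "q - 1"] g_ok[of "idop p" p "coface q j" "q - 1" "Inr j"]
        j pq bact_id[OF K y[OF j]] omit_coface[OF pq(2) j(1)] by (simp add: v_def vv_def)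
  qed
qed

text \<open>Dimensions and indices below are literals; keeping \<open>1\<close> in place of
  \<open>Suc 0\<close> lets the face and degeneracy rules stated for literals fire in the
  simplifier.\<close>

declare One_nat_def [simp del] One_nat_def [symmetric, simp]

section \<open>Groupoids presented by a composition relation\<close>

text \<open>The composites are definite descriptions over a relation \<open>T\<close>, later the
  relation of being the classes of the three edges of a 2-simplex. The axioms are therefore imposed
  on \<open>T\<close>; \<open>assoc\<close> asks for the four triangles of a tetrahedron. Right
  inverses are assumed, and left inverses are derived.\<close>

lemma rel_groupoid:
  assumes C: "C = \<lparr>Obj = Ob, Arr = A, Dom = s, Cod = t, Idn = i,
      Cmp = (\<lambda>X Y. if X \<in> A \<and> Y \<in> A \<and> s X = t Y then THE Z. T X Y Z else undefined)\<rparr>"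
    and ext: "s \<in> extensional A" "t \<in> extensional A" "i \<in> extensional Ob"
    and st: "\<And>X. X \<in> A \<Longrightarrow> s X \<in> Ob \<and> t X \<in> Ob"
    and ids: "\<And>a. a \<in> Ob \<Longrightarrow> i a \<in> A \<and> s (i a) = a \<and> t (i a) = a"
    and T: "\<And>X Y Z. T X Y Z \<Longrightarrow> X \<in> A \<and> Y \<in> A \<and> Z \<in> A \<and> s X = t Y \<and> s Z = s Y \<and> t Z = t X"
    and total: "\<And>X Y. X \<in> A \<Longrightarrow> Y \<in> A \<Longrightarrow> s X = t Y \<Longrightarrow> \<exists>Z. T X Y Z"
    and uniq: "\<And>X Y Z Z'. T X Y Z \<Longrightarrow> T X Y Z' \<Longrightarrow> Z = Z'"
    and unit: "\<And>X. X \<in> A \<Longrightarrow> T X (i (s X)) X \<and> T (i (t X)) X X"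
    and assoc: "\<And>X Y Z. X \<in> A \<Longrightarrow> Y \<in> A \<Longrightarrow> Z \<in> A \<Longrightarrow> s X = t Y \<Longrightarrow> s Y = t Z \<Longrightarrow>
      \<exists>P Q R. T X Y P \<and> T Y Z Q \<and> T P Z R \<and> T X Q R"
    and inv: "\<And>X. X \<in> A \<Longrightarrow> \<exists>Y. T X Y (i (t X))"
  shows "groupoid C \<and> ext_catg C \<and> (\<forall>X Y Z. T X Y Z \<longrightarrow> Cmp C X Y = Z)"
proof (intro conjI allI impI)
  show cmp: "Cmp C X Y = Z" if "T X Y Z" for X Y Z
    using T[OF that] that uniq by (auto simp: C)
  show "ext_catg C" using ext by (auto simp: ext_catg_def C)
  have cat: "category C"
    unfolding category_def
  proof (intro conjI ballI impI; (elim conjE)?)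
    show "Dom C \<in> Arr C \<rightarrow> Obj C" "Cod C \<in> Arr C \<rightarrow> Obj C" "Idn C \<in> Obj C \<rightarrow> Arr C"
      using st ids by (auto simp: C)
    fix a assume "a \<in> Obj C"
    then show "Dom C (Idn C a) = a" "Cod C (Idn C a) = a" using ids by (auto simp: C)
  next
    fix f g assume "f \<in> Arr C" "g \<in> Arr C" "Dom C f = Cod C g"
    then obtain h where h: "T f g h" using total by (auto simp: C)
    have "Cmp C f g = h" by (rule cmp[OF h])
    then show "Cmp C f g \<in> Arr C" "Dom C (Cmp C f g) = Dom C g" "Cod C (Cmp C f g) = Cod C f"
      using T[OF h] by (auto simp: C)
  next
    fix f assume "f \<in> Arr C"
    then have "T f (Idn C (Dom C f)) f" "T (Idn C (Cod C f)) f f" using unit by (auto simp: C)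
    then show "Cmp C f (Idn C (Dom C f)) = f" "Cmp C (Idn C (Cod C f)) f = f" using cmp by auto
  next
    fix f g h assume "f \<in> Arr C" "g \<in> Arr C" "h \<in> Arr C" "Dom C f = Cod C g" "Dom C g = Cod C h"
    then obtain P Q R where "T f g P" "T g h Q" "T P h R" "T f Q R"
      using assoc[of f g h] by (auto simp: C)
    then show "Cmp C (Cmp C f g) h = Cmp C f (Cmp C g h)" using cmp by metis
  qed
  show "groupoid C" unfolding groupoid_def
  proof (intro conjI cat ballI)
    fix f assume f: "f \<in> Arr C"
    then have fA: "f \<in> A" by (simp add: C)
    obtain g where g: "T f g (i (t f))" using inv[OF fA] by auto
    have gA: "g \<in> A" "t g = s f" "s g = t f"
      using T[OF g] ids[of "t f"] st[OF fA] by auto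
    \<comment> \<open>A right inverse \<open>h\<close> of the right inverse \<open>g\<close> of
      \<open>f\<close>: reassociating the triple composite shows \<open>h = f\<close>, so
      \<open>g\<close> is also a left inverse.\<close>
    obtain h where h: "T g h (i (t g))" using inv[OF gA(1)] by auto
    have hA: "h \<in> A" "t h = s g" "s h = t g" using T[OF h] ids[of "t g"] st[OF gA(1)] by auto
    obtain P Q R where "T f g P" "T g h Q" "T P h R" "T f Q R"
      using assoc[OF fA gA(1) hA(1)] gA hA by auto
    then have "T (i (t f)) h R" "T f (i (s f)) R" using uniq g h gA by metis+
    then have "h = R" "f = R" using uniq unit[OF hA(1)] unit[OF fA] hA gA by metis+
    then have "T g f (i (t g))" using h by simp
    from cmp[OF this] have "Cmp C g f = Idn C (Dom C f)" unfolding gA by (simp add: C)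
    moreover have "Cmp C f g = Idn C (Cod C f)" unfolding cmp[OF g] by (simp add: C)
    ultimately show "\<exists>g\<in>Arr C. Dom C g = Cod C f \<and> Cod C g = Dom C f \<and>
        Cmp C f g = Idn C (Cod C f) \<and> Cmp C g f = Idn C (Dom C f)"
      using gA by (intro bexI[of _ g]) (auto simp: C)
  qed
qed

section \<open>Kan complexes in low dimensions\<close>

lemma le_num:
  "(i::nat) \<le> 1 \<longleftrightarrow> i = 0 \<or> i = 1" "i \<le> 2 \<longleftrightarrow> i = 0 \<or> i = 1 \<or> i = 2"
  "i \<le> 3 \<longleftrightarrow> i = 0 \<or> i = 1 \<or> i = 2 \<or> i = 3" "i \<le> 4 \<longleftrightarrow> i = 0 \<or> i = 1 \<or> i = 2 \<or> i = 3 \<or> i = 4"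
  "i < 1 \<longleftrightarrow> i = 0" "i < 2 \<longleftrightarrow> i = 0 \<or> i = 1"
  "i < 3 \<longleftrightarrow> i = 0 \<or> i = 1 \<or> i = 2" "i < 4 \<longleftrightarrow> i = 0 \<or> i = 1 \<or> i = 2 \<or> i = 3"
  by arith+

locale sset =
  fixes L :: "'a sset"
  assumes simplicial: "simplicial_set L"
begin

lemma d_in [simp]:
  "x \<in> simps L 1 \<Longrightarrow> i \<le> 1 \<Longrightarrow> face L 1 i x \<in> simps L 0"
  "x \<in> simps L 2 \<Longrightarrow> i \<le> 2 \<Longrightarrow> face L 2 i x \<in> simps L 1"
  "x \<in> simps L 3 \<Longrightarrow> i \<le> 3 \<Longrightarrow> face L 3 i x \<in> simps L 2"
  "x \<in> simps L 4 \<Longrightarrow> i \<le> 4 \<Longrightarrow> face L 4 i x \<in> simps L 3"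
  using face_in[OF simplicial, of 1 i x] face_in[OF simplicial, of 2 i x]
    face_in[OF simplicial, of 3 i x] face_in[OF simplicial, of 4 i x] by simp_all

lemma s_in [simp]:
  "x \<in> simps L 0 \<Longrightarrow> i \<le> 0 \<Longrightarrow> degen L 0 i x \<in> simps L 1"
  "x \<in> simps L 1 \<Longrightarrow> i \<le> 1 \<Longrightarrow> degen L 1 i x \<in> simps L 2"
  "x \<in> simps L 2 \<Longrightarrow> i \<le> 2 \<Longrightarrow> degen L 2 i x \<in> simps L 3"
  "x \<in> simps L 3 \<Longrightarrow> i \<le> 3 \<Longrightarrow> degen L 3 i x \<in> simps L 4"
  using degen_in[OF simplicial, of i 0 x] degen_in[OF simplicial, of i 1 x]
    degen_in[OF simplicial, of i 2 x] degen_in[OF simplicial, of i 3 x] by simp_all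

lemma dd [simp]:
  "x \<in> simps L 2 \<Longrightarrow> face L 1 0 (face L 2 1 x) = face L 1 0 (face L 2 0 x)"
  "x \<in> simps L 2 \<Longrightarrow> face L 1 0 (face L 2 2 x) = face L 1 1 (face L 2 0 x)"
  "x \<in> simps L 2 \<Longrightarrow> face L 1 1 (face L 2 2 x) = face L 1 1 (face L 2 1 x)"
  "y \<in> simps L 3 \<Longrightarrow> face L 2 0 (face L 3 1 y) = face L 2 0 (face L 3 0 y)"
  "y \<in> simps L 3 \<Longrightarrow> face L 2 0 (face L 3 2 y) = face L 2 1 (face L 3 0 y)"
  "y \<in> simps L 3 \<Longrightarrow> face L 2 0 (face L 3 3 y) = face L 2 2 (face L 3 0 y)"
  "y \<in> simps L 3 \<Longrightarrow> face L 2 1 (face L 3 2 y) = face L 2 1 (face L 3 1 y)"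
  "y \<in> simps L 3 \<Longrightarrow> face L 2 1 (face L 3 3 y) = face L 2 2 (face L 3 1 y)"
  "y \<in> simps L 3 \<Longrightarrow> face L 2 2 (face L 3 3 y) = face L 2 2 (face L 3 2 y)"
  using face_face[OF simplicial, of x 2] face_face[OF simplicial, of y 3] by simp_all

lemma dd4:
  assumes "y \<in> simps L 4" "i < j" "j \<le> 4"
  shows "face L 3 i (face L 4 j y) = face L 3 (j - 1) (face L 4 i y)"
  using face_face[OF simplicial, of y 4] assms by simp

lemma ds [simp]:
  "a \<in> simps L 0 \<Longrightarrow> face L 1 0 (degen L 0 0 a) = a"
  "a \<in> simps L 0 \<Longrightarrow> face L 1 1 (degen L 0 0 a) = a"
  "x \<in> simps L 1 \<Longrightarrow> face L 2 0 (degen L 1 0 x) = x"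
  "x \<in> simps L 1 \<Longrightarrow> face L 2 1 (degen L 1 0 x) = x"
  "x \<in> simps L 1 \<Longrightarrow> face L 2 2 (degen L 1 0 x) = degen L 0 0 (face L 1 1 x)"
  "x \<in> simps L 1 \<Longrightarrow> face L 2 0 (degen L 1 1 x) = degen L 0 0 (face L 1 0 x)"
  "x \<in> simps L 1 \<Longrightarrow> face L 2 1 (degen L 1 1 x) = x"
  "x \<in> simps L 1 \<Longrightarrow> face L 2 2 (degen L 1 1 x) = x"
  "y \<in> simps L 2 \<Longrightarrow> face L 3 0 (degen L 2 0 y) = y"
  "y \<in> simps L 2 \<Longrightarrow> face L 3 1 (degen L 2 0 y) = y"
  "y \<in> simps L 2 \<Longrightarrow> face L 3 2 (degen L 2 0 y) = degen L 1 0 (face L 2 1 y)"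
  "y \<in> simps L 2 \<Longrightarrow> face L 3 3 (degen L 2 0 y) = degen L 1 0 (face L 2 2 y)"
  "y \<in> simps L 2 \<Longrightarrow> face L 3 0 (degen L 2 1 y) = degen L 1 0 (face L 2 0 y)"
  "y \<in> simps L 2 \<Longrightarrow> face L 3 1 (degen L 2 1 y) = y"
  "y \<in> simps L 2 \<Longrightarrow> face L 3 2 (degen L 2 1 y) = y"
  "y \<in> simps L 2 \<Longrightarrow> face L 3 3 (degen L 2 1 y) = degen L 1 1 (face L 2 2 y)"
  "y \<in> simps L 2 \<Longrightarrow> face L 3 0 (degen L 2 2 y) = degen L 1 1 (face L 2 0 y)"
  "y \<in> simps L 2 \<Longrightarrow> face L 3 1 (degen L 2 2 y) = degen L 1 1 (face L 2 1 y)"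
  "y \<in> simps L 2 \<Longrightarrow> face L 3 2 (degen L 2 2 y) = y"
  "y \<in> simps L 2 \<Longrightarrow> face L 3 3 (degen L 2 2 y) = y"
  using face_degen_same[OF simplicial, of a 0] face_degen_same[OF simplicial, of x 1]
    face_degen_less[OF simplicial, of x 1] face_degen_greater[OF simplicial, of x 1]
    face_degen_same[OF simplicial, of y 2]
    face_degen_less[OF simplicial, of y 2] face_degen_greater[OF simplicial, of y 2] by simp_all

end

locale kan = sset +
  assumes Kan: "Kan L"
begin

section \<open>Horn fillers, named by dimension and index of the omitted face\<close>

lemma fill2_0:
  assumes "x1 \<in> simps L 1" "x2 \<in> simps L 1"
    "face L 1 1 x2 = face L 1 1 x1"
  obtains y where "y \<in> simps L 2" "face L 2 1 y = x1" "face L 2 2 y = x2"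
proof -
  obtain y where "y \<in> simps L 2" "\<And>i. i \<le> 2 \<Longrightarrow> i \<noteq> 0 \<Longrightarrow> face L 2 i y = (if i = 1 then x1 else x2)"
    by (rule Kan_filler[OF Kan, of 2 0 "\<lambda>i. if i = 1 then x1 else x2"]) (use assms in \<open>auto simp: le_num\<close>)
  then show thesis using that[of y] by simp
qed

lemma fill2_1:
  assumes "x0 \<in> simps L 1" "x2 \<in> simps L 1"
    "face L 1 0 x2 = face L 1 1 x0"
  obtains y where "y \<in> simps L 2" "face L 2 0 y = x0" "face L 2 2 y = x2"
proof -
  obtain y where "y \<in> simps L 2" "\<And>i. i \<le> 2 \<Longrightarrow> i \<noteq> 1 \<Longrightarrow> face L 2 i y = (if i = 0 then x0 else x2)"
    by (rule Kan_filler[OF Kan, of 2 1 "\<lambda>i. if i = 0 then x0 else x2"]) (use assms in \<open>auto simp: le_num\<close>)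
  then show thesis using that[of y] by simp
qed

lemma fill3_0:
  assumes "x1 \<in> simps L 2" "x2 \<in> simps L 2" "x3 \<in> simps L 2"
    "face L 2 1 x2 = face L 2 1 x1" "face L 2 1 x3 = face L 2 2 x1" "face L 2 2 x3 = face L 2 2 x2"
  obtains y where "y \<in> simps L 3" "face L 3 1 y = x1" "face L 3 2 y = x2" "face L 3 3 y = x3"
proof -
  obtain y where "y \<in> simps L 3" "\<And>i. i \<le> 3 \<Longrightarrow> i \<noteq> 0 \<Longrightarrow> face L 3 i y = (if i = 1 then x1 else if i = 2 then x2 else x3)"
    by (rule Kan_filler[OF Kan, of 3 0 "\<lambda>i. if i = 1 then x1 else if i = 2 then x2 else x3"]) (use assms in \<open>auto simp: le_num\<close>)
  then show thesis using that[of y] by simp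
qed

lemma fill3_1:
  assumes "x0 \<in> simps L 2" "x2 \<in> simps L 2" "x3 \<in> simps L 2"
    "face L 2 0 x2 = face L 2 1 x0" "face L 2 0 x3 = face L 2 2 x0" "face L 2 2 x3 = face L 2 2 x2"
  obtains y where "y \<in> simps L 3" "face L 3 0 y = x0" "face L 3 2 y = x2" "face L 3 3 y = x3"
proof -
  obtain y where "y \<in> simps L 3" "\<And>i. i \<le> 3 \<Longrightarrow> i \<noteq> 1 \<Longrightarrow> face L 3 i y = (if i = 0 then x0 else if i = 2 then x2 else x3)"
    by (rule Kan_filler[OF Kan, of 3 1 "\<lambda>i. if i = 0 then x0 else if i = 2 then x2 else x3"]) (use assms in \<open>auto simp: le_num\<close>)
  then show thesis using that[of y] by simp
qed

lemma fill3_2: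
  assumes "x0 \<in> simps L 2" "x1 \<in> simps L 2" "x3 \<in> simps L 2"
    "face L 2 0 x1 = face L 2 0 x0" "face L 2 0 x3 = face L 2 2 x0" "face L 2 1 x3 = face L 2 2 x1"
  obtains y where "y \<in> simps L 3" "face L 3 0 y = x0" "face L 3 1 y = x1" "face L 3 3 y = x3"
proof -
  obtain y where "y \<in> simps L 3" "\<And>i. i \<le> 3 \<Longrightarrow> i \<noteq> 2 \<Longrightarrow> face L 3 i y = (if i = 0 then x0 else if i = 1 then x1 else x3)"
    by (rule Kan_filler[OF Kan, of 3 2 "\<lambda>i. if i = 0 then x0 else if i = 1 then x1 else x3"]) (use assms in \<open>auto simp: le_num\<close>)
  then show thesis using that[of y] by simp
qed

lemma fill3_3:
  assumes "x0 \<in> simps L 2" "x1 \<in> simps L 2" "x2 \<in> simps L 2"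
    "face L 2 0 x1 = face L 2 0 x0" "face L 2 0 x2 = face L 2 1 x0" "face L 2 1 x2 = face L 2 1 x1"
  obtains y where "y \<in> simps L 3" "face L 3 0 y = x0" "face L 3 1 y = x1" "face L 3 2 y = x2"
proof -
  obtain y where "y \<in> simps L 3" "\<And>i. i \<le> 3 \<Longrightarrow> i \<noteq> 3 \<Longrightarrow> face L 3 i y = (if i = 0 then x0 else if i = 1 then x1 else x2)"
    by (rule Kan_filler[OF Kan, of 3 3 "\<lambda>i. if i = 0 then x0 else if i = 1 then x1 else x2"]) (use assms in \<open>auto simp: le_num\<close>)
  then show thesis using that[of y] by simp
qed

lemma fill4_4:
  assumes "x0 \<in> simps L 3" "x1 \<in> simps L 3" "x2 \<in> simps L 3" "x3 \<in> simps L 3"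
    "face L 3 0 x1 = face L 3 0 x0" "face L 3 0 x2 = face L 3 1 x0" "face L 3 1 x2 = face L 3 1 x1" "face L 3 0 x3 = face L 3 2 x0" "face L 3 1 x3 = face L 3 2 x1" "face L 3 2 x3 = face L 3 2 x2"
  obtains y where "y \<in> simps L 4" "face L 4 0 y = x0" "face L 4 1 y = x1" "face L 4 2 y = x2" "face L 4 3 y = x3"
proof -
  obtain y where "y \<in> simps L 4" "\<And>i. i \<le> 4 \<Longrightarrow> i \<noteq> 4 \<Longrightarrow> face L 4 i y = (if i = 0 then x0 else if i = 1 then x1 else if i = 2 then x2 else x3)"
    by (rule Kan_filler[OF Kan, of 4 4 "\<lambda>i. if i = 0 then x0 else if i = 1 then x1 else if i = 2 then x2 else x3"]) (use assms in \<open>auto simp: le_num\<close>)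
  then show thesis using that[of y] by simp
qed


lemma homotopic_1_iff:
  "homotopic L 1 x x' \<longleftrightarrow> x \<in> simps L 1 \<and> x' \<in> simps L 1 \<and>
    (face L 1 0 x = face L 1 0 x' \<and> face L 1 1 x = face L 1 1 x') \<and>
    (\<exists>y\<in>simps L 2. face L 2 0 y = degen L 0 0 (face L 1 0 x) \<and> face L 2 1 y = x \<and> face L 2 2 y = x')"
proof -
  have "(\<forall>i\<le>(1::nat). P i) = (P 0 \<and> P 1)" "(\<forall>i<(1::nat). P i) = P 0" for P
    by (auto simp: le_num)
  then show ?thesis
    unfolding homotopic_def by (simp only: one_add_one diff_self_eq_0 order_refl simp_thms)
qed

text \<open>Any 2-simplex whose face \<open>0\<close> is degenerate is a homotopy between its other
  two faces; the face conditions in \<open>homotopic\<close> then follow from the simplicial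
  identities.\<close>

lemma homotopicI:
  assumes "y \<in> simps L 2" "face L 2 0 y = degen L 0 0 a" "a \<in> simps L 0"
  shows "homotopic L 1 (face L 2 1 y) (face L 2 2 y)"
proof -
  have *: "face L 1 0 (face L 2 1 y) = a" "face L 1 0 (face L 2 2 y) = a"
    using assms by simp_all
  show ?thesis unfolding homotopic_1_iff *
    by (intro conjI bexI[of _ y]) (use assms in simp_all)
qed

lemma homotopicE:
  assumes "homotopic L 1 x x'"
  obtains y where "y \<in> simps L 2" "face L 2 0 y = degen L 0 0 (face L 1 0 x)" "face L 2 1 y = x"
    "face L 2 2 y = x'" "x \<in> simps L 1" "x' \<in> simps L 1" "face L 1 0 x = face L 1 0 x'"
    "face L 1 1 x = face L 1 1 x'"
  using assms unfolding homotopic_1_iff by blast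

lemma homotopic_refl: "x \<in> simps L 1 \<Longrightarrow> homotopic L 1 x x"
  using homotopicI[of "degen L 1 1 x" "face L 1 0 x"] by simp

text \<open>The two homotopies and the doubly degenerate simplex \<open>e\<close> form a
  three-dimensional horn with face \<open>3\<close> omitted, and that face of a filler relates
  \<open>b\<close> to \<open>a\<close>. With reflexivity, this property yields symmetry and
  transitivity.\<close>

lemma homotopic_euclid:
  assumes "homotopic L 1 x a" "homotopic L 1 x b"
  shows "homotopic L 1 b a"
proof -
  obtain y where y: "y \<in> simps L 2" "face L 2 0 y = degen L 0 0 (face L 1 0 x)" "face L 2 1 y = x"
    "face L 2 2 y = a" "x \<in> simps L 1" using assms(1) by (rule homotopicE)
  obtain z where z: "z \<in> simps L 2" "face L 2 0 z = degen L 0 0 (face L 1 0 x)" "face L 2 1 z = x"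
    "face L 2 2 z = b" using assms(2) by (rule homotopicE)
  define e where "e = degen L 1 0 (degen L 0 0 (face L 1 0 x))"
  obtain w where w: "w \<in> simps L 3" "face L 3 0 w = e" "face L 3 1 w = z" "face L 3 2 w = y"
    by (rule fill3_3[of e z y]) (use y z in \<open>auto simp: e_def\<close>)
  have "face L 2 1 (face L 3 3 w) = b" "face L 2 2 (face L 3 3 w) = a"
    "face L 2 0 (face L 3 3 w) = degen L 0 0 (face L 1 0 x)"
    using w y z by (simp_all add: e_def)
  then show ?thesis using homotopicI[of "face L 3 3 w" "face L 1 0 x"] w y by simp
qed

lemma homotopic_sym: "homotopic L 1 x y \<Longrightarrow> homotopic L 1 y x"
  using homotopic_euclid homotopic_refl homotopicE by meson

lemma homotopic_trans: "homotopic L 1 x y \<Longrightarrow> homotopic L 1 y z \<Longrightarrow> homotopic L 1 x z"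
  using homotopic_euclid homotopic_sym by meson

lemma hclass_eq_iff:
  assumes "x \<in> simps L 1" shows "hclass L 1 x = hclass L 1 y \<longleftrightarrow> homotopic L 1 x y"
proof
  assume *: "hclass L 1 x = hclass L 1 y"
  have "x \<in> hclass L 1 x" using homotopic_refl[OF assms] by (simp add: hclass_def)
  then have "homotopic L 1 y x" unfolding * by (simp add: hclass_def)
  then show "homotopic L 1 x y" by (rule homotopic_sym)
next
  assume "homotopic L 1 x y"
  then show "hclass L 1 x = hclass L 1 y"
    unfolding hclass_def using homotopic_sym homotopic_trans by blast
qed

text \<open>Two fillers of the same inner horn become faces \<open>2\<close> and \<open>3\<close> of
  a three-dimensional horn whose face \<open>0\<close> is degenerate; face \<open>1\<close> of a
  filler is the homotopy between the composites.\<close>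

lemma comp_unique_strict:
  assumes "c \<in> simps L 2" "c' \<in> simps L 2" "face L 2 2 c = face L 2 2 c'" "face L 2 0 c = face L 2 0 c'"
  shows "homotopic L 1 (face L 2 1 c) (face L 2 1 c')"
proof -
  obtain w where w: "w \<in> simps L 3" "face L 3 0 w = degen L 1 1 (face L 2 0 c)" "face L 3 2 w = c"
    "face L 3 3 w = c'"
    by (rule fill3_1[of "degen L 1 1 (face L 2 0 c)" c c']) (use assms in auto)
  have "face L 2 1 (face L 3 1 w) = face L 2 1 c" "face L 2 2 (face L 3 1 w) = face L 2 1 c'"
    using dd(7,8)[OF w(1)] by (simp_all add: w)
  moreover have "face L 2 0 (face L 3 1 w) = degen L 0 0 (face L 1 0 (face L 2 0 c))"
    using w assms by simp
  ultimately show ?thesis using homotopicI[of "face L 3 1 w"] w assms by simp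
qed

text \<open>One edge is exchanged within its homotopy class while the other two stay equal, not just
  homotopic. This exactness lets such exchanges be chained, and it is needed again for simplices of
  squares.\<close>

lemma comp_replace_left:
  assumes "c \<in> simps L 2" "homotopic L 1 (face L 2 2 c) x"
  obtains c' where "c' \<in> simps L 2" "face L 2 2 c' = x" "face L 2 0 c' = face L 2 0 c"
    "face L 2 1 c' = face L 2 1 c"
proof -
  obtain y where y: "y \<in> simps L 2" "face L 2 0 y = degen L 0 0 (face L 1 0 (face L 2 2 c))"
    "face L 2 1 y = face L 2 2 c" "face L 2 2 y = x"
    using assms(2) by (rule homotopicE)
  obtain w where w: "w \<in> simps L 3" "face L 3 0 w = degen L 1 0 (face L 2 0 c)" "face L 3 1 w = c"
    "face L 3 3 w = y"
    by (rule fill3_2[of "degen L 1 0 (face L 2 0 c)" c y]) (use assms y in auto)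
  have "face L 2 2 (face L 3 2 w) = x" using dd(9)[OF w(1)] w y by simp
  moreover have "face L 2 0 (face L 3 2 w) = face L 2 0 c" "face L 2 1 (face L 3 2 w) = face L 2 1 c"
    using w assms by simp_all
  ultimately show thesis using that[of "face L 3 2 w"] w by simp
qed

lemma comp_replace_right:
  assumes "c \<in> simps L 2" "homotopic L 1 (face L 2 0 c) x"
  obtains c' where "c' \<in> simps L 2" "face L 2 0 c' = x" "face L 2 2 c' = face L 2 2 c"
    "face L 2 1 c' = face L 2 1 c"
proof -
  obtain y where y: "y \<in> simps L 2" "face L 2 0 y = degen L 0 0 (face L 1 0 (face L 2 0 c))"
    "face L 2 1 y = face L 2 0 c" "face L 2 2 y = x"
    using assms(2) by (rule homotopicE)
  obtain w where w: "w \<in> simps L 3" "face L 3 0 w = y" "face L 3 1 w = degen L 1 1 (face L 2 1 c)"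
    "face L 3 2 w = c"
    by (rule fill3_3[of y "degen L 1 1 (face L 2 1 c)" c]) (use assms y in auto)
  have "face L 2 2 (face L 3 3 w) = face L 2 2 c" "face L 2 0 (face L 3 3 w) = x"
    "face L 2 1 (face L 3 3 w) = face L 2 1 c"
    using w assms y by simp_all
  then show thesis using that[of "face L 3 3 w"] w by simp
qed

lemma comp_unique:
  assumes "c \<in> simps L 2" "c' \<in> simps L 2" "homotopic L 1 (face L 2 2 c) (face L 2 2 c')"
    "homotopic L 1 (face L 2 0 c) (face L 2 0 c')"
  shows "homotopic L 1 (face L 2 1 c) (face L 2 1 c')"
proof -
  obtain a where a: "a \<in> simps L 2" "face L 2 2 a = face L 2 2 c'" "face L 2 0 a = face L 2 0 c"
    "face L 2 1 a = face L 2 1 c" using comp_replace_left[OF assms(1,3)] .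
  obtain b where b: "b \<in> simps L 2" "face L 2 0 b = face L 2 0 c'" "face L 2 2 b = face L 2 2 a"
    "face L 2 1 b = face L 2 1 a" using comp_replace_right[of a "face L 2 0 c'"] a assms by metis
  show ?thesis using comp_unique_strict[of b c'] a b assms by simp
qed

text \<open>The difference of the two homotopies is a sphere in \<open>\<pi>\<^sub>2\<close>, and a null homotopy of it is one
  face of a 4-dimensional horn whose filler contains the required 3-simplex.\<close>

lemma homotopies_homotopic:
  assumes pi2: "\<And>a. a \<in> simps L 0 \<Longrightarrow> homotopy_group_zero L 2 a"
    and a: "a \<in> simps L 0" and th: "\<theta> \<in> simps L 2" "\<theta>' \<in> simps L 2"
    and f: "face L 2 0 \<theta> = degen L 0 0 a" "face L 2 0 \<theta>' = degen L 0 0 a"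
      "face L 2 1 \<theta> = face L 2 1 \<theta>'" "face L 2 2 \<theta> = face L 2 2 \<theta>'"
  obtains y where "y \<in> simps L 3" "face L 3 0 y = degen L 1 1 (degen L 0 0 a)"
    "face L 3 1 y = degen L 1 1 (face L 2 1 \<theta>)" "face L 3 2 y = \<theta>" "face L 3 3 y = \<theta>'"
proof -
  define e where "e = face L 2 1 \<theta>"
  have e: "e \<in> simps L 1" "face L 1 0 e = a" using th a f by (auto simp: e_def)
  define o1 where "o1 = degen L 0 0 a"
  define o2 where "o2 = degen L 1 1 o1"
  have o: "o1 \<in> simps L 1" "o2 \<in> simps L 2" "face L 2 0 o2 = o1" "face L 2 1 o2 = o1" "face L 2 2 o2 = o1"
    using a by (auto simp: o1_def o2_def)
  have e1: "face L 2 0 (degen L 1 1 e) = o1" using e by (simp add: o1_def)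
  have base1: "base_simplex L 1 a = o1" "base_simplex L 2 a = o2"
  proof -
    have "codeg 0 0 = (\<lambda>i\<in>{..1}. 0)" by (auto simp: codeg_def restrict_def)
    then show b1: "base_simplex L 1 a = o1" by (simp add: base_simplex_def o1_def degen_def)
    have "compose {..2} (codeg 0 0) (codeg 1 1) = (\<lambda>i\<in>{..2}. 0)"
      by (auto simp: codeg_def restrict_def compose_def fun_eq_iff)
    then show "base_simplex L 2 a = o2"
      using a sact_sact[OF simplicial, of "codeg 1 1" 2 1 "codeg 0 0" 0 a]
      by (simp add: base_simplex_def o1_def o2_def degen_def)
  qed
  obtain y where y: "y \<in> simps L 3" "face L 3 1 y = degen L 1 1 e" "face L 3 2 y = \<theta>" "face L 3 3 y = \<theta>'"
    by (rule fill3_0[of "degen L 1 1 e" \<theta> \<theta>']) (use th f e in \<open>auto simp: e_def\<close>)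
  define w where "w = face L 3 0 y"
  have w: "w \<in> simps L 2" "face L 2 0 w = o1" "face L 2 1 w = o1" "face L 2 2 w = o1"
    using y e e1 f dd(4-6)[OF y(1)] by (auto simp: w_def o1_def)
  have "hclass L 2 w \<in> homotopy_group L 2 a"
    unfolding homotopy_group_def using w base1 by (auto simp: le_num)
  then have hc: "hclass L 2 w = hclass L 2 o2"
    using pi2[OF a] base1 by (simp add: homotopy_group_zero_def)
  have "homotopic L 2 o2 o2"
    unfolding homotopic_def
  proof (intro conjI bexI[of _ "degen L 2 2 o2"] allI impI)
    fix i :: nat assume "i < 2"
    then have "i = 0 \<or> i = 1" by arith
    then show "face L (2 + 1) i (degen L 2 2 o2) = degen L (2 - 1) (2 - 1) (face L 2 i o2)" using o by auto
  qed (use o in auto)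
  then have "o2 \<in> hclass L 2 w" unfolding hc by (simp add: hclass_def)
  then have hom: "homotopic L 2 w o2" by (simp add: hclass_def)
  have num: "(2::nat) + 1 = 3" "(2::nat) - 1 = 1" by simp_all
  have "\<exists>v\<in>simps L 3. (\<forall>i<2. face L 3 i v = degen L 1 1 (face L 2 i w)) \<and> face L 3 2 v = w \<and> face L 3 3 v = o2"
    using hom unfolding homotopic_def num by blast
  then obtain v where v: "v \<in> simps L 3" "face L 3 2 v = w" "face L 3 3 v = o2"
    and v': "\<forall>i<2. face L 3 i v = degen L 1 1 (face L 2 i w)" by blast
  have v01: "face L 3 0 v = o2" "face L 3 1 v = o2"
    using v'[rule_format, of 0] v'[rule_format, of 1] unfolding w(2,3) o2_def by simp_all
  obtain z where z: "z \<in> simps L 4" "face L 4 0 z = v" "face L 4 1 z = degen L 2 2 (degen L 1 1 e)"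
    "face L 4 2 z = degen L 2 2 \<theta>" "face L 4 3 z = y"
    by (rule fill4_4[of v "degen L 2 2 (degen L 1 1 e)" "degen L 2 2 \<theta>" y])
      (use v v01 y e e1 th f o in \<open>auto simp: w_def[symmetric] o1_def[symmetric] o2_def[symmetric] e_def[symmetric]\<close>)
  have "face L 3 0 (face L 4 4 z) = o2" "face L 3 1 (face L 4 4 z) = degen L 1 1 e"
    "face L 3 2 (face L 4 4 z) = \<theta>" "face L 3 3 (face L 4 4 z) = \<theta>'"
    using z v v01 e th y by (simp_all add: dd4)
  then show thesis using that[of "face L 4 4 z"] z by (simp add: o2_def o1_def e_def)
qed

end

text \<open>Evaluates the definite descriptions by which the definitions pass from representatives
  to classes; the second hypothesis is independence of the representative.\<close>

lemma the_class_image: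
  assumes "x \<in> A" "\<And>x'. x' \<in> A \<Longrightarrow> h x = h x' \<Longrightarrow> g x = g x'"
  shows "(THE u. \<exists>x'\<in>A. h x = h x' \<and> u = g x') = g x"
proof (rule the_equality)
  show "\<exists>x'\<in>A. h x = h x' \<and> g x = g x'" using assms(1) by blast
  fix u assume "\<exists>x'\<in>A. h x = h x' \<and> u = g x'"
  then obtain x' where "x' \<in> A" "h x = h x'" "u = g x'" by blast
  then show "u = g x" using assms(2)[of x'] by simp
qed

section \<open>The fundamental groupoid of a Kan complex\<close>

context kan begin

lemma homotopic_face: "homotopic L 1 x x' \<Longrightarrow> i \<le> 1 \<Longrightarrow> face L 1 i x = face L 1 i x'"
  unfolding homotopic_1_iff by (auto simp: le_num)

lemma Dom_fund:
  assumes "x \<in> simps L 1" shows "Dom (fund_groupoid L) (hclass L 1 x) = face L 1 0 x"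
proof -
  have "face L 1 0 x = face L 1 0 x'" if "hclass L 1 x = hclass L 1 x'" for x'
    using that homotopic_face[of x x' 0] unfolding hclass_eq_iff[OF assms] by simp
  then have "(THE a. \<exists>x'\<in>simps L 1. hclass L 1 x = hclass L 1 x' \<and> a = face L 1 0 x') = face L 1 0 x"
    by (intro the_class_image[where h = "hclass L 1" and g = "face L 1 0"] assms)
  then show ?thesis using assms by (simp add: fund_groupoid_def Let_def)
qed

lemma Cod_fund:
  assumes "x \<in> simps L 1" shows "Cod (fund_groupoid L) (hclass L 1 x) = face L 1 1 x"
proof -
  have "face L 1 1 x = face L 1 1 x'" if "hclass L 1 x = hclass L 1 x'" for x'
    using that homotopic_face[of x x' 1] unfolding hclass_eq_iff[OF assms] by simp
  then have "(THE a. \<exists>x'\<in>simps L 1. hclass L 1 x = hclass L 1 x' \<and> a = face L 1 1 x') = face L 1 1 x"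
    by (intro the_class_image[where h = "hclass L 1" and g = "face L 1 1"] assms)
  then show ?thesis using assms by (simp add: fund_groupoid_def Let_def)
qed

lemma Obj_fund [simp]: "Obj (fund_groupoid L) = simps L 0"
  and Arr_fund [simp]: "Arr (fund_groupoid L) = hclass L 1 ` simps L 1"
  and Idn_fund: "a \<in> simps L 0 \<Longrightarrow> Idn (fund_groupoid L) a = hclass L 1 (degen L 0 0 a)"
  by (simp_all add: fund_groupoid_def Let_def)

text \<open>Three strictly composable edges form the spine of a tetrahedron. Faces \<open>3\<close>
  and \<open>0\<close> fill the two adjacent pairs, face \<open>1\<close> composes the first
  composite with \<open>z\<close>, and the omitted face \<open>2\<close> gives the other
  bracketing.\<close>

lemma assoc_filler:
  assumes "x \<in> simps L 1" "y \<in> simps L 1" "z \<in> simps L 1" "face L 1 0 x = face L 1 1 y"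
    "face L 1 0 y = face L 1 1 z"
  obtains w where "w \<in> simps L 3" "face L 2 2 (face L 3 3 w) = x" "face L 2 0 (face L 3 3 w) = y"
    "face L 2 0 (face L 3 0 w) = z"
proof -
  obtain a where a: "a \<in> simps L 2" "face L 2 0 a = y" "face L 2 2 a = x" using fill2_1 assms by metis
  obtain b where b: "b \<in> simps L 2" "face L 2 0 b = z" "face L 2 2 b = y" using fill2_1 assms by metis
  obtain c where c: "c \<in> simps L 2" "face L 2 0 c = z" "face L 2 2 c = face L 2 1 a"
    by (rule fill2_1[of z "face L 2 1 a"]) (use assms a in auto)
  obtain w where "w \<in> simps L 3" "face L 3 0 w = b" "face L 3 1 w = c" "face L 3 3 w = a"
    by (rule fill3_2[of b c a]) (use a b c in auto)
  then show thesis using that[of w] a b by simp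
qed

lemma groupoid_fund: "groupoid (fund_groupoid L)" (is ?A)
  and ext_catg_fund: "ext_catg (fund_groupoid L)" (is ?B)
  and Cmp_fund: "y \<in> simps L 2 \<Longrightarrow> Cmp (fund_groupoid L) (hclass L 1 (face L 2 2 y)) (hclass L 1 (face L 2 0 y)) =
      hclass L 1 (face L 2 1 y)" (is "PROP ?C")
proof -
  define T where "T = (\<lambda>X X' Z. \<exists>y\<in>simps L 2. X = hclass L 1 (face L 2 2 y) \<and>
    X' = hclass L 1 (face L 2 0 y) \<and> Z = hclass L 1 (face L 2 1 y))"
  let ?F = "fund_groupoid L"
  have C: "?F = \<lparr>Obj = simps L 0, Arr = hclass L 1 ` simps L 1, Dom = Dom ?F, Cod = Cod ?F, Idn = Idn ?F,
      Cmp = (\<lambda>X Y. if X \<in> hclass L 1 ` simps L 1 \<and> Y \<in> hclass L 1 ` simps L 1 \<and> Dom ?F X = Cod ?F Y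
        then THE Z. T X Y Z else undefined)\<rparr>"
    unfolding T_def by (simp add: fund_groupoid_def Let_def)
  have TI: "T (hclass L 1 (face L 2 2 y)) (hclass L 1 (face L 2 0 y)) (hclass L 1 (face L 2 1 y))"
    if "y \<in> simps L 2" for y using that T_def by blast
  have "?A \<and> ?B \<and> (\<forall>X Y Z. T X Y Z \<longrightarrow> Cmp ?F X Y = Z)"
  proof (rule rel_groupoid[OF C])
    show "Dom ?F \<in> extensional (hclass L 1 ` simps L 1)" "Cod ?F \<in> extensional (hclass L 1 ` simps L 1)"
      "Idn ?F \<in> extensional (simps L 0)" by (simp_all add: fund_groupoid_def Let_def)
    show "Dom ?F X \<in> simps L 0 \<and> Cod ?F X \<in> simps L 0" if asm: "X \<in> hclass L 1 ` simps L 1" for X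
      using asm by (auto simp: Dom_fund Cod_fund)
    show "Idn ?F a \<in> hclass L 1 ` simps L 1 \<and> Dom ?F (Idn ?F a) = a \<and> Cod ?F (Idn ?F a) = a"
      if asm: "a \<in> simps L 0" for a using asm by (auto simp: Dom_fund Cod_fund Idn_fund)
    show "X \<in> hclass L 1 ` simps L 1 \<and> Y \<in> hclass L 1 ` simps L 1 \<and> Z \<in> hclass L 1 ` simps L 1 \<and>
        Dom ?F X = Cod ?F Y \<and> Dom ?F Z = Dom ?F Y \<and> Cod ?F Z = Cod ?F X" if asm: "T X Y Z" for X Y Z
      using asm unfolding T_def by (auto simp: Dom_fund Cod_fund)
    show "\<exists>Z. T X Y Z" if asm: "X \<in> hclass L 1 ` simps L 1" "Y \<in> hclass L 1 ` simps L 1"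
      "Dom ?F X = Cod ?F Y" for X Y
    proof -
      obtain x y where xy: "x \<in> simps L 1" "X = hclass L 1 x" "y \<in> simps L 1" "Y = hclass L 1 y"
        using asm(1,2) by blast
      then have "face L 1 0 x = face L 1 1 y" using asm by (simp add: Dom_fund Cod_fund)
      then obtain c where "c \<in> simps L 2" "face L 2 0 c = y" "face L 2 2 c = x"
        using fill2_1 xy by metis
      then show ?thesis using TI[of c] xy by auto
    qed
    show "Z = Z'" if TZ: "T X Y Z" "T X Y Z'" for X Y Z Z'
    proof -
      obtain c c' where c: "c \<in> simps L 2" "X = hclass L 1 (face L 2 2 c)" "Y = hclass L 1 (face L 2 0 c)"
          "Z = hclass L 1 (face L 2 1 c)"
        and c': "c' \<in> simps L 2" "X = hclass L 1 (face L 2 2 c')" "Y = hclass L 1 (face L 2 0 c')"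
          "Z' = hclass L 1 (face L 2 1 c')"
        using TZ unfolding T_def by blast
      have "homotopic L 1 (face L 2 2 c) (face L 2 2 c')" "homotopic L 1 (face L 2 0 c) (face L 2 0 c')"
        using c c' by (simp_all flip: hclass_eq_iff)
      from comp_unique[OF c(1) c'(1) this] show ?thesis using c c' by (simp flip: hclass_eq_iff)
    qed
    show "T X (Idn ?F (Dom ?F X)) X \<and> T (Idn ?F (Cod ?F X)) X X" if asm: "X \<in> hclass L 1 ` simps L 1" for X
    proof -
      obtain x where x: "x \<in> simps L 1" "X = hclass L 1 x" using asm by blast
      show ?thesis using TI[of "degen L 1 1 x"] TI[of "degen L 1 0 x"] x
        by (simp add: Dom_fund Cod_fund Idn_fund)
    qed
    show "\<exists>P Q R. T X Y P \<and> T Y Z Q \<and> T P Z R \<and> T X Q R" if asm: "X \<in> hclass L 1 ` simps L 1"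
      "Y \<in> hclass L 1 ` simps L 1" "Z \<in> hclass L 1 ` simps L 1" "Dom ?F X = Cod ?F Y" "Dom ?F Y = Cod ?F Z"
      for X Y Z
    proof -
      obtain x y z where xy: "x \<in> simps L 1" "X = hclass L 1 x" "y \<in> simps L 1" "Y = hclass L 1 y"
        "z \<in> simps L 1" "Z = hclass L 1 z" using asm(1-3) by blast
      have e: "face L 1 0 x = face L 1 1 y" "face L 1 0 y = face L 1 1 z"
        using asm(4,5) xy by (simp_all add: Dom_fund Cod_fund)
      obtain w where w: "w \<in> simps L 3" "face L 2 2 (face L 3 3 w) = x" "face L 2 0 (face L 3 3 w) = y"
        "face L 2 0 (face L 3 0 w) = z" using assoc_filler[OF xy(1,3,5) e] .
      have "T X Y (hclass L 1 (face L 2 1 (face L 3 3 w)))"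
        using TI[of "face L 3 3 w"] w xy by simp
      moreover have "T Y Z (hclass L 1 (face L 2 1 (face L 3 0 w)))"
        using TI[of "face L 3 0 w"] w xy by simp
      moreover have "T (hclass L 1 (face L 2 1 (face L 3 3 w))) Z (hclass L 1 (face L 2 1 (face L 3 1 w)))"
        using TI[of "face L 3 1 w"] w xy by simp
      moreover have "T X (hclass L 1 (face L 2 1 (face L 3 0 w))) (hclass L 1 (face L 2 1 (face L 3 1 w)))"
        using TI[of "face L 3 2 w"] w xy by simp
      ultimately show ?thesis by blast
    qed
    show "\<exists>Y. T X Y (Idn ?F (Cod ?F X))" if asm: "X \<in> hclass L 1 ` simps L 1" for X
    proof -
      obtain x where x: "x \<in> simps L 1" "X = hclass L 1 x" using asm by blast
      \<comment> \<open>Filling an outer horn with the identity as prescribed composite produces a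
        right inverse.\<close>
      obtain c where "c \<in> simps L 2" "face L 2 2 c = x" "face L 2 1 c = degen L 0 0 (face L 1 1 x)"
        by (rule fill2_0[of "degen L 0 0 (face L 1 1 x)" x]) (use x in auto)
      then show ?thesis using TI[of c] x by (auto simp: Cod_fund Idn_fund)
    qed
  qed
  then show ?A ?B "PROP ?C" using TI by auto
qed

end

section \<open>The homotopy double groupoid\<close>

definition tr :: "'a bisset \<Rightarrow> 'a bisset" where
  "tr K = \<lparr>bisimps = (\<lambda>p q. bisimps K q p), bact = (\<lambda>m n p q \<alpha> \<beta>. bact K n m q p \<beta> \<alpha>)\<rparr>"

lemma bisimps_tr [simp]: "bisimps (tr K) p q = bisimps K q p"
  and bact_tr [simp]: "bact (tr K) m n p q \<alpha> \<beta> = bact K n m q p \<beta> \<alpha>"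
  by (simp_all add: tr_def)

lemma hrow_tr [simp]: "hrow (tr K) q = vcol K q" and vcol_tr [simp]: "vcol (tr K) p = hrow K p"
  by (simp_all add: hrow_def vcol_def)

lemma hface_tr [simp]: "hface (tr K) p q i = vface K q p i" and vface_tr [simp]: "vface (tr K) p q i = hface K q p i"
  and hdegen_tr [simp]: "hdegen (tr K) p q i = vdegen K q p i" and vdegen_tr [simp]: "vdegen (tr K) p q i = hdegen K q p i"
  by (simp_all add: hface_def vface_def hdegen_def vdegen_def)

lemma bisimplicial_set_tr: "bisimplicial_set K \<Longrightarrow> bisimplicial_set (tr K)"
  unfolding bisimplicial_set_def[of "tr K"]
  by (intro conjI allI ballI funcsetI) (simp_all add: bact_in bact_id bact_bact)

text \<open>After exchanging the two components of each cell, a map from a bihorn into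
  \<open>tr K\<close> is a map into \<open>K\<close> from the bihorn with both dimensions and both
  omitted indices exchanged; \<open>swp\<close> performs this on the given map and on its
  extension.\<close>

lemma extension_condition_tr:
  assumes "extension_condition K" shows "extension_condition (tr K)"
  unfolding extension_condition_def
proof (intro conjI allI impI ballI; (elim conjE)?)
  show "Kan (hrow (tr K) q)" "Kan (vcol (tr K) p)" for p q
    using assms by (simp_all add: extension_condition_def)
  fix p q k l :: nat and f assume pq: "1 \<le> p" "1 \<le> q" "k \<le> p" "l \<le> q" and f: "f \<in> bis_homs (biHorn k l p q) (tr K)"
  define swp where "swp f = (\<lambda>n m. \<lambda>(\<beta>, \<alpha>). f m n (\<alpha>, \<beta>))" for f :: "nat \<Rightarrow> nat \<Rightarrow> (nat \<Rightarrow> nat) \<times> (nat \<Rightarrow> nat) \<Rightarrow> 'a"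
  have H: "(\<beta>, \<alpha>) \<in> bisimps (biHorn l k q p) n m \<longleftrightarrow> (\<alpha>, \<beta>) \<in> bisimps (biHorn k l p q) m n" for m n \<alpha> \<beta>
    using pq by (auto simp: bisimps_biHorn)
  have "swp f \<in> bis_homs (biHorn l k q p) K"
    unfolding bis_homs_def using bis_hom_in[OF f] bis_hom_act[OF f, of \<beta> n j \<alpha> m i "(b, a)" for m n i j \<alpha> \<beta> a b] f
    by (auto simp: swp_def H PiE_iff extensional_def bis_homs_def)
  then obtain g where g: "g \<in> bis_homs (biDelta q p) K"
    "\<forall>n m. \<forall>z\<in>bisimps (biHorn l k q p) n m. g n m z = swp f n m z"
    using assms pq unfolding extension_condition_def by blast
  have "swp g \<in> bis_homs (biDelta p q) (tr K)"
    unfolding bis_homs_def using bis_hom_in[OF g(1)] bis_hom_act[OF g(1), of \<beta> n j \<alpha> m i "(b, a)" for m n i j \<alpha> \<beta> a b] g(1)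
    by (auto simp: swp_def PiE_iff extensional_def bis_homs_def)
  moreover have "\<forall>m n. \<forall>z\<in>bisimps (biHorn k l p q) m n. swp g m n z = f m n z"
    using g(2) H by (auto simp: swp_def)
  ultimately show "\<exists>g\<in>bis_homs (biDelta p q) (tr K). \<forall>m n. \<forall>z\<in>bisimps (biHorn k l p q) m n. g m n z = f m n z"
    by blast
qed

locale bikan =
  fixes K :: "'a bisset"
  assumes BiSet: "K \<in> Obj BiSet"
begin

lemma bis: "bisimplicial_set K" and ext_cond: "extension_condition K"
  and rows: "Kan (hrow K q)" and cols: "Kan (vcol K p)"
  and pi2h: "a \<in> bisimps K 0 0 \<Longrightarrow> homotopy_group_zero (hrow K 0) 2 a"
  and pi2v: "a \<in> bisimps K 0 0 \<Longrightarrow> homotopy_group_zero (vcol K 0) 2 a"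
  using BiSet by (auto simp: BiSet_def Let_def extension_condition_def)

lemma bikan_tr: "bikan (tr K)"
  by unfold_locales
    (simp add: BiSet_def Let_def bisimplicial_set_tr bis extension_condition_tr ext_cond pi2h pi2v)

end

lemma compose_coface_idop [simp]: "m = n - 1 \<Longrightarrow> compose {..m} (coface n i) (idop m) = coface n i"
  by (rule ops_eqI[of _ m]) (auto simp: coface_def)

lemma compose_codeg_idop [simp]: "m = n + 1 \<Longrightarrow> compose {..m} (codeg n i) (idop m) = codeg n i"
  by (rule ops_eqI[of _ m]) (auto simp: codeg_def)

lemma vface_hface:
  assumes "bisimplicial_set K" "x \<in> bisimps K p q" "1 \<le> p" "1 \<le> q" "i \<le> p" "j \<le> q"
  shows "vface K (p - 1) q j (hface K p q i x) = hface K p (q - 1) i (vface K p q j x)"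
  using assms unfolding hface_eq vface_eq by (subst (1 2) bact_bact) auto

lemma vface_hdegen:
  assumes "bisimplicial_set K" "x \<in> bisimps K p q" "1 \<le> q" "i \<le> p" "j \<le> q"
  shows "vface K (p + 1) q j (hdegen K p q i x) = hdegen K p (q - 1) i (vface K p q j x)"
  using assms unfolding hdegen_eq vface_eq by (subst (1 2) bact_bact) auto

lemma vdegen_hdegen:
  assumes "bisimplicial_set K" "x \<in> bisimps K p q" "i \<le> p" "j \<le> q"
  shows "vdegen K (p + 1) q j (hdegen K p q i x) = hdegen K p (q + 1) i (vdegen K p q j x)"
  using assms unfolding hdegen_eq vdegen_eq by (subst (1 2) bact_bact) auto

lemma hface_vdegen:
  assumes "bisimplicial_set K" "x \<in> bisimps K p q" "1 \<le> p" "i \<le> p" "j \<le> q"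
  shows "hface K p (q + 1) i (vdegen K p q j x) = vdegen K (p - 1) q j (hface K p q i x)"
  using assms unfolding vdegen_eq hface_eq by (subst (1 2) bact_bact) auto

context bikan begin

text \<open>The rewrites restate the lemmas on Kan complexes in terms of \<open>hface\<close> and
  \<open>hdegen\<close>, and for columns \<open>vface\<close> and \<open>vdegen\<close>, so that
  facts from both directions can be combined by simplification.\<close>

sublocale R: kan "hrow K q"
  rewrites "face (hrow K q) n i = hface K n q i" and "degen (hrow K q) n i = hdegen K n q i"
    and "simps (hrow K q) n = bisimps K n q" for q
proof -
  show "kan (hrow K q)" by unfold_locales (use rows in \<open>auto simp: Kan_def\<close>)
qed (simp_all add: hface_def hdegen_def hrow_def)

sublocale C: kan "vcol K p"
  rewrites "face (vcol K p) n i = vface K p n i" and "degen (vcol K p) n i = vdegen K p n i"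
    and "simps (vcol K p) n = bisimps K p n" for p
proof -
  show "kan (vcol K p)" by unfold_locales (use cols in \<open>auto simp: Kan_def\<close>)
qed (simp_all add: vface_def vdegen_def vcol_def)

text \<open>Not declared as a simplification rule, since proofs use both orientations, depending on
  the direction in which the faces are known.\<close>

lemma vh:
  "x11 \<in> bisimps K 1 1 \<Longrightarrow> i \<le> 1 \<Longrightarrow> j \<le> 1 \<Longrightarrow> vface K 0 1 j (hface K 1 1 i x11) = hface K 1 0 i (vface K 1 1 j x11)"
  "x12 \<in> bisimps K 1 2 \<Longrightarrow> i \<le> 1 \<Longrightarrow> j \<le> 2 \<Longrightarrow> vface K 0 2 j (hface K 1 2 i x12) = hface K 1 1 i (vface K 1 2 j x12)"
  "x21 \<in> bisimps K 2 1 \<Longrightarrow> i \<le> 2 \<Longrightarrow> j \<le> 1 \<Longrightarrow> vface K 1 1 j (hface K 2 1 i x21) = hface K 2 0 i (vface K 2 1 j x21)"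
  "x22 \<in> bisimps K 2 2 \<Longrightarrow> i \<le> 2 \<Longrightarrow> j \<le> 2 \<Longrightarrow> vface K 1 2 j (hface K 2 2 i x22) = hface K 2 1 i (vface K 2 2 j x22)"
  "x13 \<in> bisimps K 1 3 \<Longrightarrow> i \<le> 1 \<Longrightarrow> j \<le> 3 \<Longrightarrow> vface K 0 3 j (hface K 1 3 i x13) = hface K 1 2 i (vface K 1 3 j x13)"
  "x31 \<in> bisimps K 3 1 \<Longrightarrow> i \<le> 3 \<Longrightarrow> j \<le> 1 \<Longrightarrow> vface K 2 1 j (hface K 3 1 i x31) = hface K 3 0 i (vface K 3 1 j x31)"
  using vface_hface[OF bis, of x11 1 1 i j] vface_hface[OF bis, of x12 1 2 i j] vface_hface[OF bis, of x21 2 1 i j] vface_hface[OF bis, of x22 2 2 i j] vface_hface[OF bis, of x13 1 3 i j] vface_hface[OF bis, of x31 3 1 i j]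
  by (simp_all del: R.dd C.dd)

lemma mixed_degen [simp]:
  "x01 \<in> bisimps K 0 1 \<Longrightarrow> i \<le> 0 \<Longrightarrow> j \<le> 1 \<Longrightarrow> vface K 1 1 j (hdegen K 0 1 i x01) = hdegen K 0 0 i (vface K 0 1 j x01)"
  "x11 \<in> bisimps K 1 1 \<Longrightarrow> i \<le> 1 \<Longrightarrow> j \<le> 1 \<Longrightarrow> vface K 2 1 j (hdegen K 1 1 i x11) = hdegen K 1 0 i (vface K 1 1 j x11)"
  "x02 \<in> bisimps K 0 2 \<Longrightarrow> i \<le> 0 \<Longrightarrow> j \<le> 2 \<Longrightarrow> vface K 1 2 j (hdegen K 0 2 i x02) = hdegen K 0 1 i (vface K 0 2 j x02)"
  "x03 \<in> bisimps K 0 3 \<Longrightarrow> i \<le> 0 \<Longrightarrow> j \<le> 3 \<Longrightarrow> vface K 1 3 j (hdegen K 0 3 i x03) = hdegen K 0 2 i (vface K 0 3 j x03)"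
  "y10 \<in> bisimps K 1 0 \<Longrightarrow> i \<le> 1 \<Longrightarrow> j \<le> 0 \<Longrightarrow> hface K 1 1 i (vdegen K 1 0 j y10) = vdegen K 0 0 j (hface K 1 0 i y10)"
  "y11 \<in> bisimps K 1 1 \<Longrightarrow> i \<le> 1 \<Longrightarrow> j \<le> 1 \<Longrightarrow> hface K 1 2 i (vdegen K 1 1 j y11) = vdegen K 0 1 j (hface K 1 1 i y11)"
  "y20 \<in> bisimps K 2 0 \<Longrightarrow> i \<le> 2 \<Longrightarrow> j \<le> 0 \<Longrightarrow> hface K 2 1 i (vdegen K 2 0 j y20) = vdegen K 1 0 j (hface K 2 0 i y20)"
  "y30 \<in> bisimps K 3 0 \<Longrightarrow> i \<le> 3 \<Longrightarrow> j \<le> 0 \<Longrightarrow> hface K 3 1 i (vdegen K 3 0 j y30) = vdegen K 2 0 j (hface K 3 0 i y30)"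
  using vface_hdegen[OF bis, of x01 0 1 i j] vface_hdegen[OF bis, of x11 1 1 i j] vface_hdegen[OF bis, of x02 0 2 i j] vface_hdegen[OF bis, of x03 0 3 i j] hface_vdegen[OF bis, of y10 1 0 i j] hface_vdegen[OF bis, of y11 1 1 i j] hface_vdegen[OF bis, of y20 2 0 i j] hface_vdegen[OF bis, of y30 3 0 i j]
  by (simp_all del: R.dd C.dd)

lemma vdegen_hdegen_0: "a \<in> bisimps K 0 0 \<Longrightarrow> vdegen K 1 0 0 (hdegen K 0 0 0 a) = hdegen K 0 1 0 (vdegen K 0 0 0 a)"
  using vdegen_hdegen[OF bis, of a 0 0 0 0] by simp

section \<open>Bihorn fillers, named by dimensions and omitted horizontal and vertical face\<close>

lemma fill11_10:
  assumes "x0 \<in> bisimps K 0 1" "y1 \<in> bisimps K 1 0"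
    "vface K 0 1 1 x0 = hface K 1 0 0 y1"
  obtains z where "z \<in> bisimps K 1 1" "hface K 1 1 0 z = x0" "vface K 1 1 1 z = y1"
proof -
  obtain z where z: "z \<in> bisimps K 1 1"
    "\<And>i. i \<le> 1 \<Longrightarrow> i \<noteq> 1 \<Longrightarrow> hface K 1 1 i z = (x0)"
    "\<And>i. i \<le> 1 \<Longrightarrow> i \<noteq> 0 \<Longrightarrow> vface K 1 1 i z = (y1)"
    by (rule biHorn_filler[OF bis ext_cond, of 1 1 1 0 "\<lambda>i. x0" "\<lambda>i. y1"])
      (use assms in \<open>auto simp: le_num\<close>)
  show thesis
    by (rule that[OF z(1)]) (simp_all add: z(2,3))
qed

lemma fill12_12:
  assumes "x0 \<in> bisimps K 0 2" "y0 \<in> bisimps K 1 1" "y1 \<in> bisimps K 1 1"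
    "vface K 1 1 0 y1 = vface K 1 1 0 y0"
    "vface K 0 2 0 x0 = hface K 1 1 0 y0"
    "vface K 0 2 1 x0 = hface K 1 1 0 y1"
  obtains z where "z \<in> bisimps K 1 2" "hface K 1 2 0 z = x0" "vface K 1 2 0 z = y0" "vface K 1 2 1 z = y1"
proof -
  obtain z where z: "z \<in> bisimps K 1 2"
    "\<And>i. i \<le> 1 \<Longrightarrow> i \<noteq> 1 \<Longrightarrow> hface K 1 2 i z = (x0)"
    "\<And>i. i \<le> 2 \<Longrightarrow> i \<noteq> 2 \<Longrightarrow> vface K 1 2 i z = (if i = 0 then y0 else y1)"
    by (rule biHorn_filler[OF bis ext_cond, of 1 2 1 2 "\<lambda>i. x0" "\<lambda>i. if i = 0 then y0 else y1"])
      (use assms in \<open>auto simp: le_num\<close>)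
  show thesis
    by (rule that[OF z(1)]) (simp_all add: z(2,3))
qed

lemma fill12_11:
  assumes "x0 \<in> bisimps K 0 2" "y0 \<in> bisimps K 1 1" "y2 \<in> bisimps K 1 1"
    "vface K 1 1 0 y2 = vface K 1 1 1 y0"
    "vface K 0 2 0 x0 = hface K 1 1 0 y0"
    "vface K 0 2 2 x0 = hface K 1 1 0 y2"
  obtains z where "z \<in> bisimps K 1 2" "hface K 1 2 0 z = x0" "vface K 1 2 0 z = y0" "vface K 1 2 2 z = y2"
proof -
  obtain z where z: "z \<in> bisimps K 1 2"
    "\<And>i. i \<le> 1 \<Longrightarrow> i \<noteq> 1 \<Longrightarrow> hface K 1 2 i z = (x0)"
    "\<And>i. i \<le> 2 \<Longrightarrow> i \<noteq> 1 \<Longrightarrow> vface K 1 2 i z = (if i = 0 then y0 else y2)"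
    by (rule biHorn_filler[OF bis ext_cond, of 1 2 1 1 "\<lambda>i. x0" "\<lambda>i. if i = 0 then y0 else y2"])
      (use assms in \<open>auto simp: le_num\<close>)
  show thesis
    by (rule that[OF z(1)]) (simp_all add: z(2,3))
qed

lemma fill22_21:
  assumes "x0 \<in> bisimps K 1 2" "x1 \<in> bisimps K 1 2" "y0 \<in> bisimps K 2 1" "y2 \<in> bisimps K 2 1"
    "hface K 1 2 0 x1 = hface K 1 2 0 x0"
    "vface K 2 1 0 y2 = vface K 2 1 1 y0"
    "vface K 1 2 0 x0 = hface K 2 1 0 y0"
    "vface K 1 2 2 x0 = hface K 2 1 0 y2"
    "vface K 1 2 0 x1 = hface K 2 1 1 y0"
    "vface K 1 2 2 x1 = hface K 2 1 1 y2"
  obtains z where "z \<in> bisimps K 2 2" "hface K 2 2 0 z = x0" "hface K 2 2 1 z = x1" "vface K 2 2 0 z = y0" "vface K 2 2 2 z = y2"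
proof -
  obtain z where z: "z \<in> bisimps K 2 2"
    "\<And>i. i \<le> 2 \<Longrightarrow> i \<noteq> 2 \<Longrightarrow> hface K 2 2 i z = (if i = 0 then x0 else x1)"
    "\<And>i. i \<le> 2 \<Longrightarrow> i \<noteq> 1 \<Longrightarrow> vface K 2 2 i z = (if i = 0 then y0 else y2)"
    by (rule biHorn_filler[OF bis ext_cond, of 2 2 2 1 "\<lambda>i. if i = 0 then x0 else x1" "\<lambda>i. if i = 0 then y0 else y2"])
      (use assms in \<open>auto simp: le_num\<close>)
  show thesis
    by (rule that[OF z(1)]) (simp_all add: z(2,3))
qed

lemma fill22_12:
  assumes "x0 \<in> bisimps K 1 2" "x2 \<in> bisimps K 1 2" "y0 \<in> bisimps K 2 1" "y1 \<in> bisimps K 2 1"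
    "hface K 1 2 0 x2 = hface K 1 2 1 x0"
    "vface K 2 1 0 y1 = vface K 2 1 0 y0"
    "vface K 1 2 0 x0 = hface K 2 1 0 y0"
    "vface K 1 2 1 x0 = hface K 2 1 0 y1"
    "vface K 1 2 0 x2 = hface K 2 1 2 y0"
    "vface K 1 2 1 x2 = hface K 2 1 2 y1"
  obtains z where "z \<in> bisimps K 2 2" "hface K 2 2 0 z = x0" "hface K 2 2 2 z = x2" "vface K 2 2 0 z = y0" "vface K 2 2 1 z = y1"
proof -
  obtain z where z: "z \<in> bisimps K 2 2"
    "\<And>i. i \<le> 2 \<Longrightarrow> i \<noteq> 1 \<Longrightarrow> hface K 2 2 i z = (if i = 0 then x0 else x2)"
    "\<And>i. i \<le> 2 \<Longrightarrow> i \<noteq> 2 \<Longrightarrow> vface K 2 2 i z = (if i = 0 then y0 else y1)"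
    by (rule biHorn_filler[OF bis ext_cond, of 2 2 1 2 "\<lambda>i. if i = 0 then x0 else x2" "\<lambda>i. if i = 0 then y0 else y1"])
      (use assms in \<open>auto simp: le_num\<close>)
  show thesis
    by (rule that[OF z(1)]) (simp_all add: z(2,3))
qed

lemma fill22_11:
  assumes "x0 \<in> bisimps K 1 2" "x2 \<in> bisimps K 1 2" "y0 \<in> bisimps K 2 1" "y2 \<in> bisimps K 2 1"
    "hface K 1 2 0 x2 = hface K 1 2 1 x0"
    "vface K 2 1 0 y2 = vface K 2 1 1 y0"
    "vface K 1 2 0 x0 = hface K 2 1 0 y0"
    "vface K 1 2 2 x0 = hface K 2 1 0 y2"
    "vface K 1 2 0 x2 = hface K 2 1 2 y0"
    "vface K 1 2 2 x2 = hface K 2 1 2 y2"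
  obtains z where "z \<in> bisimps K 2 2" "hface K 2 2 0 z = x0" "hface K 2 2 2 z = x2" "vface K 2 2 0 z = y0" "vface K 2 2 2 z = y2"
proof -
  obtain z where z: "z \<in> bisimps K 2 2"
    "\<And>i. i \<le> 2 \<Longrightarrow> i \<noteq> 1 \<Longrightarrow> hface K 2 2 i z = (if i = 0 then x0 else x2)"
    "\<And>i. i \<le> 2 \<Longrightarrow> i \<noteq> 1 \<Longrightarrow> vface K 2 2 i z = (if i = 0 then y0 else y2)"
    by (rule biHorn_filler[OF bis ext_cond, of 2 2 1 1 "\<lambda>i. if i = 0 then x0 else x2" "\<lambda>i. if i = 0 then y0 else y2"])
      (use assms in \<open>auto simp: le_num\<close>)
  show thesis
    by (rule that[OF z(1)]) (simp_all add: z(2,3))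
qed

lemma fill13_13:
  assumes "x0 \<in> bisimps K 0 3" "y0 \<in> bisimps K 1 2" "y1 \<in> bisimps K 1 2" "y2 \<in> bisimps K 1 2"
    "vface K 1 2 0 y1 = vface K 1 2 0 y0"
    "vface K 1 2 0 y2 = vface K 1 2 1 y0"
    "vface K 1 2 1 y2 = vface K 1 2 1 y1"
    "vface K 0 3 0 x0 = hface K 1 2 0 y0"
    "vface K 0 3 1 x0 = hface K 1 2 0 y1"
    "vface K 0 3 2 x0 = hface K 1 2 0 y2"
  obtains z where "z \<in> bisimps K 1 3" "hface K 1 3 0 z = x0" "vface K 1 3 0 z = y0" "vface K 1 3 1 z = y1" "vface K 1 3 2 z = y2"
proof -
  obtain z where z: "z \<in> bisimps K 1 3"
    "\<And>i. i \<le> 1 \<Longrightarrow> i \<noteq> 1 \<Longrightarrow> hface K 1 3 i z = (x0)"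
    "\<And>i. i \<le> 3 \<Longrightarrow> i \<noteq> 3 \<Longrightarrow> vface K 1 3 i z = (if i = 0 then y0 else if i = 1 then y1 else y2)"
    by (rule biHorn_filler[OF bis ext_cond, of 1 3 1 3 "\<lambda>i. x0" "\<lambda>i. if i = 0 then y0 else if i = 1 then y1 else y2"])
      (use assms in \<open>auto simp: le_num\<close>)
  show thesis
    by (rule that[OF z(1)]) (simp_all add: z(2,3))
qed

section \<open>Bihomotopy of squares\<close>

abbreviation H :: "'a \<Rightarrow> 'a \<Rightarrow> bool" where "H \<equiv> homotopic (hrow K 1) 1"
abbreviation V :: "'a \<Rightarrow> 'a \<Rightarrow> bool" where "V \<equiv> homotopic (vcol K 1) 1"

lemma H_in: "H x y \<Longrightarrow> x \<in> bisimps K 1 1 \<and> y \<in> bisimps K 1 1"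
  by (erule R.homotopicE) blast

lemma V_in: "V x y \<Longrightarrow> x \<in> bisimps K 1 1 \<and> y \<in> bisimps K 1 1"
  by (erule C.homotopicE) blast

lemma V_hface: assumes "V x y" "i \<le> 1" shows "homotopic (vcol K 0) 1 (hface K 1 1 i x) (hface K 1 1 i y)"
proof -
  obtain b where b: "b \<in> bisimps K 1 2" "vface K 1 2 0 b = vdegen K 1 0 0 (vface K 1 1 0 x)"
    "vface K 1 2 1 b = x" "vface K 1 2 2 b = y" "x \<in> bisimps K 1 1"
    using assms(1) by (rule C.homotopicE) blast
  have "homotopic (vcol K 0) 1 (vface K 0 2 1 (hface K 1 2 i b)) (vface K 0 2 2 (hface K 1 2 i b))"
    by (rule C.homotopicI[where a = "hface K 1 0 i (vface K 1 1 0 x)"]) (use b assms in \<open>simp_all add: vh\<close>)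
  then show ?thesis using b assms by (simp add: vh)
qed

text \<open>Homotopy lifting along the edge \<open>hface K 1 1 0 x\<close>: the homotopy of the
  edge, a degenerate square and \<open>x\<close> form a bihorn. This converts equality of classes of
  edges into strict equality of edges.\<close>

lemma V_lift:
  assumes "x \<in> bisimps K 1 1" "homotopic (vcol K 0) 1 (hface K 1 1 0 x) u"
  obtains x' where "V x x'" "hface K 1 1 0 x' = u"
proof -
  obtain t where t: "t \<in> bisimps K 0 2" "vface K 0 2 0 t = vdegen K 0 0 0 (vface K 0 1 0 (hface K 1 1 0 x))"
    "vface K 0 2 1 t = hface K 1 1 0 x" "vface K 0 2 2 t = u"
    using assms(2) by (rule C.homotopicE) blast
  obtain z where z: "z \<in> bisimps K 1 2" "hface K 1 2 0 z = t" "vface K 1 2 0 z = vdegen K 1 0 0 (vface K 1 1 0 x)"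
    "vface K 1 2 1 z = x"
    by (rule fill12_12[of t "vdegen K 1 0 0 (vface K 1 1 0 x)" x]) (use t assms in \<open>simp_all add: vh\<close>)
  have "V x (vface K 1 2 2 z)" using C.homotopicI[OF z(1), where a = "vface K 1 1 0 x"] z assms by simp
  moreover have "hface K 1 1 0 (vface K 1 2 2 z) = u" using vh(2)[of z 0 2] z t by simp
  ultimately show thesis using that by blast
qed

text \<open>The two homotopies become faces of a (2,2)-bihorn whose other faces are degenerate. The
  omitted horizontal face \<open>2\<close> and vertical face \<open>1\<close> of a filler are the
  new homotopies, which meet in the corner \<open>y'\<close>.\<close>

lemma VH_commute:
  assumes "V x y" "H y x'"
  obtains y' where "H x y'" "V y' x'"
proof -
  obtain a where a: "a \<in> bisimps K 2 1" "hface K 2 1 0 a = hdegen K 0 1 0 (hface K 1 1 0 y)"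
    "hface K 2 1 1 a = y" "hface K 2 1 2 a = x'"
    using assms(2) by (rule R.homotopicE) blast
  obtain b where b: "b \<in> bisimps K 1 2" "vface K 1 2 0 b = vdegen K 1 0 0 (vface K 1 1 0 x)"
    "vface K 1 2 1 b = x" "vface K 1 2 2 b = y" "vface K 1 1 0 x = vface K 1 1 0 y"
    using assms(1) by (rule C.homotopicE) blast
  have xy: "x \<in> bisimps K 1 1" "y \<in> bisimps K 1 1" "x' \<in> bisimps K 1 1" using H_in V_in assms by blast+
  obtain G where G: "G \<in> bisimps K 2 2" "hface K 2 2 0 G = hdegen K 0 2 0 (hface K 1 2 0 b)" "hface K 2 2 1 G = b"
    "vface K 2 2 0 G = vdegen K 2 0 0 (vface K 2 1 0 a)" "vface K 2 2 2 G = a"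
    by (rule fill22_21[of "hdegen K 0 2 0 (hface K 1 2 0 b)" b "vdegen K 2 0 0 (vface K 2 1 0 a)" a])
      (use a b xy in \<open>simp_all add: vh(1,2) vh(3)[OF a(1), symmetric] vdegen_hdegen_0\<close>)
  define y' where "y' = vface K 1 2 1 (hface K 2 2 2 G)"
  note hv = vh(4)[OF G(1), symmetric]
  have "H x y'" using R.homotopicI[of "vface K 2 2 1 G" 1 "hface K 1 1 0 x"] G(1) xy b a
    by (simp add: hv G(2,3) y'_def vh(2)[OF b(1)])
  moreover have "V y' x'" using C.homotopicI[of "hface K 2 2 2 G" 1 "hface K 2 0 2 (vface K 2 1 0 a)"] G(1) xy b a
    by (simp add: vh(4) G(4,5) y'_def)
  ultimately show thesis using that by blast
qed

lemma bihomotopic_iff: "bihomotopic K 1 1 x x' \<longleftrightarrow> (\<exists>y. H x y \<and> V y x')"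
proof
  assume "bihomotopic K 1 1 x x'"
  then obtain y where "x \<in> bisimps K 1 1" "y \<in> bisimps K 1 1" "hcls K 1 1 x = hcls K 1 1 y"
    "vcls K 1 1 y = vcls K 1 1 x'" unfolding bihomotopic_def by blast
  then show "\<exists>y. H x y \<and> V y x'"
    unfolding hcls_def vcls_def by (intro exI[of _ y]) (simp flip: R.hclass_eq_iff C.hclass_eq_iff)
next
  assume "\<exists>y. H x y \<and> V y x'"
  then obtain y where y: "H x y" "V y x'" by blast
  then show "bihomotopic K 1 1 x x'"
    using H_in[OF y(1)] V_in[OF y(2)] unfolding bihomotopic_def hcls_def vcls_def
    by (intro conjI bexI[of _ y]) (simp_all add: R.hclass_eq_iff C.hclass_eq_iff)
qed

lemma bihomotopic_H: "H x y \<Longrightarrow> bihomotopic K 1 1 x y"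
  using bihomotopic_iff C.homotopic_refl H_in by blast

lemma bihomotopic_V: "V x y \<Longrightarrow> bihomotopic K 1 1 x y"
  using bihomotopic_iff R.homotopic_refl V_in by blast

lemma bihomotopic_refl: "x \<in> bisimps K 1 1 \<Longrightarrow> bihomotopic K 1 1 x x"
  using bihomotopic_H R.homotopic_refl by blast

text \<open>Reading the two homotopies backwards gives them in the wrong order, which
  \<open>VH_commute\<close> repairs.\<close>

lemma bihomotopic_sym: "bihomotopic K 1 1 x y \<Longrightarrow> bihomotopic K 1 1 y x"
  unfolding bihomotopic_iff by (meson VH_commute R.homotopic_sym C.homotopic_sym)

lemma bihomotopic_trans:
  assumes "bihomotopic K 1 1 x y" "bihomotopic K 1 1 y z" shows "bihomotopic K 1 1 x z"
proof -
  obtain a b where "H x a" "V a y" "H y b" "V b z" using assms bihomotopic_iff by blast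
  moreover obtain c where "H a c" "V c b" using VH_commute calculation by blast
  ultimately show ?thesis unfolding bihomotopic_iff using R.homotopic_trans C.homotopic_trans by blast
qed

lemma bicls_eq_iff:
  assumes "x \<in> bisimps K 1 1" shows "bicls K 1 1 x = bicls K 1 1 y \<longleftrightarrow> bihomotopic K 1 1 x y"
proof
  assume *: "bicls K 1 1 x = bicls K 1 1 y"
  have "x \<in> bicls K 1 1 x" using bihomotopic_refl[OF assms] by (simp add: bicls_def)
  then have "bihomotopic K 1 1 y x" unfolding * by (simp add: bicls_def)
  then show "bihomotopic K 1 1 x y" by (rule bihomotopic_sym)
next
  assume "bihomotopic K 1 1 x y"
  then show "bicls K 1 1 x = bicls K 1 1 y"
    unfolding bicls_def using bihomotopic_sym bihomotopic_trans by blast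
qed

text \<open>In the transpose the vertical homotopy comes first; symmetry of bihomotopy restores the
  order. Hence \<open>tr K\<close> has literally the same classes of squares as
  \<open>K\<close>.\<close>

lemma bihomotopic_tr: "bihomotopic (tr K) 1 1 = bihomotopic K 1 1"
proof (intro ext)
  interpret T: bikan "tr K" by (rule bikan_tr)
  fix x y
  have "bihomotopic (tr K) 1 1 x y \<longleftrightarrow> (\<exists>z. V x z \<and> H z y)" using T.bihomotopic_iff by simp
  also have "\<dots> \<longleftrightarrow> bihomotopic K 1 1 x y"
  proof
    assume "\<exists>z. V x z \<and> H z y"
    then show "bihomotopic K 1 1 x y" using bihomotopic_trans bihomotopic_H bihomotopic_V by blast
  next
    assume "bihomotopic K 1 1 x y"
    then have "bihomotopic K 1 1 y x" by (rule bihomotopic_sym)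
    then show "\<exists>z. V x z \<and> H z y" unfolding bihomotopic_iff using R.homotopic_sym C.homotopic_sym by blast
  qed
  finally show "bihomotopic (tr K) 1 1 x y = bihomotopic K 1 1 x y" .
qed

lemma classes_tr [simp]: "bicls (tr K) 1 1 = bicls K 1 1" "hcls (tr K) p q = vcls K q p" "vcls (tr K) p q = hcls K q p"
  by (simp_all add: fun_eq_iff bicls_def bihomotopic_tr hcls_def vcls_def)

lemma sq_hcat_tr: "sq_hcat (tr K) = sq_vcat K"
  unfolding sq_hcat_def sq_vcat_def by (simp cong: if_cong)

lemma vcls_eq_iff: "u \<in> bisimps K 0 1 \<Longrightarrow> vcls K 0 1 u = vcls K 0 1 u' \<longleftrightarrow> homotopic (vcol K 0) 1 u u'"
  unfolding vcls_def by (rule C.hclass_eq_iff)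

lemma bicls_hface:
  assumes "x \<in> bisimps K 1 1" "bicls K 1 1 x = bicls K 1 1 y" "i \<le> 1"
  shows "vcls K 0 1 (hface K 1 1 i x) = vcls K 0 1 (hface K 1 1 i y)"
proof -
  obtain z where z: "H x z" "V z y" using assms bicls_eq_iff bihomotopic_iff by blast
  have "hface K 1 1 i x = hface K 1 1 i z" by (rule R.homotopic_face[OF z(1) assms(3)])
  moreover have "homotopic (vcol K 0) 1 (hface K 1 1 i z) (hface K 1 1 i y)" by (rule V_hface[OF z(2) assms(3)])
  ultimately show ?thesis using vcls_eq_iff[OF R.d_in(1)[OF assms(1,3)]] by simp
qed

section \<open>The horizontal category of squares\<close>

lemma V_hdegen:
  assumes "homotopic (vcol K 0) 1 u w" shows "V (hdegen K 0 1 0 u) (hdegen K 0 1 0 w)"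
proof -
  obtain t where t: "t \<in> bisimps K 0 2" "vface K 0 2 0 t = vdegen K 0 0 0 (vface K 0 1 0 u)"
    "vface K 0 2 1 t = u" "vface K 0 2 2 t = w" "u \<in> bisimps K 0 1"
    using assms by (rule C.homotopicE) blast
  show ?thesis using C.homotopicI[of "hdegen K 0 2 0 t" 1 "hdegen K 0 0 0 (vface K 0 1 0 u)"] t
    by (simp add: vdegen_hdegen_0)
qed

lemma Obj_sqh [simp]: "Obj (sq_hcat K) = vcls K 0 1 ` bisimps K 0 1"
  and Arr_sqh [simp]: "Arr (sq_hcat K) = bicls K 1 1 ` bisimps K 1 1"
  by (simp_all add: sq_hcat_def Let_def)

lemma Dom_sqh: assumes "x \<in> bisimps K 1 1"
  shows "Dom (sq_hcat K) (bicls K 1 1 x) = vcls K 0 1 (hface K 1 1 0 x)"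
proof -
  have "(THE u. \<exists>x'\<in>bisimps K 1 1. bicls K 1 1 x = bicls K 1 1 x' \<and> u = vcls K 0 1 (hface K 1 1 0 x')) =
      vcls K 0 1 (hface K 1 1 0 x)"
    using bicls_hface[OF assms, of _ 0]
    by (intro the_class_image[where h = "bicls K 1 1" and g = "\<lambda>x. vcls K 0 1 (hface K 1 1 0 x)"] assms) simp
  then show ?thesis using assms by (simp add: sq_hcat_def Let_def)
qed

lemma Cod_sqh: assumes "x \<in> bisimps K 1 1"
  shows "Cod (sq_hcat K) (bicls K 1 1 x) = vcls K 0 1 (hface K 1 1 1 x)"
proof -
  have "(THE u. \<exists>x'\<in>bisimps K 1 1. bicls K 1 1 x = bicls K 1 1 x' \<and> u = vcls K 0 1 (hface K 1 1 1 x')) =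
      vcls K 0 1 (hface K 1 1 1 x)"
    using bicls_hface[OF assms, of _ 1]
    by (intro the_class_image[where h = "bicls K 1 1" and g = "\<lambda>x. vcls K 0 1 (hface K 1 1 1 x)"] assms) simp
  then show ?thesis using assms by (simp add: sq_hcat_def Let_def)
qed

lemma Idn_sqh: assumes "u \<in> bisimps K 0 1"
  shows "Idn (sq_hcat K) (vcls K 0 1 u) = bicls K 1 1 (hdegen K 0 1 0 u)"
proof -
  have "bicls K 1 1 (hdegen K 0 1 0 u) = bicls K 1 1 (hdegen K 0 1 0 w)" if "vcls K 0 1 u = vcls K 0 1 w" for w
    using that assms by (simp add: vcls_eq_iff bicls_eq_iff V_hdegen bihomotopic_V)
  then have "(THE Z. \<exists>w\<in>bisimps K 0 1. vcls K 0 1 u = vcls K 0 1 w \<and> Z = bicls K 1 1 (hdegen K 0 1 0 w)) =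
      bicls K 1 1 (hdegen K 0 1 0 u)"
    by (intro the_class_image[where h = "vcls K 0 1" and g = "\<lambda>u. bicls K 1 1 (hdegen K 0 1 0 u)"] assms)
  then show ?thesis using assms by (simp add: sq_hcat_def Let_def)
qed

text \<open>As \<open>\<pi>\<^sub>2\<close> of the column vanishes, the two vertical homotopies can be made to agree on the common edge.\<close>

lemma sq_comp_unique:
  assumes c: "c \<in> bisimps K 2 1" and c': "c' \<in> bisimps K 2 1"
    and e: "bihomotopic K 1 1 (hface K 2 1 2 c) (hface K 2 1 2 c')"
      "bihomotopic K 1 1 (hface K 2 1 0 c) (hface K 2 1 0 c')"
  shows "bihomotopic K 1 1 (hface K 2 1 1 c) (hface K 2 1 1 c')"
proof -
  obtain a b where a: "H (hface K 2 1 2 c) a" "V a (hface K 2 1 2 c')"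
    and b: "H (hface K 2 1 0 c) b" "V b (hface K 2 1 0 c')" using e bihomotopic_iff by blast
  \<comment> \<open>The horizontal parts of the bihomotopies are absorbed into the simplex:
    \<open>c2\<close> has outer squares \<open>a\<close> and \<open>b\<close> and still the
    composite \<open>hface K 2 1 1 c\<close>. What remains are the vertical homotopies
    \<open>\<beta>\<close> and \<open>\<beta>'\<close>.\<close>
  obtain c1 where c1: "c1 \<in> bisimps K 2 1" "hface K 2 1 2 c1 = a" "hface K 2 1 0 c1 = hface K 2 1 0 c"
    "hface K 2 1 1 c1 = hface K 2 1 1 c" by (rule R.comp_replace_left[OF c a(1)])
  have "H (hface K 2 1 0 c1) b" using b c1 by simp
  then obtain c2 where c2: "c2 \<in> bisimps K 2 1" "hface K 2 1 0 c2 = b" "hface K 2 1 2 c2 = hface K 2 1 2 c1"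
    "hface K 2 1 1 c2 = hface K 2 1 1 c1" by (rule R.comp_replace_right[OF c1(1)])
  note c2 = c2(1,2) c2(3,4)[unfolded c1]
  obtain \<beta> where \<beta>: "\<beta> \<in> bisimps K 1 2" "vface K 1 2 0 \<beta> = vdegen K 1 0 0 (vface K 1 1 0 a)"
    "vface K 1 2 1 \<beta> = a" "vface K 1 2 2 \<beta> = hface K 2 1 2 c'" "a \<in> bisimps K 1 1" using a(2) by (rule C.homotopicE) blast
  obtain \<beta>' where \<beta>': "\<beta>' \<in> bisimps K 1 2" "vface K 1 2 0 \<beta>' = vdegen K 1 0 0 (vface K 1 1 0 b)"
    "vface K 1 2 1 \<beta>' = b" "vface K 1 2 2 \<beta>' = hface K 2 1 0 c'" "b \<in> bisimps K 1 1" using b(2) by (rule C.homotopicE) blast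
  have ab: "hface K 1 1 0 a = hface K 1 1 1 b" using R.dd(2)[OF c2(1)] c2 by simp
  obtain y where y: "y \<in> bisimps K 0 3" "vface K 0 3 0 y = vdegen K 0 1 1 (vdegen K 0 0 0 (vface K 0 1 0 (hface K 1 1 0 a)))"
    "vface K 0 3 1 y = vdegen K 0 1 1 (vface K 0 2 1 (hface K 1 2 0 \<beta>))" "vface K 0 3 2 y = hface K 1 2 0 \<beta>"
    "vface K 0 3 3 y = hface K 1 2 1 \<beta>'"
    by (rule C.homotopies_homotopic[of 0 "vface K 0 1 0 (hface K 1 1 0 a)" "hface K 1 2 0 \<beta>" "hface K 1 2 1 \<beta>'"])
      (use pi2v \<beta> \<beta>' ab c' in \<open>simp_all add: vh\<close>, (use ab in \<open>simp add: vh flip: vh\<close>)?)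
  \<comment> \<open>Lifting \<open>y\<close> to a (1,3)-bisimplex replaces \<open>\<beta>\<close> by
    \<open>\<beta>2\<close>, a homotopy between the same squares whose face on the common edge is
    exactly that of \<open>\<beta>'\<close>.\<close>
  obtain z where z: "z \<in> bisimps K 1 3" "hface K 1 3 0 z = y" "vface K 1 3 0 z = vdegen K 1 1 1 (vface K 1 2 0 \<beta>)"
    "vface K 1 3 1 z = vdegen K 1 1 1 (vface K 1 2 1 \<beta>)" "vface K 1 3 2 z = \<beta>"
    by (rule fill13_13[of y "vdegen K 1 1 1 (vface K 1 2 0 \<beta>)" "vdegen K 1 1 1 (vface K 1 2 1 \<beta>)" \<beta>])
      (use \<beta> y in \<open>simp_all add: vh\<close>)
  define \<beta>2 where "\<beta>2 = vface K 1 3 3 z"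
  have \<beta>2: "\<beta>2 \<in> bisimps K 1 2" "vface K 1 2 0 \<beta>2 = vface K 1 2 0 \<beta>" "vface K 1 2 1 \<beta>2 = a"
    "vface K 1 2 2 \<beta>2 = hface K 2 1 2 c'" "hface K 1 2 0 \<beta>2 = hface K 1 2 1 \<beta>'"
    using z \<beta> y vh(5)[OF z(1), symmetric] by (simp_all add: \<beta>2_def)
  \<comment> \<open>Now \<open>\<beta>'\<close> and \<open>\<beta>2\<close> fit together as
    horizontal faces. The omitted horizontal face of \<open>G\<close> is a vertical homotopy from
    the composite along \<open>c2\<close> to the one along \<open>c3\<close>, and \<open>c3\<close>
    has the same outer squares as \<open>c'\<close>.\<close>
  obtain G where G: "G \<in> bisimps K 2 2" "hface K 2 2 0 G = \<beta>'" "hface K 2 2 2 G = \<beta>2"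
    "vface K 2 2 0 G = vdegen K 2 0 0 (vface K 2 1 0 c2)" "vface K 2 2 1 G = c2"
    by (rule fill22_12[of \<beta>' \<beta>2 "vdegen K 2 0 0 (vface K 2 1 0 c2)" c2])
      (use \<beta> \<beta>' \<beta>2 c2 c' in \<open>simp_all add: vh vh(3)[OF c2(1), symmetric]\<close>)
  define c3 where "c3 = vface K 2 2 2 G"
  have c3: "c3 \<in> bisimps K 2 1" "hface K 2 1 0 c3 = hface K 2 1 0 c'" "hface K 2 1 2 c3 = hface K 2 1 2 c'"
    using G \<beta>' \<beta>2 vh(4)[OF G(1), symmetric] by (simp_all add: c3_def)
  have "H (hface K 2 1 1 c3) (hface K 2 1 1 c')" by (rule R.comp_unique_strict[OF c3(1) c']) (use c3 in simp_all)
  moreover have "V (hface K 2 1 1 c) (hface K 2 1 1 c3)"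
    using C.homotopicI[of "hface K 2 2 1 G" 1 "hface K 2 0 1 (vface K 2 1 0 c2)"] G c2
    by (simp add: vh(4) c3_def)
  ultimately show ?thesis using bihomotopic_trans bihomotopic_H bihomotopic_V by blast
qed

text \<open>A vertical homotopy moves the representative of the first class until it meets
  \<open>y\<close> strictly. Its two horizontal edges stay fixed, which later allows adjustments in
  both directions one after the other.\<close>

lemma sq_compI:
  assumes "x \<in> bisimps K 1 1" "y \<in> bisimps K 1 1" "vcls K 0 1 (hface K 1 1 0 x) = vcls K 0 1 (hface K 1 1 1 y)"
  obtains x' where "x' \<in> bisimps K 1 1" "bicls K 1 1 x' = bicls K 1 1 x" "hface K 1 1 0 x' = hface K 1 1 1 y"
    "vface K 1 1 0 x' = vface K 1 1 0 x" "vface K 1 1 1 x' = vface K 1 1 1 x"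
proof -
  have "homotopic (vcol K 0) 1 (hface K 1 1 0 x) (hface K 1 1 1 y)" using assms by (simp add: vcls_eq_iff)
  then obtain x' where x': "V x x'" "hface K 1 1 0 x' = hface K 1 1 1 y" using V_lift[OF assms(1)] by blast
  have "bihomotopic K 1 1 x x'" by (rule bihomotopic_V[OF x'(1)])
  then have "bicls K 1 1 x' = bicls K 1 1 x" using bicls_eq_iff[OF assms(1), of x'] by simp
  then show thesis using that[of x'] x' V_in[OF x'(1)] C.homotopic_face[OF x'(1), of 0] C.homotopic_face[OF x'(1), of 1]
    by simp
qed

lemma groupoid_sqh: "groupoid (sq_hcat K)" (is ?A)
  and ext_catg_sqh: "ext_catg (sq_hcat K)" (is ?B)
  and Cmp_sqh: "c \<in> bisimps K 2 1 \<Longrightarrow> Cmp (sq_hcat K) (bicls K 1 1 (hface K 2 1 2 c)) (bicls K 1 1 (hface K 2 1 0 c)) =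
      bicls K 1 1 (hface K 2 1 1 c)" (is "PROP ?C")
proof -
  define T where "T = (\<lambda>X Y Z. \<exists>c\<in>bisimps K 2 1. X = bicls K 1 1 (hface K 2 1 2 c) \<and>
    Y = bicls K 1 1 (hface K 2 1 0 c) \<and> Z = bicls K 1 1 (hface K 2 1 1 c))"
  let ?A1 = "bicls K 1 1 ` bisimps K 1 1" and ?F = "sq_hcat K"
  have TI: "T (bicls K 1 1 (hface K 2 1 2 c)) (bicls K 1 1 (hface K 2 1 0 c)) (bicls K 1 1 (hface K 2 1 1 c))"
    if "c \<in> bisimps K 2 1" for c using that unfolding T_def by blast
  \<comment> \<open>The definition varies one factor by a vertical homotopy; since vertical
    homotopies are bihomotopies, this is the same relation as prescribing the classes of the two
    outer faces of a simplex.\<close>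
  have T_eq: "(\<lambda>Z. \<exists>x\<in>bisimps K 1 1. \<exists>y\<in>bisimps K 1 1. \<exists>x'\<in>bisimps K 1 1. \<exists>c\<in>bisimps K 2 1.
                  X = bicls K 1 1 x \<and> Y = bicls K 1 1 y \<and>
                  vcls K 1 1 x' = vcls K 1 1 x \<and> hface K 1 1 0 x' = hface K 1 1 1 y \<and>
                  hface K 2 1 2 c = x' \<and> hface K 2 1 0 c = y \<and>
                  Z = bicls K 1 1 (hface K 2 1 1 c)) = T X Y" for X Y
  proof (intro ext iffI)
    fix Z assume "\<exists>x\<in>bisimps K 1 1. \<exists>y\<in>bisimps K 1 1. \<exists>x'\<in>bisimps K 1 1. \<exists>c\<in>bisimps K 2 1.
                  X = bicls K 1 1 x \<and> Y = bicls K 1 1 y \<and>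
                  vcls K 1 1 x' = vcls K 1 1 x \<and> hface K 1 1 0 x' = hface K 1 1 1 y \<and>
                  hface K 2 1 2 c = x' \<and> hface K 2 1 0 c = y \<and>
                  Z = bicls K 1 1 (hface K 2 1 1 c)"
    then obtain x y x' c where *: "x' \<in> bisimps K 1 1" "c \<in> bisimps K 2 1" "X = bicls K 1 1 x"
      "Y = bicls K 1 1 y" "vcls K 1 1 x' = vcls K 1 1 x" "hface K 2 1 2 c = x'" "hface K 2 1 0 c = y"
      "Z = bicls K 1 1 (hface K 2 1 1 c)" by blast
    have "V x' x" using *(5) unfolding vcls_def C.hclass_eq_iff[OF *(1)] .
    then have "bicls K 1 1 x' = bicls K 1 1 x" unfolding bicls_eq_iff[OF *(1)] by (rule bihomotopic_V)
    then show "T X Y Z" using TI[OF *(2)] * by simp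
  next
    fix Z assume "T X Y Z"
    then obtain c where c: "c \<in> bisimps K 2 1" "X = bicls K 1 1 (hface K 2 1 2 c)"
      "Y = bicls K 1 1 (hface K 2 1 0 c)" "Z = bicls K 1 1 (hface K 2 1 1 c)" unfolding T_def by blast
    show "\<exists>x\<in>bisimps K 1 1. \<exists>y\<in>bisimps K 1 1. \<exists>x'\<in>bisimps K 1 1. \<exists>c\<in>bisimps K 2 1.
                  X = bicls K 1 1 x \<and> Y = bicls K 1 1 y \<and>
                  vcls K 1 1 x' = vcls K 1 1 x \<and> hface K 1 1 0 x' = hface K 1 1 1 y \<and>
                  hface K 2 1 2 c = x' \<and> hface K 2 1 0 c = y \<and>
                  Z = bicls K 1 1 (hface K 2 1 1 c)"
      by (rule bexI[of _ "hface K 2 1 2 c"], rule bexI[of _ "hface K 2 1 0 c"],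
          rule bexI[of _ "hface K 2 1 2 c"], rule bexI[of _ c]) (use c in simp_all)
  qed
  have C: "?F = \<lparr>Obj = vcls K 0 1 ` bisimps K 0 1, Arr = ?A1, Dom = Dom ?F, Cod = Cod ?F, Idn = Idn ?F,
      Cmp = (\<lambda>X Y. if X \<in> ?A1 \<and> Y \<in> ?A1 \<and> Dom ?F X = Cod ?F Y then THE Z. T X Y Z else undefined)\<rparr>"
    unfolding T_eq[symmetric] by (simp add: sq_hcat_def Let_def)
  have "?A \<and> ?B \<and> (\<forall>X Y Z. T X Y Z \<longrightarrow> Cmp ?F X Y = Z)"
  proof (rule rel_groupoid[OF C])
    show "Dom ?F \<in> extensional ?A1" "Cod ?F \<in> extensional ?A1"
      "Idn ?F \<in> extensional (vcls K 0 1 ` bisimps K 0 1)" by (simp_all add: sq_hcat_def Let_def)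
    show "Dom ?F X \<in> vcls K 0 1 ` bisimps K 0 1 \<and> Cod ?F X \<in> vcls K 0 1 ` bisimps K 0 1" if asm: "X \<in> ?A1" for X
      using asm by (auto simp: Dom_sqh Cod_sqh)
    show "Idn ?F a \<in> ?A1 \<and> Dom ?F (Idn ?F a) = a \<and> Cod ?F (Idn ?F a) = a"
      if asm: "a \<in> vcls K 0 1 ` bisimps K 0 1" for a using asm by (auto simp: Dom_sqh Cod_sqh Idn_sqh)
    show "X \<in> ?A1 \<and> Y \<in> ?A1 \<and> Z \<in> ?A1 \<and>
        Dom ?F X = Cod ?F Y \<and> Dom ?F Z = Dom ?F Y \<and> Cod ?F Z = Cod ?F X" if asm: "T X Y Z" for X Y Z
      using asm unfolding T_def by (auto simp: Dom_sqh Cod_sqh)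
    show "\<exists>Z. T X Y Z" if asm: "X \<in> ?A1" "Y \<in> ?A1" "Dom ?F X = Cod ?F Y" for X Y
    proof -
      obtain x y where xy: "x \<in> bisimps K 1 1" "X = bicls K 1 1 x" "y \<in> bisimps K 1 1" "Y = bicls K 1 1 y"
        using asm(1,2) by blast
      then have "vcls K 0 1 (hface K 1 1 0 x) = vcls K 0 1 (hface K 1 1 1 y)" using asm by (simp add: Dom_sqh Cod_sqh)
      from sq_compI[OF xy(1,3) this] obtain x' where x': "x' \<in> bisimps K 1 1" "bicls K 1 1 x' = bicls K 1 1 x"
        "hface K 1 1 0 x' = hface K 1 1 1 y" by blast
      obtain c where "c \<in> bisimps K 2 1" "hface K 2 1 0 c = y" "hface K 2 1 2 c = x'"
        by (rule R.fill2_1[OF xy(3) x'(1,3)])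
      then show ?thesis using TI[of c] xy x' by auto
    qed
    show "Z = Z'" if TZ: "T X Y Z" "T X Y Z'" for X Y Z Z'
    proof -
      obtain c c' where c: "c \<in> bisimps K 2 1" "X = bicls K 1 1 (hface K 2 1 2 c)" "Y = bicls K 1 1 (hface K 2 1 0 c)"
          "Z = bicls K 1 1 (hface K 2 1 1 c)"
        and c': "c' \<in> bisimps K 2 1" "X = bicls K 1 1 (hface K 2 1 2 c')" "Y = bicls K 1 1 (hface K 2 1 0 c')"
          "Z' = bicls K 1 1 (hface K 2 1 1 c')"
        using TZ unfolding T_def by blast
      have "bihomotopic K 1 1 (hface K 2 1 2 c) (hface K 2 1 2 c')" "bihomotopic K 1 1 (hface K 2 1 0 c) (hface K 2 1 0 c')"
        using c c' by (simp_all flip: bicls_eq_iff)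
      from sq_comp_unique[OF c(1) c'(1) this] show ?thesis using c c' by (simp flip: bicls_eq_iff)
    qed
    show "T X (Idn ?F (Dom ?F X)) X \<and> T (Idn ?F (Cod ?F X)) X X" if asm: "X \<in> ?A1" for X
    proof -
      obtain x where x: "x \<in> bisimps K 1 1" "X = bicls K 1 1 x" using asm by blast
      show ?thesis using TI[of "hdegen K 1 1 1 x"] TI[of "hdegen K 1 1 0 x"] x
        by (simp add: Dom_sqh Cod_sqh Idn_sqh)
    qed
    show "\<exists>P Q R. T X Y P \<and> T Y Z Q \<and> T P Z R \<and> T X Q R" if asm: "X \<in> ?A1" "Y \<in> ?A1" "Z \<in> ?A1"
      "Dom ?F X = Cod ?F Y" "Dom ?F Y = Cod ?F Z" for X Y Z
    proof -
      obtain x y z where xy: "x \<in> bisimps K 1 1" "X = bicls K 1 1 x" "y \<in> bisimps K 1 1" "Y = bicls K 1 1 y"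
        "z \<in> bisimps K 1 1" "Z = bicls K 1 1 z" using asm(1-3) by blast
      \<comment> \<open>The order of adjustment matters: moving \<open>y\<close> onto
        \<open>z\<close> may change the target edge of \<open>y\<close>, so \<open>x\<close> is
        moved afterwards, onto the new square \<open>y'\<close>.\<close>
      have "vcls K 0 1 (hface K 1 1 0 y) = vcls K 0 1 (hface K 1 1 1 z)" using asm xy by (simp add: Dom_sqh Cod_sqh)
      from sq_compI[OF xy(3,5) this] obtain y' where y': "y' \<in> bisimps K 1 1" "bicls K 1 1 y' = bicls K 1 1 y"
        "hface K 1 1 0 y' = hface K 1 1 1 z" by blast
      have "vcls K 0 1 (hface K 1 1 0 x) = vcls K 0 1 (hface K 1 1 1 y)" using asm xy by (simp add: Dom_sqh Cod_sqh)
      then have "vcls K 0 1 (hface K 1 1 0 x) = vcls K 0 1 (hface K 1 1 1 y')"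
        using bicls_hface[OF y'(1,2), of 1] by simp
      from sq_compI[OF xy(1) y'(1) this] obtain x' where x': "x' \<in> bisimps K 1 1" "bicls K 1 1 x' = bicls K 1 1 x"
        "hface K 1 1 0 x' = hface K 1 1 1 y'" by blast
      obtain w where w: "w \<in> bisimps K 3 1" "hface K 2 1 2 (hface K 3 1 3 w) = x'" "hface K 2 1 0 (hface K 3 1 3 w) = y'"
        "hface K 2 1 0 (hface K 3 1 0 w) = z" by (rule R.assoc_filler[OF x'(1) y'(1) xy(5) x'(3) y'(3)])
      have "T X Y (bicls K 1 1 (hface K 2 1 1 (hface K 3 1 3 w)))"
        using TI[of "hface K 3 1 3 w"] w xy x' y' by simp
      moreover have "T Y Z (bicls K 1 1 (hface K 2 1 1 (hface K 3 1 0 w)))"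
        using TI[of "hface K 3 1 0 w"] w xy x' y' by simp
      moreover have "T (bicls K 1 1 (hface K 2 1 1 (hface K 3 1 3 w))) Z (bicls K 1 1 (hface K 2 1 1 (hface K 3 1 1 w)))"
        using TI[of "hface K 3 1 1 w"] w xy by simp
      moreover have "T X (bicls K 1 1 (hface K 2 1 1 (hface K 3 1 0 w))) (bicls K 1 1 (hface K 2 1 1 (hface K 3 1 1 w)))"
        using TI[of "hface K 3 1 2 w"] w xy x' y' by simp
      ultimately show ?thesis by blast
    qed
    show "\<exists>Y. T X Y (Idn ?F (Cod ?F X))" if asm: "X \<in> ?A1" for X
    proof -
      obtain x where x: "x \<in> bisimps K 1 1" "X = bicls K 1 1 x" using asm by blast
      obtain c where "c \<in> bisimps K 2 1" "hface K 2 1 1 c = hdegen K 0 1 0 (hface K 1 1 1 x)" "hface K 2 1 2 c = x"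
        by (rule R.fill2_0[of "hdegen K 0 1 0 (hface K 1 1 1 x)" 1 x]) (use x in auto)
      then show ?thesis using TI[of c] x by (auto simp: Cod_sqh Idn_sqh)
    qed
  qed
  then show ?A ?B "PROP ?C" using TI by auto
qed

lemma sqh_composable:
  assumes "X \<in> Arr (sq_hcat K)" "Y \<in> Arr (sq_hcat K)" "Dom (sq_hcat K) X = Cod (sq_hcat K) Y"
  obtains c where "c \<in> bisimps K 2 1" "X = bicls K 1 1 (hface K 2 1 2 c)" "Y = bicls K 1 1 (hface K 2 1 0 c)"
    "Cmp (sq_hcat K) X Y = bicls K 1 1 (hface K 2 1 1 c)"
proof -
  obtain x y where xy: "x \<in> bisimps K 1 1" "X = bicls K 1 1 x" "y \<in> bisimps K 1 1" "Y = bicls K 1 1 y"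
    using assms(1,2) by auto
  then have "vcls K 0 1 (hface K 1 1 0 x) = vcls K 0 1 (hface K 1 1 1 y)" using assms by (simp add: Dom_sqh Cod_sqh)
  from sq_compI[OF xy(1,3) this] obtain x' where x': "x' \<in> bisimps K 1 1" "bicls K 1 1 x' = bicls K 1 1 x"
    "hface K 1 1 0 x' = hface K 1 1 1 y" by blast
  obtain c where "c \<in> bisimps K 2 1" "hface K 2 1 0 c = y" "hface K 2 1 2 c = x'"
    by (rule R.fill2_1[OF xy(3) x'(1,3)])
  then show thesis using that[of c] Cmp_sqh[of c] xy x' by simp
qed

lemma fund_composable:
  assumes "X \<in> Arr (fund_groupoid (hrow K 0))" "Y \<in> Arr (fund_groupoid (hrow K 0))"
    "Dom (fund_groupoid (hrow K 0)) X = Cod (fund_groupoid (hrow K 0)) Y"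
  obtains c where "c \<in> bisimps K 2 0" "X = hcls K 1 0 (hface K 2 0 2 c)" "Y = hcls K 1 0 (hface K 2 0 0 c)"
    "Cmp (fund_groupoid (hrow K 0)) X Y = hcls K 1 0 (hface K 2 0 1 c)"
proof -
  obtain x y where xy: "x \<in> bisimps K 1 0" "X = hcls K 1 0 x" "y \<in> bisimps K 1 0" "Y = hcls K 1 0 y"
    using assms(1,2) by (auto simp: hcls_def)
  then have e: "hface K 1 0 0 x = hface K 1 0 1 y"
    using assms by (simp add: R.Dom_fund R.Cod_fund hcls_def)
  obtain c where "c \<in> bisimps K 2 0" "hface K 2 0 0 c = y" "hface K 2 0 2 c = x"
    by (rule R.fill2_1[OF xy(3,1) e])
  then show thesis using that[of c] R.Cmp_fund[of c 0] xy by (simp add: hcls_def)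
qed

end

lemma HC_PGpd [simp]: "HC (PGpd K) = fund_groupoid (hrow K 0)" and VC_PGpd [simp]: "VC (PGpd K) = fund_groupoid (vcol K 0)"
  and SH_PGpd [simp]: "SH (PGpd K) = sq_hcat K" and SV_PGpd [simp]: "SV (PGpd K) = sq_vcat K"
  by (simp_all add: PGpd_def)

lemma tr_tr [simp]: "tr (tr K) = K"
  by (cases K) (simp add: tr_def)

section \<open>The double groupoid structure on \<open>PGpd K\<close>\<close>

context bikan begin

lemma Obj_H [simp]: "Obj (fund_groupoid (hrow K 0)) = bisimps K 0 0"
  and Arr_H [simp]: "Arr (fund_groupoid (hrow K 0)) = hcls K 1 0 ` bisimps K 1 0"
  and Dom_H [simp]: "x \<in> bisimps K 1 0 \<Longrightarrow> Dom (fund_groupoid (hrow K 0)) (hcls K 1 0 x) = hface K 1 0 0 x"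
  and Cod_H [simp]: "x \<in> bisimps K 1 0 \<Longrightarrow> Cod (fund_groupoid (hrow K 0)) (hcls K 1 0 x) = hface K 1 0 1 x"
  and Idn_H [simp]: "a \<in> bisimps K 0 0 \<Longrightarrow> Idn (fund_groupoid (hrow K 0)) a = hcls K 1 0 (hdegen K 0 0 0 a)"
  and Cmp_H: "c \<in> bisimps K 2 0 \<Longrightarrow> Cmp (fund_groupoid (hrow K 0)) (hcls K 1 0 (hface K 2 0 2 c))
      (hcls K 1 0 (hface K 2 0 0 c)) = hcls K 1 0 (hface K 2 0 1 c)"
  and groupoid_H: "groupoid (fund_groupoid (hrow K 0))" and ext_catg_H: "ext_catg (fund_groupoid (hrow K 0))"
  by (simp_all add: hcls_def[abs_def] R.Obj_fund R.Arr_fund R.Dom_fund R.Cod_fund R.Idn_fund R.Cmp_fund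
      R.groupoid_fund R.ext_catg_fund)

declare R.Arr_fund [simp del] C.Arr_fund [simp del]

text \<open>The equation \<open>sq_hcat_tr\<close> turns the horizontal category of squares of
  \<open>tr K\<close> into the vertical one of \<open>K\<close>; simplification translates faces,
  degeneracies and classes back.\<close>

lemmas Obj_V [simp] = bikan.Obj_H[OF bikan_tr, simplified]
  and Arr_V [simp] = bikan.Arr_H[OF bikan_tr, simplified]
  and Dom_V [simp] = bikan.Dom_H[OF bikan_tr, simplified]
  and Cod_V [simp] = bikan.Cod_H[OF bikan_tr, simplified]
  and Idn_V [simp] = bikan.Idn_H[OF bikan_tr, simplified]
  and Cmp_V = bikan.Cmp_H[OF bikan_tr, simplified]
  and groupoid_V = bikan.groupoid_H[OF bikan_tr, simplified]
  and ext_catg_V = bikan.ext_catg_H[OF bikan_tr, simplified]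
  and fund_composable_V = bikan.fund_composable[OF bikan_tr, simplified]
  and Obj_sqv [simp] = bikan.Obj_sqh[OF bikan_tr, unfolded sq_hcat_tr, simplified]
  and Arr_sqv [simp] = bikan.Arr_sqh[OF bikan_tr, unfolded sq_hcat_tr, simplified]
  and Dom_sqv = bikan.Dom_sqh[OF bikan_tr, unfolded sq_hcat_tr, simplified]
  and Cod_sqv = bikan.Cod_sqh[OF bikan_tr, unfolded sq_hcat_tr, simplified]
  and Idn_sqv = bikan.Idn_sqh[OF bikan_tr, unfolded sq_hcat_tr, simplified]
  and Cmp_sqv = bikan.Cmp_sqh[OF bikan_tr, unfolded sq_hcat_tr, simplified]
  and groupoid_sqv = bikan.groupoid_sqh[OF bikan_tr, unfolded sq_hcat_tr]
  and ext_catg_sqv = bikan.ext_catg_sqh[OF bikan_tr, unfolded sq_hcat_tr]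
  and sqv_composable = bikan.sqh_composable[OF bikan_tr, unfolded sq_hcat_tr, simplified]
  and sq_compI_V = bikan.sq_compI[OF bikan_tr, simplified]
  and fill21_11 = bikan.fill12_11[OF bikan_tr, simplified]

declare Dom_sqh [simp] Cod_sqh [simp] Idn_sqh [simp] Dom_sqv [simp] Cod_sqv [simp] Idn_sqv [simp]

text \<open>The corner \<open>w\<close> stays fixed. Then \<open>y\<close> is moved horizontally and
  \<open>z\<close> vertically to meet it, and \<open>x\<close> is moved vertically to meet
  \<open>y'\<close> and then horizontally to meet \<open>z'\<close>; each move keeps the edges
  already matched. The four squares then fit strictly into a (2,2)-bihorn.\<close>

lemma interchange_filler:
  assumes x: "x \<in> bisimps K 1 1" and y: "y \<in> bisimps K 1 1" and z: "z \<in> bisimps K 1 1" and w: "w \<in> bisimps K 1 1"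
    and xy: "vcls K 0 1 (hface K 1 1 0 x) = vcls K 0 1 (hface K 1 1 1 y)"
    and zw: "vcls K 0 1 (hface K 1 1 0 z) = vcls K 0 1 (hface K 1 1 1 w)"
    and xz: "hcls K 1 0 (vface K 1 1 0 x) = hcls K 1 0 (vface K 1 1 1 z)"
    and yw: "hcls K 1 0 (vface K 1 1 0 y) = hcls K 1 0 (vface K 1 1 1 w)"
  obtains G where "G \<in> bisimps K 2 2" "bicls K 1 1 x = bicls K 1 1 (vface K 1 2 2 (hface K 2 2 2 G))"
    "bicls K 1 1 y = bicls K 1 1 (vface K 1 2 2 (hface K 2 2 0 G))"
    "bicls K 1 1 z = bicls K 1 1 (vface K 1 2 0 (hface K 2 2 2 G))"
    "bicls K 1 1 w = bicls K 1 1 (vface K 1 2 0 (hface K 2 2 0 G))"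
proof -
  obtain y' where y': "y' \<in> bisimps K 1 1" "bicls K 1 1 y' = bicls K 1 1 y" "vface K 1 1 0 y' = vface K 1 1 1 w"
    "hface K 1 1 1 y' = hface K 1 1 1 y" by (rule sq_compI_V[OF y w yw])
  obtain z' where z': "z' \<in> bisimps K 1 1" "bicls K 1 1 z' = bicls K 1 1 z" "hface K 1 1 0 z' = hface K 1 1 1 w"
    "vface K 1 1 1 z' = vface K 1 1 1 z" by (rule sq_compI[OF z w zw])
  obtain x1 where x1: "x1 \<in> bisimps K 1 1" "bicls K 1 1 x1 = bicls K 1 1 x" "hface K 1 1 0 x1 = hface K 1 1 1 y'"
    "vface K 1 1 0 x1 = vface K 1 1 0 x" by (rule sq_compI[OF x y'(1)]) (use xy y' in simp)
  obtain x2 where x2: "x2 \<in> bisimps K 1 1" "bicls K 1 1 x2 = bicls K 1 1 x1" "vface K 1 1 0 x2 = vface K 1 1 1 z'"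
    "hface K 1 1 0 x2 = hface K 1 1 0 x1" by (rule sq_compI_V[OF x1(1) z'(1)]) (use xz x1 z' in simp)
  obtain c where c: "c \<in> bisimps K 1 2" "vface K 1 2 0 c = w" "vface K 1 2 2 c = y'"
    by (rule C.fill2_1[OF w y'(1,3)])
  \<comment> \<open>Filling relative to the edge \<open>hface K 1 2 1 c\<close> makes
    \<open>a\<close> and \<open>c\<close> fit along a common face; in the same way \<open>e\<close>
    is filled relative to \<open>vface K 2 1 1 d\<close>.\<close>
  obtain a where a: "a \<in> bisimps K 1 2" "hface K 1 2 0 a = hface K 1 2 1 c" "vface K 1 2 0 a = z'" "vface K 1 2 2 a = x2"
    by (rule fill12_11[of "hface K 1 2 1 c" z' x2]) (use c x2 x1 z' in \<open>simp_all add: vh\<close>)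
  obtain d where d: "d \<in> bisimps K 2 1" "hface K 2 1 0 d = w" "hface K 2 1 2 d = z'"
    by (rule R.fill2_1[OF w z'(1,3)])
  obtain e where e: "e \<in> bisimps K 2 1" "vface K 2 1 0 e = vface K 2 1 1 d" "hface K 2 1 0 e = y'" "hface K 2 1 2 e = x2"
    by (rule fill21_11[of "vface K 2 1 1 d" y' x2]) (use d x2 x1 y' in \<open>simp_all add: vh(3)[symmetric]\<close>)
  obtain G where "G \<in> bisimps K 2 2" "hface K 2 2 0 G = c" "hface K 2 2 2 G = a"
    by (rule fill22_11[of c a d e]) (use a c d e in simp_all)
  then show thesis using that[of G] a c x1 x2 y' z' by simp
qed

text \<open>Both sides are the class of the middle square
  \<open>vface K 1 2 1 (hface K 2 2 1 G)\<close>, reached by composing faces of \<open>G\<close> in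
  the two orders.\<close>

lemma interchange:
  assumes X: "X \<in> Arr (sq_hcat K)" "Y \<in> Arr (sq_hcat K)" "Z \<in> Arr (sq_hcat K)" "W \<in> Arr (sq_hcat K)"
    and "Dom (sq_hcat K) X = Cod (sq_hcat K) Y" "Dom (sq_hcat K) Z = Cod (sq_hcat K) W"
      "Dom (sq_vcat K) X = Cod (sq_vcat K) Z" "Dom (sq_vcat K) Y = Cod (sq_vcat K) W"
  shows "Cmp (sq_vcat K) (Cmp (sq_hcat K) X Y) (Cmp (sq_hcat K) Z W) =
    Cmp (sq_hcat K) (Cmp (sq_vcat K) X Z) (Cmp (sq_vcat K) Y W)"
proof -
  obtain x y z w where xyzw: "x \<in> bisimps K 1 1" "y \<in> bisimps K 1 1" "z \<in> bisimps K 1 1" "w \<in> bisimps K 1 1"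
    "X = bicls K 1 1 x" "Y = bicls K 1 1 y" "Z = bicls K 1 1 z" "W = bicls K 1 1 w" using X by auto
  obtain G where G: "G \<in> bisimps K 2 2" "bicls K 1 1 x = bicls K 1 1 (vface K 1 2 2 (hface K 2 2 2 G))"
    "bicls K 1 1 y = bicls K 1 1 (vface K 1 2 2 (hface K 2 2 0 G))"
    "bicls K 1 1 z = bicls K 1 1 (vface K 1 2 0 (hface K 2 2 2 G))"
    "bicls K 1 1 w = bicls K 1 1 (vface K 1 2 0 (hface K 2 2 0 G))"
    by (rule interchange_filler[OF xyzw(1-4)]) (use assms xyzw in simp_all)
  have h: "Cmp (sq_hcat K) (bicls K 1 1 (vface K 1 2 j (hface K 2 2 2 G))) (bicls K 1 1 (vface K 1 2 j (hface K 2 2 0 G))) =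
      bicls K 1 1 (vface K 1 2 j (hface K 2 2 1 G))" if "j \<le> 2" for j
    using Cmp_sqh[of "vface K 2 2 j G"] G(1) that by (simp add: vh(4))
  have v: "Cmp (sq_vcat K) (bicls K 1 1 (vface K 1 2 2 (hface K 2 2 i G))) (bicls K 1 1 (vface K 1 2 0 (hface K 2 2 i G))) =
      bicls K 1 1 (vface K 1 2 1 (hface K 2 2 i G))" if "i \<le> 2" for i
    using Cmp_sqv[of "hface K 2 2 i G"] G(1) that by simp
  show ?thesis unfolding xyzw G by (simp add: h v)
qed

text \<open>The vertical faces of a bisimplex that witnesses a composite of squares are 2-simplices
  that witness the composites of their edges.\<close>

lemma comp_boundary:
  assumes "X \<in> Arr (sq_hcat K)" "Y \<in> Arr (sq_hcat K)" "Dom (sq_hcat K) X = Cod (sq_hcat K) Y"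
  shows "Dom (sq_vcat K) (Cmp (sq_hcat K) X Y) = Cmp (fund_groupoid (hrow K 0)) (Dom (sq_vcat K) X) (Dom (sq_vcat K) Y) \<and>
    Cod (sq_vcat K) (Cmp (sq_hcat K) X Y) = Cmp (fund_groupoid (hrow K 0)) (Cod (sq_vcat K) X) (Cod (sq_vcat K) Y)"
proof -
  obtain c where c: "c \<in> bisimps K 2 1" "X = bicls K 1 1 (hface K 2 1 2 c)" "Y = bicls K 1 1 (hface K 2 1 0 c)"
    "Cmp (sq_hcat K) X Y = bicls K 1 1 (hface K 2 1 1 c)" by (rule sqh_composable[OF assms])
  show ?thesis using Cmp_H[of "vface K 2 1 0 c"] Cmp_H[of "vface K 2 1 1 c"] c(1) unfolding c(2-)
    by (simp add: vh(3) Cmp_sqh)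
qed

lemma comp_idn:
  assumes "f \<in> Arr (fund_groupoid (hrow K 0))" "g \<in> Arr (fund_groupoid (hrow K 0))"
    "Dom (fund_groupoid (hrow K 0)) f = Cod (fund_groupoid (hrow K 0)) g"
  shows "Idn (sq_vcat K) (Cmp (fund_groupoid (hrow K 0)) f g) = Cmp (sq_hcat K) (Idn (sq_vcat K) f) (Idn (sq_vcat K) g)"
proof -
  obtain c where c: "c \<in> bisimps K 2 0" "f = hcls K 1 0 (hface K 2 0 2 c)" "g = hcls K 1 0 (hface K 2 0 0 c)"
    "Cmp (fund_groupoid (hrow K 0)) f g = hcls K 1 0 (hface K 2 0 1 c)" by (rule fund_composable[OF assms])
  show ?thesis using Cmp_sqh[of "vdegen K 2 0 0 c"] c(1) unfolding c(2-) by (simp add: Cmp_H)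
qed

lemmas comp_boundary_V = bikan.comp_boundary[OF bikan_tr, unfolded sq_hcat_tr]
  and comp_idn_V = bikan.comp_idn[OF bikan_tr, unfolded sq_hcat_tr]

lemma sq_vcat_tr: "sq_vcat (tr K) = sq_hcat K"
  using bikan.sq_hcat_tr[OF bikan_tr] by simp

lemma double_category_PGpd: "double_category (PGpd K)"
  unfolding double_category_def
proof (intro conjI ballI impI; (elim conjE)?)
  show "category (HC (PGpd K))" "category (VC (PGpd K))" "category (SH (PGpd K))" "category (SV (PGpd K))"
    using groupoid_H groupoid_V groupoid_sqh groupoid_sqv by (simp_all add: groupoid_def)
  show "Obj (VC (PGpd K)) = Obj (HC (PGpd K))" "Obj (SH (PGpd K)) = Arr (VC (PGpd K))"
    "Obj (SV (PGpd K)) = Arr (HC (PGpd K))" "Arr (SV (PGpd K)) = Arr (SH (PGpd K))" by simp_all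
next
  fix x assume "x \<in> Arr (SH (PGpd K))"
  then show "Dom (HC (PGpd K)) (Dom (SV (PGpd K)) x) = Dom (VC (PGpd K)) (Dom (SH (PGpd K)) x)"
    "Cod (HC (PGpd K)) (Cod (SV (PGpd K)) x) = Cod (VC (PGpd K)) (Cod (SH (PGpd K)) x)"
    "Dom (HC (PGpd K)) (Cod (SV (PGpd K)) x) = Cod (VC (PGpd K)) (Dom (SH (PGpd K)) x)"
    "Dom (VC (PGpd K)) (Cod (SH (PGpd K)) x) = Cod (HC (PGpd K)) (Dom (SV (PGpd K)) x)"
    by (auto simp: vh(1))
next
  fix f assume "f \<in> Arr (HC (PGpd K))"
  then show "Dom (SH (PGpd K)) (Idn (SV (PGpd K)) f) = Idn (VC (PGpd K)) (Dom (HC (PGpd K)) f)"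
    "Cod (SH (PGpd K)) (Idn (SV (PGpd K)) f) = Idn (VC (PGpd K)) (Cod (HC (PGpd K)) f)" by auto
next
  fix u assume "u \<in> Arr (VC (PGpd K))"
  then show "Dom (SV (PGpd K)) (Idn (SH (PGpd K)) u) = Idn (HC (PGpd K)) (Dom (VC (PGpd K)) u)"
    "Cod (SV (PGpd K)) (Idn (SH (PGpd K)) u) = Idn (HC (PGpd K)) (Cod (VC (PGpd K)) u)" by auto
next
  fix a assume "a \<in> Obj (HC (PGpd K))"
  then show "Idn (SH (PGpd K)) (Idn (VC (PGpd K)) a) = Idn (SV (PGpd K)) (Idn (HC (PGpd K)) a)"
    by (simp add: vdegen_hdegen_0)
next
  fix x y assume "x \<in> Arr (SH (PGpd K))" "y \<in> Arr (SH (PGpd K))" "Dom (SH (PGpd K)) x = Cod (SH (PGpd K)) y"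
  then show "Dom (SV (PGpd K)) (Cmp (SH (PGpd K)) x y) = Cmp (HC (PGpd K)) (Dom (SV (PGpd K)) x) (Dom (SV (PGpd K)) y)"
    "Cod (SV (PGpd K)) (Cmp (SH (PGpd K)) x y) = Cmp (HC (PGpd K)) (Cod (SV (PGpd K)) x) (Cod (SV (PGpd K)) y)"
    using comp_boundary[of x y] by simp_all
next
  fix x y assume "x \<in> Arr (SH (PGpd K))" "y \<in> Arr (SH (PGpd K))" "Dom (SV (PGpd K)) x = Cod (SV (PGpd K)) y"
  then show "Dom (SH (PGpd K)) (Cmp (SV (PGpd K)) x y) = Cmp (VC (PGpd K)) (Dom (SH (PGpd K)) x) (Dom (SH (PGpd K)) y)"
    "Cod (SH (PGpd K)) (Cmp (SV (PGpd K)) x y) = Cmp (VC (PGpd K)) (Cod (SH (PGpd K)) x) (Cod (SH (PGpd K)) y)"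
    using comp_boundary_V[of x y] by (simp_all add: sq_vcat_tr)
next
  fix f g assume "f \<in> Arr (HC (PGpd K))" "g \<in> Arr (HC (PGpd K))" "Dom (HC (PGpd K)) f = Cod (HC (PGpd K)) g"
  then show "Idn (SV (PGpd K)) (Cmp (HC (PGpd K)) f g) = Cmp (SH (PGpd K)) (Idn (SV (PGpd K)) f) (Idn (SV (PGpd K)) g)"
    using comp_idn[of f g] by simp
next
  fix f g assume "f \<in> Arr (VC (PGpd K))" "g \<in> Arr (VC (PGpd K))" "Dom (VC (PGpd K)) f = Cod (VC (PGpd K)) g"
  then show "Idn (SH (PGpd K)) (Cmp (VC (PGpd K)) f g) = Cmp (SV (PGpd K)) (Idn (SH (PGpd K)) f) (Idn (SH (PGpd K)) g)"
    using comp_idn_V[of f g] by (simp add: sq_vcat_tr)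
next
  fix x y z w assume "x \<in> Arr (SH (PGpd K))" "y \<in> Arr (SH (PGpd K))" "z \<in> Arr (SH (PGpd K))" "w \<in> Arr (SH (PGpd K))"
    "Dom (SH (PGpd K)) x = Cod (SH (PGpd K)) y" "Dom (SH (PGpd K)) z = Cod (SH (PGpd K)) w"
    "Dom (SV (PGpd K)) x = Cod (SV (PGpd K)) z" "Dom (SV (PGpd K)) y = Cod (SV (PGpd K)) w"
  then show "Cmp (SV (PGpd K)) (Cmp (SH (PGpd K)) x y) (Cmp (SH (PGpd K)) z w) =
      Cmp (SH (PGpd K)) (Cmp (SV (PGpd K)) x z) (Cmp (SV (PGpd K)) y w)"
    unfolding SH_PGpd SV_PGpd by (intro interchange)
qed

text \<open>The filling condition is the extension condition for the (1,1)-bihorn that omits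
  horizontal face \<open>1\<close> and vertical face \<open>0\<close>.\<close>

lemma filling_PGpd: "filling (PGpd K)"
  unfolding filling_def
proof (intro ballI impI)
  fix g u assume g: "g \<in> Arr (HC (PGpd K))" and u: "u \<in> Arr (VC (PGpd K))" and e: "Dom (HC (PGpd K)) g = Cod (VC (PGpd K)) u"
  obtain f v where f: "f \<in> bisimps K 1 0" "g = hcls K 1 0 f" "v \<in> bisimps K 0 1" "u = vcls K 0 1 v" using g u by auto
  obtain x where x: "x \<in> bisimps K 1 1" "hface K 1 1 0 x = v" "vface K 1 1 1 x = f"
    by (rule fill11_10[of v f]) (use f e in simp_all)
  then show "\<exists>x\<in>Arr (SH (PGpd K)). Dom (SH (PGpd K)) x = u \<and> Cod (SV (PGpd K)) x = g"
    using f by (intro bexI[of _ "bicls K 1 1 x"]) simp_all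
qed

lemma PGpd_in_DGpd: "PGpd K \<in> Obj DGpd"
  by (simp add: DGpd_def Let_def double_groupoid_def double_category_PGpd filling_PGpd ext_dbl_def
      groupoid_H groupoid_V groupoid_sqh groupoid_sqv ext_catg_H ext_catg_V ext_catg_sqh ext_catg_sqv)

end

section \<open>Categories and groupoids\<close>

lemma is_functorI:
  assumes "\<And>a. a \<in> Obj C \<Longrightarrow> F0 a \<in> Obj D" "\<And>f. f \<in> Arr C \<Longrightarrow> F1 f \<in> Arr D"
    "\<And>f. f \<in> Arr C \<Longrightarrow> Dom D (F1 f) = F0 (Dom C f)" "\<And>f. f \<in> Arr C \<Longrightarrow> Cod D (F1 f) = F0 (Cod C f)"
    "\<And>a. a \<in> Obj C \<Longrightarrow> F1 (Idn C a) = Idn D (F0 a)"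
    "\<And>f g. f \<in> Arr C \<Longrightarrow> g \<in> Arr C \<Longrightarrow> Dom C f = Cod C g \<Longrightarrow> F1 (Cmp C f g) = Cmp D (F1 f) (F1 g)"
  shows "is_functor C F0 F1 D"
  using assms by (simp add: is_functor_def)

lemma is_functorD:
  assumes "is_functor C F0 F1 D"
  shows "a \<in> Obj C \<Longrightarrow> F0 a \<in> Obj D" "f \<in> Arr C \<Longrightarrow> F1 f \<in> Arr D"
    "f \<in> Arr C \<Longrightarrow> Dom D (F1 f) = F0 (Dom C f)" "f \<in> Arr C \<Longrightarrow> Cod D (F1 f) = F0 (Cod C f)"
    "a \<in> Obj C \<Longrightarrow> F1 (Idn C a) = Idn D (F0 a)"
    "f \<in> Arr C \<Longrightarrow> g \<in> Arr C \<Longrightarrow> Dom C f = Cod C g \<Longrightarrow> F1 (Cmp C f g) = Cmp D (F1 f) (F1 g)"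
  using assms by (auto simp: is_functor_def dest: funcset_mem)

locale cat =
  fixes C :: "('o, 'm) catg"
  assumes category: "category C"
begin

lemma cat_simps [simp]:
  "f \<in> Arr C \<Longrightarrow> Dom C f \<in> Obj C" "f \<in> Arr C \<Longrightarrow> Cod C f \<in> Obj C" "a \<in> Obj C \<Longrightarrow> Idn C a \<in> Arr C"
  "a \<in> Obj C \<Longrightarrow> Dom C (Idn C a) = a" "a \<in> Obj C \<Longrightarrow> Cod C (Idn C a) = a"
  "f \<in> Arr C \<Longrightarrow> g \<in> Arr C \<Longrightarrow> Dom C f = Cod C g \<Longrightarrow> Cmp C f g \<in> Arr C"
  "f \<in> Arr C \<Longrightarrow> g \<in> Arr C \<Longrightarrow> Dom C f = Cod C g \<Longrightarrow> Dom C (Cmp C f g) = Dom C g"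
  "f \<in> Arr C \<Longrightarrow> g \<in> Arr C \<Longrightarrow> Dom C f = Cod C g \<Longrightarrow> Cod C (Cmp C f g) = Cod C f"
  "f \<in> Arr C \<Longrightarrow> Dom C f = a \<Longrightarrow> Cmp C f (Idn C a) = f" "f \<in> Arr C \<Longrightarrow> Cod C f = a \<Longrightarrow> Cmp C (Idn C a) f = f"
proof -
  have "Dom C \<in> Arr C \<rightarrow> Obj C" "Cod C \<in> Arr C \<rightarrow> Obj C" "Idn C \<in> Obj C \<rightarrow> Arr C"
    and i: "\<forall>a\<in>Obj C. Dom C (Idn C a) = a \<and> Cod C (Idn C a) = a"
    and c: "\<forall>f\<in>Arr C. \<forall>g\<in>Arr C. Dom C f = Cod C g \<longrightarrow>
        Cmp C f g \<in> Arr C \<and> Dom C (Cmp C f g) = Dom C g \<and> Cod C (Cmp C f g) = Cod C f"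
    and u: "\<forall>f\<in>Arr C. Cmp C f (Idn C (Dom C f)) = f \<and> Cmp C (Idn C (Cod C f)) f = f"
    using category unfolding category_def by - (elim conjE, assumption)+
  then show "f \<in> Arr C \<Longrightarrow> Dom C f \<in> Obj C" "f \<in> Arr C \<Longrightarrow> Cod C f \<in> Obj C" "a \<in> Obj C \<Longrightarrow> Idn C a \<in> Arr C"
    by (auto dest: funcset_mem)
  show "a \<in> Obj C \<Longrightarrow> Dom C (Idn C a) = a" "a \<in> Obj C \<Longrightarrow> Cod C (Idn C a) = a" using i by blast+
  show "f \<in> Arr C \<Longrightarrow> g \<in> Arr C \<Longrightarrow> Dom C f = Cod C g \<Longrightarrow> Cmp C f g \<in> Arr C"
    "f \<in> Arr C \<Longrightarrow> g \<in> Arr C \<Longrightarrow> Dom C f = Cod C g \<Longrightarrow> Dom C (Cmp C f g) = Dom C g"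
    "f \<in> Arr C \<Longrightarrow> g \<in> Arr C \<Longrightarrow> Dom C f = Cod C g \<Longrightarrow> Cod C (Cmp C f g) = Cod C f" using c by blast+
  show "f \<in> Arr C \<Longrightarrow> Dom C f = a \<Longrightarrow> Cmp C f (Idn C a) = f" "f \<in> Arr C \<Longrightarrow> Cod C f = a \<Longrightarrow> Cmp C (Idn C a) f = f"
    using u by blast+
qed

lemma assoc:
  "f \<in> Arr C \<Longrightarrow> g \<in> Arr C \<Longrightarrow> h \<in> Arr C \<Longrightarrow> Dom C f = Cod C g \<Longrightarrow> Dom C g = Cod C h \<Longrightarrow>
    Cmp C (Cmp C f g) h = Cmp C f (Cmp C g h)"
  using category unfolding category_def by (elim conjE) blast

end

definition ginv :: "('o, 'm) catg \<Rightarrow> 'm \<Rightarrow> 'm" where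
  "ginv C f = (SOME g. g \<in> Arr C \<and> Dom C g = Cod C f \<and> Cod C g = Dom C f \<and>
     Cmp C f g = Idn C (Cod C f) \<and> Cmp C g f = Idn C (Dom C f))"

locale gpd =
  fixes C :: "('o, 'm) catg"
  assumes groupoid: "groupoid C"
begin

sublocale cat C by unfold_locales (use groupoid in \<open>simp add: groupoid_def\<close>)

lemma ginv_simps [simp]:
  assumes "f \<in> Arr C"
  shows "ginv C f \<in> Arr C" "Dom C (ginv C f) = Cod C f" "Cod C (ginv C f) = Dom C f"
    "Cmp C f (ginv C f) = Idn C (Cod C f)" "Cmp C (ginv C f) f = Idn C (Dom C f)"
proof -
  have "\<exists>g. g \<in> Arr C \<and> Dom C g = Cod C f \<and> Cod C g = Dom C f \<and>
     Cmp C f g = Idn C (Cod C f) \<and> Cmp C g f = Idn C (Dom C f)"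
    using groupoid assms unfolding groupoid_def by blast
  from someI_ex[OF this] show "ginv C f \<in> Arr C" "Dom C (ginv C f) = Cod C f" "Cod C (ginv C f) = Dom C f"
    "Cmp C f (ginv C f) = Idn C (Cod C f)" "Cmp C (ginv C f) f = Idn C (Dom C f)"
    unfolding ginv_def by blast+
qed

lemma ginv_cancel [simp]:
  assumes "f \<in> Arr C" "g \<in> Arr C"
  shows "Dom C f = Cod C g \<Longrightarrow> Cmp C (ginv C f) (Cmp C f g) = g"
    and "Cod C f = Cod C g \<Longrightarrow> Cmp C f (Cmp C (ginv C f) g) = g"
  using assms by (simp_all flip: assoc)

lemma ginv_solve:
  assumes "Cmp C f g = h" "f \<in> Arr C" "g \<in> Arr C" "Dom C f = Cod C g"
  shows "Cmp C (ginv C f) h = g"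
  using assms by auto

lemma ginv_unique:
  assumes "Cmp C f g = Idn C (Cod C f)" "f \<in> Arr C" "g \<in> Arr C" "Dom C f = Cod C g"
  shows "ginv C f = g"
  using ginv_solve[OF assms] assms by simp

lemma idempotent_Idn:
  assumes "f \<in> Arr C" "Dom C f = Cod C f" "Cmp C f f = f"
  shows "f = Idn C (Dom C f)"
  using ginv_solve[OF assms(3,1,1,2)] assms by simp

end

locale dgp =
  fixes G :: "('o, 'h, 'v, 'c) dbl"
  assumes dg: "double_groupoid G"
begin

sublocale H: gpd "HC G" by unfold_locales (use dg in \<open>simp add: double_groupoid_def\<close>)
sublocale V: gpd "VC G" by unfold_locales (use dg in \<open>simp add: double_groupoid_def\<close>)
sublocale SH: gpd "SH G" by unfold_locales (use dg in \<open>simp add: double_groupoid_def\<close>)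
sublocale SV: gpd "SV G" by unfold_locales (use dg in \<open>simp add: double_groupoid_def\<close>)

lemma dc: "double_category G" using dg by (simp add: double_groupoid_def)

lemma carriers [simp]: "Obj (VC G) = Obj (HC G)" "Obj (SH G) = Arr (VC G)" "Obj (SV G) = Arr (HC G)"
  "Arr (SV G) = Arr (SH G)"
  using dc unfolding double_category_def by - (elim conjE, assumption)+

text \<open>The rules \<open>carriers\<close> rewrite object and arrow sets to a normal form, so the
  groupoid lemmas are restated for these forms in order to keep matching.\<close>

lemmas carrier_simps [simp] = SV.cat_simps[unfolded carriers] SH.cat_simps[unfolded carriers] V.cat_simps[unfolded carriers]
  SV.ginv_simps[unfolded carriers] SV.ginv_cancel[unfolded carriers]

lemma corners:
  assumes "x \<in> Arr (SH G)"
  shows "Dom (HC G) (Dom (SV G) x) = Dom (VC G) (Dom (SH G) x)"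
    "Cod (HC G) (Cod (SV G) x) = Cod (VC G) (Cod (SH G) x)"
    "Dom (HC G) (Cod (SV G) x) = Cod (VC G) (Dom (SH G) x)"
    "Cod (HC G) (Dom (SV G) x) = Dom (VC G) (Cod (SH G) x)"
proof -
  have "\<forall>x\<in>Arr (SH G).
        Dom (HC G) (Dom (SV G) x) = Dom (VC G) (Dom (SH G) x) \<and>
        Cod (HC G) (Cod (SV G) x) = Cod (VC G) (Cod (SH G) x) \<and>
        Dom (HC G) (Cod (SV G) x) = Cod (VC G) (Dom (SH G) x) \<and>
        Dom (VC G) (Cod (SH G) x) = Cod (HC G) (Dom (SV G) x)"
    using dc unfolding double_category_def by (elim conjE)
  from bspec[OF this assms] show "Dom (HC G) (Dom (SV G) x) = Dom (VC G) (Dom (SH G) x)"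
    "Cod (HC G) (Cod (SV G) x) = Cod (VC G) (Cod (SH G) x)"
    "Dom (HC G) (Cod (SV G) x) = Cod (VC G) (Dom (SH G) x)"
    "Cod (HC G) (Dom (SV G) x) = Dom (VC G) (Cod (SH G) x)" by simp_all
qed

lemma idn_bdry [simp]:
  "f \<in> Arr (HC G) \<Longrightarrow> Dom (SH G) (Idn (SV G) f) = Idn (VC G) (Dom (HC G) f)"
  "f \<in> Arr (HC G) \<Longrightarrow> Cod (SH G) (Idn (SV G) f) = Idn (VC G) (Cod (HC G) f)"
  "u \<in> Arr (VC G) \<Longrightarrow> Dom (SV G) (Idn (SH G) u) = Idn (HC G) (Dom (VC G) u)"
  "u \<in> Arr (VC G) \<Longrightarrow> Cod (SV G) (Idn (SH G) u) = Idn (HC G) (Cod (VC G) u)"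
  "a \<in> Obj (HC G) \<Longrightarrow> Idn (SH G) (Idn (VC G) a) = Idn (SV G) (Idn (HC G) a)"
proof -
  have "\<forall>f\<in>Arr (HC G).
        Dom (SH G) (Idn (SV G) f) = Idn (VC G) (Dom (HC G) f) \<and>
        Cod (SH G) (Idn (SV G) f) = Idn (VC G) (Cod (HC G) f)"
    "\<forall>u\<in>Arr (VC G).
        Dom (SV G) (Idn (SH G) u) = Idn (HC G) (Dom (VC G) u) \<and>
        Cod (SV G) (Idn (SH G) u) = Idn (HC G) (Cod (VC G) u)"
    "\<forall>a\<in>Obj (HC G). Idn (SH G) (Idn (VC G) a) = Idn (SV G) (Idn (HC G) a)"
    using dc unfolding double_category_def by - (elim conjE, assumption)+
  then show "f \<in> Arr (HC G) \<Longrightarrow> Dom (SH G) (Idn (SV G) f) = Idn (VC G) (Dom (HC G) f)"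
  "f \<in> Arr (HC G) \<Longrightarrow> Cod (SH G) (Idn (SV G) f) = Idn (VC G) (Cod (HC G) f)"
  "u \<in> Arr (VC G) \<Longrightarrow> Dom (SV G) (Idn (SH G) u) = Idn (HC G) (Dom (VC G) u)"
  "u \<in> Arr (VC G) \<Longrightarrow> Cod (SV G) (Idn (SH G) u) = Idn (HC G) (Cod (VC G) u)"
  "a \<in> Obj (HC G) \<Longrightarrow> Idn (SH G) (Idn (VC G) a) = Idn (SV G) (Idn (HC G) a)" by blast+
qed

lemma cmp_bdry [simp]:
  assumes "x \<in> Arr (SH G)" "y \<in> Arr (SH G)"
  shows "Dom (SH G) x = Cod (SH G) y \<Longrightarrow> Dom (SV G) (Cmp (SH G) x y) = Cmp (HC G) (Dom (SV G) x) (Dom (SV G) y)"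
    "Dom (SH G) x = Cod (SH G) y \<Longrightarrow> Cod (SV G) (Cmp (SH G) x y) = Cmp (HC G) (Cod (SV G) x) (Cod (SV G) y)"
    "Dom (SV G) x = Cod (SV G) y \<Longrightarrow> Dom (SH G) (Cmp (SV G) x y) = Cmp (VC G) (Dom (SH G) x) (Dom (SH G) y)"
    "Dom (SV G) x = Cod (SV G) y \<Longrightarrow> Cod (SH G) (Cmp (SV G) x y) = Cmp (VC G) (Cod (SH G) x) (Cod (SH G) y)"
proof -
  have "\<forall>x\<in>Arr (SH G). \<forall>y\<in>Arr (SH G). Dom (SH G) x = Cod (SH G) y \<longrightarrow>
        Dom (SV G) (Cmp (SH G) x y) = Cmp (HC G) (Dom (SV G) x) (Dom (SV G) y) \<and>
        Cod (SV G) (Cmp (SH G) x y) = Cmp (HC G) (Cod (SV G) x) (Cod (SV G) y)"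
    "\<forall>x\<in>Arr (SH G). \<forall>y\<in>Arr (SH G). Dom (SV G) x = Cod (SV G) y \<longrightarrow>
        Dom (SH G) (Cmp (SV G) x y) = Cmp (VC G) (Dom (SH G) x) (Dom (SH G) y) \<and>
        Cod (SH G) (Cmp (SV G) x y) = Cmp (VC G) (Cod (SH G) x) (Cod (SH G) y)"
    using dc unfolding double_category_def by - (elim conjE, assumption)+
  then show "Dom (SH G) x = Cod (SH G) y \<Longrightarrow> Dom (SV G) (Cmp (SH G) x y) = Cmp (HC G) (Dom (SV G) x) (Dom (SV G) y)"
    "Dom (SH G) x = Cod (SH G) y \<Longrightarrow> Cod (SV G) (Cmp (SH G) x y) = Cmp (HC G) (Cod (SV G) x) (Cod (SV G) y)"
    "Dom (SV G) x = Cod (SV G) y \<Longrightarrow> Dom (SH G) (Cmp (SV G) x y) = Cmp (VC G) (Dom (SH G) x) (Dom (SH G) y)"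
    "Dom (SV G) x = Cod (SV G) y \<Longrightarrow> Cod (SH G) (Cmp (SV G) x y) = Cmp (VC G) (Cod (SH G) x) (Cod (SH G) y)"
    using assms by blast+
qed

lemma cmp_idn:
  "f \<in> Arr (HC G) \<Longrightarrow> g \<in> Arr (HC G) \<Longrightarrow> Dom (HC G) f = Cod (HC G) g \<Longrightarrow>
    Cmp (SH G) (Idn (SV G) f) (Idn (SV G) g) = Idn (SV G) (Cmp (HC G) f g)"
  "u \<in> Arr (VC G) \<Longrightarrow> w \<in> Arr (VC G) \<Longrightarrow> Dom (VC G) u = Cod (VC G) w \<Longrightarrow>
    Cmp (SV G) (Idn (SH G) u) (Idn (SH G) w) = Idn (SH G) (Cmp (VC G) u w)"
proof -
  have "\<forall>f\<in>Arr (HC G). \<forall>g\<in>Arr (HC G). Dom (HC G) f = Cod (HC G) g \<longrightarrow>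
        Idn (SV G) (Cmp (HC G) f g) = Cmp (SH G) (Idn (SV G) f) (Idn (SV G) g)"
    "\<forall>u\<in>Arr (VC G). \<forall>w\<in>Arr (VC G). Dom (VC G) u = Cod (VC G) w \<longrightarrow>
        Idn (SH G) (Cmp (VC G) u w) = Cmp (SV G) (Idn (SH G) u) (Idn (SH G) w)"
    using dc unfolding double_category_def by - (elim conjE, assumption)+
  then show "f \<in> Arr (HC G) \<Longrightarrow> g \<in> Arr (HC G) \<Longrightarrow> Dom (HC G) f = Cod (HC G) g \<Longrightarrow>
    Cmp (SH G) (Idn (SV G) f) (Idn (SV G) g) = Idn (SV G) (Cmp (HC G) f g)"
  "u \<in> Arr (VC G) \<Longrightarrow> w \<in> Arr (VC G) \<Longrightarrow> Dom (VC G) u = Cod (VC G) w \<Longrightarrow>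
    Cmp (SV G) (Idn (SH G) u) (Idn (SH G) w) = Idn (SH G) (Cmp (VC G) u w)" by simp_all
qed

lemma interchange:
  assumes "x \<in> Arr (SH G)" "y \<in> Arr (SH G)" "z \<in> Arr (SH G)" "w \<in> Arr (SH G)"
    "Dom (SH G) x = Cod (SH G) y" "Dom (SH G) z = Cod (SH G) w"
    "Dom (SV G) x = Cod (SV G) z" "Dom (SV G) y = Cod (SV G) w"
  shows "Cmp (SV G) (Cmp (SH G) x y) (Cmp (SH G) z w) = Cmp (SH G) (Cmp (SV G) x z) (Cmp (SV G) y w)"
proof -
  have "\<forall>x\<in>Arr (SH G). \<forall>y\<in>Arr (SH G). \<forall>z\<in>Arr (SH G). \<forall>w\<in>Arr (SH G).
        Dom (SH G) x = Cod (SH G) y \<and> Dom (SH G) z = Cod (SH G) w \<and>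
        Dom (SV G) x = Cod (SV G) z \<and> Dom (SV G) y = Cod (SV G) w \<longrightarrow>
        Cmp (SV G) (Cmp (SH G) x y) (Cmp (SH G) z w) = Cmp (SH G) (Cmp (SV G) x z) (Cmp (SV G) y w)"
    using dc unfolding double_category_def by (elim conjE)
  then show ?thesis using assms by blast
qed

lemma ginv_bdry [simp]:
  assumes x: "x \<in> Arr (SH G)"
  shows "Dom (SV G) (ginv (SH G) x) = ginv (HC G) (Dom (SV G) x)"
    "Cod (SV G) (ginv (SH G) x) = ginv (HC G) (Cod (SV G) x)"
    "Dom (SH G) (ginv (SV G) x) = ginv (VC G) (Dom (SH G) x)"
    "Cod (SH G) (ginv (SV G) x) = ginv (VC G) (Cod (SH G) x)"
proof -
  have in_: "Dom (SV G) x \<in> Arr (HC G)" "Cod (SV G) x \<in> Arr (HC G)" "Dom (SH G) x \<in> Arr (VC G)" "Cod (SH G) x \<in> Arr (VC G)"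
    "ginv (SH G) x \<in> Arr (SH G)" "ginv (SV G) x \<in> Arr (SH G)"
    "Dom (SV G) (ginv (SH G) x) \<in> Arr (HC G)" "Cod (SV G) (ginv (SH G) x) \<in> Arr (HC G)"
    "Dom (SH G) (ginv (SV G) x) \<in> Arr (VC G)" "Cod (SH G) (ginv (SV G) x) \<in> Arr (VC G)"
    using x SH.cat_simps(1,2)[of x] SV.cat_simps(1,2)[of x] SH.ginv_simps(1)[of x] SV.ginv_simps(1)[of x]
      SV.cat_simps(1,2)[of "ginv (SH G) x"] SH.cat_simps(1,2)[of "ginv (SV G) x"] by simp_all
  note c = corners[OF x] corners[OF in_(5)] corners[OF in_(6)]
  note ih = SH.ginv_simps[OF x] and iv = SV.ginv_simps[of x, unfolded carriers, OF x]
  show "Dom (SV G) (ginv (SH G) x) = ginv (HC G) (Dom (SV G) x)"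
    by (rule H.ginv_unique[symmetric])
      (use in_ c ih cmp_bdry(1)[OF x in_(5)] in \<open>simp_all flip: cmp_bdry(1)\<close>)
  show "Cod (SV G) (ginv (SH G) x) = ginv (HC G) (Cod (SV G) x)"
    by (rule H.ginv_unique[symmetric])
      (use in_ c ih cmp_bdry(2)[OF x in_(5)] in \<open>simp_all flip: cmp_bdry(2)\<close>)
  show "Dom (SH G) (ginv (SV G) x) = ginv (VC G) (Dom (SH G) x)"
    by (rule V.ginv_unique[symmetric])
      (use in_ c iv cmp_bdry(3)[OF x in_(6)] in \<open>simp_all flip: cmp_bdry(3)\<close>)
  show "Cod (SH G) (ginv (SV G) x) = ginv (VC G) (Cod (SH G) x)"
    by (rule V.ginv_unique[symmetric])
      (use in_ c iv cmp_bdry(4)[OF x in_(6)] in \<open>simp_all flip: cmp_bdry(4)\<close>)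
qed

lemma ginv_Cmp_SH:
  assumes "x \<in> Arr (SH G)" "y \<in> Arr (SH G)" "Dom (SH G) x = Cod (SH G) y"
  shows "ginv (SV G) (Cmp (SH G) x y) = Cmp (SH G) (ginv (SV G) x) (ginv (SV G) y)"
  by (rule SV.ginv_unique) (use assms in \<open>simp_all add: cmp_idn interchange corners\<close>)

end

section \<open>Double functors out of grids as families of squares\<close>

text \<open>Essentially a double functor from the product of two indiscrete groupoids:
  \<open>c i i' j j'\<close> is the square from column \<open>i\<close> to \<open>i'\<close> and
  from row \<open>j\<close> to \<open>j'\<close>, in any order of the indices. Edges and vertices
  are not separate data but boundaries of squares with repeated indices.\<close>

definition sqfam :: "('o, 'h, 'v, 'c) dbl \<Rightarrow> nat \<Rightarrow> nat \<Rightarrow> (nat \<Rightarrow> nat \<Rightarrow> nat \<Rightarrow> nat \<Rightarrow> 'c) \<Rightarrow> bool" where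
  "sqfam G p q c \<longleftrightarrow> (\<forall>i\<le>p. \<forall>i'\<le>p. \<forall>j\<le>q. \<forall>j'\<le>q. c i i' j j' \<in> Arr (SH G) \<and>
     Dom (SH G) (c i i' j j') = Dom (SH G) (c i i j j') \<and> Cod (SH G) (c i i' j j') = Dom (SH G) (c i' i' j j') \<and>
     Dom (SV G) (c i i' j j') = Dom (SV G) (c i i' j j) \<and> Cod (SV G) (c i i' j j') = Dom (SV G) (c i i' j' j') \<and>
     (\<forall>i''\<le>p. Cmp (SH G) (c i' i'' j j') (c i i' j j') = c i i'' j j') \<and>
     (\<forall>j''\<le>q. Cmp (SV G) (c i i' j' j'') (c i i' j j') = c i i' j j''))"

text \<open>An arrow \<open>(i, j)\<close> of the ordered category points from \<open>j\<close> to
  \<open>i\<close>, hence the reversed arguments \<open>snd e\<close> and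
  \<open>fst e\<close>.\<close>

definition fam_fun :: "('o, 'h, 'v, 'c) dbl \<Rightarrow> nat \<Rightarrow> nat \<Rightarrow> (nat \<Rightarrow> nat \<Rightarrow> nat \<Rightarrow> nat \<Rightarrow> 'c) \<Rightarrow>
    ('o, 'h, 'v, 'c) grid_fun" where
  "fam_fun G p q c = \<lparr>
     fO = (\<lambda>(i, j)\<in>Obj (HC (grid p q)). Dom (HC G) (Dom (SV G) (c i i j j))),
     fH = (\<lambda>(e, j)\<in>Arr (HC (grid p q)). Dom (SV G) (c (snd e) (fst e) j j)),
     fV = (\<lambda>(i, e)\<in>Arr (VC (grid p q)). Dom (SH G) (c i i (snd e) (fst e))),
     fC = (\<lambda>(e, e')\<in>Arr (SH (grid p q)). c (snd e) (fst e) (snd e') (fst e'))\<rparr>"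

text \<open>Think of \<open>S i j\<close> as the square from the vertex \<open>(i, j)\<close> to the
  base vertex. Dividing the squares for \<open>i\<close> and \<open>i'\<close> horizontally gives
  \<open>Q j\<close>, from column \<open>i\<close> to \<open>i'\<close> and from row
  \<open>j\<close> to the base row; dividing these vertically gives the square between the two
  vertices.\<close>

definition star_fam :: "('o, 'h, 'v, 'c) dbl \<Rightarrow> (nat \<Rightarrow> nat \<Rightarrow> 'c) \<Rightarrow> nat \<Rightarrow> nat \<Rightarrow> nat \<Rightarrow> nat \<Rightarrow> 'c" where
  "star_fam G S i i' j j' = (let Q = (\<lambda>j. Cmp (SH G) (ginv (SH G) (S i' j)) (S i j)) in
     Cmp (SV G) (ginv (SV G) (Q j')) (Q j))"

text \<open>The base vertex \<open>(0, 0)\<close> is chosen because every arm of its star is a cell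
  of the ordered grid.\<close>

definition fam :: "('o, 'h, 'v, 'c) dbl \<Rightarrow> ('o, 'h, 'v, 'c) grid_fun \<Rightarrow> nat \<Rightarrow> nat \<Rightarrow> nat \<Rightarrow> nat \<Rightarrow> 'c" where
  "fam G x = star_fam G (\<lambda>i j. fC x ((0, i), (0, j)))"

lemma grid_simps [simp]:
  "Obj (HC (grid p q)) = {..p} \<times> {..q}" "Arr (HC (grid p q)) = {(i, j). i \<le> j \<and> j \<le> p} \<times> {..q}"
  "Obj (VC (grid p q)) = {..p} \<times> {..q}" "Arr (VC (grid p q)) = {..p} \<times> {(i, j). i \<le> j \<and> j \<le> q}"
  "Obj (SH (grid p q)) = {..p} \<times> {(i, j). i \<le> j \<and> j \<le> q}"
  "Arr (SH (grid p q)) = {(i, j). i \<le> j \<and> j \<le> p} \<times> {(i, j). i \<le> j \<and> j \<le> q}"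
  "Obj (SV (grid p q)) = {(i, j). i \<le> j \<and> j \<le> p} \<times> {..q}"
  "Arr (SV (grid p q)) = {(i, j). i \<le> j \<and> j \<le> p} \<times> {(i, j). i \<le> j \<and> j \<le> q}"
  "Dom (HC (grid p q)) (e, b) = (snd e, b)" "Cod (HC (grid p q)) (e, b) = (fst e, b)"
  "Idn (HC (grid p q)) (a, b) = ((a, a), b)" "Cmp (HC (grid p q)) (e, b) (f, d) = ((fst e, snd f), b)"
  "Dom (VC (grid p q)) (a, e) = (a, snd e)" "Cod (VC (grid p q)) (a, e) = (a, fst e)"
  "Idn (VC (grid p q)) (a, b) = (a, (b, b))" "Cmp (VC (grid p q)) (a, e) (d, f) = (a, (fst e, snd f))"
  "Dom (SH (grid p q)) (e, u) = (snd e, u)" "Cod (SH (grid p q)) (e, u) = (fst e, u)"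
  "Idn (SH (grid p q)) (a, u) = ((a, a), u)" "Cmp (SH (grid p q)) (e, u) (f, w) = ((fst e, snd f), u)"
  "Dom (SV (grid p q)) (e, u) = (e, snd u)" "Cod (SV (grid p q)) (e, u) = (e, fst u)"
  "Idn (SV (grid p q)) (e, b) = (e, (b, b))" "Cmp (SV (grid p q)) (e, u) (f, w) = (e, (fst u, snd w))"
  by (auto simp: tensor_def ord_cat_def)

context dgp begin

lemma sqfamD:
  assumes "sqfam G p q c" "i \<le> p" "i' \<le> p" "j \<le> q" "j' \<le> q"
  shows "c i i' j j' \<in> Arr (SH G)" "Dom (SH G) (c i i' j j') = Dom (SH G) (c i i j j')"
    "Cod (SH G) (c i i' j j') = Dom (SH G) (c i' i' j j')" "Dom (SV G) (c i i' j j') = Dom (SV G) (c i i' j j)"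
    "Cod (SV G) (c i i' j j') = Dom (SV G) (c i i' j' j')"
    "i'' \<le> p \<Longrightarrow> Cmp (SH G) (c i' i'' j j') (c i i' j j') = c i i'' j j'"
    "j'' \<le> q \<Longrightarrow> Cmp (SV G) (c i i' j' j'') (c i i' j j') = c i i' j j''"
  using assms unfolding sqfam_def by blast+

text \<open>Preservation of identities is not among the conditions of \<open>sqfam\<close>; a square
  with repeated column index is idempotent, and idempotents in a groupoid are identities.\<close>

lemma sqfam_Idn:
  assumes c: "sqfam G p q c" and i: "i \<le> p" "j \<le> q" "j' \<le> q"
  shows "c i i j j' = Idn (SH G) (Dom (SH G) (c i i j j'))"
  by (rule SH.idempotent_Idn) (use i sqfamD[OF c i(1,1,2,3)] in auto)

lemma sqfam_Idn_V:
  assumes c: "sqfam G p q c" and i: "i \<le> p" "i' \<le> p" "j \<le> q"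
  shows "c i i' j j = Idn (SV G) (Dom (SV G) (c i i' j j))"
  by (rule SV.idempotent_Idn) (use i sqfamD[OF c i(1,2,3,3)] in auto)

lemma fam_fun_in:
  assumes c: "sqfam G p q c"
  shows "fam_fun G p q c \<in> dbl_homs (grid p q) G"
proof -
  have cin: "c i i' j j' \<in> Arr (SH G)" if "i \<le> p" "i' \<le> p" "j \<le> q" "j' \<le> q" for i i' j j'
    using sqfamD(1)[OF c that] .
  have vert: "Dom (VC G) (Dom (SH G) (c i i j j')) = Dom (HC G) (Dom (SV G) (c i i j j))"
    if "i \<le> p" "j \<le> q" "j' \<le> q" for i j j'
    using corners(1)[OF cin[OF that(1,1,2,3)]] sqfamD(4)[OF c that(1,1,2,3)] by simp
  have vert': "Cod (VC G) (Dom (SH G) (c i i j j')) = Dom (HC G) (Dom (SV G) (c i i j' j'))"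
    if "i \<le> p" "j \<le> q" "j' \<le> q" for i j j'
    using corners(3)[OF cin[OF that(1,1,2,3)]] sqfamD(5)[OF c that(1,1,2,3)] by simp
  have horiz: "Dom (HC G) (Dom (SV G) (c i i' j j)) = Dom (HC G) (Dom (SV G) (c i i j j))"
    if "i \<le> p" "i' \<le> p" "j \<le> q" for i i' j
    using corners(1)[OF cin[OF that(1,2,3,3)]] corners(1)[OF cin[OF that(1,1,3,3)]] sqfamD(2)[OF c that(1,2,3,3)] by simp
  have horiz': "Cod (HC G) (Dom (SV G) (c i i' j j)) = Dom (HC G) (Dom (SV G) (c i' i' j j))"
    if "i \<le> p" "i' \<le> p" "j \<le> q" for i i' j
    using corners(4)[OF cin[OF that(1,2,3,3)]] corners(1)[OF cin[OF that(2,2,3,3)]] sqfamD(3)[OF c that(1,2,3,3)] by simp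
  have hid: "Dom (SV G) (c i i j j) = Idn (HC G) (Dom (HC G) (Dom (SV G) (c i i j j)))" if "i \<le> p" "j \<le> q" for i j
    using arg_cong[OF sqfam_Idn[OF c that(1,2,2)], of "Dom (SV G)"] corners(1)[OF cin[OF that(1,1,2,2)]] cin[OF that(1,1,2,2)]
    by simp
  have vid: "Dom (SH G) (c i i j j) = Idn (VC G) (Dom (HC G) (Dom (SV G) (c i i j j)))" if "i \<le> p" "j \<le> q" for i j
    using arg_cong[OF sqfam_Idn_V[OF c that(1,1,2)], of "Dom (SH G)"] cin[OF that(1,1,2,2)] by simp
  have hc: "Cmp (HC G) (Dom (SV G) (c i' i'' j j)) (Dom (SV G) (c i i' j j)) = Dom (SV G) (c i i'' j j)"
    if "i \<le> p" "i' \<le> p" "i'' \<le> p" "j \<le> q" for i i' i'' j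
    using sqfamD(6)[OF c that(1,2,4,4,3)] cmp_bdry(1)[OF cin[OF that(2,3,4,4)] cin[OF that(1,2,4,4)]]
      sqfamD(2)[OF c that(2,3,4,4)] sqfamD(3)[OF c that(1,2,4,4)] by simp
  have vc: "Cmp (VC G) (Dom (SH G) (c i i j' j'')) (Dom (SH G) (c i i j j')) = Dom (SH G) (c i i j j'')"
    if "i \<le> p" "j \<le> q" "j' \<le> q" "j'' \<le> q" for i j j' j''
    using sqfamD(7)[OF c that(1,1,2,3,4)] cmp_bdry(3)[OF cin[OF that(1,1,3,4)] cin[OF that(1,1,2,3)]]
      sqfamD(4)[OF c that(1,1,3,4)] sqfamD(5)[OF c that(1,1,2,3)] by simp
  have "is_functor (HC (grid p q)) (fO (fam_fun G p q c)) (fH (fam_fun G p q c)) (HC G)"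
  proof (rule is_functorI; clarsimp simp: fam_fun_def)
    fix i j b assume "i \<le> j" "j \<le> p" "b \<le> q"
    then show "Dom (HC G) (Dom (SV G) (c j i b b)) = Dom (HC G) (Dom (SV G) (c j j b b))"
      "Cod (HC G) (Dom (SV G) (c j i b b)) = Dom (HC G) (Dom (SV G) (c i i b b))"
      by (intro horiz horiz'; simp)+
  qed (auto simp: cin hc intro: hid)
  moreover have "is_functor (VC (grid p q)) (fO (fam_fun G p q c)) (fV (fam_fun G p q c)) (VC G)"
  proof (rule is_functorI; clarsimp simp: fam_fun_def)
    fix a i j assume "a \<le> p" "i \<le> j" "j \<le> q"
    then show "Dom (VC G) (Dom (SH G) (c a a j i)) = Dom (HC G) (Dom (SV G) (c a a j j))"
      "Cod (VC G) (Dom (SH G) (c a a j i)) = Dom (HC G) (Dom (SV G) (c a a i i))"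
      by (intro vert vert'; simp)+
  qed (auto simp: cin vc intro: vid)
  moreover have "is_functor (SH (grid p q)) (fV (fam_fun G p q c)) (fC (fam_fun G p q c)) (SH G)"
  proof (rule is_functorI; clarsimp simp: fam_fun_def)
    fix i j a b assume "i \<le> j" "j \<le> p" "a \<le> b" "b \<le> q"
    then show "Dom (SH G) (c j i b a) = Dom (SH G) (c j j b a)" "Cod (SH G) (c j i b a) = Dom (SH G) (c i i b a)"
      by (intro sqfamD(2,3)[OF c]; simp)+
  qed (auto simp: cin sqfamD(6)[OF c] intro: sqfam_Idn[OF c])
  moreover have "is_functor (SV (grid p q)) (fH (fam_fun G p q c)) (fC (fam_fun G p q c)) (SV G)"
  proof (rule is_functorI; clarsimp simp: fam_fun_def)
    fix i j a b assume "i \<le> j" "j \<le> p" "a \<le> b" "b \<le> q"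
    then show "Dom (SV G) (c j i b a) = Dom (SV G) (c j i b b)" "Cod (SV G) (c j i b a) = Dom (SV G) (c j i a a)"
      by (intro sqfamD(4,5)[OF c]; simp)+
  qed (auto simp: cin sqfamD(7)[OF c] intro: sqfam_Idn_V[OF c])
  ultimately show ?thesis by (simp add: dbl_homs_def) (simp add: fam_fun_def)
qed

end

lemma dbl_homsD:
  assumes "F \<in> dbl_homs D E"
  shows "is_functor (HC D) (fO F) (fH F) (HC E)" "is_functor (VC D) (fO F) (fV F) (VC E)"
    "is_functor (SH D) (fV F) (fC F) (SH E)" "is_functor (SV D) (fH F) (fC F) (SV E)"
    "fO F \<in> extensional (Obj (HC D))" "fH F \<in> extensional (Arr (HC D))"
    "fV F \<in> extensional (Arr (VC D))" "fC F \<in> extensional (Arr (SH D))"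
  using assms by (auto simp: dbl_homs_def)

lemma dbl_homs_eqI:
  assumes "F \<in> dbl_homs D E" "F' \<in> dbl_homs D E'"
    "\<And>a. a \<in> Obj (HC D) \<Longrightarrow> fO F a = fO F' a" "\<And>f. f \<in> Arr (HC D) \<Longrightarrow> fH F f = fH F' f"
    "\<And>u. u \<in> Arr (VC D) \<Longrightarrow> fV F u = fV F' u" "\<And>x. x \<in> Arr (SH D) \<Longrightarrow> fC F x = fC F' x"
  shows "F = F'"
proof -
  have "fO F = fO F'" "fH F = fH F'" "fV F = fV F'" "fC F = fC F'"
    using dbl_homsD(5-8)[OF assms(1)] dbl_homsD(5-8)[OF assms(2)] assms(3-) by (auto intro: extensionalityI)
  then show ?thesis by (cases F; cases F') simp
qed

context dgp begin

text \<open>Compatibility of the arms: squares starting in the same row end in the same vertical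
  edge over the base column, and squares starting in the same column end in the same horizontal edge
  over the base row.\<close>

definition star :: "nat \<Rightarrow> nat \<Rightarrow> (nat \<Rightarrow> nat \<Rightarrow> 'c) \<Rightarrow> bool" where
  "star p q S \<longleftrightarrow> (\<forall>i\<le>p. \<forall>j\<le>q. S i j \<in> Arr (SH G) \<and>
    (\<forall>i'\<le>p. Cod (SH G) (S i' j) = Cod (SH G) (S i j)) \<and> (\<forall>j'\<le>q. Cod (SV G) (S i j') = Cod (SV G) (S i j)))"

text \<open>The horizontal quotients compose by cancellation. Interchange carries this over to their
  vertical quotients, because vertical inversion respects horizontal composition. Vertical
  composition is cancellation alone.\<close>

lemma star_sqfam:
  assumes S: "star p q S"
  shows "sqfam G p q (star_fam G S)"
proof -
  define Q where "Q i i' j = Cmp (SH G) (ginv (SH G) (S i' j)) (S i j)" for i i' j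
  have Sin: "S i j \<in> Arr (SH G)" if "i \<le> p" "j \<le> q" for i j using S that unfolding star_def by blast
  define U where "U i = Cod (SV G) (S i 0)" for i
  define W where "W j = Cod (SH G) (S 0 j)" for j
  have Sh: "Cod (SH G) (S i j) = W j" if "i \<le> p" "j \<le> q" for i j
    using S that unfolding star_def W_def by blast
  have Sv: "Cod (SV G) (S i j) = U i" if "i \<le> p" "j \<le> q" for i j
    using S that unfolding star_def U_def by blast
  have Qin: "Q i i' j \<in> Arr (SH G)" "Dom (SH G) (Q i i' j) = Dom (SH G) (S i j)"
    "Cod (SH G) (Q i i' j) = Dom (SH G) (S i' j)"
    "Dom (SV G) (Q i i' j) = Cmp (HC G) (ginv (HC G) (Dom (SV G) (S i' j))) (Dom (SV G) (S i j))"
    "Cod (SV G) (Q i i' j) = Cmp (HC G) (ginv (HC G) (U i')) (U i)"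
    if "i \<le> p" "i' \<le> p" "j \<le> q" for i i' j
    using that by (simp_all add: Q_def Sin Sh Sv)
  have QQ: "Cmp (SH G) (Q i' i'' j) (Q i i' j) = Q i i'' j" if "i \<le> p" "i' \<le> p" "i'' \<le> p" "j \<le> q" for i i' i'' j
    using that by (simp add: Q_def Sin Sh SH.assoc)
  have E: "star_fam G S i i' j j' = Cmp (SV G) (ginv (SV G) (Q i i' j')) (Q i i' j)" for i i' j j'
    by (simp add: star_fam_def Q_def Let_def)
  have hcomp: "Cmp (SH G) (Cmp (SV G) (ginv (SV G) (Q i' i'' j')) (Q i' i'' j)) (Cmp (SV G) (ginv (SV G) (Q i i' j')) (Q i i' j))
     = Cmp (SV G) (ginv (SV G) (Q i i'' j')) (Q i i'' j)"
    if "i \<le> p" "i' \<le> p" "i'' \<le> p" "j \<le> q" "j' \<le> q" for i i' i'' j j'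
  proof -
    have "Cmp (SH G) (Cmp (SV G) (ginv (SV G) (Q i' i'' j')) (Q i' i'' j)) (Cmp (SV G) (ginv (SV G) (Q i i' j')) (Q i i' j))
      = Cmp (SV G) (Cmp (SH G) (ginv (SV G) (Q i' i'' j')) (ginv (SV G) (Q i i' j'))) (Cmp (SH G) (Q i' i'' j) (Q i i' j))"
      by (rule interchange[symmetric]) (use that in \<open>simp_all add: Qin\<close>)
    also have "Cmp (SH G) (ginv (SV G) (Q i' i'' j')) (ginv (SV G) (Q i i' j')) = ginv (SV G) (Q i i'' j')"
      using ginv_Cmp_SH[of "Q i' i'' j'" "Q i i' j'"] that by (simp add: Qin QQ)
    finally show ?thesis using that by (simp add: QQ)
  qed
  show ?thesis unfolding sqfam_def E
  proof (intro allI impI conjI)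
    fix i i' j j' assume *: "i \<le> p" "i' \<le> p" "j \<le> q" "j' \<le> q"
    let ?E = "\<lambda>i i' j j'. Cmp (SV G) (ginv (SV G) (Q i i' j')) (Q i i' j)"
    show "?E i i' j j' \<in> Arr (SH G)" "Dom (SH G) (?E i i' j j') = Dom (SH G) (?E i i j j')"
      "Cod (SH G) (?E i i' j j') = Dom (SH G) (?E i' i' j j')" "Dom (SV G) (?E i i' j j') = Dom (SV G) (?E i i' j j)"
      "Cod (SV G) (?E i i' j j') = Dom (SV G) (?E i i' j' j')" using * by (simp_all add: Qin corners Sin Sh)
    show "Cmp (SH G) (?E i' i'' j j') (?E i i' j j') = ?E i i'' j j'" if "i'' \<le> p" for i''
      using hcomp that * by blast
    show "Cmp (SV G) (?E i i' j' j'') (?E i i' j j') = ?E i i' j j''" if "j'' \<le> q" for j''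
      using that * by (simp add: Qin SV.assoc)
  qed
qed

text \<open>Naming the edges by functions \<open>v\<close> and \<open>h\<close> avoids rewriting
  with the boundary equations of \<open>sqfamD\<close>, whose right-hand sides are again instances
  of their left-hand sides.\<close>

lemma sqfam_edges:
  assumes c: "sqfam G p q c"
  obtains v h where
    "\<And>i i' j j'. i \<le> p \<Longrightarrow> i' \<le> p \<Longrightarrow> j \<le> q \<Longrightarrow> j' \<le> q \<Longrightarrow> Dom (SH G) (c i i' j j') = v i j j'"
    "\<And>i i' j j'. i \<le> p \<Longrightarrow> i' \<le> p \<Longrightarrow> j \<le> q \<Longrightarrow> j' \<le> q \<Longrightarrow> Cod (SH G) (c i i' j j') = v i' j j'"
    "\<And>i i' j j'. i \<le> p \<Longrightarrow> i' \<le> p \<Longrightarrow> j \<le> q \<Longrightarrow> j' \<le> q \<Longrightarrow> Dom (SV G) (c i i' j j') = h i i' j"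
    "\<And>i i' j j'. i \<le> p \<Longrightarrow> i' \<le> p \<Longrightarrow> j \<le> q \<Longrightarrow> j' \<le> q \<Longrightarrow> Cod (SV G) (c i i' j j') = h i i' j'"
  by (rule that[of "\<lambda>i j j'. Dom (SH G) (c i i j j')" "\<lambda>i i' j. Dom (SV G) (c i i' j j)"])
    ((rule sqfamD(2-5)[OF c]; assumption)+)

text \<open>Closure under composition expresses an arm through the desired square and another arm,
  so division recovers the square. The base vertex \<open>(k, l)\<close> may lie on any side of the
  indices.\<close>

lemma star_of_fam:
  assumes c: "sqfam G p q c" and k: "k \<le> p" "l \<le> q" and ij: "i \<le> p" "i' \<le> p" "j \<le> q" "j' \<le> q"
  shows "star_fam G (\<lambda>i j. c i k j l) i i' j j' = c i i' j j'"
proof -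
  obtain v h where e: "\<And>i i' j j'. i \<le> p \<Longrightarrow> i' \<le> p \<Longrightarrow> j \<le> q \<Longrightarrow> j' \<le> q \<Longrightarrow> Dom (SH G) (c i i' j j') = v i j j'"
    "\<And>i i' j j'. i \<le> p \<Longrightarrow> i' \<le> p \<Longrightarrow> j \<le> q \<Longrightarrow> j' \<le> q \<Longrightarrow> Cod (SH G) (c i i' j j') = v i' j j'"
    "\<And>i i' j j'. i \<le> p \<Longrightarrow> i' \<le> p \<Longrightarrow> j \<le> q \<Longrightarrow> j' \<le> q \<Longrightarrow> Dom (SV G) (c i i' j j') = h i i' j"
    "\<And>i i' j j'. i \<le> p \<Longrightarrow> i' \<le> p \<Longrightarrow> j \<le> q \<Longrightarrow> j' \<le> q \<Longrightarrow> Cod (SV G) (c i i' j j') = h i i' j'"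
    by (rule sqfam_edges[OF c]) (rule that; simp)
  have Q: "Cmp (SH G) (ginv (SH G) (c i' k j l)) (c i k j l) = c i i' j l" if "j \<le> q" for j
    by (rule SH.ginv_solve) (use that k ij sqfamD(1,6)[OF c] in \<open>simp_all add: e\<close>)
  have "Cmp (SV G) (ginv (SV G) (c i i' j' l)) (c i i' j l) = c i i' j j'"
    by (rule SV.ginv_solve) (use k ij sqfamD(1,7)[OF c] in \<open>simp_all add: e\<close>)
  then show ?thesis using ij by (simp add: star_fam_def Q)
qed

lemma grid_funD:
  assumes "x \<in> dbl_homs (grid p q) G"
  shows "i \<le> j \<Longrightarrow> j \<le> p \<Longrightarrow> a \<le> b \<Longrightarrow> b \<le> q \<Longrightarrow> fC x ((i, j), (a, b)) \<in> Arr (SH G)"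
    "i \<le> j \<Longrightarrow> j \<le> p \<Longrightarrow> a \<le> b \<Longrightarrow> b \<le> q \<Longrightarrow> Dom (SH G) (fC x ((i, j), (a, b))) = fV x (j, (a, b))"
    "i \<le> j \<Longrightarrow> j \<le> p \<Longrightarrow> a \<le> b \<Longrightarrow> b \<le> q \<Longrightarrow> Cod (SH G) (fC x ((i, j), (a, b))) = fV x (i, (a, b))"
    "i \<le> j \<Longrightarrow> j \<le> p \<Longrightarrow> a \<le> b \<Longrightarrow> b \<le> q \<Longrightarrow> Dom (SV G) (fC x ((i, j), (a, b))) = fH x ((i, j), b)"
    "i \<le> j \<Longrightarrow> j \<le> p \<Longrightarrow> a \<le> b \<Longrightarrow> b \<le> q \<Longrightarrow> Cod (SV G) (fC x ((i, j), (a, b))) = fH x ((i, j), a)"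
    "i \<le> j \<Longrightarrow> j \<le> k \<Longrightarrow> k \<le> p \<Longrightarrow> a \<le> b \<Longrightarrow> b \<le> q \<Longrightarrow>
      Cmp (SH G) (fC x ((i, j), (a, b))) (fC x ((j, k), (a, b))) = fC x ((i, k), (a, b))"
    "i \<le> j \<Longrightarrow> j \<le> p \<Longrightarrow> a \<le> b \<Longrightarrow> b \<le> d \<Longrightarrow> d \<le> q \<Longrightarrow>
      Cmp (SV G) (fC x ((i, j), (a, b))) (fC x ((i, j), (b, d))) = fC x ((i, j), (a, d))"
    "i \<le> j \<Longrightarrow> j \<le> p \<Longrightarrow> a \<le> q \<Longrightarrow> Dom (HC G) (fH x ((i, j), a)) = fO x (j, a)"
  using is_functorD(2,3,4)[OF dbl_homsD(3)[OF assms], of "((i, j), (a, b))"]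
    is_functorD(3,4)[OF dbl_homsD(4)[OF assms], of "((i, j), (a, b))"]
    is_functorD(6)[OF dbl_homsD(3)[OF assms], of "((i, j), (a, b))" "((j, k), (a, b))"]
    is_functorD(6)[OF dbl_homsD(4)[OF assms], of "((i, j), (a, b))" "((i, j), (b, d))"]
    is_functorD(3)[OF dbl_homsD(1)[OF assms], of "((i, j), a)"]
  by auto

lemma fam_star:
  assumes x: "x \<in> dbl_homs (grid p q) G"
  shows "star p q (\<lambda>i j. fC x ((0, i), (0, j)))"
  unfolding star_def by (simp add: grid_funD[OF x])

lemma fam_sqfam: "x \<in> dbl_homs (grid p q) G \<Longrightarrow> sqfam G p q (fam G x)"
  unfolding fam_def by (intro star_sqfam fam_star)

text \<open>Functoriality of \<open>x\<close> writes an arm as a composite containing the cell in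
  question, which division then recovers; so \<open>fam G x\<close> extends \<open>x\<close> to
  unordered indices.\<close>

lemma fam_le:
  assumes x: "x \<in> dbl_homs (grid p q) G" and ij: "i' \<le> i" "i \<le> p" "j' \<le> j" "j \<le> q"
  shows "fam G x i i' j j' = fC x ((i', i), (j', j))"
proof -
  have Q: "Cmp (SH G) (ginv (SH G) (fC x ((0, i'), (0, j)))) (fC x ((0, i), (0, j))) = fC x ((i', i), (0, j))" if "j \<le> q" for j
    by (rule SH.ginv_solve) (use that ij in \<open>simp_all add: grid_funD[OF x]\<close>)
  have "Cmp (SV G) (ginv (SV G) (fC x ((i', i), (0, j')))) (fC x ((i', i), (0, j))) = fC x ((i', i), (j', j))"
    by (rule SV.ginv_solve) (use ij in \<open>simp_all add: grid_funD[OF x]\<close>)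
  then show ?thesis using ij by (simp add: fam_def star_fam_def Q)
qed

lemma fam_fun_fam:
  assumes x: "x \<in> dbl_homs (grid p q) G"
  shows "fam_fun G p q (fam G x) = x"
  by (rule dbl_homs_eqI[OF fam_fun_in[OF fam_sqfam[OF x]] x])
    (auto simp: fam_fun_def fam_le[OF x] grid_funD[OF x])

lemma fam_fun_cong:
  assumes "\<And>i i' j j'. i \<le> p \<Longrightarrow> i' \<le> p \<Longrightarrow> j \<le> q \<Longrightarrow> j' \<le> q \<Longrightarrow> c i i' j j' = d i i' j j'"
  shows "fam_fun G p q c = fam_fun G p q d"
  using assms by (auto simp: fam_fun_def fun_eq_iff restrict_def)

lemma fam_fam_fun:
  assumes c: "sqfam G p q c" and ij: "i \<le> p" "i' \<le> p" "j \<le> q" "j' \<le> q"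
  shows "fam G (fam_fun G p q c) i i' j j' = c i i' j j'"
proof -
  have "fam G (fam_fun G p q c) i i' j j' = star_fam G (\<lambda>i j. c i 0 j 0) i i' j j'"
    using ij by (simp add: fam_def fam_fun_def star_fam_def)
  then show ?thesis using star_of_fam[OF c _ _ ij, of 0 0] by simp
qed

lemma sqfam_pull:
  assumes "sqfam G p q c" "\<alpha> \<in> ops m p" "\<beta> \<in> ops n q"
  shows "sqfam G m n (\<lambda>i i' j j'. c (\<alpha> i) (\<alpha> i') (\<beta> j) (\<beta> j'))"
  unfolding sqfam_def
  by (intro allI impI conjI; rule sqfamD[OF assms(1)]; rule ops_le[OF assms(2)] ops_le[OF assms(3)]; assumption)

text \<open>On families, simplicial operators act by reindexing all four arguments, so the presheaf
  laws for the nerve reduce to substitution.\<close>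

lemma bact_fam_fun:
  assumes "\<alpha> \<in> ops m p" "\<beta> \<in> ops n q"
  shows "bact (Nerve G) m n p q \<alpha> \<beta> (fam_fun G p q c) = fam_fun G m n (\<lambda>i i' j j'. c (\<alpha> i) (\<alpha> i') (\<beta> j) (\<beta> j'))"
  using ops_le[OF assms(1)] ops_le[OF assms(2)] ops_mono[OF assms(1)] ops_mono[OF assms(2)]
  by (auto simp: Nerve_def fam_fun_def dbl_comp_def grid_map_def compose_def fun_eq_iff restrict_def)

lemma bact_fam:
  assumes "x \<in> dbl_homs (grid p q) G" "\<alpha> \<in> ops m p" "\<beta> \<in> ops n q"
  shows "bact (Nerve G) m n p q \<alpha> \<beta> x = fam_fun G m n (\<lambda>i i' j j'. fam G x (\<alpha> i) (\<alpha> i') (\<beta> j) (\<beta> j'))"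
  using bact_fam_fun[OF assms(2,3), of "fam G x"] by (simp add: fam_fun_fam[OF assms(1)])

lemma bact_Nerve_in:
  assumes "x \<in> dbl_homs (grid p q) G" "\<alpha> \<in> ops m p" "\<beta> \<in> ops n q"
  shows "bact (Nerve G) m n p q \<alpha> \<beta> x \<in> dbl_homs (grid m n) G"
  unfolding bact_fam[OF assms] by (rule fam_fun_in[OF sqfam_pull[OF fam_sqfam[OF assms(1)] assms(2,3)]])

lemma fam_bact:
  assumes "x \<in> dbl_homs (grid p q) G" "\<alpha> \<in> ops m p" "\<beta> \<in> ops n q" "i \<le> m" "i' \<le> m" "j \<le> n" "j' \<le> n"
  shows "fam G (bact (Nerve G) m n p q \<alpha> \<beta> x) i i' j j' = fam G x (\<alpha> i) (\<alpha> i') (\<beta> j) (\<beta> j')"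
  unfolding bact_fam[OF assms(1-3)]
  by (rule fam_fam_fun[OF sqfam_pull[OF fam_sqfam[OF assms(1)] assms(2,3)] assms(4-7)])

lemma bisimplicial_Nerve: "bisimplicial_set (Nerve G)"
  unfolding bisimplicial_set_def
proof (intro conjI allI ballI funcsetI)
  show "bact (Nerve G) m n p q \<alpha> \<beta> x \<in> bisimps (Nerve G) m n"
    if "\<alpha> \<in> ops m p" "\<beta> \<in> ops n q" "x \<in> bisimps (Nerve G) p q" for m n p q \<alpha> \<beta> x
    using bact_Nerve_in that by (simp add: Nerve_def)
  show "bact (Nerve G) p q p q (idop p) (idop q) x = x" if "x \<in> bisimps (Nerve G) p q" for p q x
  proof -
    have x: "x \<in> dbl_homs (grid p q) G" using that by (simp add: Nerve_def)
    have "bact (Nerve G) p q p q (idop p) (idop q) x = fam_fun G p q (fam G x)"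
      unfolding bact_fam[OF x idop_ops idop_ops] by (rule fam_fun_cong) simp
    then show ?thesis by (simp add: fam_fun_fam[OF x])
  qed
  fix i j m n p q \<alpha>' \<beta>' \<alpha> \<beta> x
  assume *: "\<alpha>' \<in> ops i m" "\<beta>' \<in> ops j n" "\<alpha> \<in> ops m p" "\<beta> \<in> ops n q" "x \<in> bisimps (Nerve G) p q"
  then have x: "x \<in> dbl_homs (grid p q) G" by (simp add: Nerve_def)
  show "bact (Nerve G) i j m n \<alpha>' \<beta>' (bact (Nerve G) m n p q \<alpha> \<beta> x) =
      bact (Nerve G) i j p q (compose {..i} \<alpha> \<alpha>') (compose {..j} \<beta> \<beta>') x"
    unfolding bact_fam[OF x *(3,4)] bact_fam[OF x compose_ops[OF *(1,3)] compose_ops[OF *(2,4)]] bact_fam_fun[OF *(1,2)]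
    by (rule fam_fun_cong) simp
qed

text \<open>A star is compatible with a bisimplex over an operator pair reaching its centre as soon as
  both agree on the arms; then the filler built from the star restricts to that bisimplex.\<close>

lemma star_filler:
  assumes S: "star p q S" and "\<alpha> \<in> ops m p" "\<beta> \<in> ops n q" and y: "y \<in> dbl_homs (grid m n) G"
    and k: "k0 \<le> m" "l0 \<le> n" and yS: "\<And>i j. i \<le> m \<Longrightarrow> j \<le> n \<Longrightarrow> fam G y i k0 j l0 = S (\<alpha> i) (\<beta> j)"
  shows "bact (Nerve G) m n p q \<alpha> \<beta> (fam_fun G p q (star_fam G S)) = y"
proof -
  have "fam_fun G m n (\<lambda>i i' j j'. star_fam G S (\<alpha> i) (\<alpha> i') (\<beta> j) (\<beta> j')) = fam_fun G m n (fam G y)"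
  proof (rule fam_fun_cong)
    fix i i' j j' assume ij: "i \<le> m" "i' \<le> m" "j \<le> n" "j' \<le> n"
    have "fam G y i i' j j' = star_fam G (\<lambda>i j. fam G y i k0 j l0) i i' j j'"
      using star_of_fam[OF fam_sqfam[OF y] k ij] by simp
    also have "\<dots> = star_fam G S (\<alpha> i) (\<alpha> i') (\<beta> j) (\<beta> j')"
      using ij by (simp add: star_fam_def yS)
    finally show "star_fam G S (\<alpha> i) (\<alpha> i') (\<beta> j) (\<beta> j') = fam G y i i' j j'" by simp
  qed
  then show ?thesis unfolding bact_fam_fun[OF assms(2,3)] fam_fun_fam[OF y] .
qed

lemma star_fill_in: "star p q S \<Longrightarrow> fam_fun G p q (star_fam G S) \<in> dbl_homs (grid p q) G"
  by (intro fam_fun_in star_sqfam)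

end

text \<open>An arm of a star joins \<open>i\<close> to the centre \<open>k\<close>, which may lie on
  either side, whereas operators are monotone. So the edge is taken in increasing order, and
  \<open>pos i k\<close> tells which end is \<open>i\<close>; for \<open>i = k\<close> both
  positions are \<open>0\<close>.\<close>

definition edge2 :: "nat \<Rightarrow> nat \<Rightarrow> nat \<Rightarrow> nat" where
  "edge2 i k = edge_op (min i k, max i k)"

definition pos :: "nat \<Rightarrow> nat \<Rightarrow> nat" where
  "pos i k = (if i \<le> k then 0 else 1)"

lemma pos_le [simp]: "pos i k \<le> 1" by (simp add: pos_def)

lemma edge2_ops [simp]: "i \<le> n \<Longrightarrow> k \<le> n \<Longrightarrow> edge2 i k \<in> ops 1 n"
  by (simp add: edge2_def)

lemma edge2_pos [simp]: "edge2 i k (pos i k) = i" "edge2 i k (pos k i) = k"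
  by (auto simp: edge2_def pos_def edge_op_def)

lemma edge2_compose:
  assumes "\<alpha> \<in> ops m n" "i \<le> m" "k \<le> m"
  shows "compose {..1} \<alpha> (edge2 i k) = edge2 (\<alpha> i) (\<alpha> k)"
proof (rule ops_eqI[of _ 1])
  fix j :: nat assume "j \<le> 1"
  then show "compose {..1} \<alpha> (edge2 i k) j = edge2 (\<alpha> i) (\<alpha> k) j"
    using ops_mono[OF assms(1), of i k] ops_mono[OF assms(1), of k i] assms
    by (auto simp: le_num edge2_def edge_op_def min_def max_def)
qed (auto simp: edge2_def edge_op_def)

lemma pos_inj: "(i \<le> k \<longleftrightarrow> i' \<le> k') \<Longrightarrow> pos i k = pos i' k'"
  by (simp add: pos_def)

lemma coface_le_iff: "1 \<le> n \<Longrightarrow> i \<le> n - 1 \<Longrightarrow> k \<le> n - 1 \<Longrightarrow> coface n a i \<le> coface n a k \<longleftrightarrow> i \<le> k"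
  by (auto simp: coface_def)

text \<open>The vertex \<open>k\<close> lies in every face other than the one opposite to it, so
  each face of the horn contains the centre of the star.\<close>

lemma coface_hits:
  assumes "k \<le> n" "k \<noteq> a" "a \<le> n"
  obtains k0 where "k0 \<le> n - 1" "coface n a k0 = k"
  by (rule that[of "if k < a then k else k - 1"]) (use assms in \<open>auto simp: coface_def\<close>)

lemma compose_vertex_op: "compose {..0} \<alpha> (vertex_op i) = vertex_op (\<alpha> i)"
  by (auto simp: fun_eq_iff compose_def vertex_op_def restrict_def)

lemma compose_edge_op: "compose {..1} \<alpha> (edge_op e) = edge_op (\<alpha> (fst e), \<alpha> (snd e))"
  by (auto simp: fun_eq_iff compose_def edge_op_def restrict_def)

lemma vertex_omits: "1 \<le> n \<Longrightarrow> \<exists>a\<le>n. a \<noteq> k \<and> a \<notin> vertex_op k ` {..0}"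
  by (rule exI[of _ "if k = 0 then 1 else 0"]) auto

text \<open>In dimension at least two some vertex other than \<open>k\<close> is off the edge from
  \<open>i\<close> to \<open>k\<close>, so all arms of the star at \<open>k\<close> belong to the
  horn. This is the origin of the case distinctions on the dimension below.\<close>

lemma edge2_omits:
  assumes "2 \<le> n" obtains a where "a \<le> n" "a \<noteq> k" "a \<notin> edge2 i k ` {..1}"
proof -
  have "\<exists>a. a \<le> (2::nat) \<and> a \<noteq> k \<and> a \<noteq> i" by presburger
  then obtain a where "a \<le> (2::nat)" "a \<noteq> k" "a \<noteq> i" by blast
  moreover have "edge2 i k j = i \<or> edge2 i k j = k" if "j \<le> 1" for j
    using that by (auto simp: edge2_def edge_op_def min_def max_def)
  ultimately have "a \<notin> edge2 i k ` {..1}" by (metis atMost_iff imageE)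
  then show thesis using that[of a] assms \<open>a \<le> 2\<close> \<open>a \<noteq> k\<close> by simp
qed

section \<open>The Kan condition for the rows of the nerve\<close>

context dgp begin

text \<open>The star is centred at column \<open>k\<close> and row \<open>0\<close>; any row would
  do, as each simplex of the horn has the full height \<open>q\<close>. Once the faces of the filler
  are right, the rest of the horn follows by factoring through a face.\<close>

lemma Kan_hrow_Nerve: "Kan (hrow (Nerve G) q)"
  unfolding Kan_def
proof (intro conjI allI impI ballI)
  show "simplicial_set (hrow (Nerve G) q)" by (rule simplicial_set_hrow[OF bisimplicial_Nerve])
  fix n k f assume nk: "1 \<le> n \<and> k \<le> n" and f: "f \<in> sset_homs (Horn k n) (hrow (Nerve G) q)"
  have n: "1 \<le> n" and k: "k \<le> n" using nk by auto
  have fin: "f m x \<in> dbl_homs (grid m q) G" if "x \<in> simps (Horn k n) m" for m x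
    using sset_hom_in[OF f that] by (simp add: hrow_def Nerve_def)
  have fact: "f l (compose {..l} x \<alpha>) = bact (Nerve G) l q m q \<alpha> (idop q) (f m x)"
    if "x \<in> simps (Horn k n) m" "\<alpha> \<in> ops l m" for l m x \<alpha>
    using sset_hom_act[OF f that(2,1)] by (simp add: hrow_def)
  have "\<exists>X\<in>dbl_homs (grid n q) G. \<forall>a\<le>n. a \<noteq> k \<longrightarrow>
      bact (Nerve G) (n - 1) q n q (coface n a) (idop q) X = f (n - 1) (coface n a)"
  proof (cases "n = 1")
    case True
    \<comment> \<open>In dimension one the only face of the horn is the vertex \<open>k\<close>, and
      the degeneracy of its value is a filler.\<close>
    define z where "z = f 0 (vertex_op k)"
    have vk: "vertex_op k \<in> simps (Horn k n) 0" unfolding simps_Horn[OF n] using vertex_omits[OF n] k by simp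
    have z: "z \<in> dbl_homs (grid 0 q) G" using fin[OF vk] by (simp add: z_def)
    define X where "X = bact (Nerve G) 1 q 0 q (codeg 0 0) (idop q) z"
    have X: "X \<in> dbl_homs (grid 1 q) G" unfolding X_def by (rule bact_Nerve_in[OF z]) simp_all
    have "bact (Nerve G) 0 q 1 q (coface 1 a) (idop q) X = f 0 (coface 1 a)" if "a \<le> 1" "a \<noteq> k" for a
    proof -
      have c: "coface 1 a = vertex_op k" using that k True
        by (intro ops_eqI[of _ 0]) (auto simp: coface_def vertex_op_def)
      have "bact (Nerve G) 0 q 1 q (coface 1 a) (idop q) X =
          bact (Nerve G) 0 q 0 q (compose {..0} (codeg 0 0) (coface 1 a)) (compose {..q} (idop q) (idop q)) z"
        unfolding X_def by (rule bact_bact[OF bisimplicial_Nerve]) (use that z in \<open>simp_all add: Nerve_def\<close>)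
      also have "compose {..0} (codeg 0 0) (coface 1 a) = idop 0"
        by (rule ops_eqI[of _ 0]) (use that in \<open>auto simp: coface_def codeg_def idop_def compose_def\<close>)
      also have "bact (Nerve G) 0 q 0 q (idop 0) (compose {..q} (idop q) (idop q)) z = z"
        using bact_id[OF bisimplicial_Nerve, of z 0 q] z compose_idop_left[OF idop_ops[of q]] by (simp add: Nerve_def)
      finally show ?thesis by (simp add: z_def c)
    qed
    then show ?thesis using X True by auto
  next
    case False
    then have n2: "2 \<le> n" using n by simp
    define S where "S i j = fam G (f 1 (edge2 i k)) (pos i k) (pos k i) j 0" for i j
    have e: "edge2 i k \<in> simps (Horn k n) 1" if "i \<le> n" for i
      unfolding simps_Horn[OF n] using edge2_omits[OF n2, of k i] that k by auto
    have vk: "vertex_op k \<in> simps (Horn k n) 0" unfolding simps_Horn[OF n] using vertex_omits[OF n] k by simp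
    have Cod: "Cod (SH G) (S i j) = Dom (SH G) (fam G (f 0 (vertex_op k)) 0 0 j 0)"
      "Cod (SV G) (S i j) = Cod (SV G) (S i 0)" "S i j \<in> Arr (SH G)" if "i \<le> n" "j \<le> q" for i j
    proof -
      note y = fam_sqfam[OF fin[OF e[OF that(1)]]]
      have "compose {..0} (edge2 i k) (vertex_op (pos k i)) = vertex_op k"
        by (simp only: compose_vertex_op edge2_pos)
      then have "f 0 (vertex_op k) = bact (Nerve G) 0 q 1 q (vertex_op (pos k i)) (idop q) (f 1 (edge2 i k))"
        using fact[OF e[OF that(1)], of "vertex_op (pos k i)" 0] by (simp del: atMost_0)
      then have "fam G (f 0 (vertex_op k)) 0 0 j 0 = fam G (f 1 (edge2 i k)) (pos k i) (pos k i) j 0"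
        using fam_bact[OF fin[OF e[OF that(1)]], of "vertex_op (pos k i)" 0 "idop q" q 0 0 j 0] that by simp
      then show "Cod (SH G) (S i j) = Dom (SH G) (fam G (f 0 (vertex_op k)) 0 0 j 0)"
        unfolding S_def using sqfamD(3)[OF y, of "pos i k" "pos k i" j 0] that by simp
      show "Cod (SV G) (S i j) = Cod (SV G) (S i 0)" "S i j \<in> Arr (SH G)"
        unfolding S_def using sqfamD(1,5)[OF y, of "pos i k" "pos k i" j 0] sqfamD(5)[OF y, of "pos i k" "pos k i" 0 0] that
        by simp_all
    qed
    have S: "star n q S" unfolding star_def using Cod(1,3) Cod(2) by metis
    have "bact (Nerve G) (n - 1) q n q (coface n a) (idop q) (fam_fun G n q (star_fam G S)) = f (n - 1) (coface n a)"
      if a: "a \<le> n" "a \<noteq> k" for a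
    proof -
      obtain k0 where k0: "k0 \<le> n - 1" "coface n a k0 = k" using coface_hits[OF k _ a(1)] a by blast
      have ca: "coface n a \<in> ops (n - 1) n" using a n by simp
      have mem: "coface n a \<in> simps (Horn k n) (n - 1)" unfolding simps_Horn[OF n] using ca a coface_omits by blast
      show ?thesis
      proof (rule star_filler[OF S ca idop_ops fin[OF mem] k0(1), of 0])
        fix i j assume ij: "i \<le> n - 1" "j \<le> q"
        have "f 1 (edge2 (coface n a i) k) = bact (Nerve G) 1 q (n - 1) q (edge2 i k0) (idop q) (f (n - 1) (coface n a))"
          using fact[OF mem edge2_ops[OF ij(1) k0(1)]] edge2_compose[OF ca ij(1) k0(1)] k0 by simp
        \<comment> \<open>Cofaces preserve and reflect the order, so \<open>i\<close> and the centre
          have the same relative position in the face and in the full simplex.\<close>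
        moreover have "pos (coface n a i) k = pos i k0" "pos k (coface n a i) = pos k0 i"
          using coface_le_iff[OF n, of i k0 a] coface_le_iff[OF n, of k0 i a] ij k0 by (auto intro!: pos_inj)
        ultimately have "S (coface n a i) j = fam G (f (n - 1) (coface n a)) i k0 j 0"
          unfolding S_def using fam_bact[OF fin[OF mem] edge2_ops[OF ij(1) k0(1)] idop_ops, of "pos i k0" "pos k0 i" j 0] ij by simp
        then show "fam G (f (n - 1) (coface n a)) i k0 j 0 = S (coface n a i) (idop q j)" using ij by simp
      qed simp
    qed
    then show ?thesis using star_fill_in[OF S] by blast
  qed
  then obtain X where X: "X \<in> dbl_homs (grid n q) G" "\<And>a. a \<le> n \<Longrightarrow> a \<noteq> k \<Longrightarrow>
      bact (Nerve G) (n - 1) q n q (coface n a) (idop q) X = f (n - 1) (coface n a)" by blast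
  define g where "g m = (\<lambda>\<alpha>\<in>ops m n. bact (Nerve G) m q n q \<alpha> (idop q) X)" for m
  show "\<exists>g\<in>sset_homs (Delta n) (hrow (Nerve G) q). \<forall>m. \<forall>x\<in>simps (Horn k n) m. g m x = f m x"
  proof (intro bexI[of _ g] allI ballI)
    fix m \<alpha> assume "\<alpha> \<in> simps (Horn k n) m"
    then obtain a where a: "\<alpha> \<in> ops m n" "a \<le> n" "a \<noteq> k" "a \<notin> \<alpha> ` {..m}" unfolding simps_Horn[OF n] by blast
    have ca: "coface n a \<in> ops (n - 1) n" using a n by simp
    have mem: "coface n a \<in> simps (Horn k n) (n - 1)" unfolding simps_Horn[OF n] using ca a coface_omits by blast
    note o = omit_ops[OF a(1,4,2)] and co = coface_omit[OF a(1,4,2)]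
    have "g m \<alpha> = bact (Nerve G) m q n q (compose {..m} (coface n a) (omit a m \<alpha>)) (compose {..q} (idop q) (idop q)) X"
      using a co compose_idop_left[OF idop_ops[of q]] by (simp add: g_def)
    also have "\<dots> = bact (Nerve G) m q (n - 1) q (omit a m \<alpha>) (idop q) (f (n - 1) (coface n a))"
      unfolding X(2)[OF a(2,3), symmetric]
      by (rule bact_bact[OF bisimplicial_Nerve, symmetric]) (use o ca X in \<open>simp_all add: Nerve_def\<close>)
    also have "\<dots> = f m \<alpha>" using fact[OF mem o] co by simp
    finally show "g m \<alpha> = f m \<alpha>" .
  next
    show "g \<in> sset_homs (Delta n) (hrow (Nerve G) q)"
      unfolding sset_homs_def
    proof (intro CollectI conjI allI ballI PiE_I)
      show "g m x \<in> simps (hrow (Nerve G) q) m" if "x \<in> simps (Delta n) m" for m x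
        using bact_Nerve_in[OF X(1), of x m "idop q" q] that by (simp add: g_def hrow_def Nerve_def)
      show "g m x = undefined" if "x \<notin> simps (Delta n) m" for m x using that by (simp add: g_def)
      show "g l (sact (Delta n) l m \<alpha> x) = sact (hrow (Nerve G) q) l m \<alpha> (g m x)"
        if "\<alpha> \<in> ops l m" "x \<in> simps (Delta n) m" for l m \<alpha> x
        using that bact_bact[OF bisimplicial_Nerve, of \<alpha> l m "idop q" q q x n "idop q" q X] X(1)
          compose_idop_left[OF idop_ops[of q]]
        by (simp add: g_def hrow_def) (simp add: Nerve_def)
    qed
  qed
qed

end

lemma bisimplicial_tr: "bisimplicial_set K \<Longrightarrow> bisimplicial_set (tr K)"
  unfolding bisimplicial_set_def[of "tr K"]
  by (intro conjI allI ballI funcsetI) (simp_all add: bact_in bact_id bact_bact)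

text \<open>Columns of \<open>Nerve G\<close> and rows of \<open>Nerve (trd G)\<close> correspond,
  but their simplices have different types, so the Kan property is transferred along natural maps
  and not by rewriting. A horn map is pushed along \<open>\<psi>\<close>, extended there, and
  brought back by \<open>\<phi>\<close>.\<close>

lemma Kan_retract:
  assumes L: "Kan L" and M: "simplicial_set M"
    and \<psi>: "\<And>n y. y \<in> simps M n \<Longrightarrow> \<psi> n y \<in> simps L n"
      "\<And>m n \<alpha> y. \<alpha> \<in> ops m n \<Longrightarrow> y \<in> simps M n \<Longrightarrow> \<psi> m (sact M m n \<alpha> y) = sact L m n \<alpha> (\<psi> n y)"
    and \<phi>: "\<And>n x. x \<in> simps L n \<Longrightarrow> \<phi> n x \<in> simps M n"
      "\<And>m n \<alpha> x. \<alpha> \<in> ops m n \<Longrightarrow> x \<in> simps L n \<Longrightarrow> \<phi> m (sact L m n \<alpha> x) = sact M m n \<alpha> (\<phi> n x)"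
    and \<phi>\<psi>: "\<And>n y. y \<in> simps M n \<Longrightarrow> \<phi> n (\<psi> n y) = y"
  shows "Kan M"
  unfolding Kan_def
proof (intro conjI M allI impI ballI)
  fix n k f assume nk: "1 \<le> n \<and> k \<le> n" and f: "f \<in> sset_homs (Horn k n) M"
  have n: "1 \<le> n" using nk by blast
  define f' where "f' m = (\<lambda>x\<in>simps (Horn k n) m. \<psi> m (f m x))" for m
  have Hin: "sact (Horn k n) l m \<alpha> x \<in> simps (Horn k n) l" if *: "\<alpha> \<in> ops l m" "x \<in> simps (Horn k n) m" for l m \<alpha> x
  proof -
    obtain i where "x \<in> ops m n" "i \<le> n" "i \<noteq> k" "i \<notin> x ` {..m}" using * unfolding simps_Horn[OF n] by blast
    then show ?thesis using compose_omits[OF *(1), of i x] compose_ops[OF *(1)] unfolding simps_Horn[OF n] sact_Horn by blast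
  qed
  have "f' \<in> sset_homs (Horn k n) L"
    unfolding sset_homs_def
  proof (intro CollectI conjI allI ballI PiE_I)
    show "f' m x \<in> simps L m" if "x \<in> simps (Horn k n) m" for m x
      using that \<psi>(1) sset_hom_in[OF f that] by (simp add: f'_def)
    show "f' m x = undefined" if "x \<notin> simps (Horn k n) m" for m x using that by (simp add: f'_def)
    show "f' l (sact (Horn k n) l m \<alpha> x) = sact L l m \<alpha> (f' m x)" if "\<alpha> \<in> ops l m" "x \<in> simps (Horn k n) m" for l m \<alpha> x
      using Hin[OF that] that sset_hom_act[OF f that] \<psi>(2)[OF that(1) sset_hom_in[OF f that(2)]]
      by (simp add: f'_def del: sact_Horn)
  qed
  then have "\<exists>g\<in>sset_homs (Delta n) L. \<forall>m. \<forall>x\<in>simps (Horn k n) m. g m x = f' m x"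
    using L nk unfolding Kan_def by blast
  then obtain g where g: "g \<in> sset_homs (Delta n) L" "\<forall>m. \<forall>x\<in>simps (Horn k n) m. g m x = f' m x" by blast
  define g' where "g' m = (\<lambda>x\<in>simps (Delta n) m. \<phi> m (g m x))" for m
  show "\<exists>g\<in>sset_homs (Delta n) M. \<forall>m. \<forall>x\<in>simps (Horn k n) m. g m x = f m x"
  proof (intro bexI[of _ g'] allI ballI)
    fix m x assume x: "x \<in> simps (Horn k n) m"
    then have "x \<in> simps (Delta n) m" by (simp add: simps_Horn[OF n])
    then show "g' m x = f m x" using x g(2) \<phi>\<psi>[OF sset_hom_in[OF f x]] by (simp add: g'_def f'_def)
  next
    show "g' \<in> sset_homs (Delta n) M"
      unfolding sset_homs_def
    proof (intro CollectI conjI allI ballI PiE_I)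
      show "g' m x \<in> simps M m" if "x \<in> simps (Delta n) m" for m x
        using that \<phi>(1) sset_hom_in[OF g(1) that] by (simp add: g'_def)
      show "g' m x = undefined" if "x \<notin> simps (Delta n) m" for m x using that by (simp add: g'_def)
      show "g' l (sact (Delta n) l m \<alpha> x) = sact M l m \<alpha> (g' m x)" if "\<alpha> \<in> ops l m" "x \<in> simps (Delta n) m" for l m \<alpha> x
        using that sset_hom_act[OF g(1) that] \<phi>(2)[OF that(1) sset_hom_in[OF g(1) that(2)]]
        by (simp add: g'_def)
    qed
  qed
qed

section \<open>Transposition of double groupoids and the columns of the nerve\<close>

definition trd :: "('o, 'h, 'v, 'c) dbl \<Rightarrow> ('o, 'v, 'h, 'c) dbl" where
  "trd G = \<lparr>HC = VC G, VC = HC G, SH = SV G, SV = SH G\<rparr>"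

lemma trd_simps [simp]: "HC (trd G) = VC G" "VC (trd G) = HC G" "SH (trd G) = SV G" "SV (trd G) = SH G"
  by (simp_all add: trd_def)

lemma trd_trd: "trd (trd G) = G"
  by (simp add: trd_def)

text \<open>On families the exchange of directions is a permutation of the four indices, which is
  why the transpose is defined through them.\<close>

definition trn :: "('o, 'h, 'v, 'c) dbl \<Rightarrow> nat \<Rightarrow> nat \<Rightarrow> ('o, 'h, 'v, 'c) grid_fun \<Rightarrow> ('o, 'v, 'h, 'c) grid_fun" where
  "trn G p q y = fam_fun (trd G) q p (\<lambda>j j' i i'. fam G y i i' j j')"

context dgp begin

lemma dgp_trd: "dgp (trd G)"
proof
  have "double_category (trd G)"
    unfolding double_category_def trd_simps
  proof (intro conjI ballI impI; (elim conjE)?)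
    show "Dom (SH G) (Cmp (SV G) x y) = Cmp (VC G) (Dom (SH G) x) (Dom (SH G) y)"
      "Cod (SH G) (Cmp (SV G) x y) = Cmp (VC G) (Cod (SH G) x) (Cod (SH G) y)"
      if "x \<in> Arr (SV G)" "y \<in> Arr (SV G)" "Dom (SV G) x = Cod (SV G) y" for x y using that by simp_all
    show "Dom (SV G) (Cmp (SH G) x y) = Cmp (HC G) (Dom (SV G) x) (Dom (SV G) y)"
      "Cod (SV G) (Cmp (SH G) x y) = Cmp (HC G) (Cod (SV G) x) (Cod (SV G) y)"
      if "x \<in> Arr (SV G)" "y \<in> Arr (SV G)" "Dom (SH G) x = Cod (SH G) y" for x y using that by simp_all
  qed (simp_all add: H.category V.category SH.category SV.category corners cmp_idn interchange)
  then show "double_groupoid (trd G)"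
    by (simp add: double_groupoid_def H.groupoid V.groupoid SH.groupoid SV.groupoid)
qed

lemma sqfam_trd: "sqfam G p q c \<Longrightarrow> sqfam (trd G) q p (\<lambda>j j' i i'. c i i' j j')"
  unfolding sqfam_def[of "trd G"] trd_simps carriers
  by (intro allI impI conjI) (rule sqfamD[of p q c]; assumption)+

lemma trn_in:
  assumes "y \<in> dbl_homs (grid p n) G" shows "trn G p n y \<in> dbl_homs (grid n p) (trd G)"
proof -
  interpret T: dgp "trd G" by (rule dgp_trd)
  show ?thesis unfolding trn_def by (rule T.fam_fun_in[OF sqfam_trd[OF fam_sqfam[OF assms]]])
qed

lemma trn_bact:
  assumes y: "y \<in> dbl_homs (grid p q) G" and "\<alpha> \<in> ops m p" "\<beta> \<in> ops n q"
  shows "trn G m n (bact (Nerve G) m n p q \<alpha> \<beta> y) = bact (Nerve (trd G)) n m q p \<beta> \<alpha> (trn G p q y)"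
proof -
  interpret T: dgp "trd G" by (rule dgp_trd)
  show ?thesis unfolding trn_def T.bact_fam_fun[OF assms(3,2)]
    by (rule T.fam_fun_cong) (simp add: fam_bact[OF assms])
qed

lemma trn_trn:
  assumes y: "y \<in> dbl_homs (grid p n) G" shows "trn (trd G) n p (trn G p n y) = y"
proof -
  interpret T: dgp "trd G" by (rule dgp_trd)
  have "trn (trd G) n p (trn G p n y) = fam_fun G p n (fam G y)"
    unfolding trn_def trd_trd by (rule fam_fun_cong) (simp add: T.fam_fam_fun[OF sqfam_trd[OF fam_sqfam[OF y]]])
  then show ?thesis by (simp add: fam_fun_fam[OF y])
qed

lemma vcol_trn:
  assumes y: "y \<in> simps (vcol (Nerve G) p) n"
  shows "trn G p n y \<in> simps (hrow (Nerve (trd G)) p) n"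
    "\<alpha> \<in> ops m n \<Longrightarrow> trn G p m (sact (vcol (Nerve G) p) m n \<alpha> y) = sact (hrow (Nerve (trd G)) p) m n \<alpha> (trn G p n y)"
    "trn (trd G) n p (trn G p n y) = y"
  using trn_in[of y p n] trn_bact[of y p n "idop p" p \<alpha> m] trn_trn[of y p n] y
  by (simp_all add: vcol_def hrow_def) (simp_all add: Nerve_def)

lemma Kan_vcol_Nerve: "Kan (vcol (Nerve G) p)"
proof -
  interpret T: dgp "trd G" by (rule dgp_trd)
  have hrow: "x \<in> dbl_homs (grid n p) (trd G)" if "x \<in> simps (hrow (Nerve (trd G)) p) n" for n x
    using that by (simp add: hrow_def Nerve_def)
  show ?thesis
  proof (rule Kan_retract[OF T.Kan_hrow_Nerve[of p], of _ "\<lambda>n. trn G p n" "\<lambda>n. trn (trd G) n p"])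
    show "simplicial_set (vcol (Nerve G) p)"
      using simplicial_set_hrow[OF bisimplicial_tr[OF bisimplicial_Nerve]] by simp
    show "trn (trd G) n p x \<in> simps (vcol (Nerve G) p) n" if "x \<in> simps (hrow (Nerve (trd G)) p) n" for n x
      using T.trn_in[OF hrow[OF that]] by (simp add: vcol_def Nerve_def trd_trd)
    show "trn (trd G) m p (sact (hrow (Nerve (trd G)) p) m n \<alpha> x) = sact (vcol (Nerve G) p) m n \<alpha> (trn (trd G) n p x)"
      if "\<alpha> \<in> ops m n" "x \<in> simps (hrow (Nerve (trd G)) p) n" for m n \<alpha> x
      using T.trn_bact[OF hrow[OF that(2)] that(1) idop_ops] by (simp add: vcol_def hrow_def trd_trd)
  qed (simp_all add: vcol_trn)
qed

text \<open>Filling prescribes the source in one direction and the target in the other, whereas an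
  arm of a star is prescribed by two targets. Filling for the inverse of \<open>g\<close>, followed
  by horizontal inversion of the square, turns one into the other.\<close>

lemma fill_corner:
  assumes "filling G" "g \<in> Arr (HC G)" "v \<in> Arr (VC G)" "Cod (HC G) g = Cod (VC G) v"
  obtains T where "T \<in> Arr (SH G)" "Cod (SH G) T = v" "Cod (SV G) T = g"
proof -
  obtain x where x: "x \<in> Arr (SH G)" "Dom (SH G) x = v" "Cod (SV G) x = ginv (HC G) g"
    using assms unfolding filling_def by (metis H.ginv_simps(1,2))
  have "ginv (HC G) (ginv (HC G) g) = g" by (rule H.ginv_unique) (use assms in simp_all)
  then show thesis using that[of "ginv (SH G) x"] x by simp
qed

lemma fam_edge:
  assumes "x \<in> dbl_homs (grid p q) G" "i \<le> p" "i' \<le> p" "j \<le> q" "j' \<le> q"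
  shows "Dom (SH G) (fam G x i i' j j') = Dom (SH G) (fam G x i i j j')"
    "Cod (SH G) (fam G x i i' j j') = Dom (SH G) (fam G x i' i' j j')"
    "Dom (SV G) (fam G x i i' j j') = Dom (SV G) (fam G x i i' j j)"
    "Cod (SV G) (fam G x i i' j j') = Dom (SV G) (fam G x i i' j' j')"
    "fam G x i i' j j' \<in> Arr (SH G)"
  by (rule sqfamD[OF fam_sqfam[OF assms(1)] assms(2-5)])+

text \<open>The star is centred at \<open>(k, l)\<close>, which lies in all faces of the bihorn.
  Unless both dimensions are one, each pair of edges ending in the centre belongs to the bihorn and
  supplies an arm; in dimension (1,1) the arm from the opposite vertex is missing and comes from the
  filling condition.\<close>

lemma biHorn_Nerve:
  assumes fil: "filling G" and pq: "1 \<le> p" "1 \<le> q" "k \<le> p" "l \<le> q"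
    and f: "f \<in> bis_homs (biHorn k l p q) (Nerve G)"
  obtains X where "X \<in> dbl_homs (grid p q) G"
    "\<And>a. a \<le> p \<Longrightarrow> a \<noteq> k \<Longrightarrow> bact (Nerve G) (p - 1) q p q (coface p a) (idop q) X = f (p - 1) q (coface p a, idop q)"
    "\<And>b. b \<le> q \<Longrightarrow> b \<noteq> l \<Longrightarrow> bact (Nerve G) p (q - 1) p q (idop p) (coface q b) X = f p (q - 1) (idop p, coface q b)"
proof -
  note mem = bisimps_biHorn[OF pq(1,2)]
  have fin: "f m n z \<in> dbl_homs (grid m n) G" if "z \<in> bisimps (biHorn k l p q) m n" for m n z
    using bis_hom_in[OF f that] by (simp add: Nerve_def)
  have fact: "f m' n' (compose {..m'} \<alpha> \<alpha>', compose {..n'} \<beta> \<beta>') = bact (Nerve G) m' n' m n \<alpha>' \<beta>' (f m n (\<alpha>, \<beta>))"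
    if "(\<alpha>, \<beta>) \<in> bisimps (biHorn k l p q) m n" "\<alpha>' \<in> ops m' m" "\<beta>' \<in> ops n' n" for m n m' n' \<alpha> \<beta> \<alpha>' \<beta>'
    using bis_hom_act[OF f that(2,3,1)] by simp
  have vk: "(vertex_op k, \<beta>) \<in> bisimps (biHorn k l p q) 0 n" if "\<beta> \<in> ops n q" for n \<beta>
    unfolding mem using vertex_omits[OF pq(1), of k] pq that by simp
  have vl: "(\<alpha>, vertex_op l) \<in> bisimps (biHorn k l p q) m 0" if "\<alpha> \<in> ops m p" for m \<alpha>
    unfolding mem using vertex_omits[OF pq(2), of l] pq that by simp
  have ch: "(coface p a, idop q) \<in> bisimps (biHorn k l p q) (p - 1) q" if "a \<le> p" "a \<noteq> k" for a
    unfolding mem using that coface_omits[of a p] pq by auto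
  have cv: "(idop p, coface q b) \<in> bisimps (biHorn k l p q) p (q - 1)" if "b \<le> q" "b \<noteq> l" for b
    unfolding mem using that coface_omits[of b q] pq by auto
  show thesis
  proof (cases "p = 1 \<and> q = 1")
    case True
    then have [simp]: "p = 1" "q = 1" by auto
    have k1: "k \<le> 1" "l \<le> 1" using pq by auto
    \<comment> \<open>The bihorn consists of a vertical edge at \<open>k\<close> and a horizontal
      edge at \<open>l\<close>, meeting in \<open>(k, l)\<close>; \<open>o\<close> and
      \<open>o'\<close> express their agreement at this vertex.\<close>
    define yv where "yv = f 0 1 (vertex_op k, idop 1)"
    define yh where "yh = f 1 0 (idop 1, vertex_op l)"
    have yv: "yv \<in> dbl_homs (grid 0 1) G" and yh: "yh \<in> dbl_homs (grid 1 0) G"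
      using fin[OF vk[of "idop 1" 1]] fin[OF vl[of "idop 1" 1]] by (simp_all add: yv_def yh_def)
    have o: "fam G (f 0 0 (vertex_op k, vertex_op l)) 0 0 0 0 = fam G yv 0 0 l l"
      using fact[OF vk[of "idop 1" 1], of "idop 0" 0 "vertex_op l" 0] fam_bact[OF yv, of "idop 0" 0 "vertex_op l" 0 0 0 0 0] k1
        compose_idop_right[OF vertex_op_ops[OF k1(1)]] compose_vertex_op[of "idop 1" l]
      by (simp add: yv_def del: atMost_0)
    have o': "fam G (f 0 0 (vertex_op k, vertex_op l)) 0 0 0 0 = fam G yh k k 0 0"
      using fact[OF vl[of "idop 1" 1], of "vertex_op k" 0 "idop 0" 0] fam_bact[OF yh, of "vertex_op k" 0 "idop 0" 0 0 0 0 0] k1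
        compose_idop_right[OF vertex_op_ops[OF k1(2)]] compose_vertex_op[of "idop 1" k]
      by (simp add: yh_def del: atMost_0)
    have oo: "fam G yh k k 0 0 = fam G yv 0 0 l l" using o o' by simp
    define z where "z = fam G yv 0 0 l l"
    have z: "z \<in> Arr (SH G)" "Cod (SH G) z = Dom (SH G) z" "Cod (SV G) z = Dom (SV G) z"
      using fam_edge[OF yv, of 0 0 l l] k1 by (simp_all add: z_def)
    have cz: "Cod (HC G) (Dom (SV G) z) = Cod (VC G) (Dom (SH G) z)"
      using corners[OF z(1)] z by simp
    define v where "v = Cod (SH G) (fam G yv 0 0 (1 - l) l)"
    define g where "g = Cod (SV G) (fam G yh (1 - k) k 0 0)"
    have vg: "v \<in> Arr (VC G)" "g \<in> Arr (HC G)"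
      using fam_edge(5)[OF yv, of 0 0 "1 - l" l] fam_edge(5)[OF yh, of "1 - k" k 0 0] k1 by (simp_all add: v_def g_def)
    have "Cod (VC G) v = Cod (HC G) (Cod (SV G) (fam G yv 0 0 (1 - l) l))"
      using corners(2)[OF fam_edge(5)[OF yv, of 0 0 "1 - l" l]] k1 by (simp add: v_def)
    also have "\<dots> = Cod (HC G) (Dom (SV G) z)" using fam_edge(4)[OF yv, of 0 0 "1 - l" l] k1 by (simp add: z_def)
    also have "\<dots> = Cod (VC G) (Cod (SH G) (fam G yh (1 - k) k 0 0))"
      using fam_edge(2)[OF yh, of "1 - k" k 0 0] k1 cz by (simp add: z_def oo)
    also have "\<dots> = Cod (HC G) g"
      using corners(2)[OF fam_edge(5)[OF yh, of "1 - k" k 0 0]] k1 by (simp add: g_def)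
    finally have "Cod (HC G) g = Cod (VC G) v" by simp
    from fill_corner[OF fil vg(2,1) this] obtain T where T: "T \<in> Arr (SH G)" "Cod (SH G) T = v" "Cod (SV G) T = g" by blast
    \<comment> \<open>Two arms are the given edges, seen as degenerate squares, and \<open>T\<close>
      joins the opposite vertex to \<open>(k, l)\<close>. At the centre the two descriptions by
      edges agree because of \<open>oo\<close>.\<close>
    define S where "S i j = (if i = k then fam G yv 0 0 j l else if j = l then fam G yh i k 0 0 else T)" for i j
    have Sk: "S k j = fam G yv 0 0 j l" for j by (simp add: S_def)
    have Sl: "S i l = fam G yh i k 0 0" for i by (simp add: S_def oo)
    have two: "i = k \<or> i = 1 - k" "j = l \<or> j = 1 - l" if "i \<le> 1" "j \<le> 1" for i j using that k1 by auto
    have inS: "S i j \<in> Arr (SH G)" if "i \<le> 1" "j \<le> 1" for i j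
      using that k1 T fam_edge(5)[OF yv, of 0 0 j l] fam_edge(5)[OF yh, of i k 0 0] by (simp add: S_def)
    have CH: "Cod (SH G) (S i j) = (if j = l then Dom (SH G) z else v)" if "i \<le> 1" "j \<le> 1" for i j
    proof (cases "j = l")
      case True
      then show ?thesis using fam_edge(2)[OF yh, of i k 0 0] k1 that by (simp add: Sl z_def oo)
    next
      case False
      then have "j = 1 - l" using two that by blast
      then show ?thesis using False T by (simp add: S_def v_def)
    qed
    have CV: "Cod (SV G) (S i j) = (if i = k then Dom (SV G) z else g)" if "i \<le> 1" "j \<le> 1" for i j
    proof (cases "i = k")
      case True
      then show ?thesis using fam_edge(4)[OF yv, of 0 0 j l] k1 that by (simp add: Sk z_def)
    next
      case False
      then have "i = 1 - k" using two that by blast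
      then show ?thesis using False T by (simp add: S_def g_def)
    qed
    have S: "star 1 1 S" unfolding star_def by (simp add: inS CH CV)
    have H: "bact (Nerve G) 0 1 1 1 (vertex_op k) (idop 1) (fam_fun G 1 1 (star_fam G S)) = yv"
      by (rule star_filler[OF S _ _ yv, of _ _ 0 l]) (use k1 in \<open>simp_all add: Sk\<close>)
    have V: "bact (Nerve G) 1 0 1 1 (idop 1) (vertex_op l) (fam_fun G 1 1 (star_fam G S)) = yh"
      by (rule star_filler[OF S _ _ yh, of _ _ k 0]) (use k1 in \<open>simp_all add: Sl\<close>)
    have cf: "coface 1 a = vertex_op (1 - a)" if "a \<le> 1" for a
      using that by (intro ops_eqI[of _ 0]) (auto simp: coface_def vertex_op_def)
    have "coface 1 a = vertex_op k" if "a \<le> 1" "a \<noteq> k" for a using cf[OF that(1)] that k1 by (auto simp: le_num)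
    moreover have "coface 1 b = vertex_op l" if "b \<le> 1" "b \<noteq> l" for b using cf[OF that(1)] that k1 by (auto simp: le_num)
    ultimately show thesis using that[of "fam_fun G 1 1 (star_fam G S)"] star_fill_in[OF S] H V
      by (simp add: yv_def yh_def)
  next
    case False
    then have big: "2 \<le> p \<or> 2 \<le> q" using pq by auto
    \<comment> \<open>It is enough that one component misses an admissible index, and in a direction
      of dimension at least two the edge does.\<close>
    have ee: "(edge2 i k, edge2 j l) \<in> bisimps (biHorn k l p q) 1 1" if "i \<le> p" "j \<le> q" for i j
      unfolding mem using big that pq edge2_omits[of p k i] edge2_omits[of q l j]
      by (simp del: image_iff) (metis (no_types, lifting))
    define S where "S i j = fam G (f 1 1 (edge2 i k, edge2 j l)) (pos i k) (pos k i) (pos j l) (pos l j)" for i j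
    have Cod: "Cod (SH G) (S i j) = Dom (SH G) (fam G (f 0 1 (vertex_op k, edge2 j l)) 0 0 (pos j l) (pos l j))"
      "Cod (SV G) (S i j) = Dom (SV G) (fam G (f 1 0 (edge2 i k, vertex_op l)) (pos i k) (pos k i) 0 0)"
      "S i j \<in> Arr (SH G)" if ij: "i \<le> p" "j \<le> q" for i j
    proof -
      have y: "f 1 1 (edge2 i k, edge2 j l) \<in> dbl_homs (grid 1 1) G" by (rule fin[OF ee[OF ij]])
      have e: "edge2 i k \<in> ops 1 p" "edge2 j l \<in> ops 1 q" using ij pq by simp_all
      have ck: "compose {..0} (edge2 i k) (vertex_op (pos k i)) = vertex_op k"
        "compose {..0} (edge2 j l) (vertex_op (pos l j)) = vertex_op l"
        by (simp_all only: compose_vertex_op edge2_pos)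
      have "f 0 1 (vertex_op k, edge2 j l) = bact (Nerve G) 0 1 1 1 (vertex_op (pos k i)) (idop 1) (f 1 1 (edge2 i k, edge2 j l))"
        using fact[OF ee[OF ij], of "vertex_op (pos k i)" 0 "idop 1" 1] by (simp only: ck compose_idop_right[OF e(2)] vertex_op_ops pos_le idop_ops simp_thms)
      then have "fam G (f 0 1 (vertex_op k, edge2 j l)) 0 0 (pos j l) (pos l j) =
          fam G (f 1 1 (edge2 i k, edge2 j l)) (pos k i) (pos k i) (pos j l) (pos l j)"
        using fam_bact[OF y, of "vertex_op (pos k i)" 0 "idop 1" 1 0 0 "pos j l" "pos l j"] by simp
      then show "Cod (SH G) (S i j) = Dom (SH G) (fam G (f 0 1 (vertex_op k, edge2 j l)) 0 0 (pos j l) (pos l j))"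
        unfolding S_def using fam_edge(2)[OF y, of "pos i k" "pos k i" "pos j l" "pos l j"] by simp
      have "f 1 0 (edge2 i k, vertex_op l) = bact (Nerve G) 1 0 1 1 (idop 1) (vertex_op (pos l j)) (f 1 1 (edge2 i k, edge2 j l))"
        using fact[OF ee[OF ij], of "idop 1" 1 "vertex_op (pos l j)" 0] by (simp only: ck compose_idop_right[OF e(1)] vertex_op_ops pos_le idop_ops simp_thms)
      then have "fam G (f 1 0 (edge2 i k, vertex_op l)) (pos i k) (pos k i) 0 0 =
          fam G (f 1 1 (edge2 i k, edge2 j l)) (pos i k) (pos k i) (pos l j) (pos l j)"
        using fam_bact[OF y, of "idop 1" 1 "vertex_op (pos l j)" 0 "pos i k" "pos k i" 0 0] by simp
      then show "Cod (SV G) (S i j) = Dom (SV G) (fam G (f 1 0 (edge2 i k, vertex_op l)) (pos i k) (pos k i) 0 0)"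
        unfolding S_def using fam_edge(4)[OF y, of "pos i k" "pos k i" "pos j l" "pos l j"] by simp
      show "S i j \<in> Arr (SH G)" unfolding S_def using fam_edge(5)[OF y] by simp
    qed
    have S: "star p q S" unfolding star_def by (simp add: Cod)
    have ext: "bact (Nerve G) m n p q \<alpha> \<beta> (fam_fun G p q (star_fam G S)) = f m n (\<alpha>, \<beta>)"
      if ab: "(\<alpha>, \<beta>) \<in> bisimps (biHorn k l p q) m n" "\<alpha> \<in> ops m p" "\<beta> \<in> ops n q"
        and kl: "k0 \<le> m" "l0 \<le> n" "\<alpha> k0 = k" "\<beta> l0 = l"
        and inj: "\<And>i i'. i \<le> m \<Longrightarrow> i' \<le> m \<Longrightarrow> \<alpha> i \<le> \<alpha> i' \<longleftrightarrow> i \<le> i'" "\<And>j j'. j \<le> n \<Longrightarrow> j' \<le> n \<Longrightarrow> \<beta> j \<le> \<beta> j' \<longleftrightarrow> j \<le> j'"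
      for m n \<alpha> \<beta> k0 l0
    proof (rule star_filler[OF S ab(2,3) fin[OF ab(1)] kl(1,2)])
      fix i j assume ij: "i \<le> m" "j \<le> n"
      have "f 1 1 (edge2 (\<alpha> i) k, edge2 (\<beta> j) l) = bact (Nerve G) 1 1 m n (edge2 i k0) (edge2 j l0) (f m n (\<alpha>, \<beta>))"
        using fact[OF ab(1) edge2_ops[OF ij(1) kl(1)] edge2_ops[OF ij(2) kl(2)]]
          edge2_compose[OF ab(2) ij(1) kl(1)] edge2_compose[OF ab(3) ij(2) kl(2)] kl by simp
      moreover have "pos (\<alpha> i) k = pos i k0" "pos k (\<alpha> i) = pos k0 i" "pos (\<beta> j) l = pos j l0" "pos l (\<beta> j) = pos l0 j"
        using inj(1)[of i k0] inj(1)[of k0 i] inj(2)[of j l0] inj(2)[of l0 j] ij kl by (auto intro!: pos_inj)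
      ultimately show "fam G (f m n (\<alpha>, \<beta>)) i k0 j l0 = S (\<alpha> i) (\<beta> j)"
        unfolding S_def using fam_bact[OF fin[OF ab(1)] edge2_ops[OF ij(1) kl(1)] edge2_ops[OF ij(2) kl(2)],
            of "pos i k0" "pos k0 i" "pos j l0" "pos l0 j"] by simp
    qed
    show thesis
    proof (rule that[OF star_fill_in[OF S]])
      fix a assume a: "a \<le> p" "a \<noteq> k"
      obtain k0 where k0: "k0 \<le> p - 1" "coface p a k0 = k" using coface_hits[OF pq(3) _ a(1)] a by blast
      show "bact (Nerve G) (p - 1) q p q (coface p a) (idop q) (fam_fun G p q (star_fam G S)) = f (p - 1) q (coface p a, idop q)"
        by (rule ext[OF ch[OF a], of k0 l]) (use a k0 pq coface_le_iff[OF pq(1)] in simp_all)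
    next
      fix b assume b: "b \<le> q" "b \<noteq> l"
      obtain l0 where l0: "l0 \<le> q - 1" "coface q b l0 = l" using coface_hits[OF pq(4) _ b(1)] b by blast
      show "bact (Nerve G) p (q - 1) p q (idop p) (coface q b) (fam_fun G p q (star_fam G S)) = f p (q - 1) (idop p, coface q b)"
        by (rule ext[OF cv[OF b], of k l0]) (use b l0 pq coface_le_iff[OF pq(2)] in simp_all)
    qed
  qed
qed

end

context dgp begin

text \<open>The filler matches the faces of the bihorn, and every other cell is a restriction of
  such a face along \<open>omit\<close>.\<close>

lemma extension_condition_Nerve:
  assumes fil: "filling G"
  shows "extension_condition (Nerve G)"
  unfolding extension_condition_def
proof (intro conjI allI impI ballI Kan_hrow_Nerve Kan_vcol_Nerve)
  fix p q k l f assume a: "1 \<le> p \<and> 1 \<le> q \<and> k \<le> p \<and> l \<le> q" and f: "f \<in> bis_homs (biHorn k l p q) (Nerve G)"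
  have pq: "1 \<le> p" "1 \<le> q" "k \<le> p" "l \<le> q" using a by auto
  note mem = bisimps_biHorn[OF pq(1,2)]
  obtain X where X: "X \<in> dbl_homs (grid p q) G"
    "\<And>a. a \<le> p \<Longrightarrow> a \<noteq> k \<Longrightarrow> bact (Nerve G) (p - 1) q p q (coface p a) (idop q) X = f (p - 1) q (coface p a, idop q)"
    "\<And>b. b \<le> q \<Longrightarrow> b \<noteq> l \<Longrightarrow> bact (Nerve G) p (q - 1) p q (idop p) (coface q b) X = f p (q - 1) (idop p, coface q b)"
    using biHorn_Nerve[OF fil pq f] by blast
  have XN: "X \<in> bisimps (Nerve G) p q" using X(1) by (simp add: Nerve_def)
  define g where "g m n = (\<lambda>z\<in>ops m p \<times> ops n q. bact (Nerve G) m n p q (fst z) (snd z) X)" for m n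
  show "\<exists>g\<in>bis_homs (biDelta p q) (Nerve G). \<forall>m n. \<forall>x\<in>bisimps (biHorn k l p q) m n. g m n x = f m n x"
  proof (intro bexI[of _ g] allI ballI)
    fix m n z assume "z \<in> bisimps (biHorn k l p q) m n"
    then obtain \<alpha> \<beta> where z: "z = (\<alpha>, \<beta>)" "\<alpha> \<in> ops m p" "\<beta> \<in> ops n q"
      and "(\<exists>i\<le>p. i \<noteq> k \<and> i \<notin> \<alpha> ` {..m}) \<or> (\<exists>j\<le>q. j \<noteq> l \<and> j \<notin> \<beta> ` {..n})" unfolding mem by blast
    then consider (h) i where "i \<le> p" "i \<noteq> k" "i \<notin> \<alpha> ` {..m}" | (v) j where "j \<le> q" "j \<noteq> l" "j \<notin> \<beta> ` {..n}" by blast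
    then show "g m n z = f m n z"
    proof cases
      case h
      note o = omit_ops[OF z(2) h(3,1)] and co = coface_omit[OF z(2) h(3,1)]
      have c: "(coface p i, idop q) \<in> bisimps (biHorn k l p q) (p - 1) q"
        unfolding mem using h coface_omits[of i p] pq by auto
      have "g m n z = bact (Nerve G) m n (p - 1) q (omit i m \<alpha>) \<beta> (bact (Nerve G) (p - 1) q p q (coface p i) (idop q) X)"
        using bact_bact[OF bisimplicial_Nerve o z(3) _ _ XN, of "coface p i" "idop q"] h pq co compose_idop_left[OF z(3)] z
        by (simp add: g_def)
      also have "\<dots> = f m n z" unfolding X(2)[OF h(1,2)]
        using bis_hom_act[OF f o z(3) c] co compose_idop_left[OF z(3)] z by simp
      finally show ?thesis .
    next
      case v
      note o = omit_ops[OF z(3) v(3,1)] and co = coface_omit[OF z(3) v(3,1)]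
      have c: "(idop p, coface q j) \<in> bisimps (biHorn k l p q) p (q - 1)"
        unfolding mem using v coface_omits[of j q] pq by auto
      have "g m n z = bact (Nerve G) m n p (q - 1) \<alpha> (omit j n \<beta>) (bact (Nerve G) p (q - 1) p q (idop p) (coface q j) X)"
        using bact_bact[OF bisimplicial_Nerve z(2) o _ _ XN, of "idop p" "coface q j"] v pq co compose_idop_left[OF z(2)] z
        by (simp add: g_def)
      also have "\<dots> = f m n z" unfolding X(3)[OF v(1,2)]
        using bis_hom_act[OF f z(2) o c] co compose_idop_left[OF z(2)] z by simp
      finally show ?thesis .
    qed
  next
    show "g \<in> bis_homs (biDelta p q) (Nerve G)"
      unfolding bis_homs_def
    proof (intro CollectI conjI allI ballI PiE_I)
      show "g m n z \<in> bisimps (Nerve G) m n" if "z \<in> bisimps (biDelta p q) m n" for m n z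
        using that bact_in[OF bisimplicial_Nerve _ _ XN] by (auto simp: g_def)
      show "g m n z = undefined" if "z \<notin> bisimps (biDelta p q) m n" for m n z using that by (simp add: g_def)
      show "g i j (bact (biDelta p q) i j m n \<alpha> \<beta> z) = bact (Nerve G) i j m n \<alpha> \<beta> (g m n z)"
        if "\<alpha> \<in> ops i m" "\<beta> \<in> ops j n" "z \<in> bisimps (biDelta p q) m n" for i j m n \<alpha> \<beta> z
        using that bact_bact[OF bisimplicial_Nerve that(1,2) _ _ XN, of "fst z" "snd z"] by (auto simp: g_def)
    qed
  qed
qed

end

text \<open>If 2-simplices are determined by their faces, the degenerate simplex is the only one
  with all faces at the base point, so there is just one class.\<close>

lemma homotopy_group_zero_if_unique:
  assumes L: "simplicial_set L" and a: "a \<in> simps L 0"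
    and uniq: "\<And>x y. x \<in> simps L 2 \<Longrightarrow> y \<in> simps L 2 \<Longrightarrow> (\<And>i. i \<le> 2 \<Longrightarrow> face L 2 i x = face L 2 i y) \<Longrightarrow> x = y"
  shows "homotopy_group_zero L 2 a"
proof -
  have const: "(\<lambda>i\<in>{..n}. 0) \<in> ops n 0" for n by (rule opsI) auto
  have b: "base_simplex L 2 a \<in> simps L 2" unfolding base_simplex_def by (rule sact_in[OF L const a])
  have f: "face L 2 i (base_simplex L 2 a) = base_simplex L (2 - 1) a" if "i \<le> 2" for i
  proof -
    have "compose {..2 - 1} (\<lambda>i\<in>{..2}. 0) (coface 2 i) = (\<lambda>i\<in>{..2 - 1}. 0::nat)"
      by (auto simp: fun_eq_iff compose_def coface_def restrict_def)
    then show ?thesis unfolding base_simplex_def face_def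
      using sact_sact[OF L _ const a, of "coface 2 i" "2 - 1" 2] that by simp
  qed
  have "{x \<in> simps L 2. \<forall>i\<le>2. face L 2 i x = base_simplex L (2 - 1) a} = {base_simplex L 2 a}"
  proof (intro equalityI subsetI)
    fix x assume "x \<in> {x \<in> simps L 2. \<forall>i\<le>2. face L 2 i x = base_simplex L (2 - 1) a}"
    then have x: "x \<in> simps L 2" "\<And>i. i \<le> 2 \<Longrightarrow> face L 2 i x = base_simplex L (2 - 1) a" by blast+
    have "x = base_simplex L 2 a" by (rule uniq[OF x(1) b]) (simp only: x(2) f)
    then show "x \<in> {base_simplex L 2 a}" by simp
  next
    fix x assume "x \<in> {base_simplex L 2 a}"
    then show "x \<in> {x \<in> simps L 2. \<forall>i\<le>2. face L 2 i x = base_simplex L (2 - 1) a}" using b f by blast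
  qed
  then show ?thesis unfolding homotopy_group_zero_def homotopy_group_def by simp
qed

section \<open>Triviality of homotopies in the nerve\<close>

context dgp begin

lemma third_vertex: obtains a :: nat where "a \<le> 2" "a \<noteq> i" "a \<noteq> i'"
proof -
  have "\<exists>a. a \<le> (2::nat) \<and> a \<noteq> i \<and> a \<noteq> i'" by presburger
  then show thesis using that by blast
qed

text \<open>Each square of the family involves at most two of the three columns, so it is visible in
  the face that omits a third one.\<close>

lemma hrow_Nerve_2_unique:
  assumes x: "x \<in> dbl_homs (grid 2 q) G" and y: "y \<in> dbl_homs (grid 2 q) G"
    and f: "\<And>i. i \<le> 2 \<Longrightarrow> face (hrow (Nerve G) q) 2 i x = face (hrow (Nerve G) q) 2 i y"
  shows "x = y"
proof -
  have "fam G x i i' j j' = fam G y i i' j j'" if ij: "i \<le> 2" "i' \<le> 2" "j \<le> q" "j' \<le> q" for i i' j j'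
  proof -
    obtain d where d: "d \<le> 2" "d \<noteq> i" "d \<noteq> i'" by (rule third_vertex)
    obtain i0 i1 where i: "i0 \<le> 2 - 1" "coface 2 d i0 = i" "i1 \<le> 2 - 1" "coface 2 d i1 = i'"
      using coface_hits[OF ij(1) _ d(1)] coface_hits[OF ij(2) _ d(1)] d by metis
    have "coface 2 d \<in> ops (2 - 1) 2" using d by simp
    from fam_bact[OF x this idop_ops i(1,3) ij(3,4)] fam_bact[OF y this idop_ops i(1,3) ij(3,4)] f[OF d(1)]
    show ?thesis using i ij by (simp add: face_def hrow_def)
  qed
  then have "fam_fun G 2 q (fam G x) = fam_fun G 2 q (fam G y)" by (intro fam_fun_cong)
  then show ?thesis using fam_fun_fam[OF x] fam_fun_fam[OF y] by simp
qed

lemma vcol_Nerve_2_unique: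
  assumes x: "x \<in> simps (vcol (Nerve G) p) 2" and y: "y \<in> simps (vcol (Nerve G) p) 2"
    and f: "\<And>i. i \<le> 2 \<Longrightarrow> face (vcol (Nerve G) p) 2 i x = face (vcol (Nerve G) p) 2 i y"
  shows "x = y"
proof -
  interpret T: dgp "trd G" by (rule dgp_trd)
  have "trn G p 2 x = trn G p 2 y"
  proof (rule T.hrow_Nerve_2_unique[of _ p])
    show "trn G p 2 x \<in> dbl_homs (grid 2 p) (trd G)" "trn G p 2 y \<in> dbl_homs (grid 2 p) (trd G)"
      using vcol_trn(1)[OF x] vcol_trn(1)[OF y] by (simp_all add: hrow_def Nerve_def)
    show "face (hrow (Nerve (trd G)) p) 2 i (trn G p 2 x) = face (hrow (Nerve (trd G)) p) 2 i (trn G p 2 y)" if "i \<le> 2" for i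
      using vcol_trn(2)[OF x, of "coface 2 i" "2 - 1"] vcol_trn(2)[OF y, of "coface 2 i" "2 - 1"] that f[OF that]
      by (simp add: face_def)
  qed
  then show ?thesis using vcol_trn(3)[OF x] vcol_trn(3)[OF y] by metis
qed

lemma Nerve_in_BiSet:
  assumes "filling G" shows "Nerve G \<in> Obj BiSet"
proof -
  have "homotopy_group_zero (hrow (Nerve G) 0) 2 a" "homotopy_group_zero (vcol (Nerve G) 0) 2 a"
    if a: "a \<in> bisimps (Nerve G) 0 0" for a
  proof -
    show "homotopy_group_zero (hrow (Nerve G) 0) 2 a"
    proof (rule homotopy_group_zero_if_unique)
      show "simplicial_set (hrow (Nerve G) 0)" by (rule simplicial_set_hrow[OF bisimplicial_Nerve])
      show "a \<in> simps (hrow (Nerve G) 0) 0" using a by (simp add: hrow_def)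
      show "x = y" if "x \<in> simps (hrow (Nerve G) 0) 2" "y \<in> simps (hrow (Nerve G) 0) 2"
        "\<And>i. i \<le> 2 \<Longrightarrow> face (hrow (Nerve G) 0) 2 i x = face (hrow (Nerve G) 0) 2 i y" for x y
        by (rule hrow_Nerve_2_unique[OF _ _ that(3)]) (use that(1,2) in \<open>simp_all add: hrow_def Nerve_def\<close>)
    qed
    show "homotopy_group_zero (vcol (Nerve G) 0) 2 a"
    proof (rule homotopy_group_zero_if_unique)
      show "simplicial_set (vcol (Nerve G) 0)" using Kan_vcol_Nerve[of 0] by (simp add: Kan_def)
      show "a \<in> simps (vcol (Nerve G) 0) 0" using a by (simp add: vcol_def)
    qed (rule vcol_Nerve_2_unique)
  qed
  then show ?thesis
    by (simp add: BiSet_def Let_def bisimplicial_Nerve extension_condition_Nerve[OF assms])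
qed

text \<open>The face \<open>0\<close> of a homotopy is degenerate, so its square from column
  \<open>2\<close> to column \<open>1\<close> is an identity. Hence its squares from
  \<open>2\<close> to \<open>0\<close> and from \<open>1\<close> to \<open>0\<close>, which are arms
  of \<open>x\<close> and \<open>x'\<close>, coincide, and the two stars are equal.\<close>

lemma homotopic_hrow_Nerve:
  assumes hom: "homotopic (hrow (Nerve G) q) 1 x x'" shows "x = x'"
proof -
  interpret L: kan "hrow (Nerve G) q" by unfold_locales (use Kan_hrow_Nerve in \<open>auto simp: Kan_def\<close>)
  let ?L = "hrow (Nerve G) q"
  obtain y where "y \<in> simps ?L 2" and f: "face ?L 2 0 y = degen ?L 0 0 (face ?L 1 0 x)"
    "face ?L 2 1 y = x" "face ?L 2 2 y = x'" and xx: "x \<in> simps ?L 1" "x' \<in> simps ?L 1"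
    using hom by (rule L.homotopicE) blast
  then have y: "y \<in> dbl_homs (grid 2 q) G" and x: "x \<in> dbl_homs (grid 1 q) G" "x' \<in> dbl_homs (grid 1 q) G"
    by (simp_all add: hrow_def Nerve_def)
  have "face ?L 1 0 x \<in> simps ?L 0" using xx by simp
  then have u: "face ?L 1 0 x \<in> dbl_homs (grid 0 q) G" by (simp add: hrow_def Nerve_def)
  have fy: "fam G (face ?L 2 d y) i i' j j' = fam G y (coface 2 d i) (coface 2 d i') j j'"
    if "d \<le> 2" "i \<le> 1" "i' \<le> 1" "j \<le> q" "j' \<le> q" for d i i' j j'
    using fam_bact[OF y _ idop_ops, of "coface 2 d" "2 - 1" i i' j j'] that by (simp add: face_def hrow_def)
  have "fam G x i 0 j 0 = fam G x' i 0 j 0" if ij: "i \<le> 1" "j \<le> q" for i j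
  proof (cases "i = 0")
    case True
    then show ?thesis using fy[of 1 0 0 j 0] fy[of 2 0 0 j 0] ij f by (simp add: coface_def)
  next
    case False
    then have i: "i = 1" using ij by simp
    have "fam G y 2 1 j 0 = fam G (degen ?L 0 0 (face ?L 1 0 x)) 1 0 j 0"
      using fy[of 0 1 0 j 0] f ij by (simp add: coface_def)
    also have "\<dots> = fam G (face ?L 1 0 x) 0 0 j 0"
    proof -
      have "codeg 0 0 \<in> ops 1 0" "codeg 0 0 1 = 0" "codeg 0 0 0 = 0" by (simp, simp_all add: codeg_def)
      then show ?thesis using fam_bact[OF u _ idop_ops, of "codeg 0 0" 1 1 0 j 0] ij by (simp add: degen_def hrow_def)
    qed
    also have "\<dots> = Idn (SH G) (Dom (SH G) (fam G (face ?L 1 0 x) 0 0 j 0))"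
      by (rule sqfam_Idn[OF fam_sqfam[OF u]]) (use ij in simp_all)
    finally have e: "fam G y 2 1 j 0 = Idn (SH G) (Dom (SH G) (fam G (face ?L 1 0 x) 0 0 j 0))" .
    have e2: "Dom (SH G) (fam G (face ?L 1 0 x) 0 0 j 0) = Dom (SH G) (fam G y 1 0 j 0)"
      using fam_edge(2)[OF y, of 2 1 j 0] fam_edge(1)[OF y, of 1 0 j 0] fam_edge(5)[OF u, of 0 0 j 0] ij
      by (simp add: e)
    have "fam G y 2 0 j 0 = Cmp (SH G) (fam G y 1 0 j 0) (fam G y 2 1 j 0)"
      using sqfamD(6)[OF fam_sqfam[OF y], of 2 1 j 0 0] ij by simp
    also have "\<dots> = fam G y 1 0 j 0" using fam_edge(5)[OF y, of 1 0 j 0] ij by (simp add: e e2)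
    finally show ?thesis using fy[of 1 1 0 j 0] fy[of 2 1 0 j 0] f ij i by (simp add: coface_def)
  qed
  then have "star_fam G (\<lambda>i j. fam G x i 0 j 0) i i' j j' = star_fam G (\<lambda>i j. fam G x' i 0 j 0) i i' j j'"
    if "i \<le> 1" "i' \<le> 1" "j \<le> q" "j' \<le> q" for i i' j j' using that by (simp add: star_fam_def)
  then have "fam_fun G 1 q (fam G x) = fam_fun G 1 q (fam G x')"
    using star_of_fam[OF fam_sqfam[OF x(1)], of 0 0] star_of_fam[OF fam_sqfam[OF x(2)], of 0 0]
    by (intro fam_fun_cong) simp
  then show ?thesis using fam_fun_fam[OF x(1)] fam_fun_fam[OF x(2)] by simp
qed

end

lemma homotopic_map:
  assumes "\<And>n x. x \<in> simps L n \<Longrightarrow> f n x \<in> simps M n"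
    "\<And>m n \<alpha> x. \<alpha> \<in> ops m n \<Longrightarrow> x \<in> simps L n \<Longrightarrow> f m (sact L m n \<alpha> x) = sact M m n \<alpha> (f n x)"
    and L: "kan L" and M: "kan M" and h: "homotopic L 1 x x'"
  shows "homotopic M 1 (f 1 x) (f 1 x')"
proof -
  interpret L: kan L by (rule L)
  interpret M: kan M by (rule M)
  obtain y where y: "y \<in> simps L 2" "face L 2 0 y = degen L 0 0 (face L 1 0 x)" "face L 2 1 y = x" "face L 2 2 y = x'"
    "x \<in> simps L 1" using h by (rule L.homotopicE) blast
  have fc: "face M 2 i (f 2 y) = f 1 (face L 2 i y)" if "i \<le> 2" for i
    using assms(2)[of "coface 2 i" "2 - 1" 2 y] that y by (simp add: face_def)
  have a: "face L 1 0 x \<in> simps L 0" using y by simp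
  have "f 1 (degen L 0 0 (face L 1 0 x)) = degen M 0 0 (f 0 (face L 1 0 x))"
    using assms(2)[of "codeg 0 0" 1 0 "face L 1 0 x"] a by (simp add: degen_def)
  then show ?thesis using M.homotopicI[of "f 2 y" "f 0 (face L 1 0 x)"] fc y assms(1)[OF y(1)] assms(1)[OF a] by simp
qed

context dgp begin

lemma homotopic_vcol_Nerve:
  assumes hom: "homotopic (vcol (Nerve G) p) 1 x x'" shows "x = x'"
proof -
  interpret T: dgp "trd G" by (rule dgp_trd)
  have k: "kan (vcol (Nerve G) p)" "kan (hrow (Nerve (trd G)) p)"
    using Kan_vcol_Nerve[of p] T.Kan_hrow_Nerve[of p] by (simp_all add: kan_def kan_axioms_def sset_def Kan_def)
  have "homotopic (hrow (Nerve (trd G)) p) 1 (trn G p 1 x) (trn G p 1 x')" 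
    by (rule homotopic_map[OF _ _ k hom, where f = "\<lambda>n. trn G p n"]) (simp_all add: vcol_trn)
  then have "trn G p 1 x = trn G p 1 x'" by (rule T.homotopic_hrow_Nerve)
  moreover have "x \<in> simps (vcol (Nerve G) p) 1" "x' \<in> simps (vcol (Nerve G) p) 1"
    using hom by (auto simp: homotopic_def)
  ultimately show ?thesis using vcol_trn(3) by metis
qed

lemma hcls_Nerve: "x \<in> bisimps (Nerve G) 1 q \<Longrightarrow> hcls (Nerve G) 1 q x = {x}"
proof -
  interpret L: kan "hrow (Nerve G) q" by unfold_locales (use Kan_hrow_Nerve in \<open>auto simp: Kan_def\<close>)
  assume "x \<in> bisimps (Nerve G) 1 q"
  then have "x \<in> simps (hrow (Nerve G) q) 1" by (simp add: hrow_def)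
  then show ?thesis unfolding hcls_def hclass_def using homotopic_hrow_Nerve L.homotopic_refl by blast
qed

lemma vcls_Nerve: "x \<in> bisimps (Nerve G) p 1 \<Longrightarrow> vcls (Nerve G) p 1 x = {x}"
proof -
  interpret L: kan "vcol (Nerve G) p" by unfold_locales (use Kan_vcol_Nerve in \<open>auto simp: Kan_def\<close>)
  assume "x \<in> bisimps (Nerve G) p 1"
  then have "x \<in> simps (vcol (Nerve G) p) 1" by (simp add: vcol_def)
  then show ?thesis unfolding vcls_def hclass_def using homotopic_vcol_Nerve L.homotopic_refl by blast
qed

lemma bicls_Nerve: assumes x: "x \<in> bisimps (Nerve G) 1 1" shows "bicls (Nerve G) 1 1 x = {x}"
proof -
  have "bihomotopic (Nerve G) 1 1 x y \<longleftrightarrow> x = y" for y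
  proof
    assume "bihomotopic (Nerve G) 1 1 x y"
    then obtain z where "z \<in> bisimps (Nerve G) 1 1" "y \<in> bisimps (Nerve G) 1 1"
      "hcls (Nerve G) 1 1 x = hcls (Nerve G) 1 1 z" "vcls (Nerve G) 1 1 z = vcls (Nerve G) 1 1 y"
      unfolding bihomotopic_def by blast
    then show "x = y" using x by (simp add: hcls_Nerve vcls_Nerve)
  next
    assume "x = y" then show "bihomotopic (Nerve G) 1 1 x y" unfolding bihomotopic_def using x by blast
  qed
  then show ?thesis by (auto simp: bicls_def)
qed

end

section \<open>The categories of double groupoids and of bisimplicial sets\<close>

text \<open>The part of the axioms that makes identities and composites of double functors double
  functors again. It holds for grids by inspection, so double functors out of grids are covered by
  the same lemmas.\<close>

definition dcat :: "('o, 'h, 'v, 'c) dbl \<Rightarrow> bool" where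
  "dcat D \<longleftrightarrow> category (HC D) \<and> category (VC D) \<and> category (SH D) \<and> category (SV D) \<and>
     Obj (VC D) = Obj (HC D) \<and> Obj (SH D) = Arr (VC D) \<and> Obj (SV D) = Arr (HC D) \<and> Arr (SV D) = Arr (SH D)"

lemma dcat_double_category: "double_category D \<Longrightarrow> dcat D"
  unfolding double_category_def dcat_def by (elim conjE, intro conjI) assumption+

lemma categoryI:
  assumes "\<And>f. f \<in> Arr C \<Longrightarrow> Dom C f \<in> Obj C" "\<And>f. f \<in> Arr C \<Longrightarrow> Cod C f \<in> Obj C"
    "\<And>a. a \<in> Obj C \<Longrightarrow> Idn C a \<in> Arr C"
    "\<And>a. a \<in> Obj C \<Longrightarrow> Dom C (Idn C a) = a" "\<And>a. a \<in> Obj C \<Longrightarrow> Cod C (Idn C a) = a"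
    "\<And>f g. f \<in> Arr C \<Longrightarrow> g \<in> Arr C \<Longrightarrow> Dom C f = Cod C g \<Longrightarrow> Cmp C f g \<in> Arr C"
    "\<And>f g. f \<in> Arr C \<Longrightarrow> g \<in> Arr C \<Longrightarrow> Dom C f = Cod C g \<Longrightarrow> Dom C (Cmp C f g) = Dom C g"
    "\<And>f g. f \<in> Arr C \<Longrightarrow> g \<in> Arr C \<Longrightarrow> Dom C f = Cod C g \<Longrightarrow> Cod C (Cmp C f g) = Cod C f"
    "\<And>f. f \<in> Arr C \<Longrightarrow> Cmp C f (Idn C (Dom C f)) = f" "\<And>f. f \<in> Arr C \<Longrightarrow> Cmp C (Idn C (Cod C f)) f = f"
    "\<And>f g h. f \<in> Arr C \<Longrightarrow> g \<in> Arr C \<Longrightarrow> h \<in> Arr C \<Longrightarrow> Dom C f = Cod C g \<Longrightarrow> Dom C g = Cod C h \<Longrightarrow>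
      Cmp C (Cmp C f g) h = Cmp C f (Cmp C g h)"
  shows "category C"
  unfolding category_def using assms by (intro conjI ballI impI funcsetI) simp_all

lemma dcat_grid: "dcat (grid p q)"
proof -
  have "category (HC (grid p q))" by (rule categoryI) auto
  moreover have "category (VC (grid p q))" by (rule categoryI) auto
  moreover have "category (SH (grid p q))" by (rule categoryI) auto
  moreover have "category (SV (grid p q))" by (rule categoryI) auto
  ultimately show ?thesis unfolding dcat_def by simp
qed

lemma is_functor_compose:
  assumes "category C" and F: "is_functor C F0 F1 D" and G: "is_functor D G0 G1 E"
  shows "is_functor C (compose (Obj C) G0 F0) (compose (Arr C) G1 F1) E"
proof -
  interpret cat C by unfold_locales fact
  show ?thesis
    by (rule is_functorI) (simp_all add: compose_def is_functorD[OF F] is_functorD[OF G])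
qed

lemma is_functor_id: "category C \<Longrightarrow> is_functor C (\<lambda>a\<in>Obj C. a) (\<lambda>f\<in>Arr C. f) C"
proof -
  assume "category C"
  then interpret cat C by unfold_locales
  show ?thesis by (rule is_functorI) simp_all
qed

lemma dbl_homs_maps:
  assumes "F \<in> dbl_homs D E"
  shows "fO F \<in> Obj (HC D) \<rightarrow> Obj (HC E)" "fH F \<in> Arr (HC D) \<rightarrow> Arr (HC E)"
    "fV F \<in> Arr (VC D) \<rightarrow> Arr (VC E)" "fC F \<in> Arr (SH D) \<rightarrow> Arr (SH E)"
  using is_functorD(1,2)[OF dbl_homsD(1)[OF assms]] is_functorD(2)[OF dbl_homsD(2)[OF assms]]
    is_functorD(2)[OF dbl_homsD(3)[OF assms]] by auto

lemma dbl_comp_simps [simp]: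
  "a \<in> Obj (HC D) \<Longrightarrow> fO (dbl_comp D G F) a = fO G (fO F a)"
  "f \<in> Arr (HC D) \<Longrightarrow> fH (dbl_comp D G F) f = fH G (fH F f)"
  "u \<in> Arr (VC D) \<Longrightarrow> fV (dbl_comp D G F) u = fV G (fV F u)"
  "x \<in> Arr (SH D) \<Longrightarrow> fC (dbl_comp D G F) x = fC G (fC F x)"
  by (simp_all add: dbl_comp_def compose_def)

lemma dbl_comp_in:
  assumes D: "dcat D" and F: "F \<in> dbl_homs D E" and G: "G \<in> dbl_homs E E'"
  shows "dbl_comp D G F \<in> dbl_homs D E'"
proof -
  note c = D[unfolded dcat_def]
  show ?thesis
    using is_functor_compose[OF _ dbl_homsD(1)[OF F] dbl_homsD(1)[OF G]]
      is_functor_compose[OF _ dbl_homsD(2)[OF F] dbl_homsD(2)[OF G]]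
      is_functor_compose[OF _ dbl_homsD(3)[OF F] dbl_homsD(3)[OF G]]
      is_functor_compose[OF _ dbl_homsD(4)[OF F] dbl_homsD(4)[OF G]] c
    by (simp add: dbl_homs_def dbl_comp_def)
qed

lemma dbl_id_in: assumes D: "dcat D" shows "dbl_id D \<in> dbl_homs D D"
proof -
  note c = D[unfolded dcat_def]
  show ?thesis
    using is_functor_id[of "HC D"] is_functor_id[of "VC D"] is_functor_id[of "SH D"] is_functor_id[of "SV D"] c
    by (simp add: dbl_homs_def dbl_id_def)
qed

lemma dbl_comp_assoc:
  assumes "F \<in> dbl_homs D E"
  shows "dbl_comp D H (dbl_comp D G F) = dbl_comp D (dbl_comp E H G) F"
  using dbl_homs_maps[OF assms] by (simp add: dbl_comp_def compose_assoc)

lemma dbl_comp_id_right: assumes "F \<in> dbl_homs D E" shows "dbl_comp D F (dbl_id D) = F"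
  using dbl_homs_maps[OF assms] dbl_homsD(5-8)[OF assms]
  by (cases F) (simp add: dbl_comp_def dbl_id_def compose_Id)

lemma dbl_comp_id_left: assumes "F \<in> dbl_homs D E" shows "dbl_comp D (dbl_id E) F = F"
  using dbl_homs_maps[OF assms] dbl_homsD(5-8)[OF assms]
  by (cases F) (simp add: dbl_comp_def dbl_id_def Id_compose)

lemma bis_hom_funcset: "f \<in> bis_homs K L \<Longrightarrow> f p q \<in> bisimps K p q \<rightarrow> bisimps L p q"
  by (rule funcsetI) (rule bis_hom_in)

lemma bis_hom_ext: "f \<in> bis_homs K L \<Longrightarrow> f p q \<in> extensional (bisimps K p q)"
  by (auto simp: bis_homs_def PiE_def)

lemma bis_homsI:
  assumes "\<And>p q x. x \<in> bisimps K p q \<Longrightarrow> f p q x \<in> bisimps L p q"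
    "\<And>p q. f p q \<in> extensional (bisimps K p q)"
    "\<And>m n p q \<alpha> \<beta> x. \<alpha> \<in> ops m p \<Longrightarrow> \<beta> \<in> ops n q \<Longrightarrow> x \<in> bisimps K p q \<Longrightarrow>
      f m n (bact K m n p q \<alpha> \<beta> x) = bact L m n p q \<alpha> \<beta> (f p q x)"
  shows "f \<in> bis_homs K L"
  using assms by (auto simp: bis_homs_def PiE_def)

lemma bis_homs_eqI:
  assumes "f \<in> bis_homs K L" "g \<in> bis_homs K L'" "\<And>p q x. x \<in> bisimps K p q \<Longrightarrow> f p q x = g p q x"
  shows "f = g"
proof (intro ext)
  fix p q x show "f p q x = g p q x"
    using assms(3)[of x p q] extensional_arb[OF bis_hom_ext[OF assms(1)], of x p q]
      extensional_arb[OF bis_hom_ext[OF assms(2)], of x p q] by (cases "x \<in> bisimps K p q") simp_all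
qed

lemma bis_comp_apply [simp]: "x \<in> bisimps K p q \<Longrightarrow> bis_comp K g f p q x = g p q (f p q x)"
  by (simp add: bis_comp_def compose_def)

lemma bis_comp_in:
  assumes K: "bisimplicial_set K" and f: "f \<in> bis_homs K L" and g: "g \<in> bis_homs L M"
  shows "bis_comp K g f \<in> bis_homs K M"
  by (rule bis_homsI) (simp_all add: bis_hom_in[OF f] bis_hom_in[OF g] bis_hom_act[OF f] bis_hom_act[OF g] bact_in[OF K],
    simp add: bis_comp_def)

lemma bis_id_in: "bisimplicial_set K \<Longrightarrow> bis_id K \<in> bis_homs K K"
  by (rule bis_homsI) (simp_all add: bis_id_def bact_in)

lemma bis_comp_assoc: "f \<in> bis_homs K L \<Longrightarrow> bis_comp K h (bis_comp K g f) = bis_comp K (bis_comp L h g) f"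
  unfolding bis_comp_def[abs_def] by (intro ext) (simp add: compose_assoc[OF bis_hom_funcset])

lemma bis_comp_id_right: "f \<in> bis_homs K L \<Longrightarrow> bis_comp K f (bis_id K) = f"
  unfolding bis_comp_def[abs_def] bis_id_def[abs_def] by (intro ext) (simp add: compose_Id[OF bis_hom_funcset bis_hom_ext])

lemma bis_comp_id_left: "f \<in> bis_homs K L \<Longrightarrow> bis_comp K (bis_id L) f = f"
  unfolding bis_comp_def[abs_def] bis_id_def[abs_def] by (intro ext) (simp add: Id_compose[OF bis_hom_funcset bis_hom_ext])

lemma DGpd_simps [simp]:
  "Arr DGpd = {(D, F, E). D \<in> Obj DGpd \<and> E \<in> Obj DGpd \<and> F \<in> dbl_homs D E}"
  "Dom DGpd (D, F, E) = D" "Cod DGpd (D, F, E) = E" "Idn DGpd D = (D, dbl_id D, D)"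
  "Cmp DGpd (D', G, E') (D, F, E) = (D, dbl_comp D G F, E')"
  by (simp_all add: DGpd_def Let_def)

lemma BiSet_simps [simp]:
  "Arr BiSet = {(K, f, L). K \<in> Obj BiSet \<and> L \<in> Obj BiSet \<and> f \<in> bis_homs K L}"
  "Dom BiSet (K, f, L) = K" "Cod BiSet (K, f, L) = L" "Idn BiSet K = (K, bis_id K, K)"
  "Cmp BiSet (K', g, L') (K, f, L) = (K, bis_comp K g f, L')"
  by (simp_all add: BiSet_def Let_def)

lemma Obj_DGpd: "D \<in> Obj DGpd \<longleftrightarrow> double_groupoid D \<and> filling D \<and> ext_dbl D"
  by (simp add: DGpd_def Let_def)

lemma dcat_DGpd: "D \<in> Obj DGpd \<Longrightarrow> dcat D"
  by (simp add: Obj_DGpd double_groupoid_def dcat_double_category)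

lemma dgp_DGpd: "D \<in> Obj DGpd \<Longrightarrow> dgp D"
  by (simp add: Obj_DGpd dgp_def)

lemma bisimplicial_BiSet: "K \<in> Obj BiSet \<Longrightarrow> bisimplicial_set K"
  by (simp add: BiSet_def Let_def)

lemma category_DGpd: "category DGpd"
  by (rule categoryI) (auto simp: dbl_id_in dcat_DGpd dbl_comp_in dbl_comp_id_left dbl_comp_id_right dbl_comp_assoc)

lemma category_BiSet: "category BiSet"
  by (rule categoryI) (auto simp: bis_id_in bisimplicial_BiSet bis_comp_in bis_comp_id_left bis_comp_id_right bis_comp_assoc)

section \<open>The double nerve functor\<close>

lemma Nerve_in: "G \<in> Obj DGpd \<Longrightarrow> Nerve G \<in> Obj BiSet"
  using dgp.Nerve_in_BiSet[of G] by (simp add: Obj_DGpd dgp_def)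

lemma bisimps_Nerve [simp]: "bisimps (Nerve G) p q = dbl_homs (grid p q) G"
  by (simp add: Nerve_def)

lemma bact_Nerve: "bact (Nerve G) m n p q \<alpha> \<beta> x = dbl_comp (grid m n) x (grid_map m n \<alpha> \<beta>)"
  by (simp add: Nerve_def)

lemma bact_Nerve_simps [simp]:
  "i \<le> m \<Longrightarrow> j \<le> n \<Longrightarrow> fO (bact (Nerve G) m n p q \<alpha> \<beta> x) (i, j) = fO x (\<alpha> i, \<beta> j)"
  "i \<le> i' \<Longrightarrow> i' \<le> m \<Longrightarrow> j \<le> n \<Longrightarrow> fH (bact (Nerve G) m n p q \<alpha> \<beta> x) ((i, i'), j) = fH x ((\<alpha> i, \<alpha> i'), \<beta> j)"
  "i \<le> m \<Longrightarrow> j \<le> j' \<Longrightarrow> j' \<le> n \<Longrightarrow> fV (bact (Nerve G) m n p q \<alpha> \<beta> x) (i, (j, j')) = fV x (\<alpha> i, (\<beta> j, \<beta> j'))"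
  "i \<le> i' \<Longrightarrow> i' \<le> m \<Longrightarrow> j \<le> j' \<Longrightarrow> j' \<le> n \<Longrightarrow>
    fC (bact (Nerve G) m n p q \<alpha> \<beta> x) ((i, i'), (j, j')) = fC x ((\<alpha> i, \<alpha> i'), (\<beta> j, \<beta> j'))"
  by (auto simp: bact_Nerve grid_map_def)

lemma grid_map_in:
  assumes "\<alpha> \<in> ops m p" "\<beta> \<in> ops n q"
  shows "grid_map m n \<alpha> \<beta> \<in> dbl_homs (grid m n) (grid p q)"
proof -
  note o = ops_le[OF assms(1)] ops_le[OF assms(2)] ops_mono[OF assms(1)] ops_mono[OF assms(2)]
  have "is_functor (HC (grid m n)) (fO (grid_map m n \<alpha> \<beta>)) (fH (grid_map m n \<alpha> \<beta>)) (HC (grid p q))"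
    by (rule is_functorI) (auto simp: grid_map_def o)
  moreover have "is_functor (VC (grid m n)) (fO (grid_map m n \<alpha> \<beta>)) (fV (grid_map m n \<alpha> \<beta>)) (VC (grid p q))"
    by (rule is_functorI) (auto simp: grid_map_def o)
  moreover have "is_functor (SH (grid m n)) (fV (grid_map m n \<alpha> \<beta>)) (fC (grid_map m n \<alpha> \<beta>)) (SH (grid p q))"
    by (rule is_functorI) (auto simp: grid_map_def o)
  moreover have "is_functor (SV (grid m n)) (fH (grid_map m n \<alpha> \<beta>)) (fC (grid_map m n \<alpha> \<beta>)) (SV (grid p q))"
    by (rule is_functorI) (auto simp: grid_map_def o)
  ultimately show ?thesis by (simp add: dbl_homs_def) (simp add: grid_map_def)
qed

lemma nerve_map_apply [simp]: "x \<in> dbl_homs (grid p q) G \<Longrightarrow> nerve_map G F p q x = dbl_comp (grid p q) F x"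
  by (simp add: nerve_map_def)

lemma nerve_map_in:
  assumes F: "F \<in> dbl_homs G G'"
  shows "nerve_map G F \<in> bis_homs (Nerve G) (Nerve G')"
proof (rule bis_homsI)
  show "nerve_map G F p q x \<in> bisimps (Nerve G') p q" if "x \<in> bisimps (Nerve G) p q" for p q x
    using that dbl_comp_in[OF dcat_grid _ F] by simp
  show "nerve_map G F p q \<in> extensional (bisimps (Nerve G) p q)" for p q by (simp add: nerve_map_def)
  fix m n p q \<alpha> \<beta> x assume *: "\<alpha> \<in> ops m p" "\<beta> \<in> ops n q" "x \<in> bisimps (Nerve G) p q"
  have g: "grid_map m n \<alpha> \<beta> \<in> dbl_homs (grid m n) (grid p q)" by (rule grid_map_in[OF *(1,2)])
  then show "nerve_map G F m n (bact (Nerve G) m n p q \<alpha> \<beta> x) = bact (Nerve G') m n p q \<alpha> \<beta> (nerve_map G F p q x)"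
    using * dbl_comp_in[OF dcat_grid g, of x G] by (simp add: bact_Nerve dbl_comp_assoc[OF g])
qed

lemma nerve_map_comp:
  assumes "F \<in> dbl_homs G G'"
  shows "nerve_map G (dbl_comp G F' F) = bis_comp (Nerve G) (nerve_map G' F') (nerve_map G F)"
proof (intro ext)
  fix p q x
  show "nerve_map G (dbl_comp G F' F) p q x = bis_comp (Nerve G) (nerve_map G' F') (nerve_map G F) p q x"
  proof (cases "x \<in> dbl_homs (grid p q) G")
    case True
    then show ?thesis using dbl_comp_in[OF dcat_grid True assms] by (simp add: dbl_comp_assoc[OF True])
  qed (simp add: nerve_map_def bis_comp_def compose_def)
qed

lemma nerve_map_id: "nerve_map G (dbl_id G) = bis_id (Nerve G)"
  by (intro ext) (simp add: nerve_map_def bis_id_def restrict_def dbl_comp_id_left)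

lemma Nerve_functor: "is_functor DGpd Nerve nerve_arr BiSet"
  by (rule is_functorI) (auto simp: nerve_arr_def Nerve_in nerve_map_in nerve_map_id nerve_map_comp)

section \<open>The homotopy double groupoid functor\<close>

lemma bis_hom_row:
  assumes "f \<in> bis_homs K L"
  shows "x \<in> simps (hrow K q) n \<Longrightarrow> f n q x \<in> simps (hrow L q) n"
    "\<alpha> \<in> ops m n \<Longrightarrow> x \<in> simps (hrow K q) n \<Longrightarrow> f m q (sact (hrow K q) m n \<alpha> x) = sact (hrow L q) m n \<alpha> (f n q x)"
    "y \<in> simps (vcol K p) n \<Longrightarrow> f p n y \<in> simps (vcol L p) n"
    "\<alpha> \<in> ops m n \<Longrightarrow> y \<in> simps (vcol K p) n \<Longrightarrow> f p m (sact (vcol K p) m n \<alpha> y) = sact (vcol L p) m n \<alpha> (f p n y)"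
  using bis_hom_in[OF assms] bis_hom_act[OF assms] by (simp_all add: hrow_def vcol_def)

lemma bis_hom_faces:
  assumes f: "f \<in> bis_homs K L" and x: "x \<in> bisimps K p q"
  shows "1 \<le> p \<Longrightarrow> i \<le> p \<Longrightarrow> f (p - 1) q (hface K p q i x) = hface L p q i (f p q x)"
    "1 \<le> q \<Longrightarrow> i \<le> q \<Longrightarrow> f p (q - 1) (vface K p q i x) = vface L p q i (f p q x)"
    "i \<le> p \<Longrightarrow> f (p + 1) q (hdegen K p q i x) = hdegen L p q i (f p q x)"
    "i \<le> q \<Longrightarrow> f p (q + 1) (vdegen K p q i x) = vdegen L p q i (f p q x)"
  unfolding hface_eq vface_eq hdegen_eq vdegen_eq by (rule bis_hom_act[OF f _ _ x]; simp)+

locale bikan_hom = K: bikan K + L: bikan L for K :: "'a bisset" and L :: "'b bisset" +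
  fixes f :: "nat \<Rightarrow> nat \<Rightarrow> 'a \<Rightarrow> 'b"
  assumes f: "f \<in> bis_homs K L"
begin

lemma f_in [simp]: "x \<in> bisimps K p q \<Longrightarrow> f p q x \<in> bisimps L p q"
  by (rule bis_hom_in[OF f])

lemma f_faces [simp]:
  "x \<in> bisimps K 1 0 \<Longrightarrow> i \<le> 1 \<Longrightarrow> f 0 0 (hface K 1 0 i x) = hface L 1 0 i (f 1 0 x)"
  "y \<in> bisimps K 0 1 \<Longrightarrow> i \<le> 1 \<Longrightarrow> f 0 0 (vface K 0 1 i y) = vface L 0 1 i (f 0 1 y)"
  "z \<in> bisimps K 1 1 \<Longrightarrow> i \<le> 1 \<Longrightarrow> f 0 1 (hface K 1 1 i z) = hface L 1 1 i (f 1 1 z)"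
  "z \<in> bisimps K 1 1 \<Longrightarrow> i \<le> 1 \<Longrightarrow> f 1 0 (vface K 1 1 i z) = vface L 1 1 i (f 1 1 z)"
  "c \<in> bisimps K 2 0 \<Longrightarrow> i \<le> 2 \<Longrightarrow> f 1 0 (hface K 2 0 i c) = hface L 2 0 i (f 2 0 c)"
  "d \<in> bisimps K 0 2 \<Longrightarrow> i \<le> 2 \<Longrightarrow> f 0 1 (vface K 0 2 i d) = vface L 0 2 i (f 0 2 d)"
  "e \<in> bisimps K 2 1 \<Longrightarrow> i \<le> 2 \<Longrightarrow> f 1 1 (hface K 2 1 i e) = hface L 2 1 i (f 2 1 e)"
  "g \<in> bisimps K 1 2 \<Longrightarrow> i \<le> 2 \<Longrightarrow> f 1 1 (vface K 1 2 i g) = vface L 1 2 i (f 1 2 g)"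
  using bis_hom_faces(1)[OF f, of x 1 0 i] bis_hom_faces(2)[OF f, of y 0 1 i] bis_hom_faces(1,2)[OF f, of z 1 1 i]
    bis_hom_faces(1)[OF f, of c 2 0 i] bis_hom_faces(2)[OF f, of d 0 2 i] bis_hom_faces(1)[OF f, of e 2 1 i]
    bis_hom_faces(2)[OF f, of g 1 2 i] by simp_all

lemma f_degens [simp]:
  "a \<in> bisimps K 0 0 \<Longrightarrow> f 1 0 (hdegen K 0 0 0 a) = hdegen L 0 0 0 (f 0 0 a)"
  "a \<in> bisimps K 0 0 \<Longrightarrow> f 0 1 (vdegen K 0 0 0 a) = vdegen L 0 0 0 (f 0 0 a)"
  "y \<in> bisimps K 0 1 \<Longrightarrow> f 1 1 (hdegen K 0 1 0 y) = hdegen L 0 1 0 (f 0 1 y)"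
  "x \<in> bisimps K 1 0 \<Longrightarrow> f 1 1 (vdegen K 1 0 0 x) = vdegen L 1 0 0 (f 1 0 x)"
  using bis_hom_faces(3,4)[OF f, of a 0 0 0] bis_hom_faces(3)[OF f, of y 0 1 0] bis_hom_faces(4)[OF f, of x 1 0 0]
  by simp_all

lemma homotopic_row: "homotopic (hrow K q) 1 x x' \<Longrightarrow> homotopic (hrow L q) 1 (f 1 q x) (f 1 q x')"
  by (rule homotopic_map[where f = "\<lambda>n. f n q"]) (simp_all add: bis_hom_row[OF f] K.R.kan_axioms L.R.kan_axioms)

lemma homotopic_col: "homotopic (vcol K p) 1 x x' \<Longrightarrow> homotopic (vcol L p) 1 (f p 1 x) (f p 1 x')"
  by (rule homotopic_map[where f = "\<lambda>n. f p n"]) (simp_all add: bis_hom_row[OF f] K.C.kan_axioms L.C.kan_axioms)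

lemma P_map_O: "a \<in> bisimps K 0 0 \<Longrightarrow> fO (P_map K f L) a = f 0 0 a"
  by (simp add: P_map_def)

lemma P_map_H: assumes x: "x \<in> bisimps K 1 0" shows "fH (P_map K f L) (hcls K 1 0 x) = hcls L 1 0 (f 1 0 x)"
proof -
  have "hcls L 1 0 (f 1 0 x) = hcls L 1 0 (f 1 0 x')" if "hcls K 1 0 x = hcls K 1 0 x'" for x'
    using that homotopic_row[of 0 x x'] x K.R.hclass_eq_iff[of x 0] L.R.hclass_eq_iff[of "f 1 0 x" 0] by (simp add: hcls_def)
  then have "(THE Z. \<exists>x'\<in>bisimps K 1 0. hcls K 1 0 x = hcls K 1 0 x' \<and> Z = hcls L 1 0 (f 1 0 x')) = hcls L 1 0 (f 1 0 x)"
    by (intro the_class_image[where h = "hcls K 1 0" and g = "\<lambda>x. hcls L 1 0 (f 1 0 x)"] x)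
  then show ?thesis using x by (simp add: P_map_def)
qed

lemma P_map_V: assumes x: "x \<in> bisimps K 0 1" shows "fV (P_map K f L) (vcls K 0 1 x) = vcls L 0 1 (f 0 1 x)"
proof -
  have "vcls L 0 1 (f 0 1 x) = vcls L 0 1 (f 0 1 x')" if "vcls K 0 1 x = vcls K 0 1 x'" for x'
    using that homotopic_col[of 0 x x'] x K.C.hclass_eq_iff[of x 0] L.C.hclass_eq_iff[of "f 0 1 x" 0] by (simp add: vcls_def)
  then have "(THE Z. \<exists>x'\<in>bisimps K 0 1. vcls K 0 1 x = vcls K 0 1 x' \<and> Z = vcls L 0 1 (f 0 1 x')) = vcls L 0 1 (f 0 1 x)"
    by (intro the_class_image[where h = "vcls K 0 1" and g = "\<lambda>x. vcls L 0 1 (f 0 1 x)"] x)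
  then show ?thesis using x by (simp add: P_map_def)
qed

lemma P_map_C: assumes x: "x \<in> bisimps K 1 1" shows "fC (P_map K f L) (bicls K 1 1 x) = bicls L 1 1 (f 1 1 x)"
proof -
  have "bicls L 1 1 (f 1 1 x) = bicls L 1 1 (f 1 1 x')" if e: "bicls K 1 1 x = bicls K 1 1 x'" for x'
  proof -
    have "bihomotopic K 1 1 x x'" using e unfolding K.bicls_eq_iff[OF x] .
    then obtain y where y: "K.H x y" "K.V y x'" unfolding K.bihomotopic_iff by blast
    have "bihomotopic L 1 1 (f 1 1 x) (f 1 1 x')"
      unfolding L.bihomotopic_iff using homotopic_row[OF y(1)] homotopic_col[OF y(2)] by blast
    then show ?thesis unfolding L.bicls_eq_iff[OF f_in[OF x]] .
  qed
  then have "(THE Z. \<exists>x'\<in>bisimps K 1 1. bicls K 1 1 x = bicls K 1 1 x' \<and> Z = bicls L 1 1 (f 1 1 x')) = bicls L 1 1 (f 1 1 x)"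
    by (intro the_class_image[where h = "bicls K 1 1" and g = "\<lambda>x. bicls L 1 1 (f 1 1 x)"] x)
  then show ?thesis using x by (simp add: P_map_def)
qed

lemmas P_map_simps = P_map_O P_map_H P_map_V P_map_C

text \<open>A composite of classes is witnessed by a bisimplex having it as middle face, and
  \<open>f\<close> maps the witness to a witness.\<close>

lemma P_map_in: "P_map K f L \<in> dbl_homs (PGpd K) (PGpd L)"
proof -
  have "is_functor (HC (PGpd K)) (fO (P_map K f L)) (fH (P_map K f L)) (HC (PGpd L))"
  proof (rule is_functorI)
    fix X Y assume "X \<in> Arr (HC (PGpd K))" "Y \<in> Arr (HC (PGpd K))" "Dom (HC (PGpd K)) X = Cod (HC (PGpd K)) Y"
    then obtain c where c: "c \<in> bisimps K 2 0" "X = hcls K 1 0 (hface K 2 0 2 c)" "Y = hcls K 1 0 (hface K 2 0 0 c)"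
      "Cmp (fund_groupoid (hrow K 0)) X Y = hcls K 1 0 (hface K 2 0 1 c)"
      unfolding HC_PGpd by (rule K.fund_composable)
    show "fH (P_map K f L) (Cmp (HC (PGpd K)) X Y) = Cmp (HC (PGpd L)) (fH (P_map K f L) X) (fH (P_map K f L) Y)"
      unfolding HC_PGpd c(4) unfolding c(2,3) using c(1) L.Cmp_H[of "f 2 0 c"] by (simp add: P_map_simps)
  qed (auto simp: P_map_simps)
  moreover have "is_functor (VC (PGpd K)) (fO (P_map K f L)) (fV (P_map K f L)) (VC (PGpd L))"
  proof (rule is_functorI)
    fix X Y assume "X \<in> Arr (VC (PGpd K))" "Y \<in> Arr (VC (PGpd K))" "Dom (VC (PGpd K)) X = Cod (VC (PGpd K)) Y"
    then obtain c where c: "c \<in> bisimps K 0 2" "X = vcls K 0 1 (vface K 0 2 2 c)" "Y = vcls K 0 1 (vface K 0 2 0 c)"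
      "Cmp (fund_groupoid (vcol K 0)) X Y = vcls K 0 1 (vface K 0 2 1 c)"
      unfolding VC_PGpd using K.fund_composable_V by (metis K.Arr_V)
    show "fV (P_map K f L) (Cmp (VC (PGpd K)) X Y) = Cmp (VC (PGpd L)) (fV (P_map K f L) X) (fV (P_map K f L) Y)"
      unfolding VC_PGpd c(4) unfolding c(2,3) using c(1) L.Cmp_V[of "f 0 2 c"] by (simp add: P_map_simps)
  qed (auto simp: P_map_simps)
  moreover have "is_functor (SH (PGpd K)) (fV (P_map K f L)) (fC (P_map K f L)) (SH (PGpd L))"
  proof (rule is_functorI)
    fix X Y assume "X \<in> Arr (SH (PGpd K))" "Y \<in> Arr (SH (PGpd K))" "Dom (SH (PGpd K)) X = Cod (SH (PGpd K)) Y"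
    then obtain c where c: "c \<in> bisimps K 2 1" "X = bicls K 1 1 (hface K 2 1 2 c)" "Y = bicls K 1 1 (hface K 2 1 0 c)"
      "Cmp (sq_hcat K) X Y = bicls K 1 1 (hface K 2 1 1 c)"
      unfolding SH_PGpd by (rule K.sqh_composable)
    show "fC (P_map K f L) (Cmp (SH (PGpd K)) X Y) = Cmp (SH (PGpd L)) (fC (P_map K f L) X) (fC (P_map K f L) Y)"
      unfolding SH_PGpd c(4) unfolding c(2,3) using c(1) L.Cmp_sqh[of "f 2 1 c"] by (simp add: P_map_simps)
  qed (auto simp: P_map_simps)
  moreover have "is_functor (SV (PGpd K)) (fH (P_map K f L)) (fC (P_map K f L)) (SV (PGpd L))"
  proof (rule is_functorI)
    fix X Y assume "X \<in> Arr (SV (PGpd K))" "Y \<in> Arr (SV (PGpd K))" "Dom (SV (PGpd K)) X = Cod (SV (PGpd K)) Y"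
    then obtain c where c: "c \<in> bisimps K 1 2" "X = bicls K 1 1 (vface K 1 2 2 c)" "Y = bicls K 1 1 (vface K 1 2 0 c)"
      "Cmp (sq_vcat K) X Y = bicls K 1 1 (vface K 1 2 1 c)"
      unfolding SV_PGpd using K.sqv_composable by (metis K.Arr_sqv)
    show "fC (P_map K f L) (Cmp (SV (PGpd K)) X Y) = Cmp (SV (PGpd L)) (fC (P_map K f L) X) (fC (P_map K f L) Y)"
      unfolding SV_PGpd c(4) unfolding c(2,3) using c(1) L.Cmp_sqv[of "f 1 2 c"] by (simp add: P_map_simps)
  qed (auto simp: P_map_simps)
  ultimately show ?thesis by (simp add: dbl_homs_def) (simp add: P_map_def)
qed

end

lemma bikan_hom: "K \<in> Obj BiSet \<Longrightarrow> L \<in> Obj BiSet \<Longrightarrow> f \<in> bis_homs K L \<Longrightarrow> bikan_hom K L f"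
  by (simp add: bikan_hom_def bikan_hom_axioms_def bikan_def)

lemma PGpd_in: "K \<in> Obj BiSet \<Longrightarrow> PGpd K \<in> Obj DGpd"
  using bikan.PGpd_in_DGpd bikan.intro by blast

lemma P_map_in: "K \<in> Obj BiSet \<Longrightarrow> L \<in> Obj BiSet \<Longrightarrow> f \<in> bis_homs K L \<Longrightarrow> P_map K f L \<in> dbl_homs (PGpd K) (PGpd L)"
  using bikan_hom.P_map_in bikan_hom by blast

lemma P_map_comp:
  assumes K: "K \<in> Obj BiSet" "L \<in> Obj BiSet" "M \<in> Obj BiSet" and f: "f \<in> bis_homs K L" and g: "g \<in> bis_homs L M"
  shows "P_map K (bis_comp K g f) M = dbl_comp (PGpd K) (P_map L g M) (P_map K f L)"
proof -
  have gf: "bis_comp K g f \<in> bis_homs K M" by (rule bis_comp_in[OF bisimplicial_BiSet[OF K(1)] f g])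
  interpret f: bikan_hom K L f by (rule bikan_hom[OF K(1,2) f])
  interpret g: bikan_hom L M g by (rule bikan_hom[OF K(2,3) g])
  interpret gf: bikan_hom K M "bis_comp K g f" by (rule bikan_hom[OF K(1,3) gf])
  show ?thesis
    by (rule dbl_homs_eqI[OF gf.P_map_in dbl_comp_in[OF dcat_DGpd[OF PGpd_in[OF K(1)]] f.P_map_in g.P_map_in]])
      (auto simp: f.P_map_simps g.P_map_simps gf.P_map_simps)
qed

lemma P_map_id: assumes K: "K \<in> Obj BiSet" shows "P_map K (bis_id K) K = dbl_id (PGpd K)"
proof -
  have i: "bis_id K \<in> bis_homs K K" by (rule bis_id_in[OF bisimplicial_BiSet[OF K]])
  interpret f: bikan_hom K K "bis_id K" by (rule bikan_hom[OF K K i])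
  show ?thesis
    by (rule dbl_homs_eqI[OF f.P_map_in dbl_id_in[OF dcat_DGpd[OF PGpd_in[OF K]]]])
      (auto simp: f.P_map_simps dbl_id_def bis_id_def)
qed

lemma P_functor: "is_functor BiSet PGpd P_arr DGpd"
  by (rule is_functorI) (auto simp: P_arr_def PGpd_in P_map_in P_map_id P_map_comp)

section \<open>Unit and counit\<close>

text \<open>The triangle with vertices \<open>i\<close>, \<open>j\<close>, \<open>k\<close>.
  Restricting a bisimplex along it gives the witness that the class of its long edge is the
  composite of the classes of the other two; this is the source of functoriality of
  \<open>eps\<close>.\<close>

definition tri_op :: "nat \<Rightarrow> nat \<Rightarrow> nat \<Rightarrow> nat \<Rightarrow> nat" where
  "tri_op i j k = (\<lambda>a\<in>{..2}. if a = 0 then i else if a = 1 then j else k)"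

lemma tri_op_ops: "i \<le> j \<Longrightarrow> j \<le> k \<Longrightarrow> k \<le> p \<Longrightarrow> tri_op i j k \<in> ops 2 p"
  by (rule opsI) (auto simp: tri_op_def le_num)

lemma edge_op_in: "i \<le> j \<Longrightarrow> j \<le> p \<Longrightarrow> edge_op (i, j) \<in> ops 1 p"
  by (rule edge_op_ops) simp_all

lemma restrict_faces:
  assumes K: "bisimplicial_set K" and x: "x \<in> bisimps K p q" and b: "\<beta> \<in> ops n q"
  shows "i \<le> j \<Longrightarrow> j \<le> p \<Longrightarrow> hface K 1 n 0 (bact K 1 n p q (edge_op (i, j)) \<beta> x) = bact K 0 n p q (vertex_op j) \<beta> x"
    "i \<le> j \<Longrightarrow> j \<le> p \<Longrightarrow> hface K 1 n 1 (bact K 1 n p q (edge_op (i, j)) \<beta> x) = bact K 0 n p q (vertex_op i) \<beta> x"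
    "i \<le> p \<Longrightarrow> hdegen K 0 n 0 (bact K 0 n p q (vertex_op i) \<beta> x) = bact K 1 n p q (edge_op (i, i)) \<beta> x"
    "i \<le> j \<Longrightarrow> j \<le> k \<Longrightarrow> k \<le> p \<Longrightarrow>
      hface K 2 n 0 (bact K 2 n p q (tri_op i j k) \<beta> x) = bact K 1 n p q (edge_op (j, k)) \<beta> x"
    "i \<le> j \<Longrightarrow> j \<le> k \<Longrightarrow> k \<le> p \<Longrightarrow>
      hface K 2 n 1 (bact K 2 n p q (tri_op i j k) \<beta> x) = bact K 1 n p q (edge_op (i, k)) \<beta> x"
    "i \<le> j \<Longrightarrow> j \<le> k \<Longrightarrow> k \<le> p \<Longrightarrow>
      hface K 2 n 2 (bact K 2 n p q (tri_op i j k) \<beta> x) = bact K 1 n p q (edge_op (i, j)) \<beta> x"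
proof -
  have e: "compose {..0} (edge_op (i, j)) (coface 1 0) = vertex_op j" "compose {..0} (edge_op (i, j)) (coface 1 1) = vertex_op i"
    "compose {..1} (vertex_op i) (codeg 0 0) = edge_op (i, i)"
    "compose {..1} (tri_op i j k) (coface 2 0) = edge_op (j, k)" "compose {..1} (tri_op i j k) (coface 2 1) = edge_op (i, k)"
    "compose {..1} (tri_op i j k) (coface 2 2) = edge_op (i, j)"
    by (auto simp: fun_eq_iff compose_def restrict_def coface_def codeg_def vertex_op_def edge_op_def tri_op_def)
  have n: "compose {..n} \<beta> (idop n) = \<beta>" using b by simp
  have num: "(2::nat) - 1 = 1" "(1::nat) - 1 = 0" "(0::nat) + 1 = 1" by simp_all
  note bb = bact_bact[OF K _ idop_ops _ b x]
  show "i \<le> j \<Longrightarrow> j \<le> p \<Longrightarrow> hface K 1 n 0 (bact K 1 n p q (edge_op (i, j)) \<beta> x) = bact K 0 n p q (vertex_op j) \<beta> x"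
    "i \<le> j \<Longrightarrow> j \<le> p \<Longrightarrow> hface K 1 n 1 (bact K 1 n p q (edge_op (i, j)) \<beta> x) = bact K 0 n p q (vertex_op i) \<beta> x"
    unfolding hface_eq num using bb[of "coface 1 0" 0 1 "edge_op (i, j)"] bb[of "coface 1 1" 0 1 "edge_op (i, j)"]
    unfolding e n by simp_all
  show "i \<le> p \<Longrightarrow> hdegen K 0 n 0 (bact K 0 n p q (vertex_op i) \<beta> x) = bact K 1 n p q (edge_op (i, i)) \<beta> x"
    unfolding hdegen_eq num using bb[of "codeg 0 0" 1 0 "vertex_op i"] unfolding e n by simp
  assume ijk: "i \<le> j" "j \<le> k" "k \<le> p"
  note t = tri_op_ops[OF ijk]
  show "hface K 2 n 0 (bact K 2 n p q (tri_op i j k) \<beta> x) = bact K 1 n p q (edge_op (j, k)) \<beta> x"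
    "hface K 2 n 1 (bact K 2 n p q (tri_op i j k) \<beta> x) = bact K 1 n p q (edge_op (i, k)) \<beta> x"
    "hface K 2 n 2 (bact K 2 n p q (tri_op i j k) \<beta> x) = bact K 1 n p q (edge_op (i, j)) \<beta> x"
    unfolding hface_eq num using bb[OF _ t, of "coface 2 0" 1] bb[OF _ t, of "coface 2 1" 1] bb[OF _ t, of "coface 2 2" 1]
    unfolding e n by simp_all
qed

lemma restrict_faces_V:
  assumes K: "bisimplicial_set K" and x: "x \<in> bisimps K p q" and b: "\<alpha> \<in> ops m p"
  shows "i \<le> j \<Longrightarrow> j \<le> q \<Longrightarrow> vface K m 1 0 (bact K m 1 p q \<alpha> (edge_op (i, j)) x) = bact K m 0 p q \<alpha> (vertex_op j) x"
    "i \<le> j \<Longrightarrow> j \<le> q \<Longrightarrow> vface K m 1 1 (bact K m 1 p q \<alpha> (edge_op (i, j)) x) = bact K m 0 p q \<alpha> (vertex_op i) x"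
    "i \<le> q \<Longrightarrow> vdegen K m 0 0 (bact K m 0 p q \<alpha> (vertex_op i) x) = bact K m 1 p q \<alpha> (edge_op (i, i)) x"
    "i \<le> j \<Longrightarrow> j \<le> k \<Longrightarrow> k \<le> q \<Longrightarrow>
      vface K m 2 0 (bact K m 2 p q \<alpha> (tri_op i j k) x) = bact K m 1 p q \<alpha> (edge_op (j, k)) x"
    "i \<le> j \<Longrightarrow> j \<le> k \<Longrightarrow> k \<le> q \<Longrightarrow>
      vface K m 2 1 (bact K m 2 p q \<alpha> (tri_op i j k) x) = bact K m 1 p q \<alpha> (edge_op (i, k)) x"
    "i \<le> j \<Longrightarrow> j \<le> k \<Longrightarrow> k \<le> q \<Longrightarrow>
      vface K m 2 2 (bact K m 2 p q \<alpha> (tri_op i j k) x) = bact K m 1 p q \<alpha> (edge_op (i, j)) x"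
  using restrict_faces(1,2)[OF bisimplicial_tr[OF K], of x q p \<alpha> m i j] restrict_faces(3)[OF bisimplicial_tr[OF K], of x q p \<alpha> m i]
    restrict_faces(4-6)[OF bisimplicial_tr[OF K], of x q p \<alpha> m i j k] x b
  by simp_all

lemma eps_simps [simp]:
  assumes "x \<in> bisimps K p q"
  shows "i \<le> p \<Longrightarrow> j \<le> q \<Longrightarrow> fO (eps K p q x) (i, j) = bact K 0 0 p q (vertex_op i) (vertex_op j) x"
    "i \<le> i' \<Longrightarrow> i' \<le> p \<Longrightarrow> j \<le> q \<Longrightarrow> fH (eps K p q x) ((i, i'), j) = hcls K 1 0 (bact K 1 0 p q (edge_op (i, i')) (vertex_op j) x)"
    "i \<le> p \<Longrightarrow> j \<le> j' \<Longrightarrow> j' \<le> q \<Longrightarrow> fV (eps K p q x) (i, (j, j')) = vcls K 0 1 (bact K 0 1 p q (vertex_op i) (edge_op (j, j')) x)"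
    "i \<le> i' \<Longrightarrow> i' \<le> p \<Longrightarrow> j \<le> j' \<Longrightarrow> j' \<le> q \<Longrightarrow>
      fC (eps K p q x) ((i, i'), (j, j')) = bicls K 1 1 (bact K 1 1 p q (edge_op (i, i')) (edge_op (j, j')) x)"
  using assms by (simp_all add: eps_def)

context bikan begin

lemma eps_simplex_in:
  assumes x: "x \<in> bisimps K p q"
  shows "eps K p q x \<in> dbl_homs (grid p q) (PGpd K)"
proof -
  note b = bact_in[OF bis _ _ x]
  have b_in [simp]:
    "i \<le> p \<Longrightarrow> j \<le> q \<Longrightarrow> bact K 0 0 p q (vertex_op i) (vertex_op j) x \<in> bisimps K 0 0"
    "i \<le> i' \<Longrightarrow> i' \<le> p \<Longrightarrow> j \<le> q \<Longrightarrow> bact K 1 0 p q (edge_op (i, i')) (vertex_op j) x \<in> bisimps K 1 0"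
    "i \<le> p \<Longrightarrow> j \<le> j' \<Longrightarrow> j' \<le> q \<Longrightarrow> bact K 0 1 p q (vertex_op i) (edge_op (j, j')) x \<in> bisimps K 0 1"
    "i \<le> i' \<Longrightarrow> i' \<le> p \<Longrightarrow> j \<le> j' \<Longrightarrow> j' \<le> q \<Longrightarrow> bact K 1 1 p q (edge_op (i, i')) (edge_op (j, j')) x \<in> bisimps K 1 1"
    for i i' j j' by (intro b edge_op_in vertex_op_ops; simp)+
  note r [simp] = restrict_faces[OF bis x] restrict_faces_V[OF bis x] edge_op_in
  note s [simp] = eps_simps[OF x]
  have "is_functor (HC (grid p q)) (fO (eps K p q x)) (fH (eps K p q x)) (HC (PGpd K))"
  proof (rule is_functorI)
    fix f g assume "f \<in> Arr (HC (grid p q))" "g \<in> Arr (HC (grid p q))" "Dom (HC (grid p q)) f = Cod (HC (grid p q)) g"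
    then obtain i j k a where *: "f = ((i, j), a)" "g = ((j, k), a)" "i \<le> j" "j \<le> k" "k \<le> p" "a \<le> q" by auto
    have "bact K 2 0 p q (tri_op i j k) (vertex_op a) x \<in> bisimps K 2 0" using * by (intro b tri_op_ops) simp_all
    from Cmp_H[OF this] show "fH (eps K p q x) (Cmp (HC (grid p q)) f g) =
        Cmp (HC (PGpd K)) (fH (eps K p q x) f) (fH (eps K p q x) g)" using * by simp
  qed auto
  moreover have "is_functor (VC (grid p q)) (fO (eps K p q x)) (fV (eps K p q x)) (VC (PGpd K))"
  proof (rule is_functorI)
    fix f g assume "f \<in> Arr (VC (grid p q))" "g \<in> Arr (VC (grid p q))" "Dom (VC (grid p q)) f = Cod (VC (grid p q)) g"
    then obtain i j k a where *: "f = (a, (i, j))" "g = (a, (j, k))" "i \<le> j" "j \<le> k" "k \<le> q" "a \<le> p" by auto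
    have "bact K 0 2 p q (vertex_op a) (tri_op i j k) x \<in> bisimps K 0 2" using * by (intro b tri_op_ops) simp_all
    from Cmp_V[OF this] show "fV (eps K p q x) (Cmp (VC (grid p q)) f g) =
        Cmp (VC (PGpd K)) (fV (eps K p q x) f) (fV (eps K p q x) g)" using * by simp
  qed auto
  moreover have "is_functor (SH (grid p q)) (fV (eps K p q x)) (fC (eps K p q x)) (SH (PGpd K))"
  proof (rule is_functorI)
    fix f g assume "f \<in> Arr (SH (grid p q))" "g \<in> Arr (SH (grid p q))" "Dom (SH (grid p q)) f = Cod (SH (grid p q)) g"
    then obtain i j k a a' where *: "f = ((i, j), (a, a'))" "g = ((j, k), (a, a'))" "i \<le> j" "j \<le> k" "k \<le> p" "a \<le> a'" "a' \<le> q" by auto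
    have "bact K 2 1 p q (tri_op i j k) (edge_op (a, a')) x \<in> bisimps K 2 1" using * by (intro b tri_op_ops edge_op_in)
    from Cmp_sqh[OF this] show "fC (eps K p q x) (Cmp (SH (grid p q)) f g) =
        Cmp (SH (PGpd K)) (fC (eps K p q x) f) (fC (eps K p q x) g)" using * by simp
  qed auto
  moreover have "is_functor (SV (grid p q)) (fH (eps K p q x)) (fC (eps K p q x)) (SV (PGpd K))"
  proof (rule is_functorI)
    fix f g assume "f \<in> Arr (SV (grid p q))" "g \<in> Arr (SV (grid p q))" "Dom (SV (grid p q)) f = Cod (SV (grid p q)) g"
    then obtain i j k a a' where *: "f = ((a, a'), (i, j))" "g = ((a, a'), (j, k))" "i \<le> j" "j \<le> k" "k \<le> q" "a \<le> a'" "a' \<le> p" by auto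
    have "bact K 1 2 p q (edge_op (a, a')) (tri_op i j k) x \<in> bisimps K 1 2" using * by (intro b tri_op_ops edge_op_in)
    from Cmp_sqv[OF this] show "fC (eps K p q x) (Cmp (SV (grid p q)) f g) =
        Cmp (SV (PGpd K)) (fC (eps K p q x) f) (fC (eps K p q x) g)" using * by simp
  qed auto
  ultimately show ?thesis using x by (simp add: dbl_homs_def) (simp add: eps_def)
qed

lemma eps_in: "eps K \<in> bis_homs K (Nerve (PGpd K))"
proof (rule bis_homsI)
  show "eps K p q x \<in> bisimps (Nerve (PGpd K)) p q" if "x \<in> bisimps K p q" for p q x
    using eps_simplex_in[OF that] by simp
  show "eps K p q \<in> extensional (bisimps K p q)" for p q by (simp add: eps_def)
  fix m n p q \<alpha> \<beta> x assume *: "\<alpha> \<in> ops m p" "\<beta> \<in> ops n q" "x \<in> bisimps K p q"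
  have ax: "bact K m n p q \<alpha> \<beta> x \<in> bisimps K m n" by (rule bact_in[OF bis *])
  interpret P: dgp "PGpd K" by (rule dgp_DGpd[OF PGpd_in_DGpd])
  note bb = bact_bact[OF bis _ _ *(1,2,3)]
  show "eps K m n (bact K m n p q \<alpha> \<beta> x) = bact (Nerve (PGpd K)) m n p q \<alpha> \<beta> (eps K p q x)"
    by (rule dbl_homs_eqI[OF eps_simplex_in[OF ax] P.bact_Nerve_in[OF eps_simplex_in[OF *(3)] *(1,2)]])
      (auto simp: eps_simps[OF ax] eps_simps[OF *(3)] bb edge_op_in compose_vertex_op compose_edge_op
        ops_le[OF *(1)] ops_le[OF *(2)] ops_mono[OF *(1)] ops_mono[OF *(2)] simp del: atMost_0)
qed

end

lemma eps_in: "K \<in> Obj BiSet \<Longrightarrow> eps K \<in> bis_homs K (Nerve (PGpd K))"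
  using bikan.eps_in bikan.intro by blast

lemma eps_natural:
  assumes K: "K \<in> Obj BiSet" and L: "L \<in> Obj BiSet" and f: "f \<in> bis_homs K L"
  shows "bis_comp K (eps L) f = bis_comp K (nerve_map (PGpd K) (P_map K f L)) (eps K)"
proof -
  note bK = bisimplicial_BiSet[OF K]
  interpret f: bikan_hom K L f by (rule bikan_hom[OF K L f])
  note N = nerve_map_in[OF f.P_map_in]
  show ?thesis
  proof (rule bis_homs_eqI[OF bis_comp_in[OF bK f eps_in[OF L]] bis_comp_in[OF bK eps_in[OF K] N]])
    fix p q x assume x: "x \<in> bisimps K p q"
    have e: "eps K p q x \<in> dbl_homs (grid p q) (PGpd K)" by (rule f.K.eps_simplex_in[OF x])
    have fx: "f p q x \<in> bisimps L p q" by (rule bis_hom_in[OF f x])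
    note act = bis_hom_act[OF f _ _ x, symmetric]
    have "eps L p q (f p q x) = dbl_comp (grid p q) (P_map K f L) (eps K p q x)"
      by (rule dbl_homs_eqI[OF f.L.eps_simplex_in[OF fx] dbl_comp_in[OF dcat_grid e f.P_map_in]])
        (auto simp: eps_simps[OF x] eps_simps[OF fx] act edge_op_in f.P_map_simps bact_in[OF bK _ _ x])
    then show "bis_comp K (eps L) f p q x = bis_comp K (nerve_map (PGpd K) (P_map K f L)) (eps K) p q x"
      using x e by simp
  qed
qed

lemma is_functor_inverse:
  assumes F: "is_functor C F0 F1 D" and C: "category C"
    and b: "bij_betw F0 (Obj C) (Obj D)" "bij_betw F1 (Arr C) (Arr D)"
  shows "is_functor D (\<lambda>a\<in>Obj D. inv_into (Obj C) F0 a) (\<lambda>f\<in>Arr D. inv_into (Arr C) F1 f) C"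
proof -
  interpret cat C by unfold_locales fact
  have i: "inj_on F0 (Obj C)" "inj_on F1 (Arr C)" and s: "F0 ` Obj C = Obj D" "F1 ` Arr C = Arr D"
    using b by (auto simp: bij_betw_def)
  note iF [simp] = inv_into_f_f[OF i(1)] inv_into_f_f[OF i(2)]
  note d [simp] = is_functorD[OF F]
  have obj: "\<exists>b\<in>Obj C. a = F0 b" if "a \<in> Obj D" for a using that s(1) by blast
  have arr: "\<exists>g\<in>Arr C. f = F1 g" if "f \<in> Arr D" for f using that s(2) by blast
  show ?thesis
  proof (rule is_functorI)
    fix a assume "a \<in> Obj D"
    then obtain b where b: "b \<in> Obj C" "a = F0 b" using obj by blast
    then show "(\<lambda>a\<in>Obj D. inv_into (Obj C) F0 a) a \<in> Obj C" by simp
    have "Idn D a = F1 (Idn C b)" using b by simp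
    then show "(\<lambda>f\<in>Arr D. inv_into (Arr C) F1 f) (Idn D a) = Idn C ((\<lambda>a\<in>Obj D. inv_into (Obj C) F0 a) a)"
      using b d(2)[of "Idn C b"] iF(2)[of "Idn C b"] by simp
  next
    fix f assume "f \<in> Arr D"
    then obtain g where g: "g \<in> Arr C" "f = F1 g" using arr by blast
    then show "(\<lambda>f\<in>Arr D. inv_into (Arr C) F1 f) f \<in> Arr C"
      "Dom C ((\<lambda>f\<in>Arr D. inv_into (Arr C) F1 f) f) = (\<lambda>a\<in>Obj D. inv_into (Obj C) F0 a) (Dom D f)"
      "Cod C ((\<lambda>f\<in>Arr D. inv_into (Arr C) F1 f) f) = (\<lambda>a\<in>Obj D. inv_into (Obj C) F0 a) (Cod D f)"
      by simp_all
  next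
    fix f f' assume "f \<in> Arr D" "f' \<in> Arr D" and e: "Dom D f = Cod D f'"
    then obtain g g' where g: "g \<in> Arr C" "f = F1 g" "g' \<in> Arr C" "f' = F1 g'" using arr by blast
    then have "F0 (Dom C g) = F0 (Cod C g')" using e by simp
    then have gg: "Dom C g = Cod C g'" using i(1) g by (simp add: inj_on_eq_iff)
    then have "Cmp D f f' = F1 (Cmp C g g')" using g by simp
    then show "(\<lambda>f\<in>Arr D. inv_into (Arr C) F1 f) (Cmp D f f') =
        Cmp C ((\<lambda>f\<in>Arr D. inv_into (Arr C) F1 f) f) ((\<lambda>f\<in>Arr D. inv_into (Arr C) F1 f) f')"
      using g gg d(2)[of "Cmp C g g'"] iF(2)[of "Cmp C g g'"] by simp
  qed
qed

text \<open>Inverse maps of a bijective functor are functorial, which spares an explicit inverse of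
  \<open>PN_ident\<close>.\<close>

lemma dbl_isos_if_bij:
  assumes D: "dcat D" "dcat E" and F: "F \<in> dbl_homs D E"
    and b: "bij_betw (fO F) (Obj (HC D)) (Obj (HC E))" "bij_betw (fH F) (Arr (HC D)) (Arr (HC E))"
      "bij_betw (fV F) (Arr (VC D)) (Arr (VC E))" "bij_betw (fC F) (Arr (SH D)) (Arr (SH E))"
  shows "F \<in> dbl_isos D E"
proof -
  define I where "I = \<lparr>fO = (\<lambda>a\<in>Obj (HC E). inv_into (Obj (HC D)) (fO F) a), fH = (\<lambda>a\<in>Arr (HC E). inv_into (Arr (HC D)) (fH F) a),
    fV = (\<lambda>a\<in>Arr (VC E). inv_into (Arr (VC D)) (fV F) a), fC = (\<lambda>a\<in>Arr (SH E). inv_into (Arr (SH D)) (fC F) a)\<rparr>"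
  note c = D[unfolded dcat_def]
  have I: "I \<in> dbl_homs E D"
    using is_functor_inverse[OF dbl_homsD(1)[OF F]] is_functor_inverse[OF dbl_homsD(2)[OF F]]
      is_functor_inverse[OF dbl_homsD(3)[OF F]] is_functor_inverse[OF dbl_homsD(4)[OF F]] b c
    by (simp add: dbl_homs_def I_def)
  note m = dbl_homs_maps[OF F, THEN funcset_mem] dbl_homs_maps[OF I, THEN funcset_mem]
  have "dbl_comp D I F = dbl_id D"
    by (rule dbl_homs_eqI[OF dbl_comp_in[OF D(1) F I] dbl_id_in[OF D(1)]])
      (use m b in \<open>simp_all add: dbl_id_def I_def bij_betw_def\<close>)
  moreover have "dbl_comp E F I = dbl_id E"
    by (rule dbl_homs_eqI[OF dbl_comp_in[OF D(2) I F] dbl_id_in[OF D(2)]])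
      (use m b in \<open>simp_all add: dbl_id_def I_def bij_betw_def f_inv_into_f\<close>)
  ultimately show ?thesis using F I unfolding dbl_isos_def by blast
qed

section \<open>Grids with sides at most one and the identification of their double functors with
  cells\<close>

context dgp begin

lemma grid_fun_Idn:
  assumes x: "x \<in> dbl_homs (grid p q) G"
  shows "i \<le> p \<Longrightarrow> a \<le> b \<Longrightarrow> b \<le> q \<Longrightarrow> fC x ((i, i), (a, b)) = Idn (SH G) (fV x (i, (a, b)))"
    "i \<le> j \<Longrightarrow> j \<le> p \<Longrightarrow> a \<le> q \<Longrightarrow> fC x ((i, j), (a, a)) = Idn (SV G) (fH x ((i, j), a))"
    "i \<le> p \<Longrightarrow> a \<le> q \<Longrightarrow> fV x (i, (a, a)) = Idn (VC G) (fO x (i, a))"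
    "i \<le> p \<Longrightarrow> a \<le> q \<Longrightarrow> fH x ((i, i), a) = Idn (HC G) (fO x (i, a))"
    "i \<le> j \<Longrightarrow> j \<le> p \<Longrightarrow> a \<le> q \<Longrightarrow> Cod (HC G) (fH x ((i, j), a)) = fO x (i, a)"
    "i \<le> p \<Longrightarrow> a \<le> b \<Longrightarrow> b \<le> q \<Longrightarrow> Cod (VC G) (fV x (i, (a, b))) = fO x (i, a)"
    "i \<le> p \<Longrightarrow> a \<le> b \<Longrightarrow> b \<le> q \<Longrightarrow> Dom (VC G) (fV x (i, (a, b))) = fO x (i, b)"
    "i \<le> j \<Longrightarrow> j \<le> p \<Longrightarrow> a \<le> q \<Longrightarrow> fH x ((i, j), a) \<in> Arr (HC G)"
    "i \<le> p \<Longrightarrow> a \<le> b \<Longrightarrow> b \<le> q \<Longrightarrow> fV x (i, (a, b)) \<in> Arr (VC G)"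
    "i \<le> p \<Longrightarrow> a \<le> q \<Longrightarrow> fO x (i, a) \<in> Obj (HC G)"
    "i \<le> j \<Longrightarrow> j \<le> k \<Longrightarrow> k \<le> p \<Longrightarrow> a \<le> q \<Longrightarrow> Cmp (HC G) (fH x ((i, j), a)) (fH x ((j, k), a)) = fH x ((i, k), a)"
    "i \<le> p \<Longrightarrow> a \<le> b \<Longrightarrow> b \<le> d \<Longrightarrow> d \<le> q \<Longrightarrow> Cmp (VC G) (fV x (i, (a, b))) (fV x (i, (b, d))) = fV x (i, (a, d))"
  using is_functorD(5)[OF dbl_homsD(3)[OF x], of "(i, (a, b))"] is_functorD(5)[OF dbl_homsD(4)[OF x], of "((i, j), a)"]
    is_functorD(5)[OF dbl_homsD(2)[OF x], of "(i, a)"] is_functorD(5)[OF dbl_homsD(1)[OF x], of "(i, a)"]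
    is_functorD(2,4)[OF dbl_homsD(1)[OF x], of "((i, j), a)"] is_functorD(2,3,4)[OF dbl_homsD(2)[OF x], of "(i, (a, b))"]
    is_functorD(1)[OF dbl_homsD(1)[OF x], of "(i, a)"] is_functorD(6)[OF dbl_homsD(1)[OF x], of "((i, j), a)" "((j, k), a)"]
    is_functorD(6)[OF dbl_homsD(2)[OF x], of "(i, (a, b))" "(i, (b, d))"]
  by auto

lemma grid_fun_eqI:
  assumes x: "x \<in> dbl_homs (grid p q) G" and y: "y \<in> dbl_homs (grid p q) G"
    and e: "\<And>i j. i \<le> p \<Longrightarrow> j \<le> q \<Longrightarrow> fC x ((0, i), (0, j)) = fC y ((0, i), (0, j))"
  shows "x = y"
proof -
  have "fam_fun G p q (fam G x) = fam_fun G p q (fam G y)"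
    by (rule fam_fun_cong) (simp add: fam_def star_fam_def e)
  then show ?thesis using fam_fun_fam[OF x] fam_fun_fam[OF y] by simp
qed

text \<open>The star at \<open>(0, 0)\<close> consists of the generating cell and identities on its
  boundary, so this cell determines the double functor.\<close>

lemma grid_fun_inj:
  "x \<in> dbl_homs (grid 0 0) G \<Longrightarrow> y \<in> dbl_homs (grid 0 0) G \<Longrightarrow> fO x (0, 0) = fO y (0, 0) \<Longrightarrow> x = y"
  "x1 \<in> dbl_homs (grid 1 0) G \<Longrightarrow> y1 \<in> dbl_homs (grid 1 0) G \<Longrightarrow> fH x1 ((0, 1), 0) = fH y1 ((0, 1), 0) \<Longrightarrow> x1 = y1"
  "x2 \<in> dbl_homs (grid 0 1) G \<Longrightarrow> y2 \<in> dbl_homs (grid 0 1) G \<Longrightarrow> fV x2 (0, (0, 1)) = fV y2 (0, (0, 1)) \<Longrightarrow> x2 = y2"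
  "x3 \<in> dbl_homs (grid 1 1) G \<Longrightarrow> y3 \<in> dbl_homs (grid 1 1) G \<Longrightarrow>
    fC x3 ((0, 1), (0, 1)) = fC y3 ((0, 1), (0, 1)) \<Longrightarrow> x3 = y3"
proof -
  assume *: "x \<in> dbl_homs (grid 0 0) G" "y \<in> dbl_homs (grid 0 0) G" "fO x (0, 0) = fO y (0, 0)"
  show "x = y" by (rule grid_fun_eqI[OF *(1,2)]) (simp add: grid_fun_Idn[OF *(1)] grid_fun_Idn[OF *(2)] *(3))
next
  assume *: "x1 \<in> dbl_homs (grid 1 0) G" "y1 \<in> dbl_homs (grid 1 0) G" "fH x1 ((0, 1), 0) = fH y1 ((0, 1), 0)"
  have "fO x1 (0, 0) = fO y1 (0, 0)" using grid_fun_Idn(5)[OF *(1), of 0 1 0] grid_fun_Idn(5)[OF *(2), of 0 1 0] *(3) by simp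
  then show "x1 = y1" by (intro grid_fun_eqI[OF *(1,2)]) (auto simp: le_num grid_fun_Idn[OF *(1)] grid_fun_Idn[OF *(2)] *(3))
next
  assume *: "x2 \<in> dbl_homs (grid 0 1) G" "y2 \<in> dbl_homs (grid 0 1) G" "fV x2 (0, (0, 1)) = fV y2 (0, (0, 1))"
  have "fO x2 (0, 0) = fO y2 (0, 0)" using grid_fun_Idn(6)[OF *(1), of 0 0 1] grid_fun_Idn(6)[OF *(2), of 0 0 1] *(3) by simp
  then show "x2 = y2" by (intro grid_fun_eqI[OF *(1,2)]) (auto simp: le_num grid_fun_Idn[OF *(1)] grid_fun_Idn[OF *(2)] *(3))
next
  assume *: "x3 \<in> dbl_homs (grid 1 1) G" "y3 \<in> dbl_homs (grid 1 1) G" "fC x3 ((0, 1), (0, 1)) = fC y3 ((0, 1), (0, 1))"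
  have v: "fV x3 (0, (0, 1)) = fV y3 (0, (0, 1))"
    using grid_funD(3)[OF *(1), of 0 1 0 1] grid_funD(3)[OF *(2), of 0 1 0 1] *(3) by simp
  have h: "fH x3 ((0, 1), 0) = fH y3 ((0, 1), 0)"
    using grid_funD(5)[OF *(1), of 0 1 0 1] grid_funD(5)[OF *(2), of 0 1 0 1] *(3) by simp
  have "fO x3 (0, 0) = fO y3 (0, 0)" using grid_fun_Idn(5)[OF *(1), of 0 1 0] grid_fun_Idn(5)[OF *(2), of 0 1 0] h by simp
  then show "x3 = y3" using v h by (intro grid_fun_eqI[OF *(1,2)]) (auto simp: le_num grid_fun_Idn[OF *(1)] grid_fun_Idn[OF *(2)] *(3))
qed

text \<open>The far arm of the star \<open>T\<close> is \<open>s\<close> itself and the other arms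
  are identities on its target edges and target vertex, so the quotients in \<open>star_fam\<close>
  return \<open>s\<close>.\<close>

lemma grid_fun_square:
  assumes s: "s \<in> Arr (SH G)"
  obtains x where "x \<in> dbl_homs (grid 1 1) G" "fC x ((0, 1), (0, 1)) = s"
proof -
  define T where "T i j = (if i = 1 then if j = 1 then s else Idn (SV G) (Cod (SV G) s)
    else if j = 1 then Idn (SH G) (Cod (SH G) s) else Idn (SH G) (Idn (VC G) (Cod (VC G) (Cod (SH G) s))))" for i j :: nat
  have cd: "Cod (HC G) (Cod (SV G) s) = Cod (VC G) (Cod (SH G) s)" by (rule corners(2)[OF s])
  have T: "star 1 1 T" unfolding star_def T_def using s cd by (simp add: le_num)
  have iS: "ginv (SH G) (Idn (SH G) a) = Idn (SH G) a" if "a \<in> Arr (VC G)" for a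
    by (rule SH.ginv_unique) (use that in simp_all)
  have iV: "ginv (SV G) (Idn (SV G) a) = Idn (SV G) a" if "a \<in> Arr (HC G)" for a
    by (rule SV.ginv_unique) (use that in simp_all)
  have iO: "ginv (SH G) (Idn (SV G) (Idn (HC G) a)) = Idn (SV G) (Idn (HC G) a)" if "a \<in> Obj (HC G)" for a
    using iS[of "Idn (VC G) a"] that by simp
  have "star_fam G T 1 0 1 0 = s" using s cd by (simp add: star_fam_def T_def iS iV iO cmp_idn)
  then have "fC (fam_fun G 1 1 (star_fam G T)) ((0, 1), (0, 1)) = s" by (simp add: fam_fun_def)
  then show thesis using that star_fill_in[OF T] by blast
qed

text \<open>Cells of lower dimension are realised through their identity squares or edges, whose
  boundary returns the given cell.\<close>

lemma grid_fun_surj: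
  "h \<in> Arr (HC G) \<Longrightarrow> \<exists>x\<in>dbl_homs (grid 1 0) G. fH x ((0, 1), 0) = h"
  "u \<in> Arr (VC G) \<Longrightarrow> \<exists>x\<in>dbl_homs (grid 0 1) G. fV x (0, (0, 1)) = u"
  "a \<in> Obj (HC G) \<Longrightarrow> \<exists>x\<in>dbl_homs (grid 0 0) G. fO x (0, 0) = a"
proof -
  show h: "\<exists>x\<in>dbl_homs (grid 1 0) G. fH x ((0, 1), 0) = h" if "h \<in> Arr (HC G)" for h
  proof -
    have s: "Idn (SV G) h \<in> Arr (SH G)" using that by simp
    obtain x where x: "x \<in> dbl_homs (grid 1 1) G" "fC x ((0, 1), (0, 1)) = Idn (SV G) h" by (rule grid_fun_square[OF s])
    have "fH x ((0, 1), 0) = h" using grid_funD(5)[OF x(1), of 0 1 0 1] x(2) that by simp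
    then show ?thesis using bact_Nerve_in[OF x(1), of "idop 1" 1 "vertex_op 0" 0]
      by (intro bexI[of _ "bact (Nerve G) 1 0 1 1 (idop 1) (vertex_op 0) x"]) simp_all
  qed
  show "\<exists>x\<in>dbl_homs (grid 0 1) G. fV x (0, (0, 1)) = u" if "u \<in> Arr (VC G)"
  proof -
    have s: "Idn (SH G) u \<in> Arr (SH G)" using that by simp
    obtain x where x: "x \<in> dbl_homs (grid 1 1) G" "fC x ((0, 1), (0, 1)) = Idn (SH G) u" by (rule grid_fun_square[OF s])
    have "fV x (0, (0, 1)) = u" using grid_funD(3)[OF x(1), of 0 1 0 1] x(2) that by simp
    then show ?thesis using bact_Nerve_in[OF x(1), of "vertex_op 0" 0 "idop 1" 1]
      by (intro bexI[of _ "bact (Nerve G) 0 1 1 1 (vertex_op 0) (idop 1) x"]) simp_all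
  qed
  show "\<exists>x\<in>dbl_homs (grid 0 0) G. fO x (0, 0) = a" if a: "a \<in> Obj (HC G)"
  proof -
    obtain x where x: "x \<in> dbl_homs (grid 1 0) G" "fH x ((0, 1), 0) = Idn (HC G) a" using h[of "Idn (HC G) a"] a by auto
    have "fO x (0, 0) = a" using grid_fun_Idn(5)[OF x(1), of 0 1 0] x(2) a by simp
    then show ?thesis using bact_Nerve_in[OF x(1), of "vertex_op 0" 0 "idop 0" 0]
      by (intro bexI[of _ "bact (Nerve G) 0 0 1 0 (vertex_op 0) (idop 0) x"]) simp_all
  qed
qed

end

locale dgf = dgp G for G :: "('o, 'h, 'v, 'c) dbl" +
  assumes filling: "filling G"
begin

sublocale N: bikan "Nerve G" by (rule bikan.intro[OF Nerve_in_BiSet[OF filling]])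

lemma PN_simps:
  "x \<in> dbl_homs (grid 0 0) G \<Longrightarrow> fO (PN_ident G) x = fO x (0, 0)"
  "x1 \<in> dbl_homs (grid 1 0) G \<Longrightarrow> fH (PN_ident G) (hcls (Nerve G) 1 0 x1) = fH x1 ((0, 1), 0)"
  "x2 \<in> dbl_homs (grid 0 1) G \<Longrightarrow> fV (PN_ident G) (vcls (Nerve G) 0 1 x2) = fV x2 (0, (0, 1))"
  "x3 \<in> dbl_homs (grid 1 1) G \<Longrightarrow> fC (PN_ident G) (bicls (Nerve G) 1 1 x3) = fC x3 ((0, 1), (0, 1))"
  by (simp_all add: PN_ident_def) (simp_all add: hcls_Nerve vcls_Nerve bicls_Nerve)

lemma coface_values: "coface 1 0 0 = 1" "coface 1 1 0 = 0" "coface 2 0 0 = 1" "coface 2 0 1 = 2" "coface 2 1 0 = 0"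
  "coface 2 1 1 = 2" "coface 2 2 0 = 0" "coface 2 2 1 = 1" "codeg 0 0 0 = 0" "codeg 0 0 1 = 0"
  by (simp_all add: coface_def codeg_def)

text \<open>A composite in the homotopy double groupoid of the nerve is witnessed by a double
  functor \<open>c\<close> on a grid with one side \<open>2\<close>; evaluating its three faces
  turns the claim into functoriality of \<open>c\<close>.\<close>

lemma PN_ident_in: "PN_ident G \<in> dbl_homs (PGpd (Nerve G)) G"
proof -
  note fd = N.R.d_in[unfolded bisimps_Nerve] N.C.d_in[unfolded bisimps_Nerve] N.R.s_in[unfolded bisimps_Nerve] N.C.s_in[unfolded bisimps_Nerve]
  note ev = hface_eq vface_eq hdegen_eq vdegen_eq coface_values
  have "is_functor (HC (PGpd (Nerve G))) (fO (PN_ident G)) (fH (PN_ident G)) (HC G)"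
  proof (rule is_functorI)
    fix X Y assume "X \<in> Arr (HC (PGpd (Nerve G)))" "Y \<in> Arr (HC (PGpd (Nerve G)))"
      "Dom (HC (PGpd (Nerve G))) X = Cod (HC (PGpd (Nerve G))) Y"
    then obtain c where c: "c \<in> dbl_homs (grid 2 0) G" "X = hcls (Nerve G) 1 0 (hface (Nerve G) 2 0 2 c)"
      "Y = hcls (Nerve G) 1 0 (hface (Nerve G) 2 0 0 c)"
      "Cmp (fund_groupoid (hrow (Nerve G) 0)) X Y = hcls (Nerve G) 1 0 (hface (Nerve G) 2 0 1 c)"
      unfolding HC_PGpd by (rule N.fund_composable) (simp only: bisimps_Nerve)
    show "fH (PN_ident G) (Cmp (HC (PGpd (Nerve G))) X Y) = Cmp (HC G) (fH (PN_ident G) X) (fH (PN_ident G) Y)"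
      unfolding HC_PGpd c(4) unfolding c(2,3) using c(1) by (simp add: PN_simps fd) (simp add: ev grid_fun_Idn(11)[OF c(1)])
  qed (auto simp: PN_simps fd, auto simp: ev grid_fun_Idn grid_funD)
  moreover have "is_functor (VC (PGpd (Nerve G))) (fO (PN_ident G)) (fV (PN_ident G)) (VC G)"
  proof (rule is_functorI)
    fix X Y assume "X \<in> Arr (VC (PGpd (Nerve G)))" "Y \<in> Arr (VC (PGpd (Nerve G)))"
      "Dom (VC (PGpd (Nerve G))) X = Cod (VC (PGpd (Nerve G))) Y"
    then obtain c where c: "c \<in> dbl_homs (grid 0 2) G" "X = vcls (Nerve G) 0 1 (vface (Nerve G) 0 2 2 c)"
      "Y = vcls (Nerve G) 0 1 (vface (Nerve G) 0 2 0 c)"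
      "Cmp (fund_groupoid (vcol (Nerve G) 0)) X Y = vcls (Nerve G) 0 1 (vface (Nerve G) 0 2 1 c)"
      unfolding VC_PGpd using N.fund_composable_V by (metis N.Arr_V bisimps_Nerve)
    show "fV (PN_ident G) (Cmp (VC (PGpd (Nerve G))) X Y) = Cmp (VC G) (fV (PN_ident G) X) (fV (PN_ident G) Y)"
      unfolding VC_PGpd c(4) unfolding c(2,3) using c(1) by (simp add: PN_simps fd) (simp add: ev grid_fun_Idn(12)[OF c(1)])
  qed (auto simp: PN_simps fd, auto simp: ev grid_fun_Idn grid_funD)
  moreover have "is_functor (SH (PGpd (Nerve G))) (fV (PN_ident G)) (fC (PN_ident G)) (SH G)"
  proof (rule is_functorI)
    fix X Y assume "X \<in> Arr (SH (PGpd (Nerve G)))" "Y \<in> Arr (SH (PGpd (Nerve G)))"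
      "Dom (SH (PGpd (Nerve G))) X = Cod (SH (PGpd (Nerve G))) Y"
    then obtain c where c: "c \<in> dbl_homs (grid 2 1) G" "X = bicls (Nerve G) 1 1 (hface (Nerve G) 2 1 2 c)"
      "Y = bicls (Nerve G) 1 1 (hface (Nerve G) 2 1 0 c)"
      "Cmp (sq_hcat (Nerve G)) X Y = bicls (Nerve G) 1 1 (hface (Nerve G) 2 1 1 c)"
      unfolding SH_PGpd by (rule N.sqh_composable) (simp only: bisimps_Nerve)
    show "fC (PN_ident G) (Cmp (SH (PGpd (Nerve G))) X Y) = Cmp (SH G) (fC (PN_ident G) X) (fC (PN_ident G) Y)"
      unfolding SH_PGpd c(4) unfolding c(2,3) using c(1) by (simp add: PN_simps fd) (simp add: ev grid_funD(6)[OF c(1)])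
  qed (auto simp: PN_simps fd, auto simp: ev grid_fun_Idn grid_funD)
  moreover have "is_functor (SV (PGpd (Nerve G))) (fH (PN_ident G)) (fC (PN_ident G)) (SV G)"
  proof (rule is_functorI)
    fix X Y assume "X \<in> Arr (SV (PGpd (Nerve G)))" "Y \<in> Arr (SV (PGpd (Nerve G)))"
      "Dom (SV (PGpd (Nerve G))) X = Cod (SV (PGpd (Nerve G))) Y"
    then obtain c where c: "c \<in> dbl_homs (grid 1 2) G" "X = bicls (Nerve G) 1 1 (vface (Nerve G) 1 2 2 c)"
      "Y = bicls (Nerve G) 1 1 (vface (Nerve G) 1 2 0 c)"
      "Cmp (sq_vcat (Nerve G)) X Y = bicls (Nerve G) 1 1 (vface (Nerve G) 1 2 1 c)"
      unfolding SV_PGpd using N.sqv_composable by (metis N.Arr_sqv bisimps_Nerve)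
    show "fC (PN_ident G) (Cmp (SV (PGpd (Nerve G))) X Y) = Cmp (SV G) (fC (PN_ident G) X) (fC (PN_ident G) Y)"
      unfolding SV_PGpd c(4) unfolding c(2,3) using c(1) by (simp add: PN_simps fd) (simp add: ev grid_funD(7)[OF c(1)])
  qed (auto simp: PN_simps fd, auto simp: ev grid_fun_Idn grid_funD)
  moreover have "fO (PN_ident G) \<in> extensional (Obj (HC (PGpd (Nerve G))))"
    "fH (PN_ident G) \<in> extensional (Arr (HC (PGpd (Nerve G))))" "fV (PN_ident G) \<in> extensional (Arr (VC (PGpd (Nerve G))))"
    "fC (PN_ident G) \<in> extensional (Arr (SH (PGpd (Nerve G))))"
    by (simp_all only: PN_ident_def dfun.simps restrict_extensional)
  ultimately show ?thesis unfolding dbl_homs_def by blast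
qed

lemma PN_ident_bij:
  "bij_betw (fO (PN_ident G)) (Obj (HC (PGpd (Nerve G)))) (Obj (HC G))"
  "bij_betw (fH (PN_ident G)) (Arr (HC (PGpd (Nerve G)))) (Arr (HC G))"
  "bij_betw (fV (PN_ident G)) (Arr (VC (PGpd (Nerve G)))) (Arr (VC G))"
  "bij_betw (fC (PN_ident G)) (Arr (SH (PGpd (Nerve G)))) (Arr (SH G))"
proof -
  note m = dbl_homs_maps[OF PN_ident_in]
  note si = HC_PGpd VC_PGpd SH_PGpd N.Obj_H N.Arr_H N.Arr_V N.Arr_sqh bisimps_Nerve
  show "bij_betw (fO (PN_ident G)) (Obj (HC (PGpd (Nerve G)))) (Obj (HC G))"
    unfolding bij_betw_def
  proof (intro conjI equalityI)
    show "inj_on (fO (PN_ident G)) (Obj (HC (PGpd (Nerve G))))" unfolding si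
      by (rule inj_onI) (simp add: PN_simps grid_fun_inj(1))
    show "fO (PN_ident G) ` Obj (HC (PGpd (Nerve G))) \<subseteq> Obj (HC G)" using m(1) by blast
    show "Obj (HC G) \<subseteq> fO (PN_ident G) ` Obj (HC (PGpd (Nerve G)))"
    proof
      fix a assume a: "a \<in> Obj (HC G)"
      obtain x where x: "x \<in> dbl_homs (grid 0 0) G" "fO x (0, 0) = a" using grid_fun_surj(3)[OF a] by blast
      then have "a = fO (PN_ident G) (x)" by (simp add: PN_simps)
      then show "a \<in> fO (PN_ident G) ` Obj (HC (PGpd (Nerve G)))" unfolding si using x(1) by blast
    qed
  qed
  show "bij_betw (fH (PN_ident G)) (Arr (HC (PGpd (Nerve G)))) (Arr (HC G))"
    unfolding bij_betw_def
  proof (intro conjI equalityI)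
    show "inj_on (fH (PN_ident G)) (Arr (HC (PGpd (Nerve G))))" unfolding si
      by (rule inj_onI) (auto simp: PN_simps dest: grid_fun_inj(2))
    show "fH (PN_ident G) ` Arr (HC (PGpd (Nerve G))) \<subseteq> Arr (HC G)" using m(2) by blast
    show "Arr (HC G) \<subseteq> fH (PN_ident G) ` Arr (HC (PGpd (Nerve G)))"
    proof
      fix a assume a: "a \<in> Arr (HC G)"
      obtain x where x: "x \<in> dbl_homs (grid 1 0) G" "fH x ((0, 1), 0) = a" using grid_fun_surj(1)[OF a] by blast
      then have "a = fH (PN_ident G) (hcls (Nerve G) 1 0 x)" by (simp add: PN_simps)
      then show "a \<in> fH (PN_ident G) ` Arr (HC (PGpd (Nerve G)))" unfolding si using x(1) by blast
    qed
  qed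
  show "bij_betw (fV (PN_ident G)) (Arr (VC (PGpd (Nerve G)))) (Arr (VC G))"
    unfolding bij_betw_def
  proof (intro conjI equalityI)
    show "inj_on (fV (PN_ident G)) (Arr (VC (PGpd (Nerve G))))" unfolding si
      by (rule inj_onI) (auto simp: PN_simps dest: grid_fun_inj(3))
    show "fV (PN_ident G) ` Arr (VC (PGpd (Nerve G))) \<subseteq> Arr (VC G)" using m(3) by blast
    show "Arr (VC G) \<subseteq> fV (PN_ident G) ` Arr (VC (PGpd (Nerve G)))"
    proof
      fix a assume a: "a \<in> Arr (VC G)"
      obtain x where x: "x \<in> dbl_homs (grid 0 1) G" "fV x (0, (0, 1)) = a" using grid_fun_surj(2)[OF a] by blast
      then have "a = fV (PN_ident G) (vcls (Nerve G) 0 1 x)" by (simp add: PN_simps)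
      then show "a \<in> fV (PN_ident G) ` Arr (VC (PGpd (Nerve G)))" unfolding si using x(1) by blast
    qed
  qed
  show "bij_betw (fC (PN_ident G)) (Arr (SH (PGpd (Nerve G)))) (Arr (SH G))"
    unfolding bij_betw_def
  proof (intro conjI equalityI)
    show "inj_on (fC (PN_ident G)) (Arr (SH (PGpd (Nerve G))))" unfolding si
      by (rule inj_onI) (auto simp: PN_simps dest: grid_fun_inj(4))
    show "fC (PN_ident G) ` Arr (SH (PGpd (Nerve G))) \<subseteq> Arr (SH G)" using m(4) by blast
    show "Arr (SH G) \<subseteq> fC (PN_ident G) ` Arr (SH (PGpd (Nerve G)))"
    proof
      fix a assume a: "a \<in> Arr (SH G)"
      obtain x where x: "x \<in> dbl_homs (grid 1 1) G" "fC x ((0, 1), (0, 1)) = a" by (rule grid_fun_square[OF a])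
      then have "a = fC (PN_ident G) (bicls (Nerve G) 1 1 x)" by (simp add: PN_simps)
      then show "a \<in> fC (PN_ident G) ` Arr (SH (PGpd (Nerve G)))" unfolding si using x(1) by blast
    qed
  qed
qed

end


section \<open>Naturality of the identification and the triangle identities\<close>

lemma dgf_DGpd: "G \<in> Obj DGpd \<Longrightarrow> dgf G"
  by (simp add: dgf_def dgf_axioms_def dgp_def Obj_DGpd)

lemma PN_ident_in: "G \<in> Obj DGpd \<Longrightarrow> PN_ident G \<in> dbl_homs (PGpd (Nerve G)) G"
  using dgf.PN_ident_in dgf_DGpd by blast

lemma PN_ident_iso: "G \<in> Obj DGpd \<Longrightarrow> PN_ident G \<in> dbl_isos (PGpd (Nerve G)) G"
  by (rule dbl_isos_if_bij[OF dcat_DGpd dcat_DGpd PN_ident_in dgf.PN_ident_bij])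
    (simp_all add: PGpd_in Nerve_in dgf_DGpd)

lemma PN_ident_natural:
  assumes G: "G \<in> Obj DGpd" and G': "G' \<in> Obj DGpd" and F: "F \<in> dbl_homs G G'"
  shows "dbl_comp (PGpd (Nerve G)) (PN_ident G') (P_map (Nerve G) (nerve_map G F) (Nerve G')) =
    dbl_comp (PGpd (Nerve G)) F (PN_ident G)"
proof -
  interpret G: dgf G by (rule dgf_DGpd[OF G])
  interpret G': dgf G' by (rule dgf_DGpd[OF G'])
  note PN = Nerve_in[OF G] Nerve_in[OF G']
  interpret f: bikan_hom "Nerve G" "Nerve G'" "nerve_map G F" by (rule bikan_hom[OF PN nerve_map_in[OF F]])
  note d = dcat_DGpd[OF PGpd_in[OF PN(1)]]
  have c: "dbl_comp (grid p q) F x \<in> dbl_homs (grid p q) G'" if "x \<in> dbl_homs (grid p q) G" for p q x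
    by (rule dbl_comp_in[OF dcat_grid that F])
  note P = f.P_map_simps[unfolded bisimps_Nerve]
  show ?thesis
    by (rule dbl_homs_eqI[OF dbl_comp_in[OF d f.P_map_in G'.PN_ident_in] dbl_comp_in[OF d G.PN_ident_in F]])
      (auto simp: P G.PN_simps G'.PN_simps c)
qed

lemma edge_op_1 [simp]: "edge_op e 1 = snd e"
  by (simp add: edge_op_def)

lemma edge_op_idop: "edge_op (0, 1) = idop 1"
  by (auto simp: edge_op_def idop_def fun_eq_iff restrict_def)

lemma vertex_op_idop: "vertex_op 0 = idop 0"
  by (auto simp: vertex_op_def idop_def fun_eq_iff restrict_def)

text \<open>This says that the homotopy double groupoid functor sends the unit to the identity, up
  to \<open>PN_ident\<close>. A class of \<open>x\<close> is sent to the value of \<open>eps\<close>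
  of \<open>x\<close> at the generating cell, which is the class of \<open>x\<close> because
  \<open>edge_op (0, 1)\<close> and \<open>vertex_op 0\<close> are identity operators.\<close>

lemma triangle_P:
  assumes K: "K \<in> Obj BiSet"
  shows "dbl_comp (PGpd K) (PN_ident (PGpd K)) (P_map K (eps K) (Nerve (PGpd K))) = dbl_id (PGpd K)"
proof -
  note PK = PGpd_in[OF K]
  interpret G: dgf "PGpd K" by (rule dgf_DGpd[OF PK])
  interpret f: bikan_hom K "Nerve (PGpd K)" "eps K" by (rule bikan_hom[OF K Nerve_in[OF PK] eps_in[OF K]])
  note e = f.K.eps_simplex_in
  note d = dcat_DGpd[OF PK]
  show ?thesis
    by (rule dbl_homs_eqI[OF dbl_comp_in[OF d f.P_map_in G.PN_ident_in] dbl_id_in[OF d]])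
      (auto simp: f.P_map_simps G.PN_simps e dbl_id_def edge_op_idop vertex_op_idop bact_id[OF f.K.bis])
qed

text \<open>\<open>PN_ident\<close> evaluates the class of a cell of the nerve at the generating
  cell; for the restriction of \<open>x\<close> to a cell of the grid this is the value of
  \<open>x\<close> there.\<close>

lemma triangle_N:
  assumes G: "G \<in> Obj DGpd"
  shows "bis_comp (Nerve G) (nerve_map (PGpd (Nerve G)) (PN_ident G)) (eps (Nerve G)) = bis_id (Nerve G)"
proof -
  note N = Nerve_in[OF G]
  interpret G: dgf G by (rule dgf_DGpd[OF G])
  note bN = bisimplicial_BiSet[OF N]
  show ?thesis
  proof (rule bis_homs_eqI[OF bis_comp_in[OF bN eps_in[OF N] nerve_map_in[OF G.PN_ident_in]] bis_id_in[OF bN]])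
    fix p q x assume "x \<in> bisimps (Nerve G) p q"
    then have x: "x \<in> bisimps (Nerve G) p q" "x \<in> dbl_homs (grid p q) G" by simp_all
    have e: "eps (Nerve G) p q x \<in> dbl_homs (grid p q) (PGpd (Nerve G))" by (rule G.N.eps_simplex_in[OF x(1)])
    note b = G.bact_Nerve_in[OF x(2)]
    have "dbl_comp (grid p q) (PN_ident G) (eps (Nerve G) p q x) = x"
      by (rule dbl_homs_eqI[OF dbl_comp_in[OF dcat_grid e G.PN_ident_in] x(2)])
        (auto simp: eps_simps[OF x(1)] G.PN_simps b edge_op_in)
    then show "bis_comp (Nerve G) (nerve_map (PGpd (Nerve G)) (PN_ident G)) (eps (Nerve G)) p q x = bis_id (Nerve G) p q x"
      using x e by (simp add: bis_id_def)
  qed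
qed

section \<open>The adjunction and the embedding\<close>

lemma transpose_in:
  assumes K: "K \<in> Obj BiSet" and F: "F \<in> dbl_homs (PGpd K) G"
  shows "transpose_map K F \<in> bis_homs K (Nerve G)"
  unfolding transpose_map_def by (rule bis_comp_in[OF bisimplicial_BiSet[OF K] eps_in[OF K] nerve_map_in[OF F]])

text \<open>The inverse applies \<open>P_map\<close> and then the identification. One round trip
  uses naturality of \<open>PN_ident\<close> and \<open>triangle_P\<close>, the other naturality of
  \<open>eps\<close> and \<open>triangle_N\<close>.\<close>

lemma adjunction_bij:
  assumes K: "K \<in> Obj BiSet" and G: "G \<in> Obj DGpd"
  shows "bij_betw (transpose_map K) (dbl_homs (PGpd K) G) (bis_homs K (Nerve G))"
proof (rule bij_betw_byWitness[where f' = "\<lambda>f. dbl_comp (PGpd K) (PN_ident G) (P_map K f (Nerve G))"])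
  note PK = PGpd_in[OF K] and NG = Nerve_in[OF G]
  note NPK = Nerve_in[OF PK] and PNG = PGpd_in[OF NG]
  note bK = bisimplicial_BiSet[OF K] and eK = eps_in[OF K]
  note d = dcat_DGpd[OF PK]
  show "\<forall>F\<in>dbl_homs (PGpd K) G. dbl_comp (PGpd K) (PN_ident G) (P_map K (transpose_map K F) (Nerve G)) = F"
  proof
    fix F assume F: "F \<in> dbl_homs (PGpd K) G"
    note NF = nerve_map_in[OF F] and Pe = P_map_in[OF K NPK eK]
    have "dbl_comp (PGpd K) (PN_ident G) (P_map K (transpose_map K F) (Nerve G)) =
        dbl_comp (PGpd K) (dbl_comp (PGpd (Nerve (PGpd K))) (PN_ident G) (P_map (Nerve (PGpd K)) (nerve_map (PGpd K) F) (Nerve G)))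
          (P_map K (eps K) (Nerve (PGpd K)))"
      unfolding transpose_map_def P_map_comp[OF K NPK NG eK NF] by (rule dbl_comp_assoc[OF Pe])
    also have "\<dots> = dbl_comp (PGpd K) F (dbl_id (PGpd K))"
      unfolding PN_ident_natural[OF PK G F] dbl_comp_assoc[OF Pe, symmetric] triangle_P[OF K] ..
    finally show "dbl_comp (PGpd K) (PN_ident G) (P_map K (transpose_map K F) (Nerve G)) = F"
      by (simp add: dbl_comp_id_right[OF F])
  qed
  show "\<forall>f\<in>bis_homs K (Nerve G). transpose_map K (dbl_comp (PGpd K) (PN_ident G) (P_map K f (Nerve G))) = f"
  proof
    fix f assume f: "f \<in> bis_homs K (Nerve G)"
    note Pf = P_map_in[OF K NG f]
    have "transpose_map K (dbl_comp (PGpd K) (PN_ident G) (P_map K f (Nerve G))) =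
        bis_comp K (nerve_map (PGpd (Nerve G)) (PN_ident G)) (bis_comp K (eps (Nerve G)) f)"
      unfolding transpose_map_def nerve_map_comp[OF Pf] bis_comp_assoc[OF eK, symmetric] eps_natural[OF K NG f] ..
    also have "\<dots> = bis_comp K (bis_id (Nerve G)) f"
      unfolding bis_comp_assoc[OF f] triangle_N[OF G] ..
    finally show "transpose_map K (dbl_comp (PGpd K) (PN_ident G) (P_map K f (Nerve G))) = f"
      by (simp add: bis_comp_id_left[OF f])
  qed
  show "transpose_map K ` dbl_homs (PGpd K) G \<subseteq> bis_homs K (Nerve G)" using transpose_in[OF K] by blast
  show "(\<lambda>f. dbl_comp (PGpd K) (PN_ident G) (P_map K f (Nerve G))) ` bis_homs K (Nerve G) \<subseteq> dbl_homs (PGpd K) G"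
    using dbl_comp_in[OF d P_map_in[OF K NG] PN_ident_in[OF G]] by blast
qed

lemma adjunction_natural:
  assumes K: "K \<in> Obj BiSet" and K': "K' \<in> Obj BiSet" and k: "k \<in> bis_homs K' K"
    and F: "F \<in> dbl_homs (PGpd K) G" and g: "g \<in> dbl_homs G G'"
  shows "transpose_map K' (dbl_comp (PGpd K') g (dbl_comp (PGpd K') F (P_map K' k K))) =
    bis_comp K' (nerve_map G g) (bis_comp K' (transpose_map K F) k)"
proof -
  note Pk = P_map_in[OF K' K k]
  have FP: "dbl_comp (PGpd K') F (P_map K' k K) \<in> dbl_homs (PGpd K') G"
    by (rule dbl_comp_in[OF dcat_DGpd[OF PGpd_in[OF K']] Pk F])
  show ?thesis
    unfolding transpose_map_def nerve_map_comp[OF FP] nerve_map_comp[OF Pk]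
      bis_comp_assoc[OF eps_in[OF K'], symmetric] eps_natural[OF K' K k, symmetric] bis_comp_assoc[OF k] ..
qed

text \<open>The preimage of \<open>g\<close> is its \<open>P_map\<close>, conjugated by the
  identifications. The nerve sends the inverse \<open>I\<close> of \<open>PN_ident G\<close> to
  \<open>eps (Nerve G)\<close>, so naturality of \<open>eps\<close> and \<open>triangle_N\<close>
  for the target return \<open>g\<close>.\<close>

lemma Nerve_full: "full (DGpd :: (('o, 'h, 'v, 'c) dbl, ('o, 'h, 'v, 'c) dbl_arr) catg) Nerve nerve_arr BiSet"
  unfolding full_def
proof (intro ballI impI)
  fix G G' :: "('o, 'h, 'v, 'c) dbl" and a :: "('o, 'h, 'v, 'c) grid_fun bis_arr"
  assume G: "G \<in> Obj DGpd" and G': "G' \<in> Obj DGpd" and "a \<in> Arr BiSet" "Dom BiSet a = Nerve G \<and> Cod BiSet a = Nerve G'"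
  then obtain g where a: "a = (Nerve G, g, Nerve G')" and g: "g \<in> bis_homs (Nerve G) (Nerve G')" by auto
  note NG = Nerve_in[OF G] and NG' = Nerve_in[OF G']
  note PNG = PGpd_in[OF NG]
  obtain I where I: "I \<in> dbl_homs G (PGpd (Nerve G))" "dbl_comp (PGpd (Nerve G)) I (PN_ident G) = dbl_id (PGpd (Nerve G))"
    using PN_ident_iso[OF G] unfolding dbl_isos_def by blast
  note eN = eps_in[OF NG] and Pg = P_map_in[OF NG NG' g] and PN = PN_ident_in[OF G] and PN' = PN_ident_in[OF G']
  define F where "F = dbl_comp G (PN_ident G') (dbl_comp G (P_map (Nerve G) g (Nerve G')) I)"
  have PI: "dbl_comp G (P_map (Nerve G) g (Nerve G')) I \<in> dbl_homs G (PGpd (Nerve G'))"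
    by (rule dbl_comp_in[OF dcat_DGpd[OF G] I(1) Pg])
  have F: "F \<in> dbl_homs G G'" unfolding F_def by (rule dbl_comp_in[OF dcat_DGpd[OF G] PI PN'])
  have "nerve_map G I = bis_comp (Nerve G) (nerve_map G I) (bis_comp (Nerve G) (nerve_map (PGpd (Nerve G)) (PN_ident G)) (eps (Nerve G)))"
    unfolding triangle_N[OF G] bis_comp_id_right[OF nerve_map_in[OF I(1)]] ..
  also have "\<dots> = eps (Nerve G)"
    unfolding bis_comp_assoc[OF eN] nerve_map_comp[OF PN, symmetric] I(2) nerve_map_id bis_comp_id_left[OF eN] ..
  finally have NI: "nerve_map G I = eps (Nerve G)" .
  have "nerve_map G F = bis_comp (Nerve G) (nerve_map (PGpd (Nerve G')) (PN_ident G')) (bis_comp (Nerve G) (eps (Nerve G')) g)"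
    unfolding F_def nerve_map_comp[OF PI] nerve_map_comp[OF I(1)] NI eps_natural[OF NG NG' g] ..
  also have "\<dots> = g" unfolding bis_comp_assoc[OF g] triangle_N[OF G'] bis_comp_id_left[OF g] ..
  finally show "\<exists>f\<in>Arr DGpd. Dom DGpd f = G \<and> Cod DGpd f = G' \<and> nerve_arr f = a"
    using F G G' a by (intro bexI[of _ "(G, F, G')"]) (simp_all add: nerve_arr_def)
qed

text \<open>By naturality, \<open>nerve_map G F\<close> determines the composite of \<open>F\<close>
  with \<open>PN_ident G\<close>, and this isomorphism can be cancelled.\<close>

lemma Nerve_faithful: "faithful (DGpd :: (('o, 'h, 'v, 'c) dbl, ('o, 'h, 'v, 'c) dbl_arr) catg) nerve_arr"
  unfolding faithful_def
proof (intro ballI impI)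
  fix a b :: "('o, 'h, 'v, 'c) dbl_arr"
  assume "a \<in> Arr DGpd" "b \<in> Arr DGpd" and ab': "Dom DGpd a = Dom DGpd b \<and> Cod DGpd a = Cod DGpd b \<and> nerve_arr a = nerve_arr b"
  then obtain G G' F F' where ab: "a = (G, F, G')" "b = (G, F', G')" and G: "G \<in> Obj DGpd" "G' \<in> Obj DGpd"
    and F: "F \<in> dbl_homs G G'" "F' \<in> dbl_homs G G'" by auto
  have e: "nerve_map G F = nerve_map G F'" using ab' by (simp add: ab nerve_arr_def)
  obtain I where I: "I \<in> dbl_homs G (PGpd (Nerve G))" "dbl_comp G (PN_ident G) I = dbl_id G"
    using PN_ident_iso[OF G(1)] unfolding dbl_isos_def by blast
  have "dbl_comp (PGpd (Nerve G)) F (PN_ident G) = dbl_comp (PGpd (Nerve G)) F' (PN_ident G)"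
    unfolding PN_ident_natural[OF G F(1), symmetric] PN_ident_natural[OF G F(2), symmetric] e ..
  then have "dbl_comp G (dbl_comp (PGpd (Nerve G)) F (PN_ident G)) I = dbl_comp G (dbl_comp (PGpd (Nerve G)) F' (PN_ident G)) I"
    by simp
  then have "F = F'" unfolding dbl_comp_assoc[OF I(1), symmetric] I(2) dbl_comp_id_right[OF F(1)] dbl_comp_id_right[OF F(2)] .
  then show "a = b" by (simp add: ab)
qed

text \<open>A bijective functor transports all structure from its source, so two targets of the same
  one agree on objects and arrows; extensionality settles the values elsewhere.\<close>

lemma catg_eq_if_bij_functors:
  assumes F: "is_functor C F0 F1 D" and F': "is_functor C F0 F1 D'"
    and b: "bij_betw F0 (Obj C) (Obj D)" "bij_betw F1 (Arr C) (Arr D)"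
    and b': "bij_betw F0 (Obj C) (Obj D')" "bij_betw F1 (Arr C) (Arr D')"
    and C: "category C" and e: "ext_catg D" "ext_catg D'"
  shows "D = D'"
proof -
  interpret cat C by unfold_locales fact
  have o: "Obj D = Obj D'" "Arr D = Arr D'" and im: "Obj D = F0 ` Obj C" "Arr D = F1 ` Arr C"
    using b b' by (auto simp: bij_betw_def)
  note d = is_functorD[OF F] and d' = is_functorD[OF F']
  have dom: "Dom D f = Dom D' f" "Cod D f = Cod D' f" if "f \<in> Arr D" for f
    using that unfolding im by (auto simp: d(3,4) d'(3,4))
  have "Dom D = Dom D'" "Cod D = Cod D'" using dom e o by (auto simp: ext_catg_def intro!: extensionalityI[of _ "Arr D"])
  moreover have "Idn D a = Idn D' a" if "a \<in> Obj D" for a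
    using that unfolding im by (auto simp flip: d(5) d'(5))
  then have "Idn D = Idn D'" using e o by (auto simp: ext_catg_def intro!: extensionalityI[of _ "Obj D"])
  moreover have "Cmp D f g = Cmp D' f g" for f g
  proof (cases "f \<in> Arr D \<and> g \<in> Arr D \<and> Dom D f = Cod D g")
    case True
    then obtain x y where xy: "x \<in> Arr C" "f = F1 x" "y \<in> Arr C" "g = F1 y" unfolding im by blast
    then have "F0 (Dom C x) = F0 (Cod C y)" using True by (simp add: d(3,4))
    then have "Dom C x = Cod C y" using b(1) xy by (auto simp: bij_betw_def inj_on_def)
    then show ?thesis using d(6)[of x y] d'(6)[of x y] xy by simp
  next
    case False
    then have "Cmp D f g = undefined" using e(1) unfolding ext_catg_def by blast
    moreover have "Cmp D' f g = undefined" using e(2) False o dom unfolding ext_catg_def by metis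
    ultimately show ?thesis by simp
  qed
  then have "Cmp D = Cmp D'" by blast
  ultimately show ?thesis using o by (cases D; cases D') simp
qed

text \<open>\<open>PN_ident G\<close> depends on \<open>G\<close> only through
  \<open>Nerve G\<close>. If two nerves coincide, one and the same quadruple of maps consists of
  bijective functors onto the four categories of both double groupoids.\<close>

lemma Nerve_inj: "inj_on Nerve (Obj (DGpd :: (('o, 'h, 'v, 'c) dbl, ('o, 'h, 'v, 'c) dbl_arr) catg))"
proof (rule inj_onI)
  fix G G' :: "('o, 'h, 'v, 'c) dbl"
  assume G: "G \<in> Obj DGpd" and G': "G' \<in> Obj DGpd" and N: "Nerve G = Nerve G'"
  have P: "PN_ident G = PN_ident G'" by (simp add: PN_ident_def N)
  let ?D = "PGpd (Nerve G)"
  note F = PN_ident_in[OF G] and F' = PN_ident_in[OF G', folded N P]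
  note b = dgf.PN_ident_bij[OF dgf_DGpd[OF G]] and b' = dgf.PN_ident_bij[OF dgf_DGpd[OF G'], folded N P]
  have D: "dcat ?D" "dcat G" "dcat G'" using G G' by (simp_all add: dcat_DGpd PGpd_in Nerve_in)
  note c = D[unfolded dcat_def]
  have e: "ext_dbl G" "ext_dbl G'" using G G' by (simp_all add: Obj_DGpd)
  note e = e[unfolded ext_dbl_def]
  have "HC G = HC G'"
    by (rule catg_eq_if_bij_functors[OF dbl_homsD(1)[OF F] dbl_homsD(1)[OF F']]) (use b b' c e in simp_all)
  moreover have "VC G = VC G'"
    by (rule catg_eq_if_bij_functors[OF dbl_homsD(2)[OF F] dbl_homsD(2)[OF F']]) (use b b' c e in simp_all)
  moreover have "SH G = SH G'"
    by (rule catg_eq_if_bij_functors[OF dbl_homsD(3)[OF F] dbl_homsD(3)[OF F']]) (use b b' c e in simp_all)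
  moreover have "SV G = SV G'"
    by (rule catg_eq_if_bij_functors[OF dbl_homsD(4)[OF F] dbl_homsD(4)[OF F']]) (use b b' c e in simp_all)
  ultimately show "G = G'" by (cases G; cases G') simp
qed

theorem theorem6p4:
  shows
    "category (DGpd :: (('o, 'h, 'v, 'c) dbl, ('o, 'h, 'v, 'c) dbl_arr) catg) \<and>
     category (BiSet :: ('a bisset, 'a bis_arr) catg) \<and>
     is_functor (DGpd :: (('o, 'h, 'v, 'c) dbl, ('o, 'h, 'v, 'c) dbl_arr) catg)
       Nerve nerve_arr BiSet \<and>
     full (DGpd :: (('o, 'h, 'v, 'c) dbl, ('o, 'h, 'v, 'c) dbl_arr) catg)
       Nerve nerve_arr BiSet \<and>
     faithful (DGpd :: (('o, 'h, 'v, 'c) dbl, ('o, 'h, 'v, 'c) dbl_arr) catg) nerve_arr \<and>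
     inj_on Nerve (Obj (DGpd :: (('o, 'h, 'v, 'c) dbl, ('o, 'h, 'v, 'c) dbl_arr) catg)) \<and>
     is_functor (BiSet :: ('a bisset, 'a bis_arr) catg) PGpd P_arr DGpd \<and>

     (\<forall>(K :: 'a bisset) (G :: ('o, 'h, 'v, 'c) dbl). K \<in> Obj BiSet \<and> G \<in> Obj DGpd \<longrightarrow>
        bij_betw (transpose_map K) (dbl_homs (PGpd K) G) (bis_homs K (Nerve G))) \<and>
     (\<forall>(K :: 'a bisset) (K' :: 'b bisset) (G :: ('o, 'h, 'v, 'c) dbl)
         (G' :: ('o2, 'h2, 'v2, 'c2) dbl).
        K \<in> Obj BiSet \<and> K' \<in> Obj BiSet \<and> G \<in> Obj DGpd \<and> G' \<in> Obj DGpd \<longrightarrow>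
        (\<forall>k\<in>bis_homs K' K. \<forall>F\<in>dbl_homs (PGpd K) G. \<forall>g\<in>dbl_homs G G'.
           transpose_map K' (dbl_comp (PGpd K') g (dbl_comp (PGpd K') F (P_map K' k K))) =
           bis_comp K' (nerve_map G g) (bis_comp K' (transpose_map K F) k))) \<and>

     (\<forall>G :: ('o, 'h, 'v, 'c) dbl. G \<in> Obj DGpd \<longrightarrow>
        (\<forall>x\<in>bisimps (Nerve G) 1 0. hcls (Nerve G) 1 0 x = {x}) \<and>
        (\<forall>x\<in>bisimps (Nerve G) 0 1. vcls (Nerve G) 0 1 x = {x}) \<and>
        (\<forall>x\<in>bisimps (Nerve G) 1 1. bicls (Nerve G) 1 1 x = {x}) \<and>
        PN_ident G \<in> dbl_isos (PGpd (Nerve G)) G) \<and>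
     (\<forall>(G :: ('o, 'h, 'v, 'c) dbl) (G' :: ('o2, 'h2, 'v2, 'c2) dbl).
        G \<in> Obj DGpd \<and> G' \<in> Obj DGpd \<longrightarrow>
        (\<forall>F\<in>dbl_homs G G'.
           dbl_comp (PGpd (Nerve G)) (PN_ident G')
             (P_map (Nerve G) (nerve_map G F) (Nerve G')) =
           dbl_comp (PGpd (Nerve G)) F (PN_ident G))) \<and>

     (\<forall>K :: 'a bisset. K \<in> Obj BiSet \<longrightarrow> eps K \<in> bis_homs K (Nerve (PGpd K))) \<and>
     (\<forall>(K :: 'a bisset) (L :: 'b bisset). K \<in> Obj BiSet \<and> L \<in> Obj BiSet \<longrightarrow>
        (\<forall>f\<in>bis_homs K L.
           bis_comp K (eps L) f = bis_comp K (nerve_map (PGpd K) (P_map K f L)) (eps K))) \<and>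

     (\<forall>K :: 'a bisset. K \<in> Obj BiSet \<longrightarrow>
        dbl_comp (PGpd K) (PN_ident (PGpd K)) (P_map K (eps K) (Nerve (PGpd K))) =
        dbl_id (PGpd K)) \<and>
     (\<forall>G :: ('o, 'h, 'v, 'c) dbl. G \<in> Obj DGpd \<longrightarrow>
        bis_comp (Nerve G) (nerve_map (PGpd (Nerve G)) (PN_ident G)) (eps (Nerve G)) =
        bis_id (Nerve G))"
proof (intro conjI allI impI ballI; (elim conjE)?)
  show "category (DGpd :: (('o, 'h, 'v, 'c) dbl, ('o, 'h, 'v, 'c) dbl_arr) catg)" by (rule category_DGpd)
  show "category (BiSet :: ('a bisset, 'a bis_arr) catg)" by (rule category_BiSet)
  show "is_functor (DGpd :: (('o, 'h, 'v, 'c) dbl, ('o, 'h, 'v, 'c) dbl_arr) catg) Nerve nerve_arr BiSet"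
    by (rule Nerve_functor)
  show "full (DGpd :: (('o, 'h, 'v, 'c) dbl, ('o, 'h, 'v, 'c) dbl_arr) catg) Nerve nerve_arr BiSet" by (rule Nerve_full)
  show "faithful (DGpd :: (('o, 'h, 'v, 'c) dbl, ('o, 'h, 'v, 'c) dbl_arr) catg) nerve_arr" by (rule Nerve_faithful)
  show "inj_on Nerve (Obj (DGpd :: (('o, 'h, 'v, 'c) dbl, ('o, 'h, 'v, 'c) dbl_arr) catg))" by (rule Nerve_inj)
  show "is_functor (BiSet :: ('a bisset, 'a bis_arr) catg) PGpd P_arr DGpd" by (rule P_functor)
next
  fix G :: "('o, 'h, 'v, 'c) dbl" and x
  assume G: "G \<in> Obj DGpd"
  interpret dgf G by (rule dgf_DGpd[OF G])
  show "x \<in> bisimps (Nerve G) 1 0 \<Longrightarrow> hcls (Nerve G) 1 0 x = {x}"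
    "x \<in> bisimps (Nerve G) 0 1 \<Longrightarrow> vcls (Nerve G) 0 1 x = {x}"
    "x \<in> bisimps (Nerve G) 1 1 \<Longrightarrow> bicls (Nerve G) 1 1 x = {x}"
    by (rule hcls_Nerve vcls_Nerve bicls_Nerve; assumption)+
qed (fact adjunction_bij adjunction_natural PN_ident_iso PN_ident_natural eps_in eps_natural triangle_P triangle_N
  | rule adjunction_bij adjunction_natural PN_ident_iso PN_ident_natural eps_in eps_natural triangle_P triangle_N; assumption)+

end
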